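(* Let $(M,g)$ be a closed connected oriented smooth Riemannian manifold. For all $V^1,\dots,V^4\in\mathscr V\mathscr C^\infty_{b,\nabla}$ (cylinder gradient-type vector fields) we have, pointwise on $\mathscr P$, \begin{align*} \mathbf G^\nabla\big(\Pi(\mathbf R^{\mathrm{der}}(V^1,V^2)V^3),V^4\big)&=V^1\mathbf G^\nabla\big(\boldsymbol\nabla^{\nabla}_{V^2}V^3,V^4\big)-\mathbf G^\nabla\big(\boldsymbol\nabla^{\nabla}_{V^2}V^3,\boldsymbol\nabla^{\nabla}_{V^1}V^4\big)\\ &\quad-V^2\mathbf G^\nabla\big(\boldsymbol\nabla^{\nabla}_{V^1}V^3,V^4\big)+\mathbf G^\nabla\big(\boldsymbol\nabla^{\nabla}_{V^1}V^3,\boldsymbol\nabla^{\nabla}_{V^2}V^4\big)\\ &\quad-\mathbf G^\nabla\big(\boldsymbol\nabla^{\nabla}_{\Pi\llbracket V^1,V^2\rrbracket}V^3,V^4\big)\\ &\quad-\mathbf G^{\mathrm{der}}\big(\mathrm{II}(V^2,V^3),\mathrm{II}(V^1,V^4)\big)+\mathbf G^{\mathrm{der}}\big(\mathrm{II}(V^1,V^3),\mathrm{II}(V^2,V^4)\big)\\ &\quad-\mathbf G^\nabla\big((\boldsymbol\Omega^{\mathrm{LC}}V^3)\,\mathbf A(V^1,V^2),V^4\big). \end{align*} In particular, the reduced Riemann tensor $\mathbf R^\nabla$ satisfies \begin{align*} \mathbf R^\nabla(V^1,V^2)V^3&=\Pi\big(\mathbf R^{\mathrm{der}}(V^1,V^2)V^3\big)\\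 &\quad+\mathbf G^{\mathrm{der},\sharp}\Big(\mathbf G^{\mathrm{der}}\big(\mathrm{II}(V^2,V^3),\mathrm{II}(V^1,\cdot)\big)-\mathbf G^{\mathrm{der}}\big(\mathrm{II}(V^1,V^3),\mathrm{II}(V^2,\cdot)\big)\Big)\\ &\quad+(\boldsymbol\Omega^{\mathrm{LC}}V^3)\,\mathbf A(V^1,V^2), \end{align*} where this last equality is understood pointwise at each $\mu\in\mathscr P$ modulo $\ker\mathrm{div}_\mu$, i.e. as equality after pairing both sides by $\mathbf G^\nabla$ with every $V^4\in\mathscr V\mathscr C^\infty_{b,\nabla}$.
   Context: $\mathscr P$ is the set of Borel probability measures on $M$; $\mathfrak X^\infty$ the smooth vector fields on $M$; $\mathfrak X^\infty_\nabla=\{\nabla^g f:f\in C^\infty(M)\}$ the gradient vector fields; $\nabla^{\mathrm{LC}}$ the Levi-Civita connection of $(M,g)$. For $f\in C^\infty(M)$ put $f^\star(\mu)=\int f\,d\mu$. In the claim the superscript $\nabla$ on $\mathbf G^\nabla,\boldsymbol\nabla^\nabla,\mathbf R^\nabla$ means "gradient-type". Cylinder functions: $\mathscr F\mathscr C^\infty_b$ is the algebra of functions $u:\mathscr P\to\mathbb R$, $u=F\circ(f_1^\star,\dots,f_k^\star)$, $k\in\mathbb N_0$, $F\in C^\infty(\mathbb R^k)$, $f_i\in C^\infty(M)$. Cylinder vector fields: $\mathscr V\mathscr C^\infty_b:=\mathscr F\mathscr C^\infty_b\otimes_{\mathbb R}\mathfrak X^\infty$; gradient-type ones: $\mathscr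 V\mathscr C^\infty_{b,\nabla}:=\mathscr F\mathscr C^\infty_b\otimes_{\mathbb R}\mathfrak X^\infty_\nabla$. For $V=\sum_iu_i\otimes w_i$ set $V_\mu=\sum_iu_i(\mu)w_i$. Differential: $\mathbf D_\mu u=\sum_i(\partial_iF)(f_1^\star\mu,\dots,f_k^\star\mu)\,df_i$; action $(Vu)(\mu)=\int(\mathbf D_\mu u)(V_\mu)\,d\mu$. Cylinder vector fields are identified with the derivations $u\mapsto Vu$ of $\mathscr F\mathscr C^\infty_b$ (this is injective). Bracket: $\llbracket V,Z\rrbracket\in\mathscr V\mathscr C^\infty_b$ is the cylinder vector field with $\llbracket V,Z\rrbracket u=V(Zu)-Z(Vu)$. Tangent spaces: $\mathfrak X_\mu=T^{\mathrm{der}}_\mu\mathscr P$ is the Hilbert completion of $\mathfrak X^\infty$ (modulo null vectors) for $\|w\|_\mu^2=\int g(w,w)\,d\mu$; $T^\nabla_\mu\mathscr P$ is the closure of $\mathfrak X^\infty_\nabla$ in $\mathfrak X_\mu$; $\Pi_\mu:T^{\mathrm{der}}_\mu\mathscr P\to T^\nabla_\mu\mathscr P$ the orthogonal projection, $\Pi^\perp_\mu=\mathrm{Id}-\Pi_\mu$, with range $\ker\mathrm{div}_\mu=\{w\in\mathfrak X_\mu:\int (df)w\,d\mu=0\ \forall f\in C^\infty(M)\}$. $\Pi,\Pi^\perp$ act pointwise in $\mu$. Metrics: $\mathbf G^{\mathrm{der}}_\mu(V,Z)=\int g(V_\mu,Z_\mu)\,d\mu$ (extended to $\mathfrak X_\mu$),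 $\mathbf G^\nabla_\mu(V,Z)=\int g(\Pi_\mu V_\mu,\Pi_\mu Z_\mu)\,d\mu$. Connections: $\boldsymbol\nabla^{\mathrm{int}}_V(u\otimes w)=(Vu)\otimes w$ (extended linearly); $\big((\boldsymbol\Omega^{\mathrm{LC}}Z)V\big)_\mu=\nabla^{\mathrm{LC}}_{V_\mu}Z_\mu$; $\boldsymbol\nabla^{\mathrm{LC}}_VZ:=\boldsymbol\nabla^{\mathrm{int}}_VZ+(\boldsymbol\Omega^{\mathrm{LC}}Z)V$. The values of these at $\mu$ depend on $V$ only through $V_\mu$ and extend by continuity to directions in $\mathfrak X_\mu$; this is how expressions with direction $\Pi\llbracket V^1,V^2\rrbracket$ or $\mathbf A(V^1,V^2)$ are understood. All the following objects are understood pointwise in $\mu$ (they need not be cylinder vector fields): $\boldsymbol\nabla^\nabla_VZ:=\Pi\,\boldsymbol\nabla^{\mathrm{LC}}_VZ$; $\mathrm{II}(V,Z):=\Pi^\perp\boldsymbol\nabla^{\mathrm{LC}}_VZ$; $\mathbf A(V,Z):=\mathrm{II}(V,Z)-\mathrm{II}(Z,V)$, for $V,Z\in\mathscr V\mathscr C^\infty_{b,\nabla}$. Riemann tensors: $\mathbf R^{\mathrm{der}}(V^1,V^2)V^3:=\boldsymbol\nabla^{\mathrm{LC}}_{V^1}\boldsymbol\nabla^{\mathrm{LC}}_{V^2}V^3-\boldsymbol\nabla^{\mathrm{LC}}_{V^2}\boldsymbol\nabla^{\mathrm{LC}}_{V^1}V^3-\boldsymbol\nabla^{\mathrm{LC}}_{\llbracket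 V^1,V^2\rrbracket}V^3$. The reduced Riemann tensor $\mathbf R^\nabla$ is the (pointwise, weakly defined) curvature of $\boldsymbol\nabla^\nabla$: $\mathbf G^\nabla(\mathbf R^\nabla(V^1,V^2)V^3,V^4):=V^1\mathbf G^\nabla(\boldsymbol\nabla^\nabla_{V^2}V^3,V^4)-\mathbf G^\nabla(\boldsymbol\nabla^\nabla_{V^2}V^3,\boldsymbol\nabla^\nabla_{V^1}V^4)-V^2\mathbf G^\nabla(\boldsymbol\nabla^\nabla_{V^1}V^3,V^4)+\mathbf G^\nabla(\boldsymbol\nabla^\nabla_{V^1}V^3,\boldsymbol\nabla^\nabla_{V^2}V^4)-\mathbf G^\nabla(\boldsymbol\nabla^\nabla_{\Pi\llbracket V^1,V^2\rrbracket}V^3,V^4)$ for all $V^4\in\mathscr V\mathscr C^\infty_{b,\nabla}$. $\mathbf G^{\mathrm{der},\sharp}$ is the musical (Riesz) map: $\mathbf G^{\mathrm{der},\sharp}(\ell)$ at $\mu$ represents the functional $V^4\mapsto\ell(V^4)_\mu$ on gradient-type fields via $\mathbf G^{\mathrm{der}}_\mu$. *)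

theory Defs
  imports "HOL-Analysis.Analysis" "HOL-Probability.Probability"
begin

section \<open>Smooth manifolds\<close>

primrec Ck_on :: "nat \<Rightarrow> 'a::real_normed_vector set \<Rightarrow> ('a \<Rightarrow> 'b::real_normed_vector) \<Rightarrow> bool" where
  "Ck_on 0 S f \<longleftrightarrow> continuous_on S f"
| "Ck_on (Suc k) S f \<longleftrightarrow>
     (\<forall>x\<in>S. f differentiable (at x)) \<and> (\<forall>v. Ck_on k S (\<lambda>x. frechet_derivative f (at x) v))"

text \<open>To be used for open \<open>S\<close> only, since derivatives are taken in the full neighbourhood filter.\<close>

definition smooth_on :: "'a::real_normed_vector set \<Rightarrow> ('a \<Rightarrow> 'b::real_normed_vector) \<Rightarrow> bool" where
  "smooth_on S f \<longleftrightarrow> (\<forall>k. Ck_on k S f)"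

text \<open>A chart \<open>(U, \<phi>)\<close> is a homeomorphism \<open>\<phi>\<close> of the open set \<open>U\<close> onto an open subset of
  \<open>real ^ 'n\<close>; values of \<open>\<phi>\<close> outside \<open>U\<close> are irrelevant.\<close>

type_synonym ('m, 'n) chart = "'m set \<times> ('m \<Rightarrow> real ^ 'n)"

definition is_chart :: "('m::topological_space, 'n::finite) chart \<Rightarrow> bool" where
  "is_chart c \<longleftrightarrow> (case c of (U, \<phi>) \<Rightarrow>
     open U \<and> open (\<phi> ` U) \<and> (\<exists>\<psi>. homeomorphism U (\<phi> ` U) \<phi> \<psi>))"

definition transition :: "('m, 'n) chart \<Rightarrow> ('m, 'n) chart \<Rightarrow> real ^ 'n \<Rightarrow> real ^ 'n" where
  "transition c c' = snd c' \<circ> inv_into (fst c) (snd c)"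

text \<open>An orientation is recorded by the atlas itself: all transition maps have positive
  Jacobian determinant.\<close>

definition oriented_smooth_atlas :: "('m::topological_space, 'n::finite) chart set \<Rightarrow> bool" where
  "oriented_smooth_atlas \<A> \<longleftrightarrow>
     (\<forall>c\<in>\<A>. is_chart c) \<and> (\<Union>c\<in>\<A>. fst c) = UNIV \<and>
     (\<forall>c\<in>\<A>. \<forall>c'\<in>\<A>. smooth_on (snd c ` (fst c \<inter> fst c')) (transition c c') \<and>
        (\<forall>y \<in> snd c ` (fst c \<inter> fst c').
           det (matrix (frechet_derivative (transition c c') (at y))) > 0))"

text \<open>A tangent vector at \<open>x\<close> is a derivation at \<open>x\<close> of the algebra of smooth functions, a vector
  field is a section of the tangent bundle, so that \<open>w x f\<close> is \<open>df(w)\<close> at \<open>x\<close>.\<close>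

type_synonym 'm tvec = "('m \<Rightarrow> real) \<Rightarrow> real"
type_synonym 'm vfield = "'m \<Rightarrow> 'm tvec"

record ('m, 'n) riemannian =
  atlas :: "('m, 'n) chart set"
  metric :: "'m \<Rightarrow> 'm tvec \<Rightarrow> 'm tvec \<Rightarrow> real"

definition smooth_functions :: "('m, 'n::finite) riemannian \<Rightarrow> ('m \<Rightarrow> real) set" where
  "smooth_functions M =
     {f. \<forall>c \<in> atlas M. smooth_on (snd c ` fst c) (f \<circ> inv_into (fst c) (snd c))}"

text \<open>The value on non-smooth functions is normalised to \<open>0\<close>, so that derivations which agree on
  the smooth functions are equal.\<close>

definition tangent_space :: "('m, 'n::finite) riemannian \<Rightarrow> 'm \<Rightarrow> 'm tvec set" where
  "tangent_space M x = {v.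
     (\<forall>f\<in>smooth_functions M. \<forall>h\<in>smooth_functions M. \<forall>c.
        v (\<lambda>y. f y + h y) = v f + v h \<and>
        v (\<lambda>y. c * f y) = c * v f \<and>
        v (\<lambda>y. f y * h y) = v f * h x + f x * v h) \<and>
     (\<forall>f. f \<notin> smooth_functions M \<longrightarrow> v f = 0)}"

definition vector_fields :: "('m, 'n::finite) riemannian \<Rightarrow> 'm vfield set" where
  "vector_fields M = {w. (\<forall>x. w x \<in> tangent_space M x) \<and>
     (\<forall>f\<in>smooth_functions M. (\<lambda>x. w x f) \<in> smooth_functions M)}"

definition tv_add :: "'m tvec \<Rightarrow> 'm tvec \<Rightarrow> 'm tvec" where
  "tv_add v w = (\<lambda>f. v f + w f)"

definition tv_scale :: "real \<Rightarrow> 'm tvec \<Rightarrow> 'm tvec" where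
  "tv_scale c v = (\<lambda>f. c * v f)"

definition vf_add :: "'m vfield \<Rightarrow> 'm vfield \<Rightarrow> 'm vfield" where
  "vf_add w z = (\<lambda>x. tv_add (w x) (z x))"

definition vf_smult :: "('m \<Rightarrow> real) \<Rightarrow> 'm vfield \<Rightarrow> 'm vfield" where
  "vf_smult h w = (\<lambda>x. tv_scale (h x) (w x))"

definition vf_diff :: "'m vfield \<Rightarrow> 'm vfield \<Rightarrow> 'm vfield" where
  "vf_diff w z = vf_add w (vf_smult (\<lambda>x. - 1) z)"

definition vf_lincomb :: "nat \<Rightarrow> (nat \<Rightarrow> real) \<Rightarrow> (nat \<Rightarrow> 'm vfield) \<Rightarrow> 'm vfield" where
  "vf_lincomb k c w = (\<lambda>x f. \<Sum>i<k. c i * w i x f)"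

definition lie_bracket :: "'m vfield \<Rightarrow> 'm vfield \<Rightarrow> 'm vfield" where
  "lie_bracket w z = (\<lambda>x f. w x (\<lambda>y. z y f) - z x (\<lambda>y. w y f))"

definition riemannian_metric :: "('m, 'n::finite) riemannian \<Rightarrow> bool" where
  "riemannian_metric M \<longleftrightarrow>
     (\<forall>x. \<forall>v\<in>tangent_space M x. \<forall>w\<in>tangent_space M x. \<forall>z\<in>tangent_space M x. \<forall>c.
        metric M x v w = metric M x w v \<and>
        metric M x (tv_add v w) z = metric M x v z + metric M x w z \<and>
        metric M x (tv_scale c v) w = c * metric M x v w \<and>
        (v \<noteq> (\<lambda>f. 0) \<longrightarrow> metric M x v v > 0)) \<and>
     (\<forall>w\<in>vector_fields M. \<forall>z\<in>vector_fields M.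
        (\<lambda>x. metric M x (w x) (z x)) \<in> smooth_functions M)"

text \<open>Second countability and the Hausdorff property are type class constraints. The second
  disjunct is the zero-dimensional case, which \<open>real ^ 'n\<close> cannot model: on a one-point space with
  no charts all functions are smooth and the tangent space is trivial.\<close>

definition closed_connected_oriented_riemannian ::
    "('m::{t2_space, second_countable_topology}, 'n::finite) riemannian \<Rightarrow> bool" where
  "closed_connected_oriented_riemannian M \<longleftrightarrow>
     compact (UNIV :: 'm set) \<and> connected (UNIV :: 'm set) \<and>
     (oriented_smooth_atlas (atlas M) \<or> atlas M = {} \<and> (\<exists>p. (UNIV :: 'm set) = {p})) \<and>
     riemannian_metric M"

definition levi_civita ::
    "('m, 'n::finite) riemannian \<Rightarrow> ('m vfield \<Rightarrow> 'm vfield \<Rightarrow> 'm vfield) \<Rightarrow> bool" where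
  "levi_civita M LC \<longleftrightarrow>
     (\<forall>w\<in>vector_fields M. \<forall>z\<in>vector_fields M. LC w z \<in> vector_fields M) \<and>
     (\<forall>w\<in>vector_fields M. \<forall>y\<in>vector_fields M. \<forall>z\<in>vector_fields M. \<forall>h\<in>smooth_functions M.
        LC (vf_add w y) z = vf_add (LC w z) (LC y z) \<and>
        LC (vf_smult h w) z = vf_smult h (LC w z) \<and>
        LC w (vf_add y z) = vf_add (LC w y) (LC w z) \<and>
        LC w (vf_smult h z) = vf_add (vf_smult (\<lambda>x. w x h) z) (vf_smult h (LC w z)) \<and>
        vf_diff (LC w z) (LC z w) = lie_bracket w z \<and>
        (\<forall>x. w x (\<lambda>p. metric M p (y p) (z p)) =
               metric M x (LC w y x) (z x) + metric M x (y x) (LC w z x)))"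

definition gradient_fields :: "('m, 'n::finite) riemannian \<Rightarrow> 'm vfield set" where
  "gradient_fields M = {w \<in> vector_fields M. \<exists>f\<in>smooth_functions M.
     \<forall>x. \<forall>v\<in>tangent_space M x. metric M x (w x) v = v f}"


section \<open>Cylinder functions and cylinder vector fields\<close>

typedef (overloaded) ('m::topological_space) borel_prob =
  "{\<mu> :: 'm measure. sets \<mu> = sets borel \<and> prob_space \<mu>}"
  morphisms law Abs_borel_prob
proof
  show "return borel undefined \<in> {\<mu> :: 'm measure. sets \<mu> = sets borel \<and> prob_space \<mu>}"
    by (simp add: prob_space_return)
qed

text \<open>Since \<open>k\<close> varies, a function on \<open>\<real>\<^sup>k\<close> is a function of a real sequence that depends only on
  the first \<open>k\<close> entries. For such functions, continuity in the product topology of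
  \<open>nat \<Rightarrow> real\<close> is continuity on \<open>\<real>\<^sup>k\<close>, and smoothness is existence and continuity of all iterated
  partial derivatives.\<close>

definition partial :: "nat \<Rightarrow> ((nat \<Rightarrow> real) \<Rightarrow> real) \<Rightarrow> (nat \<Rightarrow> real) \<Rightarrow> real" where
  "partial i F = (\<lambda>x. deriv (\<lambda>t. F (x(i := t))) (x i))"

primrec Ck_coords :: "nat \<Rightarrow> nat \<Rightarrow> ((nat \<Rightarrow> real) \<Rightarrow> real) \<Rightarrow> bool" where
  "Ck_coords k 0 F \<longleftrightarrow> continuous_on UNIV F"
| "Ck_coords k (Suc m) F \<longleftrightarrow> continuous_on UNIV F \<and>
     (\<forall>i<k. (\<forall>x. (\<lambda>t. F (x(i := t))) differentiable (at (x i))) \<and> Ck_coords k m (partial i F))"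

definition smooth_coords :: "nat \<Rightarrow> ((nat \<Rightarrow> real) \<Rightarrow> real) set" where
  "smooth_coords k = {F. (\<forall>x y. (\<forall>i<k. x i = y i) \<longrightarrow> F x = F y) \<and> (\<forall>m. Ck_coords k m F)}"

definition star :: "('m::topological_space \<Rightarrow> real) \<Rightarrow> 'm borel_prob \<Rightarrow> real" where
  "star f \<mu> = (\<integral>x. f x \<partial>law \<mu>)"

definition represents :: "('m::topological_space, 'n::finite) riemannian \<Rightarrow>
    nat \<Rightarrow> ((nat \<Rightarrow> real) \<Rightarrow> real) \<Rightarrow> (nat \<Rightarrow> 'm \<Rightarrow> real) \<Rightarrow> ('m borel_prob \<Rightarrow> real) \<Rightarrow> bool" where
  "represents M k F f u \<longleftrightarrow> F \<in> smooth_coords k \<and> (\<forall>i. f i \<in> smooth_functions M) \<and>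
     u = (\<lambda>\<mu>. F (\<lambda>i. star (f i) \<mu>))"

definition cyl_functions ::
    "('m::topological_space, 'n::finite) riemannian \<Rightarrow> ('m borel_prob \<Rightarrow> real) set" where
  "cyl_functions M = {u. \<exists>k F f. represents M k F f u}"

text \<open>The tensor \<open>\<Sum>i<k. u i \<otimes> w i\<close> is identified with the map
  \<open>\<mu> \<mapsto> V\<^sub>\<mu> = (\<Sum>i<k. u i \<mu> \<cdot> w i)\<close>; this identification is injective.\<close>

type_synonym 'm cvfield = "'m borel_prob \<Rightarrow> 'm vfield"

definition tensor_rep :: "('m::topological_space, 'n::finite) riemannian \<Rightarrow> 'm vfield set \<Rightarrow>
    nat \<Rightarrow> (nat \<Rightarrow> 'm borel_prob \<Rightarrow> real) \<Rightarrow> (nat \<Rightarrow> 'm vfield) \<Rightarrow> 'm cvfield \<Rightarrow> bool" where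
  "tensor_rep M X k u w V \<longleftrightarrow> (\<forall>i<k. u i \<in> cyl_functions M \<and> w i \<in> X) \<and>
     V = (\<lambda>\<mu>. vf_lincomb k (\<lambda>i. u i \<mu>) w)"

definition cyl_fields :: "('m::topological_space, 'n::finite) riemannian \<Rightarrow> 'm cvfield set" where
  "cyl_fields M = {V. \<exists>k u w. tensor_rep M (vector_fields M) k u w V}"

definition cyl_grad_fields ::
    "('m::topological_space, 'n::finite) riemannian \<Rightarrow> 'm cvfield set" where
  "cyl_grad_fields M = {V. \<exists>k u w. tensor_rep M (gradient_fields M) k u w V}"

text \<open>\<open>differential M u \<mu> x v\<close> is the one-form \<open>\<^bold>D\<^sub>\<mu> u\<close> at \<open>x\<close>, applied to \<open>v \<in> tangent_space M x\<close>;
  its value does not depend on the representation of \<open>u\<close>.\<close>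

definition differential :: "('m::topological_space, 'n::finite) riemannian \<Rightarrow>
    ('m borel_prob \<Rightarrow> real) \<Rightarrow> 'm borel_prob \<Rightarrow> 'm \<Rightarrow> 'm tvec \<Rightarrow> real" where
  "differential M u \<mu> x v = (THE r. \<exists>k F f. represents M k F f u \<and>
     r = (\<Sum>i<k. partial i F (\<lambda>j. star (f j) \<mu>) * v (f i)))"

definition action_at :: "('m::topological_space, 'n::finite) riemannian \<Rightarrow>
    'm borel_prob \<Rightarrow> 'm vfield \<Rightarrow> ('m borel_prob \<Rightarrow> real) \<Rightarrow> real" where
  "action_at M \<mu> w u = (\<integral>x. differential M u \<mu> x (w x) \<partial>law \<mu>)"

definition action :: "('m::topological_space, 'n::finite) riemannian \<Rightarrow>
    'm cvfield \<Rightarrow> ('m borel_prob \<Rightarrow> real) \<Rightarrow> 'm borel_prob \<Rightarrow> real" where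
  "action M V u = (\<lambda>\<mu>. action_at M \<mu> (V \<mu>) u)"

definition cyl_bracket :: "('m::topological_space, 'n::finite) riemannian \<Rightarrow>
    'm cvfield \<Rightarrow> 'm cvfield \<Rightarrow> 'm cvfield" where
  "cyl_bracket M V Z = (THE W. W \<in> cyl_fields M \<and> (\<forall>u\<in>cyl_functions M. \<forall>\<mu>.
     action M W u \<mu> = action M V (action M Z u) \<mu> - action M Z (action M V u) \<mu>))"


section \<open>Tangent spaces\<close>

text \<open>The space \<open>tangent_der M \<mu>\<close> is the Hilbert completion of the smooth vector fields modulo null
  vectors: classes of Cauchy sequences, two of them being identified if their difference tends
  to zero.\<close>

type_synonym 'm tclass = "(nat \<Rightarrow> 'm vfield) set"

definition l2_inner :: "('m::topological_space, 'n::finite) riemannian \<Rightarrow>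
    'm borel_prob \<Rightarrow> 'm vfield \<Rightarrow> 'm vfield \<Rightarrow> real" where
  "l2_inner M \<mu> w z = (\<integral>x. metric M x (w x) (z x) \<partial>law \<mu>)"

definition l2_norm :: "('m::topological_space, 'n::finite) riemannian \<Rightarrow>
    'm borel_prob \<Rightarrow> 'm vfield \<Rightarrow> real" where
  "l2_norm M \<mu> w = sqrt (l2_inner M \<mu> w w)"

definition cauchy_fields :: "('m::topological_space, 'n::finite) riemannian \<Rightarrow>
    'm borel_prob \<Rightarrow> (nat \<Rightarrow> 'm vfield) set" where
  "cauchy_fields M \<mu> = {a. (\<forall>n. a n \<in> vector_fields M) \<and>
     (\<forall>e>0. \<exists>N. \<forall>m\<ge>N. \<forall>n\<ge>N. l2_norm M \<mu> (vf_diff (a m) (a n)) < e)}"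

definition null_rel :: "('m::topological_space, 'n::finite) riemannian \<Rightarrow>
    'm borel_prob \<Rightarrow> ((nat \<Rightarrow> 'm vfield) \<times> (nat \<Rightarrow> 'm vfield)) set" where
  "null_rel M \<mu> = {(a, b). a \<in> cauchy_fields M \<mu> \<and> b \<in> cauchy_fields M \<mu> \<and>
     (\<lambda>n. l2_norm M \<mu> (vf_diff (a n) (b n))) \<longlonglongrightarrow> 0}"

definition tangent_der :: "('m::topological_space, 'n::finite) riemannian \<Rightarrow>
    'm borel_prob \<Rightarrow> 'm tclass set" where
  "tangent_der M \<mu> = cauchy_fields M \<mu> // null_rel M \<mu>"

definition tclass_of :: "('m::topological_space, 'n::finite) riemannian \<Rightarrow>
    'm borel_prob \<Rightarrow> (nat \<Rightarrow> 'm vfield) \<Rightarrow> 'm tclass" where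
  "tclass_of M \<mu> a = null_rel M \<mu> `` {a}"

definition emb :: "('m::topological_space, 'n::finite) riemannian \<Rightarrow>
    'm borel_prob \<Rightarrow> 'm vfield \<Rightarrow> 'm tclass" where
  "emb M \<mu> w = tclass_of M \<mu> (\<lambda>n. w)"

definition tc_add :: "('m::topological_space, 'n::finite) riemannian \<Rightarrow>
    'm borel_prob \<Rightarrow> 'm tclass \<Rightarrow> 'm tclass \<Rightarrow> 'm tclass" where
  "tc_add M \<mu> A B = (\<Union>a\<in>A. \<Union>b\<in>B. tclass_of M \<mu> (\<lambda>n. vf_add (a n) (b n)))"

definition tc_diff :: "('m::topological_space, 'n::finite) riemannian \<Rightarrow>
    'm borel_prob \<Rightarrow> 'm tclass \<Rightarrow> 'm tclass \<Rightarrow> 'm tclass" where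
  "tc_diff M \<mu> A B = (\<Union>a\<in>A. \<Union>b\<in>B. tclass_of M \<mu> (\<lambda>n. vf_diff (a n) (b n)))"

definition G_der :: "('m::topological_space, 'n::finite) riemannian \<Rightarrow>
    'm borel_prob \<Rightarrow> 'm tclass \<Rightarrow> 'm tclass \<Rightarrow> real" where
  "G_der M \<mu> A B = (THE r. \<forall>a\<in>A. \<forall>b\<in>B. (\<lambda>n. l2_inner M \<mu> (a n) (b n)) \<longlonglongrightarrow> r)"

definition tangent_grad :: "('m::topological_space, 'n::finite) riemannian \<Rightarrow>
    'm borel_prob \<Rightarrow> 'm tclass set" where
  "tangent_grad M \<mu> = {A \<in> tangent_der M \<mu>. \<forall>e>0. \<exists>w\<in>gradient_fields M.
     sqrt (G_der M \<mu> (tc_diff M \<mu> A (emb M \<mu> w)) (tc_diff M \<mu> A (emb M \<mu> w))) < e}"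

definition proj :: "('m::topological_space, 'n::finite) riemannian \<Rightarrow>
    'm borel_prob \<Rightarrow> 'm tclass \<Rightarrow> 'm tclass" where
  "proj M \<mu> A = (THE B. B \<in> tangent_grad M \<mu> \<and>
     (\<forall>C\<in>tangent_grad M \<mu>. G_der M \<mu> (tc_diff M \<mu> A B) C = 0))"

definition proj_perp :: "('m::topological_space, 'n::finite) riemannian \<Rightarrow>
    'm borel_prob \<Rightarrow> 'm tclass \<Rightarrow> 'm tclass" where
  "proj_perp M \<mu> A = tc_diff M \<mu> A (proj M \<mu> A)"

definition G_grad :: "('m::topological_space, 'n::finite) riemannian \<Rightarrow>
    'm borel_prob \<Rightarrow> 'm tclass \<Rightarrow> 'm tclass \<Rightarrow> real" where
  "G_grad M \<mu> A B = G_der M \<mu> (proj M \<mu> A) (proj M \<mu> B)"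

text \<open>The value at \<open>A\<close> of the extension by continuity of a linear operator on vector fields
  (bounded for the seminorm \<open>l2_norm M \<mu>\<close>) to the completion.\<close>

definition extend :: "('m::topological_space, 'n::finite) riemannian \<Rightarrow>
    'm borel_prob \<Rightarrow> ('m vfield \<Rightarrow> 'm vfield) \<Rightarrow> 'm tclass \<Rightarrow> 'm tclass" where
  "extend M \<mu> L A = (THE B. B \<in> tangent_der M \<mu> \<and> (\<forall>a\<in>A. (\<lambda>n. L (a n)) \<in> B))"


section \<open>Connections and curvature\<close>

text \<open>Direction \<open>w\<close> at \<open>\<mu>\<close>: on \<open>Z = \<Sum>i<k. u i \<otimes> z i\<close> the value is \<open>\<Sum>i<k. (w u i)(\<mu>) \<cdot> z i\<close>,
  independently of the representation of \<open>Z\<close>.\<close>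

definition nabla_int_at :: "('m::topological_space, 'n::finite) riemannian \<Rightarrow>
    'm borel_prob \<Rightarrow> 'm vfield \<Rightarrow> 'm cvfield \<Rightarrow> 'm vfield" where
  "nabla_int_at M \<mu> w Z = (THE y. \<exists>k u z. tensor_rep M (vector_fields M) k u z Z \<and>
     y = vf_lincomb k (\<lambda>i. action_at M \<mu> w (u i)) z)"

definition omega_at :: "('m vfield \<Rightarrow> 'm vfield \<Rightarrow> 'm vfield) \<Rightarrow>
    'm::topological_space borel_prob \<Rightarrow> 'm cvfield \<Rightarrow> 'm vfield \<Rightarrow> 'm vfield" where
  "omega_at LC \<mu> Z w = LC w (Z \<mu>)"

definition nabla_LC_at :: "('m::topological_space, 'n::finite) riemannian \<Rightarrow>
    ('m vfield \<Rightarrow> 'm vfield \<Rightarrow> 'm vfield) \<Rightarrow> 'm borel_prob \<Rightarrow> 'm vfield \<Rightarrow> 'm cvfield \<Rightarrow> 'm vfield" where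
  "nabla_LC_at M LC \<mu> w Z = vf_add (nabla_int_at M \<mu> w Z) (omega_at LC \<mu> Z w)"

definition nabla_LC :: "('m::topological_space, 'n::finite) riemannian \<Rightarrow>
    ('m vfield \<Rightarrow> 'm vfield \<Rightarrow> 'm vfield) \<Rightarrow> 'm cvfield \<Rightarrow> 'm cvfield \<Rightarrow> 'm cvfield" where
  "nabla_LC M LC V Z = (\<lambda>\<mu>. nabla_LC_at M LC \<mu> (V \<mu>) Z)"

definition omega_dir :: "('m::topological_space, 'n::finite) riemannian \<Rightarrow>
    ('m vfield \<Rightarrow> 'm vfield \<Rightarrow> 'm vfield) \<Rightarrow> 'm borel_prob \<Rightarrow> 'm cvfield \<Rightarrow> 'm tclass \<Rightarrow> 'm tclass" where
  "omega_dir M LC \<mu> Z A = extend M \<mu> (omega_at LC \<mu> Z) A"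

definition nabla_grad :: "('m::topological_space, 'n::finite) riemannian \<Rightarrow>
    ('m vfield \<Rightarrow> 'm vfield \<Rightarrow> 'm vfield) \<Rightarrow> 'm borel_prob \<Rightarrow> 'm cvfield \<Rightarrow> 'm cvfield \<Rightarrow> 'm tclass" where
  "nabla_grad M LC \<mu> V Z = proj M \<mu> (emb M \<mu> (nabla_LC M LC V Z \<mu>))"

text \<open>The same with a direction in the completion \<open>tangent_der M \<mu>\<close>.\<close>

definition nabla_grad_dir :: "('m::topological_space, 'n::finite) riemannian \<Rightarrow>
    ('m vfield \<Rightarrow> 'm vfield \<Rightarrow> 'm vfield) \<Rightarrow> 'm borel_prob \<Rightarrow> 'm tclass \<Rightarrow> 'm cvfield \<Rightarrow> 'm tclass" where
  "nabla_grad_dir M LC \<mu> A Z = proj M \<mu> (extend M \<mu> (\<lambda>w. nabla_LC_at M LC \<mu> w Z) A)"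

definition II :: "('m::topological_space, 'n::finite) riemannian \<Rightarrow>
    ('m vfield \<Rightarrow> 'm vfield \<Rightarrow> 'm vfield) \<Rightarrow> 'm borel_prob \<Rightarrow> 'm cvfield \<Rightarrow> 'm cvfield \<Rightarrow> 'm tclass" where
  "II M LC \<mu> V Z = proj_perp M \<mu> (emb M \<mu> (nabla_LC M LC V Z \<mu>))"

definition A_tensor :: "('m::topological_space, 'n::finite) riemannian \<Rightarrow>
    ('m vfield \<Rightarrow> 'm vfield \<Rightarrow> 'm vfield) \<Rightarrow> 'm borel_prob \<Rightarrow> 'm cvfield \<Rightarrow> 'm cvfield \<Rightarrow> 'm tclass" where
  "A_tensor M LC \<mu> V Z = tc_diff M \<mu> (II M LC \<mu> V Z) (II M LC \<mu> Z V)"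

definition R_der :: "('m::topological_space, 'n::finite) riemannian \<Rightarrow>
    ('m vfield \<Rightarrow> 'm vfield \<Rightarrow> 'm vfield) \<Rightarrow> 'm cvfield \<Rightarrow> 'm cvfield \<Rightarrow> 'm cvfield \<Rightarrow> 'm cvfield" where
  "R_der M LC V1 V2 V3 = (\<lambda>\<mu>.
     vf_diff (vf_diff (nabla_LC M LC V1 (nabla_LC M LC V2 V3) \<mu>)
                      (nabla_LC M LC V2 (nabla_LC M LC V1 V3) \<mu>))
             (nabla_LC M LC (cyl_bracket M V1 V2) V3 \<mu>))"

text \<open>The Riesz map: a functional \<open>\<ell>\<close> on gradient-type cylinder fields is represented in
  \<open>tangent_grad M \<mu>\<close>.\<close>

definition sharp :: "('m::topological_space, 'n::finite) riemannian \<Rightarrow>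
    'm borel_prob \<Rightarrow> ('m cvfield \<Rightarrow> real) \<Rightarrow> 'm tclass" where
  "sharp M \<mu> l = (THE B. B \<in> tangent_grad M \<mu> \<and>
     (\<forall>V\<in>cyl_grad_fields M. G_der M \<mu> B (emb M \<mu> (V \<mu>)) = l V))"

text \<open>The defining pairing determines the reduced Riemann tensor only modulo the orthogonal
  complement of \<open>tangent_grad M \<mu>\<close>; the representative in \<open>tangent_grad M \<mu>\<close> is taken.\<close>

definition R_grad :: "('m::topological_space, 'n::finite) riemannian \<Rightarrow>
    ('m vfield \<Rightarrow> 'm vfield \<Rightarrow> 'm vfield) \<Rightarrow> 'm borel_prob \<Rightarrow>
    'm cvfield \<Rightarrow> 'm cvfield \<Rightarrow> 'm cvfield \<Rightarrow> 'm tclass" where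
  "R_grad M LC \<mu> V1 V2 V3 = (THE R. R \<in> tangent_grad M \<mu> \<and>
     (\<forall>V4\<in>cyl_grad_fields M.
        G_grad M \<mu> R (emb M \<mu> (V4 \<mu>)) =
          action M V1 (\<lambda>\<nu>. G_grad M \<nu> (nabla_grad M LC \<nu> V2 V3) (emb M \<nu> (V4 \<nu>))) \<mu>
        - G_grad M \<mu> (nabla_grad M LC \<mu> V2 V3) (nabla_grad M LC \<mu> V1 V4)
        - action M V2 (\<lambda>\<nu>. G_grad M \<nu> (nabla_grad M LC \<nu> V1 V3) (emb M \<nu> (V4 \<nu>))) \<mu>
        + G_grad M \<mu> (nabla_grad M LC \<mu> V1 V3) (nabla_grad M LC \<mu> V2 V4)
        - G_grad M \<mu>
            (nabla_grad_dir M LC \<mu> (proj M \<mu> (emb M \<mu> (cyl_bracket M V1 V2 \<mu>))) V3)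
            (emb M \<mu> (V4 \<mu>))))"

end

theory Submission
  imports Defs "HOL-Library.Function_Algebras"
begin

text \<open>The connection \<open>\<nabla>\<^sup>L\<^sup>C\<close> on cylinder fields is metric, and torsion-free for the cylinder bracket, so the
  first identity is a Gauss equation: by Pythagoras each product \<open>G(\<nabla>V\<^sub>i, \<nabla>V\<^sub>j)\<close> splits into a gradient part and a
  product of second fundamental forms, and the direction \<open>[V\<^sub>1, V\<^sub>2]\<close> splits into its gradient part and
  \<open>A(V\<^sub>1, V\<^sub>2)\<close>. The latter is orthogonal to gradients, hence annihilates cylinder functions, so that only
  the \<open>\<Omega>\<close>-part of the connection survives in that direction. In the second identity the functional
  \<open>V\<^sub>4 \<mapsto> G(II(V\<^sub>2, V\<^sub>3), II(V\<^sub>1, V\<^sub>4))\<close> is bounded although it differentiates \<open>V\<^sub>4\<close>: \<open>II\<close> is antisymmetric on gradients,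
  and the symmetry of Hessians even exhibits the representing vector. On \<open>M\<close> itself, Hadamard's lemma
  yields local frames, whence the existence of gradients and the uniform boundedness of tensorial maps; the
  latter is what allows directions in the completion.\<close>

section \<open>Vector fields and sequences as vector spaces\<close>

text \<open>Most objects of the statement are definite descriptions (\<open>THE\<close>), so each
  needs existence and uniqueness before it can be computed. The differential must not depend on how
  a cylinder function is represented, and the bracket exists only because a cylinder field is
  determined by its action; both come down to having enough probability measures to test with.
  Nothing is computed on classes: a class is traded for a Cauchy sequence of fields, and these
  sequences carry a semi-inner product of their own, so that one locale serves the tangent space at
  a point, the fields under \<open>l2_inner\<close>, and the completion. Representatives are fixed
  only up to null sequences, which is why equalities there read "seminorm of the difference is 0".
  Projected derivatives need not vary with \<mu> in a cylinder way; they are differentiated only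
  inside a pairing with a gradient field, where the projection drops out. The Riesz vector
  \<open>sharp\<close> and the tensor \<open>R_grad\<close> exist because their representing vectors
  are written down explicitly.\<close>

text \<open>With this instance \<open>vf_add\<close>, \<open>vf_diff\<close> and \<open>vf_lincomb\<close> become the vector space operations, and sequences of
  vector fields form a vector space as well.\<close>

instantiation "fun" :: (type, scaleR) scaleR
begin
definition scaleR_fun_def: "c *\<^sub>R f = (\<lambda>x. c *\<^sub>R f x)"
instance ..
end

lemma scaleR_fun_apply [simp]: "(c *\<^sub>R f) x = c *\<^sub>R f x"
  by (simp add: scaleR_fun_def)

instance "fun" :: (type, real_vector) real_vector
  by standard (auto simp: fun_eq_iff algebra_simps)

lemma sum_fun_apply [simp]: "sum f A x = (\<Sum>i\<in>A. f i x)"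
  by (induction A rule: infinite_finite_induct) auto

lemma tv_add_eq: "tv_add v w = v + w"
  by (simp add: fun_eq_iff tv_add_def)

lemma tv_scale_eq: "tv_scale c v = c *\<^sub>R v"
  by (simp add: fun_eq_iff tv_scale_def)

lemma vf_add_eq: "vf_add w z = w + z"
  by (simp add: fun_eq_iff vf_add_def tv_add_def)

lemma vf_smult_const_eq: "vf_smult (\<lambda>x. c) w = c *\<^sub>R w"
  by (simp add: fun_eq_iff vf_smult_def tv_scale_def)

lemma vf_diff_eq: "vf_diff w z = w - z"
  by (simp add: fun_eq_iff vf_diff_def vf_add_def vf_smult_def tv_add_def tv_scale_def)

lemma vf_lincomb_eq: "vf_lincomb k c w = (\<Sum>i<k. c i *\<^sub>R w i)"
  by (simp add: fun_eq_iff vf_lincomb_def)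

section \<open>Smooth maps between normed spaces\<close>

text \<open>On an open set, agreement of two functions carries over to their derivatives in the full
  neighbourhood filter. Functions read in a chart are arbitrary off the chart image, so smoothness
  has to be insensitive to those values.\<close>

lemma Ck_on_cong:
  assumes "open S" "\<And>x. x \<in> S \<Longrightarrow> f x = g x" "Ck_on k S f"
  shows "Ck_on k S g"
  using assms(2,3)
proof (induction k arbitrary: f g)
  case 0
  then show ?case by (simp cong: continuous_on_cong)
next
  case (Suc k)
  have ev: "\<forall>\<^sub>F y in nhds x. f y = g y" if "x \<in> S" for x
    using eventually_nhds_in_open[OF assms(1) that] Suc.prems(1) by (auto elim: eventually_mono)
  have der: "(f has_derivative D) (at x) \<longleftrightarrow> (g has_derivative D) (at x)" if "x \<in> S" for x D
    using has_derivative_transform_within_open[OF _ assms(1) that, of f D UNIV g]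
      has_derivative_transform_within_open[OF _ assms(1) that, of g D UNIV f] Suc.prems(1)
    by auto
  have fd: "frechet_derivative f (at x) = frechet_derivative g (at x)" if "x \<in> S" for x
    unfolding frechet_derivative_def using der[OF that] by simp
  have "Ck_on k S (\<lambda>x. frechet_derivative g (at x) v)" for v
  proof (rule Suc.IH)
    show "frechet_derivative f (at x) v = frechet_derivative g (at x) v" if "x \<in> S" for x
      using fd[OF that] by simp
  qed (use Suc.prems(2) in simp)
  moreover have "f differentiable (at x) \<longleftrightarrow> g differentiable (at x)" if "x \<in> S" for x
    unfolding differentiable_def using der[OF that] by simp
  ultimately show ?case
    using Suc.prems(2) unfolding Ck_on.simps
    by simp
qed

lemma Ck_on_subset: "Ck_on k T f \<Longrightarrow> S \<subseteq> T \<Longrightarrow> Ck_on k S f"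
proof (induction k arbitrary: f)
  case 0
  then show ?case by (simp add: continuous_on_subset)
next
  case (Suc k)
  then show ?case by auto
qed

lemma Ck_on_local:
  assumes "\<And>x. x \<in> S \<Longrightarrow> \<exists>T. open T \<and> x \<in> T \<and> Ck_on k (T \<inter> S) f" "open S"
  shows "Ck_on k S f"
  using assms(1)
proof (induction k arbitrary: f)
  case 0
  show ?case
    unfolding Ck_on.simps continuous_on_eq_continuous_at[OF assms(2)]
  proof
    fix x assume x: "x \<in> S"
    then obtain T where "open T" "x \<in> T" "continuous_on (T \<inter> S) f" using 0 by auto
    then show "isCont f x" using x assms(2) by (simp add: continuous_on_eq_continuous_at open_Int)
  qed
next
  case (Suc k)
  show ?case
    unfolding Ck_on.simps
  proof (intro conjI ballI allI)
    show "f differentiable (at x)" if "x \<in> S" for x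
      using Suc.prems[OF that] that by auto
    show "Ck_on k S (\<lambda>x. frechet_derivative f (at x) v)" for v
    proof (rule Suc.IH)
      fix x assume "x \<in> S"
      from Suc.prems[OF this] show "\<exists>T. open T \<and> x \<in> T \<and> Ck_on k (T \<inter> S) (\<lambda>x. frechet_derivative f (at x) v)"
        by auto
    qed
  qed
qed

text \<open>\<open>frechet_derivative\<close> is a choice operator; uniqueness of the derivative
  lets the rules below supply an explicit family \<open>D\<close>, whose regularity can be read
  off.\<close>

lemma Ck_on_SucI:
  assumes "open S" "\<And>x. x \<in> S \<Longrightarrow> (f has_derivative D x) (at x)" "\<And>v. Ck_on k S (\<lambda>x. D x v)"
  shows "Ck_on (Suc k) S f"
proof -
  have "D x = frechet_derivative f (at x)" if "x \<in> S" for x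
    using assms(2) frechet_derivative_at that by blast
  then have "Ck_on k S (\<lambda>x. frechet_derivative f (at x) v)" for v
    by (intro Ck_on_cong[OF assms(1) _ assms(3)[of v]]) auto
  then show ?thesis using assms(2) unfolding Ck_on.simps differentiable_def by blast
qed

lemma Ck_on_SucD:
  assumes "Ck_on (Suc k) S f" "x \<in> S"
  shows "(f has_derivative frechet_derivative f (at x)) (at x)"
  using assms frechet_derivative_works by auto

lemma Ck_on_continuous: "Ck_on k S f \<Longrightarrow> continuous_on S f"
  by (cases k) (auto intro!: continuous_at_imp_continuous_on differentiable_imp_continuous_within)

lemma Ck_on_Suc_mono: "Ck_on (Suc k) S f \<Longrightarrow> Ck_on k S f"
proof (induction k arbitrary: f)
  case 0
  then show ?case using Ck_on_continuous[OF 0] by simp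
next
  case (Suc k)
  show ?case
    unfolding Ck_on.simps(2)[of k]
  proof (intro conjI allI)
    show "\<forall>x\<in>S. f differentiable at x"
      using Suc.prems by simp
    show "Ck_on k S (\<lambda>x. frechet_derivative f (at x) v)" for v
      by (rule Suc.IH) (use Suc.prems in \<open>simp only: Ck_on.simps(2)[of "Suc k"]; simp\<close>)
  qed
qed

lemma Ck_on_const: "open S \<Longrightarrow> Ck_on k S (\<lambda>x. c)"
proof (induction k arbitrary: c)
  case (Suc k)
  then show ?case
    by (intro Ck_on_SucI[where D = "\<lambda>x v. 0"]) (auto intro!: derivative_eq_intros)
qed simp

lemma Ck_on_bounded_linear_comp:
  assumes "open S" "bounded_linear L"
  shows "Ck_on k S f \<Longrightarrow> Ck_on k S (\<lambda>x. L (f x))"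
proof (induction k arbitrary: f)
  case 0
  then show ?case
    using bounded_linear.continuous_on[OF assms(2)] by simp
next
  case (Suc k)
  show ?case
  proof (rule Ck_on_SucI[OF assms(1)])
    show "((\<lambda>x. L (f x)) has_derivative (\<lambda>v. L (frechet_derivative f (at x) v))) (at x)" if "x \<in> S" for x
      using bounded_linear.has_derivative[OF assms(2) Ck_on_SucD[OF Suc.prems that]] .
  qed (use Suc in auto)
qed

lemma Ck_on_linear:
  assumes "open S" "bounded_linear L" shows "Ck_on k S L"
proof (cases k)
  case 0
  then show ?thesis using assms by (simp add: linear_continuous_on)
next
  case (Suc m)
  then show ?thesis
    using assms unfolding Suc
    by (intro Ck_on_SucI[where D = "\<lambda>x. L"] Ck_on_const bounded_linear_imp_has_derivative)
qed

lemma Ck_on_add: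
  assumes "open S"
  shows "Ck_on k S f \<Longrightarrow> Ck_on k S g \<Longrightarrow> Ck_on k S (\<lambda>x. f x + g x)"
proof (induction k arbitrary: f g)
  case 0
  then show ?case by (simp add: continuous_on_add)
next
  case (Suc k)
  show ?case
  proof (rule Ck_on_SucI[OF assms(1)])
    show "((\<lambda>x. f x + g x) has_derivative
        (\<lambda>v. frechet_derivative f (at x) v + frechet_derivative g (at x) v)) (at x)" if "x \<in> S" for x
      using has_derivative_add[OF Ck_on_SucD[OF Suc.prems(1) that] Ck_on_SucD[OF Suc.prems(2) that]] .
  qed (use Suc in auto)
qed

lemma Ck_on_mult:
  fixes f g :: "'a::real_normed_vector \<Rightarrow> real"
  assumes "open S"
  shows "Ck_on k S f \<Longrightarrow> Ck_on k S g \<Longrightarrow> Ck_on k S (\<lambda>x. f x * g x)"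
proof (induction k arbitrary: f g)
  case 0
  then show ?case by (simp add: continuous_on_mult)
next
  case (Suc k)
  show ?case
  proof (rule Ck_on_SucI[OF assms(1)])
    show "((\<lambda>x. f x * g x) has_derivative
        (\<lambda>v. f x * frechet_derivative g (at x) v + frechet_derivative f (at x) v * g x)) (at x)" if "x \<in> S" for x
      using has_derivative_mult[OF Ck_on_SucD[OF Suc.prems(1) that] Ck_on_SucD[OF Suc.prems(2) that]] .
    show "Ck_on k S (\<lambda>x. f x * frechet_derivative g (at x) v + frechet_derivative f (at x) v * g x)" for v
      using Suc.prems by (intro Ck_on_add[OF assms] Suc.IH Ck_on_Suc_mono[OF Suc.prems(1)] Ck_on_Suc_mono[OF Suc.prems(2)]) auto
  qed
qed

lemma Ck_on_sum:
  assumes "open S" "\<And>i. i \<in> I \<Longrightarrow> Ck_on k S (f i)"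
  shows "Ck_on k S (\<lambda>x. \<Sum>i\<in>I. f i x)"
  using assms(2)
proof (induction I rule: infinite_finite_induct)
  case (insert i I)
  have "Ck_on k S (\<lambda>x. f i x + (\<Sum>i\<in>I. f i x))"
    using insert by (intro Ck_on_add[OF assms(1)]) auto
  with insert show ?case by simp
qed (simp_all add: Ck_on_const[OF assms(1)])

text \<open>The chain rule composes linear maps; expanding the inner derivative in
  \<open>Basis\<close> turns it into a finite sum of products of scalar functions. The induction
  varies only \<open>g\<close>, since the partial derivatives of \<open>g\<close> are composed with
  the same \<open>f\<close>.\<close>

lemma Ck_on_compose:
  fixes f :: "'a::real_normed_vector \<Rightarrow> 'b::euclidean_space" and g :: "'b \<Rightarrow> real"
  assumes "open S" "open T" "\<And>x. x \<in> S \<Longrightarrow> f x \<in> T"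
  shows "Ck_on k S f \<Longrightarrow> Ck_on k T g \<Longrightarrow> Ck_on k S (\<lambda>x. g (f x))"
proof (induction k arbitrary: g)
  case 0
  then show ?case
    by (auto intro!: continuous_on_compose2[of T g S f] assms(3))
next
  case (Suc k)
  let ?D = "\<lambda>x v. \<Sum>b\<in>Basis. (frechet_derivative f (at x) v \<bullet> b) * frechet_derivative g (at (f x)) b"
  show ?case
  proof (rule Ck_on_SucI[OF assms(1), where D = ?D])
    fix x assume x: "x \<in> S"
    have f: "(f has_derivative frechet_derivative f (at x)) (at x)"
      using Ck_on_SucD[OF Suc.prems(1) x] .
    have g: "(g has_derivative frechet_derivative g (at (f x))) (at (f x))"
      using Ck_on_SucD[OF Suc.prems(2) assms(3)[OF x]] .
    interpret g: bounded_linear "frechet_derivative g (at (f x))"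
      using g has_derivative_bounded_linear by blast
    have "frechet_derivative g (at (f x)) (frechet_derivative f (at x) v) = ?D x v" for v
    proof -
      have "frechet_derivative g (at (f x)) (frechet_derivative f (at x) v) =
        frechet_derivative g (at (f x)) (\<Sum>b\<in>Basis. (frechet_derivative f (at x) v \<bullet> b) *\<^sub>R b)"
        by (simp add: euclidean_representation)
      also have "\<dots> = ?D x v"
        by (simp add: g.sum g.scaleR)
      finally show ?thesis .
    qed
    then have "frechet_derivative g (at (f x)) \<circ> frechet_derivative f (at x) = ?D x"
      by (simp add: fun_eq_iff)
    with diff_chain_at[OF f g] show "((\<lambda>x. g (f x)) has_derivative ?D x) (at x)"
      by (simp add: o_def)
  next
    fix v
    show "Ck_on k S (\<lambda>x. ?D x v)"
      using Suc.prems
      by (intro Ck_on_sum[OF assms(1)] Ck_on_mult[OF assms(1)]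
          Ck_on_bounded_linear_comp[OF assms(1) bounded_linear_inner_left] Suc.IH Ck_on_Suc_mono[OF Suc.prems(1)]) auto
  qed
qed

text \<open>The derivative of 1/f is a product that contains 1/f undifferentiated, so the induction
  closes with one order of smoothness less.\<close>

lemma Ck_on_inverse:
  fixes f :: "'a::real_normed_vector \<Rightarrow> real"
  assumes "open S" "\<And>x. x \<in> S \<Longrightarrow> f x \<noteq> 0"
  shows "Ck_on k S f \<Longrightarrow> Ck_on k S (\<lambda>x. inverse (f x))"
proof (induction k)
  case 0
  then show ?case using assms by (simp add: continuous_on_inverse)
next
  case (Suc k)
  have mono: "Ck_on k S f" using Ck_on_Suc_mono[OF Suc.prems] .
  show ?case
  proof (rule Ck_on_SucI[OF assms(1)])
    show "((\<lambda>x. inverse (f x)) has_derivative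
        (\<lambda>v. (- 1) * (inverse (f x) * frechet_derivative f (at x) v * inverse (f x)))) (at x)" if "x \<in> S" for x
      using Deriv.has_derivative_inverse[OF assms(2)[OF that] Ck_on_SucD[OF Suc.prems that]] by simp
    show "Ck_on k S (\<lambda>x. (- 1) * (inverse (f x) * frechet_derivative f (at x) v * inverse (f x)))" for v
      using Suc.prems
      by (intro Ck_on_mult[OF assms(1)] Ck_on_const[OF assms(1)] Suc.IH[OF mono]) auto
  qed
qed

lemma smooth_onI: "(\<And>k. Ck_on k S f) \<Longrightarrow> smooth_on S f"
  by (simp add: smooth_on_def)

lemma smooth_onD: "smooth_on S f \<Longrightarrow> Ck_on k S f"
  by (simp add: smooth_on_def)

lemma smooth_on_cong: "open S \<Longrightarrow> (\<And>x. x \<in> S \<Longrightarrow> f x = g x) \<Longrightarrow> smooth_on S f \<Longrightarrow> smooth_on S g"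
  unfolding smooth_on_def using Ck_on_cong by blast

lemma smooth_on_subset: "smooth_on T f \<Longrightarrow> S \<subseteq> T \<Longrightarrow> smooth_on S f"
  unfolding smooth_on_def using Ck_on_subset by blast

lemma smooth_on_local:
  assumes "open S" "\<And>x. x \<in> S \<Longrightarrow> \<exists>T. open T \<and> x \<in> T \<and> smooth_on (T \<inter> S) f"
  shows "smooth_on S f"
  unfolding smooth_on_def
  using assms(2) by (intro allI Ck_on_local[OF _ assms(1)]) (meson smooth_onD)

lemma smooth_on_const: "open S \<Longrightarrow> smooth_on S (\<lambda>x. c)"
  by (simp add: smooth_on_def Ck_on_const)

lemma smooth_on_linear: "open S \<Longrightarrow> bounded_linear L \<Longrightarrow> smooth_on S L"
  by (simp add: smooth_on_def Ck_on_linear)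

lemma smooth_on_add: "open S \<Longrightarrow> smooth_on S f \<Longrightarrow> smooth_on S g \<Longrightarrow> smooth_on S (\<lambda>x. f x + g x)"
  by (simp add: smooth_on_def Ck_on_add)

lemma smooth_on_mult:
  fixes f g :: "'a::real_normed_vector \<Rightarrow> real"
  shows "open S \<Longrightarrow> smooth_on S f \<Longrightarrow> smooth_on S g \<Longrightarrow> smooth_on S (\<lambda>x. f x * g x)"
  by (simp add: smooth_on_def Ck_on_mult)

lemma smooth_on_inverse:
  fixes f :: "'a::real_normed_vector \<Rightarrow> real"
  shows "open S \<Longrightarrow> (\<And>x. x \<in> S \<Longrightarrow> f x \<noteq> 0) \<Longrightarrow> smooth_on S f \<Longrightarrow> smooth_on S (\<lambda>x. inverse (f x))"
  by (simp add: smooth_on_def Ck_on_inverse)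

lemma smooth_on_compose:
  fixes f :: "'a::real_normed_vector \<Rightarrow> 'b::euclidean_space" and g :: "'b \<Rightarrow> real"
  shows "open S \<Longrightarrow> open T \<Longrightarrow> f ` S \<subseteq> T \<Longrightarrow> smooth_on S f \<Longrightarrow> smooth_on T g \<Longrightarrow> smooth_on S (\<lambda>x. g (f x))"
  by (auto simp: smooth_on_def intro!: Ck_on_compose[of S T f])

lemma smooth_on_continuous: "smooth_on S f \<Longrightarrow> continuous_on S f"
  using smooth_onD Ck_on_continuous by blast

lemma smooth_on_has_derivative:
  "smooth_on S f \<Longrightarrow> x \<in> S \<Longrightarrow> (f has_derivative frechet_derivative f (at x)) (at x)"
  using Ck_on_SucD smooth_onD by blast

lemma smooth_on_frechet_derivative:
  "smooth_on S f \<Longrightarrow> smooth_on S (\<lambda>x. frechet_derivative f (at x) v)"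
  unfolding smooth_on_def by (metis Ck_on.simps(2))

section \<open>Flat functions and smooth bumps\<close>

text \<open>The functions t^(-n) exp(-1/t), extended by 0 to t \<le> 0. The derivative of each is a
  linear combination of the members n+1 and n+2, so smoothness is proved for the whole family at
  once; the bumps use n = 0.\<close>

definition flat_exp :: "nat \<Rightarrow> real \<Rightarrow> real" where
  "flat_exp n t = (if t > 0 then inverse t ^ n * exp (- inverse t) else 0)"

lemma flat_exp_tendsto: "(flat_exp n \<longlongrightarrow> 0) (at 0)"
proof -
  have "((\<lambda>x::real. x ^ n / exp x) \<longlongrightarrow> 0) at_top"
    by (rule tendsto_power_div_exp_0)
  then have "((\<lambda>t::real. inverse t ^ n / exp (inverse t)) \<longlongrightarrow> 0) (at_right 0)"
    using filterlim_compose filterlim_inverse_at_top_right by blast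
  moreover have "\<forall>\<^sub>F t in at_right 0. inverse t ^ n / exp (inverse t) = flat_exp n t"
    by (rule eventually_at_right_less[THEN eventually_mono]) (simp add: flat_exp_def exp_minus field_simps)
  ultimately have "(flat_exp n \<longlongrightarrow> 0) (at_right 0)"
    by (rule Lim_transform_eventually)
  moreover have "(flat_exp n \<longlongrightarrow> 0) (at_left 0)"
  proof (rule Lim_transform_eventually[OF tendsto_const])
    show "\<forall>\<^sub>F t in at_left 0. 0 = flat_exp n t"
      by (rule eventually_mono[OF eventually_at_left_real[of "-1" 0]]) (auto simp: flat_exp_def)
  qed
  ultimately show ?thesis by (simp add: filterlim_at_split)
qed

lemma flat_exp_deriv:
  "(flat_exp n has_real_derivative - real n * flat_exp (n + 1) t + flat_exp (n + 2) t) (at t)"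
proof -
  consider "t > 0" | "t < 0" | "t = 0" by linarith
  then show ?thesis
  proof cases
    case 1
    have "((\<lambda>t. inverse t ^ n * exp (- inverse t)) has_real_derivative
        - real n * (inverse t ^ (n + 1) * exp (- inverse t)) + inverse t ^ (n + 2) * exp (- inverse t)) (at t)"
    proof -
      have "((\<lambda>t. inverse t ^ n * exp (- inverse t)) has_real_derivative
        inverse t ^ n * (exp (- inverse t) * (inverse t * inverse t)) +
        real n * (inverse t ^ (n - Suc 0) * - (inverse t * inverse t)) * exp (- inverse t)) (at t)"
        using 1 by (auto intro!: derivative_eq_intros simp: power2_eq_square algebra_simps)
      moreover have "real n * (inverse t ^ (n - Suc 0) * - (inverse t * inverse t)) = - real n * inverse t ^ (n + 1)"
        by (cases n) (auto simp: algebra_simps)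
      ultimately have "((\<lambda>t. inverse t ^ n * exp (- inverse t)) has_real_derivative
        inverse t ^ n * (exp (- inverse t) * (inverse t * inverse t)) +
        - real n * inverse t ^ (n + 1) * exp (- inverse t)) (at t)"
        by (simp only:)
      then show ?thesis by (simp add: algebra_simps)
    qed
    then have "(flat_exp n has_real_derivative
        - real n * (inverse t ^ (n + 1) * exp (- inverse t)) + inverse t ^ (n + 2) * exp (- inverse t)) (at t)"
      by (rule has_field_derivative_transform_within_open[where S = "{0<..}"])
        (use 1 in \<open>auto simp: flat_exp_def\<close>)
    then show ?thesis using 1 by (simp add: flat_exp_def)
  next
    case 2
    have "((\<lambda>t. 0) has_real_derivative 0) (at t)" by simp
    then have "(flat_exp n has_real_derivative 0) (at t)"
      by (rule has_field_derivative_transform_within_open[where S = "{..<0}"])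
        (use 2 in \<open>auto simp: flat_exp_def\<close>)
    then show ?thesis using 2 by (simp add: flat_exp_def)
  next
    case 3
    \<comment> \<open>At 0 the difference quotient of member n is member n+1, which tends to 0; this
      is also the value of the claimed formula there.\<close>
    have "((\<lambda>h. (flat_exp n (0 + h) - flat_exp n 0) / h) \<longlongrightarrow> 0) (at 0)"
      by (rule Lim_transform_eventually[OF flat_exp_tendsto[of "n + 1"]])
        (auto simp: flat_exp_def eventually_at_filter field_simps)
    then show ?thesis using 3 by (simp add: DERIV_def flat_exp_def)
  qed
qed

lemma smooth_on_flat_exp: "smooth_on UNIV (flat_exp n)"
proof (rule smooth_onI)
  show "Ck_on k UNIV (flat_exp n)" for k
  proof (induction k arbitrary: n)
    case 0
    then show ?case
      using flat_exp_deriv by (auto intro!: DERIV_continuous_on[of _ _ "\<lambda>t. - real n * flat_exp (n + 1) t + flat_exp (n + 2) t"])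
  next
    case (Suc k)
    show ?case
    proof (rule Ck_on_SucI)
      show "(flat_exp n has_derivative (\<lambda>v. (- real n * flat_exp (n + 1) t + flat_exp (n + 2) t) * v)) (at t)" for t
        using flat_exp_deriv[of n t] unfolding has_field_derivative_def by simp
      show "Ck_on k UNIV (\<lambda>t. (- real n * flat_exp (n + 1) t + flat_exp (n + 2) t) * v)" for v
        by (intro Ck_on_mult Ck_on_add Ck_on_const Suc.IH open_UNIV)
    qed simp
  qed
qed

text \<open>The bump is u / (u + w): \<open>u\<close> is positive exactly inside radius r and
  \<open>w\<close> exactly outside radius r/2, so they never vanish together. The quotient is 1
  where w = 0 and 0 where u = 0.\<close>

lemma smooth_bump_exists:
  fixes p :: "'a::euclidean_space"
  assumes "r > 0"
  shows "\<exists>b::'a \<Rightarrow> real. smooth_on UNIV b \<and> (\<forall>y. dist p y \<le> r / 2 \<longrightarrow> b y = 1) \<and> (\<forall>y. dist p y \<ge> r \<longrightarrow> b y = 0)"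
proof -
  \<comment> \<open>The squared distance to \<open>p\<close>, spelled out as a sum of products of
    affine functions so that its smoothness is immediate; the distance itself is not differentiable
    at \<open>p\<close>.\<close>
  define q where "q y = (\<Sum>b\<in>Basis. (y \<bullet> b + - (p \<bullet> b)) * (y \<bullet> b + - (p \<bullet> b)))" for y
  have q: "q y = (dist p y)\<^sup>2" for y
  proof -
    have "q y = (y - p) \<bullet> (y - p)"
      by (subst euclidean_inner) (simp add: q_def inner_diff_left)
    then show ?thesis
      by (simp add: dist_norm power2_norm_eq_inner norm_minus_commute[of p])
  qed
  have sq: "smooth_on UNIV q"
    unfolding q_def
  proof (rule smooth_onI, rule Ck_on_sum[OF open_UNIV])
    fix k and b :: 'a
    have "Ck_on k UNIV (\<lambda>y. y \<bullet> b + - (p \<bullet> b))"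
      by (rule Ck_on_add[OF open_UNIV Ck_on_linear[OF open_UNIV bounded_linear_inner_left] Ck_on_const[OF open_UNIV]])
    from Ck_on_mult[OF open_UNIV this this]
    show "Ck_on k UNIV (\<lambda>y. (y \<bullet> b + - (p \<bullet> b)) * (y \<bullet> b + - (p \<bullet> b)))" .
  qed
  define u where "u y = flat_exp 0 (r\<^sup>2 + (-1) * q y)" for y
  define w where "w y = flat_exp 0 (q y + - ((r / 2)\<^sup>2))" for y
  note comp = smooth_on_compose[where T = UNIV and g = "flat_exp 0", OF open_UNIV open_UNIV subset_UNIV _ smooth_on_flat_exp]
  have su: "smooth_on UNIV u" unfolding u_def
    by (rule comp, rule smooth_on_add[OF open_UNIV smooth_on_const[OF open_UNIV]
          smooth_on_mult[OF open_UNIV smooth_on_const[OF open_UNIV] sq]])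
  have sw: "smooth_on UNIV w" unfolding w_def
    by (rule comp, rule smooth_on_add[OF open_UNIV sq smooth_on_const[OF open_UNIV]])
  have lt: "(r / 2)\<^sup>2 < r\<^sup>2" using assms by (simp add: power2_eq_square)
  have pos: "u y + w y \<noteq> 0" for y
  proof (cases "q y < r\<^sup>2")
    case True
    then have "u y > 0" "w y \<ge> 0" by (auto simp: u_def w_def flat_exp_def)
    then show ?thesis by linarith
  next
    case False
    then have "u y \<ge> 0" "w y > 0" using lt by (auto simp: u_def w_def flat_exp_def)
    then show ?thesis by linarith
  qed
  have "smooth_on UNIV (\<lambda>y. u y * inverse (u y + w y))"
    by (rule smooth_on_mult[OF open_UNIV su smooth_on_inverse[OF open_UNIV pos smooth_on_add[OF open_UNIV su sw]]])
  moreover have "u y * inverse (u y + w y) = 1" if "dist p y \<le> r / 2" for y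
  proof -
    have "q y \<le> (r / 2)\<^sup>2" unfolding q using that by (intro power_mono) auto
    then have "w y = 0" by (simp add: w_def flat_exp_def)
    then show ?thesis using pos[of y] by simp
  qed
  moreover have "u y * inverse (u y + w y) = 0" if "dist p y \<ge> r" for y
  proof -
    have "q y \<ge> r\<^sup>2" unfolding q using that assms by (intro power_mono) auto
    then show ?thesis by (simp add: u_def flat_exp_def)
  qed
  ultimately show ?thesis by blast
qed

section \<open>Hadamard's lemma\<close>

text \<open>Differentiating under the integral replaces \<open>H\<close> by a directional derivative
  and produces a factor t. The weight \<phi> is there to absorb that factor, which makes the
  statement stable under the induction.\<close>

lemma Ck_on_line_integral:
  fixes p :: "'a::euclidean_space" and H :: "'a \<Rightarrow> real"
  assumes "continuous_on {0..1} \<phi>" "Ck_on k (ball p r) H"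
  shows "Ck_on k (ball p r) (\<lambda>x. integral {0..1} (\<lambda>t. \<phi> t * H (p + t *\<^sub>R (x - p))))"
proof -
  have ball: "p + t *\<^sub>R (x - p) \<in> ball p r" if "x \<in> ball p r" "t \<in> {0..1}" for x t
  proof -
    have "norm (t *\<^sub>R (x - p)) \<le> norm (x - p)" using that by (simp add: mult_left_le_one_le)
    also have "\<dots> < r" using that by (simp add: dist_norm norm_minus_commute)
    finally show ?thesis by (simp add: dist_norm)
  qed
  have cont: "continuous_on (ball p r \<times> cbox 0 1) (\<lambda>(x, t). \<phi> t * H (p + t *\<^sub>R (x - p)))"
    if "continuous_on {0..1} \<phi>" "continuous_on (ball p r) H" for \<phi> and H :: "'a \<Rightarrow> real"
    unfolding case_prod_unfold
    by (intro continuous_intros continuous_on_compose2[OF that(1)] continuous_on_compose2[OF that(2)])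
      (use ball in \<open>auto simp: cbox_interval\<close>)
  show ?thesis
    using assms
  proof (induction k arbitrary: \<phi> H)
    case 0
    then show ?case
      using integral_continuous_on_param[OF cont[of \<phi> H]] by (simp add: cbox_interval)
  next
    case (Suc k)
    \<comment> \<open>The x-derivative of the integrand as a bounded linear map, the form in which
      the Leibniz rule takes it. Writing it over \<open>Basis\<close> reduces joint continuity in
      (x, t) to scalar functions.\<close>
    define G where "G x t = (\<Sum>b\<in>Basis. (\<phi> t * t * frechet_derivative H (at (p + t *\<^sub>R (x - p))) b) *\<^sub>R blinfun_inner_left b)"
      for x :: 'a and t

    have cH: "continuous_on (ball p r) H" using Ck_on_continuous[OF Suc.prems(2)] .
    have cD: "continuous_on (ball p r) (\<lambda>y. frechet_derivative H (at y) b)" for b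
      using Suc.prems(2) Ck_on_continuous by simp blast
    have lin: "linear (frechet_derivative H (at y))" if "y \<in> ball p r" for y
      using Ck_on_SucD[OF Suc.prems(2) that] has_derivative_linear by blast
    have G: "blinfun_apply (G x t) v = \<phi> t * t * frechet_derivative H (at (p + t *\<^sub>R (x - p))) v"
      if "x \<in> ball p r" "t \<in> {0..1}" for x t v
    proof -
      have "frechet_derivative H (at (p + t *\<^sub>R (x - p))) v =
          frechet_derivative H (at (p + t *\<^sub>R (x - p))) (\<Sum>b\<in>Basis. (v \<bullet> b) *\<^sub>R b)"
        by (simp add: euclidean_representation)
      also have "\<dots> = (\<Sum>b\<in>Basis. (v \<bullet> b) * frechet_derivative H (at (p + t *\<^sub>R (x - p))) b)"
        using lin[OF ball[OF that]] by (simp add: linear_sum linear_cmul)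
      finally show ?thesis
        by (simp add: G_def blinfun.sum_left blinfun.scaleR_left sum_distrib_left mult_ac)
    qed
    have cG: "continuous_on (ball p r \<times> cbox 0 1) (\<lambda>(x, t). G x t)"
      unfolding case_prod_unfold G_def
      by (intro continuous_intros continuous_on_compose2[OF Suc.prems(1)] continuous_on_compose2[OF cD])
        (use ball in \<open>auto simp: cbox_interval\<close>)
    have der: "((\<lambda>x. \<phi> t * H (p + t *\<^sub>R (x - p))) has_derivative blinfun_apply (G x t)) (at x within ball p r)"
      if "x \<in> ball p r" "t \<in> {0..1}" for x t
    proof -
      have 1: "((\<lambda>x. p + t *\<^sub>R (x - p)) has_derivative (\<lambda>v. t *\<^sub>R v)) (at x)"
        by (auto intro!: derivative_eq_intros)
      have "((\<lambda>x. H (p + t *\<^sub>R (x - p))) has_derivative (\<lambda>v. frechet_derivative H (at (p + t *\<^sub>R (x - p))) (t *\<^sub>R v))) (at x)"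
        using diff_chain_at[OF 1 Ck_on_SucD[OF Suc.prems(2) ball[OF that]]] by (simp add: o_def)
      then have "((\<lambda>x. \<phi> t * H (p + t *\<^sub>R (x - p))) has_derivative
          (\<lambda>v. \<phi> t * frechet_derivative H (at (p + t *\<^sub>R (x - p))) (t *\<^sub>R v))) (at x)"
        by (rule has_derivative_mult_right)
      moreover have "(\<lambda>v. \<phi> t * frechet_derivative H (at (p + t *\<^sub>R (x - p))) (t *\<^sub>R v)) = blinfun_apply (G x t)"
        using G[OF that] lin[OF ball[OF that]] by (auto simp: fun_eq_iff linear_cmul)
      ultimately show ?thesis using has_derivative_at_withinI by metis
    qed
    have int: "(\<lambda>t. G x t) integrable_on {0..1}" if "x \<in> ball p r" for x
    proof -
      have "continuous_on (cbox 0 1) (\<lambda>t. (\<lambda>(x, t). G x t) (x, t))"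
        by (rule continuous_on_compose2[OF cG]) (use that in \<open>auto intro!: continuous_intros\<close>)
      then show ?thesis using integrable_continuous[of 0 1 "G x"] by (simp add: cbox_interval)
    qed
    have intH: "(\<lambda>t. \<phi> t * H (p + t *\<^sub>R (x - p))) integrable_on cbox 0 1" if "x \<in> ball p r" for x
    proof (rule integrable_continuous)
      have "continuous_on (cbox 0 1) (\<lambda>t. (\<lambda>(x, t). \<phi> t * H (p + t *\<^sub>R (x - p))) (x, t))"
        by (rule continuous_on_compose2[OF cont[OF Suc.prems(1) cH]]) (use that in \<open>auto intro!: continuous_intros\<close>)
      then show "continuous_on (cbox 0 1) (\<lambda>t. \<phi> t * H (p + t *\<^sub>R (x - p)))" by simp
    qed
    show ?case
    proof (rule Ck_on_SucI[OF open_ball])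
      fix x assume x: "x \<in> ball p r"
      have "((\<lambda>x. integral (cbox 0 1) (\<lambda>t. \<phi> t * H (p + t *\<^sub>R (x - p)))) has_derivative
          blinfun_apply (integral (cbox 0 1) (G x))) (at x within ball p r)"
        by (rule leibniz_rule[OF _ intH cG x convex_ball]) (use der in \<open>auto simp: cbox_interval\<close>)
      moreover have "blinfun_apply (integral (cbox 0 1) (G x)) v =
          integral {0..1} (\<lambda>t. (\<phi> t * t) * frechet_derivative H (at (p + t *\<^sub>R (x - p))) v)" for v
      proof -
        have "blinfun_apply (integral {0..1} (G x)) v = integral {0..1} (\<lambda>t. blinfun_apply (G x t) v)"
          by (rule blinfun_apply_integral[OF int[OF x]])
        also have "\<dots> = integral {0..1} (\<lambda>t. (\<phi> t * t) * frechet_derivative H (at (p + t *\<^sub>R (x - p))) v)"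
          by (rule integral_cong) (rule G[OF x])
        finally show ?thesis by (simp only: cbox_interval)
      qed
      then have "blinfun_apply (integral (cbox 0 1) (G x)) =
          (\<lambda>v. integral {0..1} (\<lambda>t. (\<phi> t * t) * frechet_derivative H (at (p + t *\<^sub>R (x - p))) v))"
        by (simp add: fun_eq_iff)
      ultimately show "((\<lambda>x. integral {0..1} (\<lambda>t. \<phi> t * H (p + t *\<^sub>R (x - p)))) has_derivative
          (\<lambda>v. integral {0..1} (\<lambda>t. (\<phi> t * t) * frechet_derivative H (at (p + t *\<^sub>R (x - p))) v))) (at x)"
        using x by (simp add: at_within_open[OF x open_ball] cbox_interval)
    next
      fix v
      show "Ck_on k (ball p r) (\<lambda>x. integral {0..1} (\<lambda>t. (\<phi> t * t) * frechet_derivative H (at (p + t *\<^sub>R (x - p))) v))"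
        using Suc.prems by (intro Suc.IH continuous_intros) auto
    qed
  qed
qed

text \<open>Integrate the derivative of f along the segment from p to x: the fundamental theorem of
  calculus gives f x - f p, and each \<open>h b\<close> is the integral of one partial derivative
  along that segment, smooth by the previous lemma with weight 1.\<close>

lemma Hadamard_lemma:
  fixes p :: "'a::euclidean_space" and f :: "'a \<Rightarrow> real"
  assumes "smooth_on (ball p r) f"
  shows "\<exists>h. (\<forall>b. smooth_on (ball p r) (h b)) \<and> (\<forall>b. h b p = frechet_derivative f (at p) b) \<and>
    (\<forall>x\<in>ball p r. f x = f p + (\<Sum>b\<in>Basis. ((x - p) \<bullet> b) * h b x))"
proof (intro exI conjI allI ballI)
  let ?h = "\<lambda>b x. integral {0..1} (\<lambda>t. 1 * frechet_derivative f (at (p + t *\<^sub>R (x - p))) b)"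
  show "smooth_on (ball p r) (?h b)" for b
    by (intro smooth_onI Ck_on_line_integral continuous_on_const
        smooth_onD[OF smooth_on_frechet_derivative[OF assms]])
  show "?h b p = frechet_derivative f (at p) b" for b by simp
  fix x assume x: "x \<in> ball p r"
  have ball: "p + t *\<^sub>R (x - p) \<in> ball p r" if "t \<in> {0..1}" for t
  proof -
    have "norm (t *\<^sub>R (x - p)) \<le> norm (x - p)" using that by (simp add: mult_left_le_one_le)
    also have "\<dots> < r" using x by (simp add: dist_norm norm_minus_commute)
    finally show ?thesis by (simp add: dist_norm)
  qed
  have der: "(f has_derivative frechet_derivative f (at (p + t *\<^sub>R (x - p)))) (at (p + t *\<^sub>R (x - p)))"
    if "t \<in> {0..1}" for t
    using smooth_on_has_derivative[OF assms ball[OF that]] .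
  have "((\<lambda>t. f (p + t *\<^sub>R (x - p))) has_vector_derivative frechet_derivative f (at (p + t *\<^sub>R (x - p))) (x - p))
      (at t within {0..1})" if "t \<in> {0..1}" for t
  proof -
    have "((\<lambda>t. p + t *\<^sub>R (x - p)) has_derivative (\<lambda>s. s *\<^sub>R (x - p))) (at t)"
      using has_derivative_add[OF has_derivative_const has_derivative_scaleR_left[OF has_derivative_ident], of p "x - p" "at t"]
      by simp
    then have "((\<lambda>t. f (p + t *\<^sub>R (x - p))) has_derivative
        (\<lambda>s. frechet_derivative f (at (p + t *\<^sub>R (x - p))) (s *\<^sub>R (x - p)))) (at t)"
      using diff_chain_at[of "\<lambda>t. p + t *\<^sub>R (x - p)" _ t f] der[OF that] unfolding o_def by blast
    then show ?thesis
      unfolding has_vector_derivative_def linear_cmul[OF has_derivative_linear[OF der[OF that]]]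
      by (rule has_derivative_at_withinI)
  qed
  then have "((\<lambda>t. frechet_derivative f (at (p + t *\<^sub>R (x - p))) (x - p)) has_integral
      f (p + 1 *\<^sub>R (x - p)) - f (p + 0 *\<^sub>R (x - p))) {0..1}"
    by (intro fundamental_theorem_of_calculus) auto
  then have "f x - f p = integral {0..1} (\<lambda>t. frechet_derivative f (at (p + t *\<^sub>R (x - p))) (x - p))"
    by (simp add: integral_unique)
  also have "\<dots> = integral {0..1} (\<lambda>t. \<Sum>b\<in>Basis. ((x - p) \<bullet> b) * frechet_derivative f (at (p + t *\<^sub>R (x - p))) b)"
  proof (rule integral_cong)
    fix t :: real assume t: "t \<in> {0..1}"
    have "frechet_derivative f (at (p + t *\<^sub>R (x - p))) (x - p) =
        frechet_derivative f (at (p + t *\<^sub>R (x - p))) (\<Sum>b\<in>Basis. ((x - p) \<bullet> b) *\<^sub>R b)"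
      by (simp only: euclidean_representation)
    also have "\<dots> = (\<Sum>b\<in>Basis. ((x - p) \<bullet> b) * frechet_derivative f (at (p + t *\<^sub>R (x - p))) b)"
      using has_derivative_linear[OF der[OF t]] by (simp add: linear_sum linear_cmul)
    finally show "frechet_derivative f (at (p + t *\<^sub>R (x - p))) (x - p) =
        (\<Sum>b\<in>Basis. ((x - p) \<bullet> b) * frechet_derivative f (at (p + t *\<^sub>R (x - p))) b)" .
  qed
  also have "\<dots> = (\<Sum>b\<in>Basis. integral {0..1} (\<lambda>t. ((x - p) \<bullet> b) * frechet_derivative f (at (p + t *\<^sub>R (x - p))) b))"
  proof (intro integral_sum integrable_continuous_interval)
    fix b :: 'a
    have "continuous_on (ball p r) (\<lambda>y. frechet_derivative f (at y) b)"
      by (intro smooth_on_continuous smooth_on_frechet_derivative assms)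
    then show "continuous_on {0..1} (\<lambda>t. ((x - p) \<bullet> b) * frechet_derivative f (at (p + t *\<^sub>R (x - p))) b)"
      by (rule continuous_on_mult[OF continuous_on_const continuous_on_compose2])
        (use ball in \<open>auto intro!: continuous_intros\<close>)
  qed simp
  finally show "f x = f p + (\<Sum>b\<in>Basis. ((x - p) \<bullet> b) * ?h b x)"
    by simp
qed

lemma sum_Basis_axis:
  fixes f :: "real ^ 'k \<Rightarrow> real"
  shows "(\<Sum>b\<in>Basis. f b) = (\<Sum>i\<in>UNIV. f (axis i 1))"
proof -
  have eq: "(Basis :: (real ^ 'k) set) = (\<lambda>i. axis i 1) ` UNIV" by (auto simp: Basis_vec_def)
  have inj: "inj (\<lambda>i::'k. axis i (1::real))" by (auto simp: inj_def axis_eq_axis)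
  show ?thesis unfolding eq sum.reindex[OF inj] by (simp add: o_def)
qed

section \<open>Smooth functions of finitely many coordinates\<close>

lemma Ck_coords_continuous: "Ck_coords k m F \<Longrightarrow> continuous_on UNIV F"
  by (cases m) auto

lemma Ck_coords_Suc_mono: "Ck_coords k (Suc m) F \<Longrightarrow> Ck_coords k m F"
  by (induction m arbitrary: F) auto

lemma partial_DERIV:
  assumes "Ck_coords k (Suc m) F" "i < k"
  shows "((\<lambda>t. F (x(i := t))) has_real_derivative partial i F (x(i := t))) (at t)"
proof -
  have "(\<lambda>s. F ((x(i := t))(i := s))) differentiable (at ((x(i := t)) i))"
    using assms unfolding Ck_coords.simps by blast
  then have "(\<lambda>s. F (x(i := s))) differentiable (at t)" by simp
  then have "((\<lambda>s. F (x(i := s))) has_real_derivative deriv (\<lambda>s. F (x(i := s))) t) (at t)"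
    by (simp add: DERIV_deriv_iff_real_differentiable)
  then show ?thesis by (simp add: partial_def)
qed

lemma partial_eqI:
  assumes "((\<lambda>t. F (x(i := t))) has_real_derivative D) (at (x i))"
  shows "partial i F x = D"
  unfolding partial_def using assms by (rule DERIV_imp_deriv)

lemma Ck_coords_SucI:
  assumes "continuous_on UNIV F"
    "\<And>i x. i < k \<Longrightarrow> ((\<lambda>t. F (x(i := t))) has_real_derivative D i x) (at (x i))"
    "\<And>i. i < k \<Longrightarrow> Ck_coords k m (D i)"
  shows "Ck_coords k (Suc m) F"
proof -
  have "partial i F = D i" if "i < k" for i
    by (rule ext) (rule partial_eqI[OF assms(2)[OF that]])
  then show ?thesis
    using assms by (auto simp: real_differentiable_def)
qed

lemma partial_DERIV_at:
  assumes "Ck_coords k (Suc m) F" "i < k"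
  shows "((\<lambda>t. F (x(i := t))) has_real_derivative partial i F x) (at (x i))"
  using partial_DERIV[OF assms, of x "x i"] by simp

lemma Ck_coords_const: "Ck_coords k m (\<lambda>x. c)"
proof (induction m arbitrary: c)
  case (Suc m)
  show ?case by (rule Ck_coords_SucI[where D = "\<lambda>i x. 0"]) (auto intro: Suc)
qed simp

lemma continuous_on_coordinate: "continuous_on UNIV (\<lambda>x::nat \<Rightarrow> real. x j)"
  by (rule continuous_on_product_coordinates)

lemma Ck_coords_coordinate: "Ck_coords k m (\<lambda>x. x j)"
proof (cases m)
  case (Suc n)
  show ?thesis unfolding Suc
    by (rule Ck_coords_SucI[where D = "\<lambda>i x. if i = j then 1 else 0"])
      (auto intro: Ck_coords_const continuous_on_coordinate)
qed (simp add: continuous_on_coordinate)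

lemma Ck_coords_add: "Ck_coords k m F \<Longrightarrow> Ck_coords k m G \<Longrightarrow> Ck_coords k m (\<lambda>x. F x + G x)"
proof (induction m arbitrary: F G)
  case (Suc m)
  show ?case
  proof (rule Ck_coords_SucI)
    show "continuous_on UNIV (\<lambda>x. F x + G x)"
      by (intro continuous_intros Ck_coords_continuous[OF Suc.prems(1)] Ck_coords_continuous[OF Suc.prems(2)])
    show "((\<lambda>t. F (x(i := t)) + G (x(i := t))) has_real_derivative partial i F x + partial i G x) (at (x i))"
      if "i < k" for i x
      by (rule DERIV_add[OF partial_DERIV_at[OF Suc.prems(1) that] partial_DERIV_at[OF Suc.prems(2) that]])
    show "Ck_coords k m (\<lambda>x. partial i F x + partial i G x)" if "i < k" for i
      using Suc.prems that by (intro Suc.IH) auto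
  qed
qed (simp add: continuous_on_add)

lemma Ck_coords_mult: "Ck_coords k m F \<Longrightarrow> Ck_coords k m G \<Longrightarrow> Ck_coords k m (\<lambda>x. F x * G x)"
proof (induction m arbitrary: F G)
  case (Suc m)
  show ?case
  proof (rule Ck_coords_SucI)
    show "continuous_on UNIV (\<lambda>x. F x * G x)"
      by (intro continuous_intros Ck_coords_continuous[OF Suc.prems(1)] Ck_coords_continuous[OF Suc.prems(2)])
    show "((\<lambda>t. F (x(i := t)) * G (x(i := t))) has_real_derivative partial i F x * G x + partial i G x * F x) (at (x i))"
      if "i < k" for i x
      using DERIV_mult[OF partial_DERIV_at[OF Suc.prems(1) that] partial_DERIV_at[OF Suc.prems(2) that], of x x]
      unfolding fun_upd_triv .
    show "Ck_coords k m (\<lambda>x. partial i F x * G x + partial i G x * F x)" if "i < k" for i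
      using Suc.prems that
      by (intro Ck_coords_add Suc.IH Ck_coords_Suc_mono[OF Suc.prems(1)] Ck_coords_Suc_mono[OF Suc.prems(2)]) auto
  qed
qed (simp add: continuous_on_mult)

text \<open>\<open>Ck_coords k\<close> constrains only the first k partial derivatives. Independence
  of the remaining coordinates is split off because it makes the other partial derivatives vanish
  and thereby controls them too.\<close>

definition depends_below :: "nat \<Rightarrow> ((nat \<Rightarrow> real) \<Rightarrow> real) \<Rightarrow> bool" where
  "depends_below k F \<longleftrightarrow> (\<forall>x y. (\<forall>i<k. x i = y i) \<longrightarrow> F x = F y)"

lemma smooth_coords_iff: "F \<in> smooth_coords k \<longleftrightarrow> depends_below k F \<and> (\<forall>m. Ck_coords k m F)"
  by (simp add: smooth_coords_def depends_below_def)

lemma depends_belowD: "depends_below k F \<Longrightarrow> (\<And>i. i < k \<Longrightarrow> x i = y i) \<Longrightarrow> F x = F y"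
  by (simp add: depends_below_def)

lemma partial_beyond:
  assumes "depends_below k F" "i \<ge> k"
  shows "((\<lambda>t. F (x(i := t))) has_real_derivative 0) (at t)" "partial i F x = 0"
proof -
  have "(\<lambda>t. F (x(i := t))) = (\<lambda>t. F x)"
    using assms by (auto intro!: depends_belowD[OF assms(1)])
  then show 1: "((\<lambda>t. F (x(i := t))) has_real_derivative 0) (at t)" for t by simp
  show "partial i F x = 0" by (rule partial_eqI[OF 1])
qed

lemma depends_below_partial:
  assumes "depends_below k F" "i < k"
  shows "depends_below k (partial i F)"
  unfolding depends_below_def
proof (intro allI impI)
  fix x y :: "nat \<Rightarrow> real" assume eq: "\<forall>i<k. x i = y i"
  then have "(\<lambda>t. F (x(i := t))) = (\<lambda>t. F (y(i := t)))"
    by (intro ext depends_belowD[OF assms(1)]) auto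
  then show "partial i F x = partial i F y" using eq assms(2) by (simp add: partial_def)
qed

lemma smooth_coords_partial: "F \<in> smooth_coords k \<Longrightarrow> i < k \<Longrightarrow> partial i F \<in> smooth_coords k"
  unfolding smooth_coords_iff using depends_below_partial by (metis Ck_coords.simps(2))

lemma smooth_coords_const: "(\<lambda>x. c) \<in> smooth_coords k"
  by (simp add: smooth_coords_iff Ck_coords_const depends_below_def)

lemma smooth_coords_coordinate: "j < k \<Longrightarrow> (\<lambda>x. x j) \<in> smooth_coords k"
  by (simp add: smooth_coords_iff Ck_coords_coordinate depends_below_def)

lemma smooth_coords_add: "F \<in> smooth_coords k \<Longrightarrow> G \<in> smooth_coords k \<Longrightarrow> (\<lambda>x. F x + G x) \<in> smooth_coords k"
  unfolding smooth_coords_iff using Ck_coords_add by (auto simp: depends_below_def) metis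

lemma smooth_coords_mult: "F \<in> smooth_coords k \<Longrightarrow> G \<in> smooth_coords k \<Longrightarrow> (\<lambda>x. F x * G x) \<in> smooth_coords k"
  unfolding smooth_coords_iff using Ck_coords_mult by (auto simp: depends_below_def) metis

lemma smooth_coords_DERIV:
  "F \<in> smooth_coords k \<Longrightarrow> ((\<lambda>t. F (x(i := t))) has_real_derivative partial i F (x(i := t))) (at t)"
  using partial_DERIV[of k 0 F i x t] partial_beyond[of k F i x] partial_beyond(2)[of k F i]
  unfolding smooth_coords_iff by (cases "i < k") (auto simp del: Ck_coords.simps)

lemma smooth_coords_DERIV_at:
  "F \<in> smooth_coords k \<Longrightarrow> ((\<lambda>t. F (x(i := t))) has_real_derivative partial i F x) (at (x i))"
  using smooth_coords_DERIV[of F k x i "x i"] by simp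

lemma partial_add:
  "F \<in> smooth_coords k \<Longrightarrow> G \<in> smooth_coords k \<Longrightarrow> partial i (\<lambda>x. F x + G x) x = partial i F x + partial i G x"
  by (intro partial_eqI derivative_intros smooth_coords_DERIV_at)

lemma partial_mult:
  assumes "F \<in> smooth_coords k" "G \<in> smooth_coords k"
  shows "partial i (\<lambda>x. F x * G x) x = partial i F x * G x + partial i G x * F x"
  using DERIV_mult[OF smooth_coords_DERIV_at[OF assms(1)] smooth_coords_DERIV_at[OF assms(2)], of x i x]
  unfolding fun_upd_triv by (rule partial_eqI)

lemma partial_coordinate: "partial i (\<lambda>x. x j) x = (if i = j then 1 else 0)"
  by (intro partial_eqI) auto

lemma smooth_coords_continuous: "F \<in> smooth_coords k \<Longrightarrow> continuous_on UNIV F"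
  using Ck_coords_continuous smooth_coords_iff by blast

section \<open>Changing the number of coordinates\<close>

text \<open>The additional partial derivatives are identically zero. Together with the shift of
  variables below, this lets two functions be placed on disjoint blocks of one common list of
  coordinates.\<close>

lemma Ck_coords_weaken: "depends_below k F \<Longrightarrow> Ck_coords k m F \<Longrightarrow> Ck_coords (k + l) m F"
proof (induction m arbitrary: F)
  case (Suc m)
  show ?case
  proof (rule Ck_coords_SucI)
    show "continuous_on UNIV F" using Suc.prems by simp
    show "((\<lambda>t. F (x(i := t))) has_real_derivative partial i F x) (at (x i))" for i x
    proof (cases "i < k")
      case False
      then show ?thesis
        using partial_beyond[OF Suc.prems(1), of i x] by (simp del: fun_upd_apply)
    qed (rule partial_DERIV_at[OF Suc.prems(2)])
    show "Ck_coords (k + l) m (partial i F)" for i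
    proof (cases "i < k")
      case True
      then show ?thesis using Suc.prems by (intro Suc.IH depends_below_partial) auto
    next
      case False
      then have "partial i F = (\<lambda>x. 0)" using partial_beyond(2)[OF Suc.prems(1)] by auto
      then show ?thesis by (simp add: Ck_coords_const)
    qed
  qed
qed simp

lemma smooth_coords_weaken: "F \<in> smooth_coords k \<Longrightarrow> F \<in> smooth_coords (k + l)"
  unfolding smooth_coords_iff using Ck_coords_weaken by (auto simp: depends_below_def)

lemma continuous_on_shift: "continuous_on UNIV (\<lambda>(x::nat \<Rightarrow> real) i. x (i + k))"
  by (intro continuous_on_coordinatewise_then_product continuous_on_coordinate)

lemma shift_upd: "(\<lambda>j. (x(i := t)) (j + k)) = (if i < k then (\<lambda>j. x (j + k)) else (\<lambda>j. x (j + k))(i - k := t))"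
  for x :: "nat \<Rightarrow> real"
  by (auto simp: fun_eq_iff)

lemma Ck_coords_shift: "Ck_coords l m G \<Longrightarrow> Ck_coords (k + l) m (\<lambda>x. G (\<lambda>i. x (i + k)))"
proof (induction m arbitrary: G)
  case 0
  show ?case
    unfolding Ck_coords.simps
    by (rule continuous_on_compose2[OF Ck_coords_continuous[OF 0] continuous_on_shift subset_UNIV])
next
  case (Suc m)
  show ?case
  proof (rule Ck_coords_SucI)
    show "continuous_on UNIV (\<lambda>x. G (\<lambda>i. x (i + k)))"
      by (rule continuous_on_compose2[OF Ck_coords_continuous[OF Suc.prems] continuous_on_shift subset_UNIV])
    let ?D = "\<lambda>i x. if i < k then 0 else partial (i - k) G (\<lambda>j. x (j + k))"
    show "((\<lambda>t. G (\<lambda>j. (x(i := t)) (j + k))) has_real_derivative ?D i x) (at (x i))" if "i < k + l" for i x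
      using partial_DERIV_at[OF Suc.prems, of "i - k" "\<lambda>j. x (j + k)"] that
      by (cases "i < k") (simp_all add: shift_upd del: fun_upd_apply)
    show "Ck_coords (k + l) m (?D i)" if "i < k + l" for i
      using Suc.IH[of "partial (i - k) G"] Suc.prems that by (cases "i < k") (auto simp: Ck_coords_const)
  qed
qed

lemma smooth_coords_shift: "G \<in> smooth_coords l \<Longrightarrow> (\<lambda>x. G (\<lambda>i. x (i + k))) \<in> smooth_coords (k + l)"
  unfolding smooth_coords_iff using Ck_coords_shift by (auto simp: depends_below_def)

section \<open>Chain rule along lines and symmetry of second partials\<close>

text \<open>A basic open set of the product topology restricts finitely many coordinates, and
  finitely many eventual conditions hold together.\<close>

lemma tendsto_fun_componentwise:
  fixes z :: "'b \<Rightarrow> nat \<Rightarrow> real"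
  assumes "\<And>i. ((\<lambda>t. z t i) \<longlongrightarrow> a i) F"
  shows "(z \<longlongrightarrow> a) F"
proof (rule topological_tendstoI)
  fix S :: "(nat \<Rightarrow> real) set" assume S: "open S" "a \<in> S"
  then have "openin (product_topology (\<lambda>i. euclidean) UNIV) S" by (simp add: open_fun_def)
  from product_topology_open_contains_basis[OF this S(2)]
  obtain X where X: "a \<in> (\<Pi>\<^sub>E i\<in>UNIV. X i)" "\<And>i. open (X i)" "finite {i. X i \<noteq> UNIV}" "(\<Pi>\<^sub>E i\<in>UNIV. X i) \<subseteq> S"
    by auto
  have "\<forall>\<^sub>F t in F. \<forall>i\<in>{i. X i \<noteq> UNIV}. z t i \<in> X i"
    using X assms by (intro eventually_ball_finite) (auto intro!: topological_tendstoD)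
  then show "\<forall>\<^sub>F t in F. z t \<in> S"
  proof (rule eventually_mono)
    fix t assume "\<forall>i\<in>{i. X i \<noteq> UNIV}. z t i \<in> X i"
    then have "z t \<in> (\<Pi>\<^sub>E i\<in>UNIV. X i)" by auto
    then show "z t \<in> S" using X(4) by blast
  qed
qed

text \<open>\<open>smooth_coords\<close> speaks of partial derivatives only, so the chain rule has
  to come from their continuity: the increment is split into steps along single coordinates, each
  handled by the mean value theorem, and the intermediate points converge to
  \<open>a\<close>.\<close>

lemma smooth_coords_line_DERIV:
  assumes F: "F \<in> smooth_coords k"
  shows "((\<lambda>t. F (\<lambda>i. a i + t * b i)) has_real_derivative (\<Sum>i<k. partial i F a * b i)) (at 0)"
proof -
  \<comment> \<open>\<open>y n t\<close> has moved the first n coordinates only, so consecutive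
    points differ in coordinate n alone and the increments telescope.\<close>
  define y where "y n t = (\<lambda>i. if i < n then a i + t * b i else a i)" for n :: nat and t :: real
  have step: "\<exists>z. (\<forall>i. \<bar>z i - a i\<bar> \<le> \<bar>t * b i\<bar>) \<and> F (y (Suc n) t) - F (y n t) = t * b n * partial n F z" for n t
  proof -
    let ?g = "\<lambda>s. F ((y n t)(n := a n + s * (t * b n)))"
    have g: "(?g has_real_derivative partial n F ((y n t)(n := a n + s * (t * b n))) * (t * b n)) (at s)" for s
      by (rule DERIV_chain2[where f = "\<lambda>u. F ((y n t)(n := u))", OF smooth_coords_DERIV[OF F]])
        (auto intro!: derivative_eq_intros)
    obtain s where s: "0 < s" "s < 1" "?g 1 - ?g 0 = (1 - 0) * (partial n F ((y n t)(n := a n + s * (t * b n))) * (t * b n))"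
      using MVT2[of 0 1 ?g "\<lambda>s. partial n F ((y n t)(n := a n + s * (t * b n))) * (t * b n)"] g by auto
    have "(y n t)(n := a n + 1 * (t * b n)) = y (Suc n) t" "(y n t)(n := a n + 0 * (t * b n)) = y n t"
      by (auto simp: y_def fun_eq_iff less_Suc_eq)
    then have "F (y (Suc n) t) - F (y n t) = t * b n * partial n F ((y n t)(n := a n + s * (t * b n)))"
      using s(3) by (simp only: diff_0_right mult_1_left mult.commute)
    moreover have "\<bar>((y n t)(n := a n + s * (t * b n))) i - a i\<bar> \<le> \<bar>t * b i\<bar>" for i
      using s(1,2) by (auto simp: y_def abs_mult mult_left_le_one_le)
    ultimately show ?thesis by blast
  qed
  define z where "z n t = (SOME z. (\<forall>i. \<bar>z i - a i\<bar> \<le> \<bar>t * b i\<bar>) \<and>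
    F (y (Suc n) t) - F (y n t) = t * b n * partial n F z)" for n t
  have z: "\<bar>z n t i - a i\<bar> \<le> \<bar>t * b i\<bar>" and zF: "F (y (Suc n) t) - F (y n t) = t * b n * partial n F (z n t)" for n t i
    using someI_ex[OF step[of t n]] unfolding z_def[symmetric] by blast+
  have "(z n \<longlongrightarrow> a) (at 0)" for n
  proof (rule tendsto_fun_componentwise)
    fix i
    have "((\<lambda>t. \<bar>t * b i\<bar>) \<longlongrightarrow> 0) (at 0)"
      by (rule tendsto_rabs_zero[OF tendsto_mult_left_zero[OF tendsto_ident_at]])
    then have "((\<lambda>t. z n t i - a i) \<longlongrightarrow> 0) (at 0)"
      by (rule Lim_null_comparison[rotated]) (simp only: real_norm_def z always_eventually simp_thms)
    then show "((\<lambda>t. z n t i) \<longlongrightarrow> a i) (at 0)" by (rule LIM_zero_cancel)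
  qed
  moreover have "continuous_on UNIV (partial n F)" if "n < k" for n
    using smooth_coords_continuous[OF smooth_coords_partial[OF F that]] .
  ultimately have lim: "((\<lambda>t. partial n F (z n t)) \<longlongrightarrow> partial n F a) (at 0)" if "n < k" for n
    using that by (intro continuous_on_tendsto_compose[of UNIV "partial n F"]) auto
  have tel: "F (\<lambda>i. a i + t * b i) - F a = (\<Sum>n<k. t * b n * partial n F (z n t))" for t
  proof -
    have "F (\<lambda>i. a i + t * b i) = F (y k t)"
      using F by (intro depends_belowD[of k F]) (auto simp: smooth_coords_iff y_def)
    moreover have "F a = F (y 0 t)" by (simp add: y_def)
    moreover have "(\<Sum>n<k. F (y (Suc n) t) - F (y n t)) = F (y k t) - F (y 0 t)"
      by (rule sum_lessThan_telescope)
    ultimately show ?thesis by (simp add: zF)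
  qed
  have "((\<lambda>t. \<Sum>n<k. b n * partial n F (z n t)) \<longlongrightarrow> (\<Sum>n<k. b n * partial n F a)) (at 0)"
    by (intro tendsto_intros lim) auto
  moreover have "\<forall>\<^sub>F t in at 0. (\<Sum>n<k. b n * partial n F (z n t)) = (F (\<lambda>i. a i + t * b i) - F a) / t"
    by (auto simp: eventually_at_filter tel sum_divide_distrib intro!: always_eventually sum.cong)
  ultimately have "((\<lambda>t. (F (\<lambda>i. a i + t * b i) - F a) / t) \<longlongrightarrow> (\<Sum>n<k. b n * partial n F a)) (at 0)"
    by (rule Lim_transform_eventually)
  then show ?thesis by (simp add: DERIV_def mult.commute)
qed

text \<open>The mean value theorem is used twice, in coordinate i for the difference in direction j,
  then in coordinate j for the resulting partial derivative. The left side is symmetric in i and j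
  while the right side is not, which yields commuting partials in the limit.\<close>

lemma second_difference:
  assumes F: "F \<in> smooth_coords k" and ij: "i < k" "j < k" "i \<noteq> j" and h: "h > 0"
  shows "\<exists>z. (\<forall>l. \<bar>z l - x l\<bar> \<le> h) \<and>
    F (x(i := x i + h, j := x j + h)) - F (x(i := x i + h)) - (F (x(j := x j + h)) - F x) = h * (h * partial j (partial i F) z)"
proof -
  let ?g = "\<lambda>s. F ((x(j := x j + h))(i := s)) - F (x(i := s))"
  have g: "(?g has_real_derivative partial i F ((x(j := x j + h))(i := s)) - partial i F (x(i := s))) (at s)" for s
    by (intro derivative_intros smooth_coords_DERIV[OF F])
  obtain s where s: "x i < s" "s < x i + h"
    "?g (x i + h) - ?g (x i) = (x i + h - x i) * (partial i F ((x(j := x j + h))(i := s)) - partial i F (x(i := s)))"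
    using MVT2[of "x i" "x i + h" ?g "\<lambda>s. partial i F ((x(j := x j + h))(i := s)) - partial i F (x(i := s))"] g h by auto
  let ?p = "\<lambda>t. partial i F ((x(i := s))(j := t))"
  have p: "(?p has_real_derivative partial j (partial i F) ((x(i := s))(j := t))) (at t)" for t
    by (rule smooth_coords_DERIV[OF smooth_coords_partial[OF F ij(1)]])
  obtain t where t: "x j < t" "t < x j + h" "?p (x j + h) - ?p (x j) = (x j + h - x j) * partial j (partial i F) ((x(i := s))(j := t))"
    using MVT2[of "x j" "x j + h" ?p "\<lambda>t. partial j (partial i F) ((x(i := s))(j := t))"] p h by auto
  have u: "(x(j := x j + h))(i := s) = (x(i := s))(j := x j + h)" for s using ij(3) by (rule fun_upd_twist[symmetric])
  have "(x(i := s))(j := x j) = x(i := s)" "(x(j := x j + h))(i := x i) = x(j := x j + h)" using ij(3) by auto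
  then have "F (x(i := x i + h, j := x j + h)) - F (x(i := x i + h)) - (F (x(j := x j + h)) - F x) =
      h * (h * partial j (partial i F) ((x(i := s))(j := t)))"
    using s(3) t(3) unfolding u by simp
  moreover have "\<bar>((x(i := s))(j := t)) l - x l\<bar> \<le> h" for l using s t h by auto
  ultimately show ?thesis by blast
qed

text \<open>Both orders of differentiation evaluate the same second difference, at points that
  shrink to x. In \<open>commutator\<close> this removes the second-order terms.\<close>

lemma partial_commute:
  assumes F: "F \<in> smooth_coords k" and ij: "i < k" "j < k"
  shows "partial i (partial j F) x = partial j (partial i F) x"
proof (cases "i = j")
  case False
  let ?h = "\<lambda>n. inverse (real (Suc n))"
  have h: "?h n > 0" for n by simp
  obtain z where z: "\<And>n l. \<bar>z n l - x l\<bar> \<le> ?h n"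
    and zF: "\<And>n. F (x(i := x i + ?h n, j := x j + ?h n)) - F (x(i := x i + ?h n)) - (F (x(j := x j + ?h n)) - F x) = ?h n * (?h n * partial j (partial i F) (z n))"
    using second_difference[OF F ij False h] by metis
  obtain z' where z': "\<And>n l. \<bar>z' n l - x l\<bar> \<le> ?h n"
    and zF': "\<And>n. F (x(j := x j + ?h n, i := x i + ?h n)) - F (x(j := x j + ?h n)) - (F (x(i := x i + ?h n)) - F x) = ?h n * (?h n * partial i (partial j F) (z' n))"
    using second_difference[OF F ij(2,1) False[symmetric] h] by metis
  have "?h n * (?h n * partial j (partial i F) (z n)) = ?h n * (?h n * partial i (partial j F) (z' n))" for n
    unfolding zF[symmetric] zF'[symmetric] fun_upd_twist[OF False] by simp
  then have eq: "partial j (partial i F) (z n) = partial i (partial j F) (z' n)" for n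
    by (metis h less_irrefl mult_left_cancel)
  have lim: "w \<longlonglongrightarrow> x" if "\<And>n l. \<bar>w n l - x l\<bar> \<le> ?h n" for w
  proof (rule tendsto_fun_componentwise)
    fix l
    have "(\<lambda>n. w n l - x l) \<longlonglongrightarrow> 0"
      by (rule Lim_null_comparison[OF _ LIMSEQ_inverse_real_of_nat]) (use that in \<open>simp add: always_eventually\<close>)
    then show "(\<lambda>n. w n l) \<longlonglongrightarrow> x l" by (rule LIM_zero_cancel)
  qed
  have c: "continuous_on UNIV (partial j (partial i F))" "continuous_on UNIV (partial i (partial j F))"
    using F ij by (auto intro!: smooth_coords_continuous smooth_coords_partial)
  have "(\<lambda>n. partial j (partial i F) (z n)) \<longlonglongrightarrow> partial j (partial i F) x"
    using continuous_on_tendsto_compose[OF c(1) lim[of z]] z by simp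
  moreover have "(\<lambda>n. partial i (partial j F) (z' n)) \<longlonglongrightarrow> partial i (partial j F) x"
    using continuous_on_tendsto_compose[OF c(2) lim[of z']] z' by simp
  ultimately show ?thesis unfolding eq by (rule LIMSEQ_unique[symmetric])
qed simp

text \<open>Convex combinations of measures exist for parameters in [0, 1], so two curves are known
  to agree only to the right of 0; the one-sided limit still determines the derivative.\<close>

lemma real_derivative_unique_right:
  fixes \<phi> \<psi> :: "real \<Rightarrow> real"
  assumes "(\<phi> has_real_derivative D) (at 0)" "(\<psi> has_real_derivative E) (at 0)" "\<And>t. 0 \<le> t \<Longrightarrow> t \<le> 1 \<Longrightarrow> \<phi> t = \<psi> t"
  shows "D = E"
proof -
  have 1: "((\<lambda>h. (\<phi> h - \<phi> 0) / h) \<longlongrightarrow> D) (at_right 0)" "((\<lambda>h. (\<psi> h - \<psi> 0) / h) \<longlongrightarrow> E) (at_right 0)"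
    using assms(1,2) by (auto simp: DERIV_def filterlim_at_split)
  have "\<forall>\<^sub>F h in at_right 0. (\<phi> h - \<phi> 0) / h = (\<psi> h - \<psi> 0) / h"
    using eventually_at_right_real[of 0 1] by (rule eventually_mono) (use assms(3) in auto)
  from Lim_transform_eventually[OF 1(1) this] show ?thesis
    using 1(2) tendsto_unique trivial_limit_at_right_real by blast
qed

section \<open>Semi-inner products and Cauchy completion\<close>

text \<open>Three instances follow: a tangent space with \<open>metric\<close>, the vector fields
  with \<open>l2_inner\<close>, and Cauchy sequences of fields with the limits of such products.
  Null vectors occur in the last two, hence semidefiniteness; the laws are restricted to a carrier
  because the forms are arbitrary outside it.\<close>

locale semi_inner =
  fixes S :: "'a::real_vector set" and B :: "'a \<Rightarrow> 'a \<Rightarrow> real"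
  assumes subspace: "subspace S"
    and sym: "x \<in> S \<Longrightarrow> y \<in> S \<Longrightarrow> B x y = B y x"
    and add_left: "x \<in> S \<Longrightarrow> y \<in> S \<Longrightarrow> z \<in> S \<Longrightarrow> B (x + y) z = B x z + B y z"
    and scale_left: "x \<in> S \<Longrightarrow> y \<in> S \<Longrightarrow> B (c *\<^sub>R x) y = c * B x y"
    and nonneg: "x \<in> S \<Longrightarrow> B x x \<ge> 0"
begin

lemmas closed_simps = subspace_0[OF subspace] subspace_add[OF subspace] subspace_diff[OF subspace]
  subspace_scale[OF subspace] subspace_neg[OF subspace] subspace_sum[OF subspace]

lemma add_right: "x \<in> S \<Longrightarrow> y \<in> S \<Longrightarrow> z \<in> S \<Longrightarrow> B z (x + y) = B z x + B z y"
  using sym add_left closed_simps by metis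

lemma scale_right: "x \<in> S \<Longrightarrow> y \<in> S \<Longrightarrow> B x (c *\<^sub>R y) = c * B x y"
  using sym scale_left closed_simps by metis

lemma diff_left: "x \<in> S \<Longrightarrow> y \<in> S \<Longrightarrow> z \<in> S \<Longrightarrow> B (x - y) z = B x z - B y z"
  using add_left[of x "(-1) *\<^sub>R y" z] scale_left[of y z "-1"] closed_simps by simp

lemma diff_right: "x \<in> S \<Longrightarrow> y \<in> S \<Longrightarrow> z \<in> S \<Longrightarrow> B z (x - y) = B z x - B z y"
  using sym diff_left closed_simps by metis

lemma zero_left [simp]: "y \<in> S \<Longrightarrow> B 0 y = 0"
  using scale_left[of y y 0] by simp

lemma zero_right [simp]: "y \<in> S \<Longrightarrow> B y 0 = 0"
  using scale_right[of y y 0] by simp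

lemma sum_left: "(\<And>i. i \<in> I \<Longrightarrow> f i \<in> S) \<Longrightarrow> y \<in> S \<Longrightarrow> B (\<Sum>i\<in>I. f i) y = (\<Sum>i\<in>I. B (f i) y)"
  by (induction I rule: infinite_finite_induct) (auto simp: add_left closed_simps)

lemma sum_right: "(\<And>i. i \<in> I \<Longrightarrow> f i \<in> S) \<Longrightarrow> y \<in> S \<Longrightarrow> B y (\<Sum>i\<in>I. f i) = (\<Sum>i\<in>I. B y (f i))"
  by (induction I rule: infinite_finite_induct) (auto simp: add_right closed_simps)

lemma square_diff: "x \<in> S \<Longrightarrow> y \<in> S \<Longrightarrow> B (x - y) (x - y) = B x x - 2 * B x y + B y y"
  using sym by (simp add: diff_left diff_right closed_simps)

lemma square_add: "x \<in> S \<Longrightarrow> y \<in> S \<Longrightarrow> B (x + y) (x + y) = B x x + 2 * B x y + B y y"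
  using sym by (simp add: add_left add_right closed_simps)

section \<open>Cauchy-Schwarz inequality and seminorm\<close>

lemma Cauchy_Schwarz:
  assumes "x \<in> S" "y \<in> S"
  shows "(B x y)\<^sup>2 \<le> B x x * B y y"
proof -
  have q: "0 \<le> B x x - 2 * t * B x y + t\<^sup>2 * B y y" for t
    using nonneg[of "x - t *\<^sub>R y"] assms
    by (simp add: square_diff scale_left scale_right closed_simps power2_eq_square algebra_simps)
  show ?thesis
  proof (cases "B y y = 0")
    case True
    have "B x y = 0"
    proof (rule ccontr)
      assume "B x y \<noteq> 0"
      \<comment> \<open>With \<open>B y y = 0\<close> the quadratic is affine in t, and this t gives
        it the value -1.\<close>
      then show False
        using q[of "(B x x + 1) / (2 * B x y)"] True by simp
    qed
    then show ?thesis using True by simp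
  next
    case False
    then have "B y y > 0" using nonneg[OF assms(2)] by simp
    then show ?thesis using q[of "B x y / B y y"] by (simp add: field_simps power2_eq_square)
  qed
qed

definition nrm :: "'a \<Rightarrow> real" where "nrm x = sqrt (B x x)"

lemma nrm_nonneg [simp]: "x \<in> S \<Longrightarrow> nrm x \<ge> 0"
  by (simp add: nrm_def nonneg)

lemma nrm_square: "x \<in> S \<Longrightarrow> (nrm x)\<^sup>2 = B x x"
  by (simp add: nrm_def nonneg)

lemma abs_le_nrm:
  assumes "x \<in> S" "y \<in> S"
  shows "\<bar>B x y\<bar> \<le> nrm x * nrm y"
  using real_sqrt_le_mono[OF Cauchy_Schwarz[OF assms]] by (simp add: nrm_def real_sqrt_mult)

lemma nrm_triangle:
  assumes "x \<in> S" "y \<in> S"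
  shows "nrm (x + y) \<le> nrm x + nrm y"
proof (rule power2_le_imp_le)
  show "(nrm (x + y))\<^sup>2 \<le> (nrm x + nrm y)\<^sup>2"
    using abs_le_nrm[OF assms] assms
    by (simp add: nrm_square closed_simps square_add power2_sum)
qed (use assms in simp)

lemma nrm_scale: "x \<in> S \<Longrightarrow> nrm (c *\<^sub>R x) = \<bar>c\<bar> * nrm x"
  by (simp add: nrm_def scale_left scale_right closed_simps real_sqrt_mult flip: mult.assoc)

lemma nrm_minus_commute: "x \<in> S \<Longrightarrow> y \<in> S \<Longrightarrow> nrm (x - y) = nrm (y - x)"
  using nrm_scale[of "x - y" "-1"] by (simp add: closed_simps)

lemma nrm_sum: "(\<And>i. i \<in> I \<Longrightarrow> f i \<in> S) \<Longrightarrow> nrm (\<Sum>i\<in>I. f i) \<le> (\<Sum>i\<in>I. nrm (f i))"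
proof (induction I rule: infinite_finite_induct)
  case (insert i I)
  have "nrm (f i + sum f I) \<le> nrm (f i) + nrm (sum f I)"
    using insert by (intro nrm_triangle closed_simps) auto
  also have "nrm (sum f I) \<le> (\<Sum>i\<in>I. nrm (f i))" using insert by simp
  finally show ?case using insert by simp
qed (simp_all add: nrm_def closed_simps)

lemma nrm_zero [simp]: "nrm 0 = 0"
  by (simp add: nrm_def closed_simps)

lemma null_left:
  assumes "x \<in> S" "y \<in> S" "nrm x = 0"
  shows "B x y = 0"
  using abs_le_nrm[OF assms(1,2)] assms(3) by simp

lemma null_cong:
  assumes "x \<in> S" "x' \<in> S" "y \<in> S" "nrm (x - x') = 0"
  shows "B x y = B x' y"
  using null_left[OF closed_simps(3)[OF assms(1,2)] assms(3,4)] diff_left[OF assms(1-3)] by simp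

text \<open>First variation: the square is a quadratic polynomial in t, and t = B a w / B w w would
  lower it by (B a w)^2 / B w w.\<close>

lemma orthogonal_of_minimal:
  assumes a: "a \<in> S" and w: "w \<in> S" and min: "\<And>t. B a a \<le> B (a - t *\<^sub>R w) (a - t *\<^sub>R w)"
  shows "B a w = 0"
proof (cases "B w w = 0")
  case True
  then show ?thesis using null_left[OF w a] sym[OF a w] by (simp add: nrm_def)
next
  case False
  then have pos: "B w w > 0" using nonneg[OF w] by simp
  have "B (a - t *\<^sub>R w) (a - t *\<^sub>R w) = B a a - 2 * t * B a w + t\<^sup>2 * B w w" for t
    using a w by (simp add: square_diff scale_left scale_right closed_simps power2_eq_square)
  from min[of "B a w / B w w", unfolded this] have "(B a w)\<^sup>2 \<le> 0"
    using pos by (simp add: field_simps power2_eq_square)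
  then show ?thesis by simp
qed

section \<open>Closures and orthogonal projection\<close>

text \<open>The closure is taken for the seminorm, so it contains with an element everything in
  \<open>S\<close> at distance 0 from it: membership is a property of classes.\<close>

definition clos :: "'a set \<Rightarrow> 'a set" where
  "clos G = {a \<in> S. \<forall>e>0. \<exists>w\<in>G. nrm (a - w) < e}"

lemma clos_subset: "G \<subseteq> S \<Longrightarrow> G \<subseteq> clos G"
  by (auto simp: clos_def intro!: bexI)

lemma clos_orthogonal:
  assumes G: "G \<subseteq> S" and a: "a \<in> S" and orth: "\<And>w. w \<in> G \<Longrightarrow> B a w = 0" and w: "w \<in> clos G"
  shows "B a w = 0"
proof (rule ccontr)
  assume "B a w \<noteq> 0"
  define e where "e = \<bar>B a w\<bar> / (nrm a + 1)"
  have n: "nrm a + 1 > 0" using a by (simp add: add_nonneg_pos)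
  then have "e > 0" using \<open>B a w \<noteq> 0\<close> by (simp add: e_def)
  then obtain z where z: "z \<in> G" "nrm (w - z) < e" using w by (auto simp: clos_def)
  have zS: "z \<in> S" "w \<in> S" using z G w by (auto simp: clos_def)
  have "\<bar>B a w\<bar> = \<bar>B a (w - z)\<bar>" using diff_right[OF zS(2,1) a] orth[OF z(1)] by simp
  also have "\<dots> \<le> nrm a * nrm (w - z)" by (intro abs_le_nrm a closed_simps zS)
  also have "\<dots> \<le> nrm a * e" using z a by (intro mult_left_mono) auto
  also have "\<dots> < (nrm a + 1) * e" using \<open>e > 0\<close> by simp
  also have "\<dots> = \<bar>B a w\<bar>" using n by (simp add: e_def)
  finally show False by simp
qed

lemma subspace_clos:
  assumes G: "subspace G" "G \<subseteq> S"
  shows "subspace (clos G)"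
proof (rule subspaceI)
  show "0 \<in> clos G" using subspace_0[OF G(1)] clos_subset[OF G(2)] by blast
next
  fix x y assume x: "x \<in> clos G" and y: "y \<in> clos G"
  then have S: "x \<in> S" "y \<in> S" by (auto simp: clos_def)
  have "\<exists>w\<in>G. nrm (x + y - w) < e" if "e > 0" for e
  proof -
    obtain w z where w: "w \<in> G" "nrm (x - w) < e / 2" "z \<in> G" "nrm (y - z) < e / 2"
      using x y \<open>e > 0\<close> by (auto simp: clos_def dest!: spec[of _ "e / 2"])
    have "nrm (x + y - (w + z)) = nrm ((x - w) + (y - z))" by (simp add: algebra_simps)
    also have "\<dots> \<le> nrm (x - w) + nrm (y - z)"
      using S w G(2) by (intro nrm_triangle closed_simps) auto
    finally show ?thesis using w subspace_add[OF G(1)] by (intro bexI[of _ "w + z"]) auto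
  qed
  then show "x + y \<in> clos G" using S closed_simps by (simp add: clos_def)
next
  fix c x assume x: "x \<in> clos G"
  then have S: "x \<in> S" by (auto simp: clos_def)
  have "\<exists>w\<in>G. nrm (c *\<^sub>R x - w) < e" if "e > 0" for e
  proof -
    obtain w where w: "w \<in> G" "nrm (x - w) < e / (\<bar>c\<bar> + 1)"
      using x \<open>e > 0\<close> by (auto simp: clos_def dest!: spec[of _ "e / (\<bar>c\<bar> + 1)"])
    have "nrm (c *\<^sub>R x - c *\<^sub>R w) = \<bar>c\<bar> * nrm (x - w)"
      using S w G(2) by (subst scaleR_diff_right[symmetric], subst nrm_scale) (auto intro!: closed_simps)
    also have "\<dots> \<le> \<bar>c\<bar> * (e / (\<bar>c\<bar> + 1))" using w by (intro mult_left_mono) auto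
    also have "\<dots> < e" using \<open>e > 0\<close> by (simp add: field_simps)
    finally show ?thesis using w subspace_scale[OF G(1)] by (intro bexI[of _ "c *\<^sub>R w"]) auto
  qed
  then show "c *\<^sub>R x \<in> clos G" using S closed_simps by (simp add: clos_def)
qed

definition cauchy_in :: "(nat \<Rightarrow> 'a) \<Rightarrow> bool" where
  "cauchy_in a \<longleftrightarrow> (\<forall>n. a n \<in> S) \<and> (\<forall>e>0. \<exists>N. \<forall>m\<ge>N. \<forall>n\<ge>N. nrm (a m - a n) < e)"

text \<open>Completeness is only needed for minimizing sequences in \<open>G\<close>, by the parallelogram law.\<close>

lemma projection_exists:
  assumes G: "subspace G" "G \<subseteq> S" and a: "a \<in> S"
    and complete: "\<And>w. cauchy_in w \<Longrightarrow> (\<And>n. w n \<in> G) \<Longrightarrow> \<exists>b\<in>S. (\<lambda>n. nrm (w n - b)) \<longlonglongrightarrow> 0"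
  shows "\<exists>b\<in>clos G. \<forall>w\<in>clos G. B (a - b) w = 0"
proof -
  define D where "D = (\<lambda>w. B (a - w) (a - w)) ` G"
  define d where "d = Inf D"
  have D0: "x \<ge> 0" if "x \<in> D" for x using that G a by (auto simp: D_def intro!: nonneg closed_simps)
  have bdd: "bdd_below D" unfolding bdd_below_def using D0 by blast
  have ne: "D \<noteq> {}" using subspace_0[OF G(1)] by (auto simp: D_def)
  have low: "d \<le> B (a - w) (a - w)" if "w \<in> G" for w
    unfolding d_def by (rule cInf_lower[OF _ bdd]) (use that in \<open>simp add: D_def\<close>)
  have "\<exists>w\<in>G. B (a - w) (a - w) < d + inverse (real (Suc n))" for n
    using cInf_lessD[OF ne, of "d + inverse (real (Suc n))"] by (auto simp: d_def D_def)
  then obtain w where w: "\<And>n. w n \<in> G" "\<And>n. B (a - w n) (a - w n) < d + inverse (real (Suc n))" by metis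
  have wS: "w n \<in> S" for n using w(1) G(2) by blast
  \<comment> \<open>The midpoint of \<open>w m\<close> and \<open>w n\<close> lies in
    \<open>G\<close>, so its squared distance from a is at least d; the parallelogram law turns this
    into a bound on the distance between the two points.\<close>
  have par: "B (w m - w n) (w m - w n) \<le> 2 * (B (a - w m) (a - w m) - d) + 2 * (B (a - w n) (a - w n) - d)" for m n
  proof -
    let ?x = "a - w m" and ?y = "a - w n"
    have S: "?x \<in> S" "?y \<in> S" using a wS by (auto intro: closed_simps)
    have "(1/2) *\<^sub>R (w m + w n) \<in> G" by (intro subspace_scale[OF G(1)] subspace_add[OF G(1)] w)
    from low[OF this] have "d \<le> B ((1/2) *\<^sub>R (?x + ?y)) ((1/2) *\<^sub>R (?x + ?y))"
      by (simp add: algebra_simps flip: scaleR_add_left)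
    also have "\<dots> = 1/4 * B (?x + ?y) (?x + ?y)" using S by (simp add: scale_left scale_right closed_simps)
    finally have "4 * d \<le> B ?x ?x + 2 * B ?x ?y + B ?y ?y" using square_add[OF S] by simp
    moreover have "B (w m - w n) (w m - w n) = B (?y - ?x) (?y - ?x)" by simp
    ultimately show ?thesis using square_diff[OF S(2,1)] sym[OF S] by simp
  qed
  have "cauchy_in w"
    unfolding cauchy_in_def
  proof (intro conjI allI impI wS)
    fix e :: real assume "e > 0"
    then obtain N where N: "inverse (real (Suc N)) < e\<^sup>2 / 4" using reals_Archimedean[of "e\<^sup>2 / 4"] by auto
    have "nrm (w m - w n) < e" if "m \<ge> N" "n \<ge> N" for m n
    proof -
      have le: "B (a - w k) (a - w k) - d < e\<^sup>2 / 4" if "k \<ge> N" for k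
      proof -
        have "inverse (real (Suc k)) \<le> inverse (real (Suc N))" using that by (intro le_imp_inverse_le) auto
        then have "B (a - w k) (a - w k) < d + e\<^sup>2 / 4" using w(2)[of k] N by (meson add_left_mono le_less_trans less_le_trans order_less_imp_le add_strict_left_mono less_trans)
        then show ?thesis by simp
      qed
      have "2 * (B (a - w m) (a - w m) - d) + 2 * (B (a - w n) (a - w n) - d) < 2 * (e\<^sup>2 / 4) + 2 * (e\<^sup>2 / 4)"
        using le[OF that(1)] le[OF that(2)] by (intro add_strict_mono mult_strict_left_mono) auto
      then have "B (w m - w n) (w m - w n) < e\<^sup>2" using par[of m n] by simp
      then show ?thesis unfolding nrm_def using \<open>e > 0\<close> real_sqrt_less_mono by fastforce
    qed
    then show "\<exists>N. \<forall>m\<ge>N. \<forall>n\<ge>N. nrm (w m - w n) < e" by blast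
  qed
  with complete w(1) obtain b where b: "b \<in> S" "(\<lambda>n. nrm (w n - b)) \<longlonglongrightarrow> 0" by blast
  have bc: "b \<in> clos G"
    unfolding clos_def
  proof (intro CollectI conjI b allI impI)
    fix e :: real assume "e > 0"
    then have "\<forall>\<^sub>F n in sequentially. nrm (w n - b) < e" using order_tendstoD(2)[OF b(2)] by blast
    then obtain n where "nrm (w n - b) < e" by (meson eventually_sequentially order_refl)
    then show "\<exists>w\<in>G. nrm (b - w) < e" using w(1)[of n] nrm_minus_commute[OF b(1) wS[of n]] by (intro bexI[of _ "w n"]) auto
  qed
  have lim: "(\<lambda>n. B (a - w n) (a - w n)) \<longlonglongrightarrow> B (a - b) (a - b)"
  proof -
    have "(\<lambda>n. B (a - w n) (a - w n) - B (a - b) (a - b)) \<longlonglongrightarrow> 0"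
    proof (rule tendsto_rabs_zero_cancel, rule tendsto_sandwich[OF _ _ tendsto_const])
      have eq: "B (a - w n) (a - w n) - B (a - b) (a - b) = B (w n - b) (w n - b) - 2 * B (w n - b) (a - b)" for n
      proof -
        have "B ((a - b) - (w n - b)) ((a - b) - (w n - b)) =
            B (a - b) (a - b) - 2 * B (a - b) (w n - b) + B (w n - b) (w n - b)"
          by (intro square_diff closed_simps a b wS)
        moreover have "B (a - b) (w n - b) = B (w n - b) (a - b)" by (intro sym closed_simps a b wS)
        ultimately show ?thesis by simp
      qed
      show "\<forall>\<^sub>F n in sequentially. \<bar>B (a - w n) (a - w n) - B (a - b) (a - b)\<bar>
          \<le> nrm (w n - b) * nrm (w n - b) + 2 * (nrm (w n - b) * nrm (a - b))"
      proof (intro always_eventually allI)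
        fix n
        have "\<bar>B (w n - b) (a - b)\<bar> \<le> nrm (w n - b) * nrm (a - b)"
          "\<bar>B (w n - b) (w n - b)\<bar> \<le> nrm (w n - b) * nrm (w n - b)"
          by (intro abs_le_nrm closed_simps a b wS)+
        then show "\<bar>B (a - w n) (a - w n) - B (a - b) (a - b)\<bar>
          \<le> nrm (w n - b) * nrm (w n - b) + 2 * (nrm (w n - b) * nrm (a - b))"
          unfolding eq by linarith
      qed
      have "(\<lambda>n. nrm (w n - b) * nrm (w n - b) + 2 * (nrm (w n - b) * nrm (a - b)))
          \<longlonglongrightarrow> 0 * 0 + 2 * (0 * nrm (a - b))"
        by (intro tendsto_intros b(2))
      then show "(\<lambda>n. nrm (w n - b) * nrm (w n - b) + 2 * (nrm (w n - b) * nrm (a - b))) \<longlonglongrightarrow> 0"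
        by simp
    qed simp
    then show ?thesis by (rule LIM_zero_cancel)
  qed
  have "B (a - b) z = 0" if z: "z \<in> G" for z
  proof (rule orthogonal_of_minimal)
    show "a - b \<in> S" "z \<in> S" using a b z G by (auto intro: closed_simps)
    fix t
    have zS: "z \<in> S" using z G by blast
    have "(\<lambda>n. B (a - w n) (a - w n)) \<longlonglongrightarrow> d"
    proof (rule tendsto_sandwich[OF _ _ tendsto_const])
      show "\<forall>\<^sub>F n in sequentially. d \<le> B (a - w n) (a - w n)" using low[OF w(1)] by simp
      show "\<forall>\<^sub>F n in sequentially. B (a - w n) (a - w n) \<le> d + inverse (real (Suc n))"
        using w(2) by (auto intro!: always_eventually less_imp_le)
      show "(\<lambda>n. d + inverse (real (Suc n))) \<longlonglongrightarrow> d"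
        using tendsto_add[OF tendsto_const LIMSEQ_inverse_real_of_nat, of d] by simp
    qed
    then have d: "B (a - b) (a - b) = d" by (rule LIMSEQ_unique[OF lim])
    show "B (a - b) (a - b) \<le> B (a - b - t *\<^sub>R z) (a - b - t *\<^sub>R z)"
    proof (rule field_le_epsilon)
      fix e :: real assume "e > 0"
      let ?c = "a - b - t *\<^sub>R z"
      have cS: "?c \<in> S" by (intro closed_simps a b zS)
      have "(\<lambda>n. 2 * (nrm ?c * nrm (w n - b)) + nrm (w n - b) * nrm (w n - b)) \<longlonglongrightarrow> 2 * (nrm ?c * 0) + 0 * 0"
        by (intro tendsto_intros b(2))
      then have "\<forall>\<^sub>F n in sequentially. 2 * (nrm ?c * nrm (w n - b)) + nrm (w n - b) * nrm (w n - b) < e"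
        using order_tendstoD(2)[of _ 0 sequentially e] \<open>e > 0\<close> by simp
      then obtain n where n: "2 * (nrm ?c * nrm (w n - b)) + nrm (w n - b) * nrm (w n - b) < e"
        by (meson eventually_sequentially order_refl)
      \<comment> \<open>The limit b plus t z need not lie in \<open>G\<close>, so the lower bound d
        is applied with \<open>w n\<close> in place of b; the error is controlled by the distance of
        \<open>w n\<close> from b.\<close>
      have "w n + t *\<^sub>R z \<in> G" by (intro subspace_add[OF G(1)] subspace_scale[OF G(1)] w z)
      from low[OF this] have "d \<le> B (?c - (w n - b)) (?c - (w n - b))" by (simp add: algebra_simps)
      also have "\<dots> = B ?c ?c - 2 * B ?c (w n - b) + B (w n - b) (w n - b)"
        by (intro square_diff cS closed_simps b wS)
      also have "\<dots> \<le> B ?c ?c + 2 * (nrm ?c * nrm (w n - b)) + nrm (w n - b) * nrm (w n - b)"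
        using abs_le_nrm[OF cS, of "w n - b"] abs_le_nrm[of "w n - b" "w n - b"] closed_simps(3)[OF wS[of n] b(1)]
        by linarith
      finally show "B (a - b) (a - b) \<le> B ?c ?c + e" using n d by linarith
    qed
  qed
  then have "B (a - b) z = 0" if "z \<in> clos G" for z
    by (rule clos_orthogonal[OF G(2) closed_simps(3)[OF a b(1)] _ that])
  then show ?thesis using bc by blast
qed

text \<open>Two projections differ by an element of the closure that is orthogonal to the closure,
  hence to itself. In a seminormed space this is as much uniqueness as there can be.\<close>

lemma projection_unique:
  assumes G: "subspace G" "G \<subseteq> S" and a: "a \<in> S" and b: "b \<in> clos G" "b' \<in> clos G"
    and "\<And>w. w \<in> clos G \<Longrightarrow> B (a - b) w = 0" "\<And>w. w \<in> clos G \<Longrightarrow> B (a - b') w = 0"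
  shows "nrm (b - b') = 0"
proof -
  have S: "b \<in> S" "b' \<in> S" using b by (auto simp: clos_def)
  have c: "b - b' \<in> clos G" using subspace_diff[OF subspace_clos[OF G]] b by blast
  have "B (b - b') (b - b') = B ((a - b') - (a - b)) (b - b')" by simp
  also have "\<dots> = 0" using assms(6)[OF c] assms(7)[OF c] S a closed_simps by (subst diff_left) auto
  finally show ?thesis by (simp add: nrm_def)
qed

section \<open>The completion, seen as a space of Cauchy sequences\<close>

definition lim_inner :: "(nat \<Rightarrow> 'a) \<Rightarrow> (nat \<Rightarrow> 'a) \<Rightarrow> real" where
  "lim_inner a b = lim (\<lambda>n. B (a n) (b n))"

abbreviation cauchy_seqs :: "(nat \<Rightarrow> 'a) set" where
  "cauchy_seqs \<equiv> Collect cauchy_in"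

lemma cauchy_in_mem: "cauchy_in a \<Longrightarrow> a n \<in> S"
  by (simp add: cauchy_in_def)

lemma cauchy_in_bounded:
  assumes "cauchy_in a"
  shows "\<exists>K>0. \<forall>n. nrm (a n) \<le> K"
proof -
  have aS: "a n \<in> S" for n using cauchy_in_mem[OF assms] .
  obtain N where N: "\<And>m n. m \<ge> N \<Longrightarrow> n \<ge> N \<Longrightarrow> nrm (a m - a n) < 1"
    using assms unfolding cauchy_in_def by (meson zero_less_one)
  define K where "K = (\<Sum>n\<le>N. nrm (a n)) + 1"
  have le: "nrm (a n) \<le> (\<Sum>n\<le>N. nrm (a n))" if "n \<le> N" for n
    using that aS by (intro member_le_sum) auto
  have "nrm (a n) \<le> K" for n
  proof (cases "n \<le> N")
    case True
    then show ?thesis using le[OF True] by (simp add: K_def)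
  next
    case False
    have "nrm (a n) = nrm (a N + (a n - a N))" by simp
    also have "\<dots> \<le> nrm (a N) + nrm (a n - a N)" by (intro nrm_triangle closed_simps aS)
    also have "\<dots> \<le> K" using le[of N] N[of n N] False by (simp add: K_def)
    finally show ?thesis .
  qed
  moreover have "K > 0" using aS by (simp add: K_def sum_nonneg add_nonneg_pos)
  ultimately show ?thesis by blast
qed

lemma lim_inner_tendsto:
  assumes a: "cauchy_in a" and b: "cauchy_in b"
  shows "(\<lambda>n. B (a n) (b n)) \<longlonglongrightarrow> lim_inner a b"
proof -
  have S: "a n \<in> S" "b n \<in> S" for n using a b by (auto simp: cauchy_in_mem)
  obtain K where K: "K > 0" "\<And>n. nrm (a n) \<le> K" using cauchy_in_bounded[OF a] by blast
  obtain L where L: "L > 0" "\<And>n. nrm (b n) \<le> L" using cauchy_in_bounded[OF b] by blast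
  have "Cauchy (\<lambda>n. B (a n) (b n))"
  proof (rule metric_CauchyI)
    fix e :: real assume "e > 0"
    then obtain N N' where N: "\<And>m n. m \<ge> N \<Longrightarrow> n \<ge> N \<Longrightarrow> nrm (a m - a n) < e / (2 * L)"
      and N': "\<And>m n. m \<ge> N' \<Longrightarrow> n \<ge> N' \<Longrightarrow> nrm (b m - b n) < e / (2 * K)"
      using a b K(1) L(1) unfolding cauchy_in_def
      by (metis divide_pos_pos mult_pos_pos zero_less_numeral)
    have "dist (B (a m) (b m)) (B (a n) (b n)) < e" if "m \<ge> max N N'" "n \<ge> max N N'" for m n
    proof -
      have "B (a m) (b m) - B (a n) (b n) = B (a m - a n) (b m) + B (a n) (b m - b n)"
        using S by (simp add: diff_left diff_right)
      also have "\<bar>\<dots>\<bar> \<le> nrm (a m - a n) * nrm (b m) + nrm (a n) * nrm (b m - b n)"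
        using abs_le_nrm[of "a m - a n" "b m"] abs_le_nrm[of "a n" "b m - b n"] S closed_simps by force
      also have "nrm (a m - a n) * nrm (b m) \<le> nrm (a m - a n) * L"
        using S L closed_simps by (intro mult_left_mono) auto
      also have "nrm (a n) * nrm (b m - b n) \<le> K * nrm (b m - b n)"
        using S K closed_simps by (intro mult_right_mono) auto
      also have "nrm (a m - a n) * L < e / (2 * L) * L"
        using N[of m n] that L(1) by (intro mult_strict_right_mono) auto
      also have "K * nrm (b m - b n) < K * (e / (2 * K))"
        using N'[of m n] that K(1) by (intro mult_strict_left_mono) auto
      finally show ?thesis using K(1) L(1) by (simp add: dist_real_def)
    qed
    then show "\<exists>N. \<forall>m\<ge>N. \<forall>n\<ge>N. dist (B (a m) (b m)) (B (a n) (b n)) < e" by blast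
  qed
  then show ?thesis unfolding lim_inner_def using Cauchy_convergent_iff convergent_LIMSEQ_iff by blast
qed

lemma cauchy_in_const: "w \<in> S \<Longrightarrow> cauchy_in (\<lambda>n. w)"
  by (simp add: cauchy_in_def)

lemma lim_inner_const [simp]: "lim_inner (\<lambda>n. w) (\<lambda>n. z) = B w z"
  by (simp add: lim_inner_def)

lemma cauchy_in_image:
  assumes a: "cauchy_in a" and L: "\<And>w. w \<in> S \<Longrightarrow> L w \<in> S" "\<And>w z. w \<in> S \<Longrightarrow> z \<in> S \<Longrightarrow> L (w - z) = L w - L z"
    and C: "\<And>w. w \<in> S \<Longrightarrow> nrm (L w) \<le> C * nrm w"
  shows "cauchy_in (\<lambda>n. L (a n))"
  unfolding cauchy_in_def
proof (intro conjI allI impI)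
  have aS: "a n \<in> S" for n using a by (simp add: cauchy_in_mem)
  show "L (a n) \<in> S" for n by (intro L aS)
  fix e :: real assume "e > 0"
  then have "e / (\<bar>C\<bar> + 1) > 0" by simp
  then obtain N where N: "\<And>m n. m \<ge> N \<Longrightarrow> n \<ge> N \<Longrightarrow> nrm (a m - a n) < e / (\<bar>C\<bar> + 1)"
    using a unfolding cauchy_in_def by metis
  have "nrm (L (a m) - L (a n)) < e" if "m \<ge> N" "n \<ge> N" for m n
  proof -
    have S: "a m - a n \<in> S" by (intro closed_simps aS)
    have "nrm (L (a m) - L (a n)) = nrm (L (a m - a n))" by (simp add: L(2) aS)
    also have "\<dots> \<le> C * nrm (a m - a n)" by (rule C[OF S])
    also have "\<dots> \<le> \<bar>C\<bar> * nrm (a m - a n)" using S by (intro mult_right_mono) auto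
    also have "\<dots> \<le> \<bar>C\<bar> * (e / (\<bar>C\<bar> + 1))" using N[OF that] by (intro mult_left_mono) auto
    also have "\<dots> < e" using \<open>e > 0\<close> by (simp add: field_simps)
    finally show ?thesis .
  qed
  then show "\<exists>N. \<forall>m\<ge>N. \<forall>n\<ge>N. nrm (L (a m) - L (a n)) < e" by blast
qed

lemma cauchy_in_add:
  assumes a: "cauchy_in a" and b: "cauchy_in b"
  shows "cauchy_in (a + b)"
  unfolding cauchy_in_def
proof (intro conjI allI impI)
  have S: "a n \<in> S" "b n \<in> S" for n using a b by (auto simp: cauchy_in_mem)
  show "(a + b) n \<in> S" for n using S closed_simps by simp
  fix e :: real assume "e > 0"
  then have "e / 2 > 0" by simp
  then obtain N N' where N: "\<And>m n. m \<ge> N \<Longrightarrow> n \<ge> N \<Longrightarrow> nrm (a m - a n) < e / 2"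
      and N': "\<And>m n. m \<ge> N' \<Longrightarrow> n \<ge> N' \<Longrightarrow> nrm (b m - b n) < e / 2"
    using a b unfolding cauchy_in_def by metis
  have "nrm ((a + b) m - (a + b) n) < e" if "m \<ge> max N N'" "n \<ge> max N N'" for m n
  proof -
    have "nrm ((a + b) m - (a + b) n) = nrm ((a m - a n) + (b m - b n))" by (simp add: algebra_simps)
    also have "\<dots> \<le> nrm (a m - a n) + nrm (b m - b n)" by (intro nrm_triangle closed_simps S)
    also have "\<dots> < e" using N[of m n] N'[of m n] that by simp
    finally show ?thesis .
  qed
  then show "\<exists>N. \<forall>m\<ge>N. \<forall>n\<ge>N. nrm ((a + b) m - (a + b) n) < e" by blast
qed

lemma cauchy_in_scale:
  assumes "cauchy_in a"
  shows "cauchy_in (c *\<^sub>R a)"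
proof -
  have "cauchy_in (\<lambda>n. c *\<^sub>R a n)"
    by (rule cauchy_in_image[OF assms, of _ "\<bar>c\<bar>"]) (auto simp: closed_simps nrm_scale scaleR_diff_right)
  then show ?thesis by (simp add: scaleR_fun_def)
qed

text \<open>Each law passes to the limit termwise. Closures and projections of this locale become
  available again, now for the completion through its representatives.\<close>

lemma semi_inner_cauchy_seqs: "semi_inner cauchy_seqs lim_inner"
proof
  show sub: "subspace cauchy_seqs"
    using cauchy_in_const[of 0] closed_simps(1)
    by (intro subspaceI) (auto simp: cauchy_in_add cauchy_in_scale zero_fun_def)
  note lim = lim_inner_tendsto LIMSEQ_unique
  fix x y z :: "nat \<Rightarrow> 'a" and c :: real assume x: "x \<in> cauchy_seqs"
  then have xS: "x n \<in> S" for n by (simp add: cauchy_in_mem)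
  have "(\<lambda>n. B (x n) (x n)) \<longlonglongrightarrow> lim_inner x x" using x lim_inner_tendsto by blast
  then show "lim_inner x x \<ge> 0" by (rule LIMSEQ_le_const) (simp add: nonneg xS)
  assume y: "y \<in> cauchy_seqs"
  then have yS: "y n \<in> S" for n by (simp add: cauchy_in_mem)
  show "lim_inner x y = lim_inner y x" unfolding lim_inner_def using sym xS yS by simp
  have "(\<lambda>n. c * B (x n) (y n)) \<longlonglongrightarrow> c * lim_inner x y"
    using x y lim_inner_tendsto by (intro tendsto_intros) auto
  moreover have "(\<lambda>n. B ((c *\<^sub>R x) n) (y n)) \<longlonglongrightarrow> lim_inner (c *\<^sub>R x) y"
    using x y by (intro lim_inner_tendsto cauchy_in_scale) auto
  ultimately show "lim_inner (c *\<^sub>R x) y = c * lim_inner x y"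
    using LIMSEQ_unique by (simp add: scale_left xS yS) blast
  assume z: "z \<in> cauchy_seqs"
  then have zS: "z n \<in> S" for n by (simp add: cauchy_in_mem)
  have "(\<lambda>n. B (x n) (z n) + B (y n) (z n)) \<longlonglongrightarrow> lim_inner x z + lim_inner y z"
    using x y z lim_inner_tendsto by (intro tendsto_intros) auto
  moreover have "(\<lambda>n. B ((x + y) n) (z n)) \<longlonglongrightarrow> lim_inner (x + y) z"
    using x y z by (intro lim_inner_tendsto cauchy_in_add) auto
  ultimately show "lim_inner (x + y) z = lim_inner x z + lim_inner y z"
    using LIMSEQ_unique by (simp add: add_left xS yS zS) blast
qed

abbreviation lim_nrm :: "(nat \<Rightarrow> 'a) \<Rightarrow> real" where
  "lim_nrm \<equiv> semi_inner.nrm lim_inner"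

lemma lim_nrm_eq: "lim_nrm a = sqrt (lim_inner a a)"
  by (simp add: semi_inner.nrm_def[OF semi_inner_cauchy_seqs])

lemma lim_nrm_tendsto: "cauchy_in a \<Longrightarrow> (\<lambda>n. nrm (a n)) \<longlonglongrightarrow> lim_nrm a"
  unfolding lim_nrm_eq nrm_def by (intro tendsto_intros lim_inner_tendsto)

lemma cauchy_in_diff: "cauchy_in a \<Longrightarrow> cauchy_in b \<Longrightarrow> cauchy_in (a - b)"
  using semi_inner.closed_simps(3)[OF semi_inner_cauchy_seqs, of a b] by simp

lemma cauchy_in_approx:
  assumes a: "cauchy_in a" and e: "e > 0"
  shows "\<exists>N. \<forall>k\<ge>N. lim_nrm (a - (\<lambda>n. a k)) \<le> e"
proof -
  obtain N where N: "\<And>m n. m \<ge> N \<Longrightarrow> n \<ge> N \<Longrightarrow> nrm (a m - a n) < e"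
    using a e unfolding cauchy_in_def by metis
  have "lim_nrm (a - (\<lambda>n. a k)) \<le> e" if "k \<ge> N" for k
  proof (rule LIMSEQ_le_const2[OF lim_nrm_tendsto])
    show "cauchy_in (a - (\<lambda>n. a k))" using a by (intro cauchy_in_diff cauchy_in_const cauchy_in_mem)
    show "\<exists>N. \<forall>n\<ge>N. nrm ((a - (\<lambda>n. a k)) n) \<le> e"
      using N that by (auto intro!: exI[of _ N] less_imp_le simp: fun_diff_def)
  qed
  then show ?thesis by blast
qed

text \<open>A Cauchy sequence of constant sequences amounts to one Cauchy sequence z in
  \<open>G\<close>; this z, read as a single point of the completion, is its limit.\<close>

lemma cauchy_seqs_complete:
  assumes w: "semi_inner.cauchy_in cauchy_seqs lim_inner w" and g: "\<And>n. w n \<in> (\<lambda>z n. z) ` G" and G: "G \<subseteq> S"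
  shows "\<exists>b\<in>cauchy_seqs. (\<lambda>n. lim_nrm (w n - b)) \<longlonglongrightarrow> 0"
proof -
  obtain z where z: "\<And>n. w n = (\<lambda>k. z n)" "\<And>n. z n \<in> G" using g by (auto simp: image_iff) metis
  have nz: "lim_nrm (w m - w n) = nrm (z m - z n)" for m n
    by (simp add: lim_nrm_eq z fun_diff_def nrm_def)
  have zc: "cauchy_in z"
    using w z(2) G unfolding semi_inner.cauchy_in_def[OF semi_inner_cauchy_seqs] nz
    by (auto simp: cauchy_in_def)
  have "(\<lambda>n. lim_nrm (w n - z)) \<longlonglongrightarrow> 0"
  proof (rule LIMSEQ_I)
    fix e :: real assume "e > 0"
    then obtain N where N: "\<And>k. k \<ge> N \<Longrightarrow> lim_nrm (z - (\<lambda>n. z k)) \<le> e / 2"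
      using cauchy_in_approx[OF zc, of "e / 2"] by auto
    have "norm (lim_nrm (w k - z) - 0) < e" if "k \<ge> N" for k
    proof -
      have c: "z \<in> cauchy_seqs" "w k \<in> cauchy_seqs" using zc z G by (auto intro: cauchy_in_const)
      have "lim_nrm (w k - z) = lim_nrm (z - w k)"
        by (rule semi_inner.nrm_minus_commute[OF semi_inner_cauchy_seqs c(2,1)])
      moreover have "lim_nrm (w k - z) \<ge> 0"
        using c by (intro semi_inner.nrm_nonneg[OF semi_inner_cauchy_seqs] semi_inner.closed_simps(3)[OF semi_inner_cauchy_seqs])
      ultimately show ?thesis using N[OF that] z(1) \<open>e > 0\<close> by simp
    qed
    then show "\<exists>N. \<forall>k\<ge>N. norm (lim_nrm (w k - z) - 0) < e" by blast
  qed
  then show ?thesis using zc by blast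
qed

end

section \<open>Smooth functions and frames on manifolds\<close>

definition smooth_at_open :: "('m::topological_space, 'n::finite) riemannian \<Rightarrow> 'm set \<Rightarrow> ('m \<Rightarrow> real) \<Rightarrow> bool" where
  "smooth_at_open M W f \<longleftrightarrow>
     (\<forall>c\<in>atlas M. smooth_on (snd c ` (fst c \<inter> W)) (f \<circ> inv_into (fst c) (snd c)))"

lemma smooth_functions_iff: "f \<in> smooth_functions M \<longleftrightarrow> smooth_at_open M UNIV f"
  by (simp add: smooth_functions_def smooth_at_open_def)

text \<open>The assumption holds for a covering atlas and for the empty atlas of the one-point space
  alike, so the rules below serve both cases of the hypothesis on \<open>M\<close>.\<close>

locale charted =
  fixes M :: "('m::{t2_space, second_countable_topology}, 'n::finite) riemannian"
  assumes charts: "c \<in> atlas M \<Longrightarrow> is_chart c"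
begin

lemma chart_open: "c \<in> atlas M \<Longrightarrow> open (fst c)"
  using charts[of c] by (auto simp: is_chart_def)

text \<open>\<open>is_chart\<close> provides some inverse, whereas smoothness is stated with
  \<open>inv_into\<close>; injectivity identifies the two on the chart image.\<close>

lemma chart_homeomorphism:
  assumes "c \<in> atlas M"
  shows "homeomorphism (fst c) (snd c ` fst c) (snd c) (inv_into (fst c) (snd c))"
proof -
  obtain \<psi> where h: "homeomorphism (fst c) (snd c ` fst c) (snd c) \<psi>"
    using charts[OF assms] by (auto simp: is_chart_def)
  then have inj: "inj_on (snd c) (fst c)"
    by (auto intro: inj_on_inverseI[of _ \<psi>] dest: homeomorphism_apply1)
  have "inv_into (fst c) (snd c) y = \<psi> y" if "y \<in> snd c ` fst c" for y
    using that inj homeomorphism_apply1[OF h] by auto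
  then show ?thesis
    by (intro homeomorphism_cong[OF h refl refl refl]) auto
qed

lemma chart_inj: "c \<in> atlas M \<Longrightarrow> inj_on (snd c) (fst c)"
  using homeomorphism_apply1[OF chart_homeomorphism] inj_on_inverseI by metis

lemma chart_image_open:
  assumes "c \<in> atlas M" "open W"
  shows "open (snd c ` (fst c \<inter> W))"
proof -
  have "open (snd c ` fst c)" using charts[OF assms(1)] by (auto simp: is_chart_def)
  moreover have "openin (top_of_set (snd c ` fst c)) (snd c ` (fst c \<inter> W))"
    using homeomorphism_imp_open_map[OF chart_homeomorphism[OF assms(1)]] assms(2) by auto
  ultimately show ?thesis using openin_open_trans by blast
qed

lemma chart_inv: "c \<in> atlas M \<Longrightarrow> x \<in> fst c \<Longrightarrow> inv_into (fst c) (snd c) (snd c x) = x"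
  using chart_inj by simp

lemma chart_continuous: "c \<in> atlas M \<Longrightarrow> continuous_on (fst c) (snd c)"
  using homeomorphism_cont1[OF chart_homeomorphism] .

lemma smooth_at_open_cong:
  assumes "open W" "\<And>x. x \<in> W \<Longrightarrow> f x = h x" "smooth_at_open M W f"
  shows "smooth_at_open M W h"
  unfolding smooth_at_open_def
proof
  fix c assume c: "c \<in> atlas M"
  show "smooth_on (snd c ` (fst c \<inter> W)) (h \<circ> inv_into (fst c) (snd c))"
    by (rule smooth_on_cong[OF chart_image_open[OF c assms(1)], where f = "f \<circ> inv_into (fst c) (snd c)"])
      (use assms c chart_inv[OF c] in \<open>auto simp: smooth_at_open_def o_def\<close>)
qed

lemma smooth_at_open_subset: "smooth_at_open M W f \<Longrightarrow> V \<subseteq> W \<Longrightarrow> smooth_at_open M V f"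
  unfolding smooth_at_open_def by (meson Int_mono image_mono order_refl smooth_on_subset)

lemma smooth_functions_at_open: "f \<in> smooth_functions M \<Longrightarrow> smooth_at_open M W f"
  using smooth_at_open_subset[of UNIV f W] by (simp add: smooth_functions_iff)

lemma smooth_functions_local:
  assumes "\<And>x. \<exists>W. open W \<and> x \<in> W \<and> smooth_at_open M W f"
  shows "f \<in> smooth_functions M"
  unfolding smooth_functions_iff smooth_at_open_def
proof
  fix c assume c: "c \<in> atlas M"
  show "smooth_on (snd c ` (fst c \<inter> UNIV)) (f \<circ> inv_into (fst c) (snd c))"
  proof (rule smooth_on_local)
    show "open (snd c ` (fst c \<inter> UNIV))" using chart_image_open[OF c] by blast
    fix y assume "y \<in> snd c ` (fst c \<inter> UNIV)"
    then obtain x where x: "x \<in> fst c" "y = snd c x" by auto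
    obtain W where W: "open W" "x \<in> W" "smooth_at_open M W f" using assms by blast
    have "snd c ` (fst c \<inter> W) \<inter> snd c ` (fst c \<inter> UNIV) = snd c ` (fst c \<inter> W)" by auto
    then show "\<exists>T. open T \<and> y \<in> T \<and> smooth_on (T \<inter> snd c ` (fst c \<inter> UNIV)) (f \<circ> inv_into (fst c) (snd c))"
      using W x c chart_image_open[OF c W(1)] unfolding smooth_at_open_def
      by (intro exI[of _ "snd c ` (fst c \<inter> W)"]) auto
  qed
qed

lemma smooth_at_open_const: "open W \<Longrightarrow> smooth_at_open M W (\<lambda>x. a)"
  unfolding smooth_at_open_def o_def by (auto intro: smooth_on_const chart_image_open)

lemma smooth_at_open_add:
  "open W \<Longrightarrow> smooth_at_open M W f \<Longrightarrow> smooth_at_open M W h \<Longrightarrow> smooth_at_open M W (\<lambda>x. f x + h x)"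
  unfolding smooth_at_open_def o_def by (auto intro: smooth_on_add chart_image_open)

lemma smooth_at_open_mult:
  "open W \<Longrightarrow> smooth_at_open M W f \<Longrightarrow> smooth_at_open M W h \<Longrightarrow> smooth_at_open M W (\<lambda>x. f x * h x)"
  unfolding smooth_at_open_def o_def by (auto intro: smooth_on_mult chart_image_open)

lemma smooth_at_open_inverse:
  assumes "open W" "smooth_at_open M W f" "\<And>x. x \<in> W \<Longrightarrow> f x \<noteq> 0"
  shows "smooth_at_open M W (\<lambda>x. inverse (f x))"
  unfolding smooth_at_open_def o_def
proof
  fix c assume c: "c \<in> atlas M"
  show "smooth_on (snd c ` (fst c \<inter> W)) (\<lambda>x. inverse (f (inv_into (fst c) (snd c) x)))"
    by (rule smooth_on_inverse[OF chart_image_open[OF c assms(1)]])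
      (use assms c chart_inv[OF c] in \<open>auto simp: smooth_at_open_def o_def\<close>)
qed

lemma smooth_at_open_sum:
  assumes "open W" "\<And>i. i \<in> I \<Longrightarrow> smooth_at_open M W (f i)"
  shows "smooth_at_open M W (\<lambda>x. \<Sum>i\<in>I. f i x)"
  using assms(2)
proof (induction I rule: infinite_finite_induct)
  case (insert i I)
  have "smooth_at_open M W (\<lambda>x. f i x + (\<Sum>i\<in>I. f i x))"
    using insert.IH insert.prems by (intro smooth_at_open_add[OF assms(1)]) blast+
  with insert show ?case by simp
qed (simp_all add: smooth_at_open_const[OF assms(1)])

lemma smooth_at_open_prod:
  assumes "open W" "\<And>i. i \<in> I \<Longrightarrow> smooth_at_open M W (f i)"
  shows "smooth_at_open M W (\<lambda>x. \<Prod>i\<in>I. f i x)"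
  using assms(2)
proof (induction I rule: infinite_finite_induct)
  case (insert i I)
  have "smooth_at_open M W (\<lambda>x. f i x * (\<Prod>i\<in>I. f i x))"
    using insert.IH insert.prems by (intro smooth_at_open_mult[OF assms(1)]) blast+
  with insert show ?case by simp
qed (simp_all add: smooth_at_open_const[OF assms(1)])

lemma smooth_const [intro, simp]: "(\<lambda>x. a) \<in> smooth_functions M"
  by (simp add: smooth_functions_iff smooth_at_open_const)

lemma smooth_add [intro]: "f \<in> smooth_functions M \<Longrightarrow> h \<in> smooth_functions M \<Longrightarrow> (\<lambda>x. f x + h x) \<in> smooth_functions M"
  by (simp add: smooth_functions_iff smooth_at_open_add)

lemma smooth_mult [intro]: "f \<in> smooth_functions M \<Longrightarrow> h \<in> smooth_functions M \<Longrightarrow> (\<lambda>x. f x * h x) \<in> smooth_functions M"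
  by (simp add: smooth_functions_iff smooth_at_open_mult)

lemma smooth_cmult [intro]: "f \<in> smooth_functions M \<Longrightarrow> (\<lambda>x. a * f x) \<in> smooth_functions M"
  by (intro smooth_mult smooth_const)

lemma smooth_diff [intro]:
  assumes "f \<in> smooth_functions M" "h \<in> smooth_functions M"
  shows "(\<lambda>x. f x - h x) \<in> smooth_functions M"
  using smooth_add[OF assms(1) smooth_cmult[OF assms(2), of "-1"]] by simp

lemma smooth_sum [intro]: "(\<And>i. i \<in> I \<Longrightarrow> f i \<in> smooth_functions M) \<Longrightarrow> (\<lambda>x. \<Sum>i\<in>I. f i x) \<in> smooth_functions M"
  by (simp add: smooth_functions_iff smooth_at_open_sum)

section \<open>Derivations and vector fields\<close>

lemma subspace_tangent_space: "subspace (tangent_space M x)"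
  by (rule subspaceI) (auto simp: tangent_space_def algebra_simps)

lemma tangent_add: "v \<in> tangent_space M x \<Longrightarrow> f \<in> smooth_functions M \<Longrightarrow> h \<in> smooth_functions M \<Longrightarrow>
    v (\<lambda>y. f y + h y) = v f + v h"
  by (simp add: tangent_space_def)

lemma tangent_cmult: "v \<in> tangent_space M x \<Longrightarrow> f \<in> smooth_functions M \<Longrightarrow> v (\<lambda>y. a * f y) = a * v f"
  unfolding tangent_space_def by blast

lemma tangent_mult: "v \<in> tangent_space M x \<Longrightarrow> f \<in> smooth_functions M \<Longrightarrow> h \<in> smooth_functions M \<Longrightarrow>
    v (\<lambda>y. f y * h y) = v f * h x + f x * v h"
  by (simp add: tangent_space_def)

lemma tangent_nonsmooth: "v \<in> tangent_space M x \<Longrightarrow> f \<notin> smooth_functions M \<Longrightarrow> v f = 0"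
  by (simp add: tangent_space_def)

lemma tangent_const:
  assumes "v \<in> tangent_space M x"
  shows "v (\<lambda>y. a) = 0"
proof -
  have "v (\<lambda>y. 1) = 0"
    using tangent_mult[OF assms smooth_const[of 1] smooth_const[of 1]] by simp
  then show ?thesis using tangent_cmult[OF assms smooth_const[of 1], of a] by simp
qed

lemma tangent_diff:
  assumes "v \<in> tangent_space M x" "f \<in> smooth_functions M" "h \<in> smooth_functions M"
  shows "v (\<lambda>y. f y - h y) = v f - v h"
  using tangent_add[OF assms(1,2) smooth_cmult[OF assms(3), of "-1"]] tangent_cmult[OF assms(1,3), of "-1"]
  by simp

lemma tangent_sum:
  assumes "v \<in> tangent_space M x" "\<And>i. i \<in> I \<Longrightarrow> f i \<in> smooth_functions M"
  shows "v (\<lambda>y. \<Sum>i\<in>I. f i y) = (\<Sum>i\<in>I. v (f i))"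
  using assms(2)
  by (induction I rule: infinite_finite_induct)
    (auto simp: tangent_const[OF assms(1)] tangent_add[OF assms(1)] smooth_sum)

lemma vector_field_tangent: "w \<in> vector_fields M \<Longrightarrow> w x \<in> tangent_space M x"
  by (simp add: vector_fields_def)

lemma vector_field_smooth: "w \<in> vector_fields M \<Longrightarrow> f \<in> smooth_functions M \<Longrightarrow> (\<lambda>x. w x f) \<in> smooth_functions M"
  by (simp add: vector_fields_def)

lemma subspace_vector_fields: "subspace (vector_fields M)"
  by (rule subspaceI)
    (auto simp: vector_fields_def intro: subspace_0 subspace_add subspace_scale subspace_tangent_space)

lemma vf_smult_vector_field:
  assumes "h \<in> smooth_functions M" "w \<in> vector_fields M"
  shows "vf_smult h w \<in> vector_fields M"
  using assms subspace_scale[OF subspace_tangent_space]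
  by (auto simp: vector_fields_def vf_smult_def tv_scale_eq)

end

locale smooth_manifold =
  fixes M :: "('m::{t2_space, second_countable_topology}, 'n::finite) riemannian"
  assumes oriented_atlas: "oriented_smooth_atlas (atlas M)"

sublocale smooth_manifold \<subseteq> charted M
  using oriented_atlas by unfold_locales (simp add: oriented_smooth_atlas_def)

context smooth_manifold
begin

lemma chart_exists: "\<exists>c\<in>atlas M. x \<in> fst c"
  using oriented_atlas by (auto simp: oriented_smooth_atlas_def)

lemma transition_smooth:
  "c \<in> atlas M \<Longrightarrow> c' \<in> atlas M \<Longrightarrow> smooth_on (snd c ` (fst c \<inter> fst c')) (transition c c')"
  using oriented_atlas by (auto simp: oriented_smooth_atlas_def)

lemma smooth_at_open_continuous:
  assumes W: "open W" and f: "smooth_at_open M W f"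
  shows "continuous_on W f"
  unfolding continuous_on_eq_continuous_at[OF W]
proof
  fix x assume x: "x \<in> W"
  obtain c where c: "c \<in> atlas M" "x \<in> fst c" using chart_exists by blast
  have "continuous_on (snd c ` (fst c \<inter> W)) (f \<circ> inv_into (fst c) (snd c))"
    using f c smooth_on_continuous unfolding smooth_at_open_def by blast
  then have "continuous_on (fst c \<inter> W) (\<lambda>z. (f \<circ> inv_into (fst c) (snd c)) (snd c z))"
    by (rule continuous_on_compose2[OF _ continuous_on_subset[OF chart_continuous[OF c(1)]]]) auto
  then have "continuous_on (fst c \<inter> W) f"
    by (rule continuous_on_eq) (use chart_inv[OF c(1)] in auto)
  then show "isCont f x"
    using x c W chart_open[OF c(1)] by (simp add: continuous_on_eq_continuous_at open_Int)
qed

lemma smooth_functions_continuous: "f \<in> smooth_functions M \<Longrightarrow> continuous_on UNIV f"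
  using smooth_at_open_continuous by (simp add: smooth_functions_iff)

section \<open>Extension by zero and bump functions\<close>

lemma chart_preimage_open:
  assumes "c \<in> atlas M" "open B"
  shows "open {x \<in> fst c. snd c x \<in> B}"
proof -
  have "open (snd c -` B \<inter> fst c)"
    using continuous_on_open_vimage[OF chart_open[OF assms(1)]] chart_continuous[OF assms(1)] assms(2) by blast
  moreover have "snd c -` B \<inter> fst c = {x \<in> fst c. snd c x \<in> B}" by auto
  ultimately show ?thesis by simp
qed

text \<open>The preimage is a compact set, being the image of \<open>K\<close> under the continuous
  inverse chart, and compact sets are closed in a Hausdorff space. This is what makes extension by
  zero out of a chart smooth.\<close>

lemma chart_preimage_closed:
  assumes c: "c \<in> atlas M" and K: "compact K" "K \<subseteq> snd c ` fst c"
  shows "closed {x \<in> fst c. snd c x \<in> K}"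
proof -
  have "{x \<in> fst c. snd c x \<in> K} = inv_into (fst c) (snd c) ` K"
  proof
    show "{x \<in> fst c. snd c x \<in> K} \<subseteq> inv_into (fst c) (snd c) ` K"
      using chart_inv[OF c] by (auto simp: image_iff) metis
    show "inv_into (fst c) (snd c) ` K \<subseteq> {x \<in> fst c. snd c x \<in> K}"
      using K(2) by (auto simp: inv_into_into f_inv_into_f)
  qed
  moreover have "compact (inv_into (fst c) (snd c) ` K)"
    using homeomorphism_cont2[OF chart_homeomorphism[OF c]] K
    by (intro compact_continuous_image) (auto intro: continuous_on_subset)
  ultimately show ?thesis by (simp add: compact_imp_closed)
qed

lemma smooth_at_open_chart:
  assumes c: "c \<in> atlas M" and B: "open B" "B \<subseteq> snd c ` fst c" and h: "smooth_on B h"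
  shows "smooth_at_open M {x \<in> fst c. snd c x \<in> B} (\<lambda>x. h (snd c x))"
  unfolding smooth_at_open_def o_def
proof
  fix c' assume c': "c' \<in> atlas M"
  let ?S = "snd c' ` (fst c' \<inter> {x \<in> fst c. snd c x \<in> B})"
  have "smooth_on ?S (\<lambda>y. h (transition c' c y))"
  proof (rule smooth_on_compose[OF chart_image_open[OF c' chart_preimage_open[OF c B(1)]] B(1) _ _ h])
    show "transition c' c ` ?S \<subseteq> B"
      using chart_inv[OF c'] by (auto simp: transition_def)
    show "smooth_on ?S (transition c' c)"
      by (rule smooth_on_subset[OF transition_smooth[OF c' c]]) auto
  qed
  then show "smooth_on ?S (\<lambda>y. h (snd c (inv_into (fst c') (snd c') y)))"
    by (simp add: transition_def)
qed

text \<open>On the preimage of the larger ball the function is a product of smooth functions, and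
  off the preimage of the closed smaller ball it is 0. Since r < R, these two open sets cover the
  manifold.\<close>

lemma chart_cutoff:
  assumes c: "c \<in> atlas M" and r: "r < R" and B: "ball q R \<subseteq> snd c ` fst c"
    and h: "smooth_on (ball q R) h" and b: "smooth_on UNIV b" "\<And>y. dist q y \<ge> r \<Longrightarrow> b y = 0"
  shows "(\<lambda>x. if x \<in> fst c \<and> snd c x \<in> ball q R then b (snd c x) * h (snd c x) else 0) \<in> smooth_functions M"
    (is "?f \<in> _")
proof (rule smooth_functions_local)
  fix x
  show "\<exists>W. open W \<and> x \<in> W \<and> smooth_at_open M W ?f"
  proof (cases "x \<in> fst c \<and> snd c x \<in> ball q R")
    case True
    let ?W = "{x \<in> fst c. snd c x \<in> ball q R}"
    have W: "open ?W" by (rule chart_preimage_open[OF c open_ball])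
    have "smooth_on (ball q R) (\<lambda>y. b y * h y)"
      by (rule smooth_on_mult[OF open_ball smooth_on_subset[OF b(1)] h]) simp
    then have "smooth_at_open M ?W (\<lambda>x. b (snd c x) * h (snd c x))"
      using smooth_at_open_chart[OF c open_ball B] by blast
    then have "smooth_at_open M ?W ?f"
      by (rule smooth_at_open_cong[OF W, rotated]) auto
    then show ?thesis using W True by blast
  next
    case False
    let ?W = "- {x \<in> fst c. snd c x \<in> cball q r}"
    have "cball q r \<subseteq> snd c ` fst c" using r B by force
    then have W: "open ?W" using chart_preimage_closed[OF c compact_cball] by (simp add: open_Compl)
    have "smooth_at_open M ?W ?f"
      by (rule smooth_at_open_cong[OF W _ smooth_at_open_const[OF W, of 0]]) (auto simp: b)
    moreover have "x \<in> ?W" using False r by auto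
    ultimately show ?thesis using W by blast
  qed
qed

lemma chart_ball_exists:
  assumes "open N" "p \<in> N"
  shows "\<exists>c\<in>atlas M. \<exists>R>0. p \<in> fst c \<and> ball (snd c p) R \<subseteq> snd c ` (fst c \<inter> N)"
proof -
  obtain c where c: "c \<in> atlas M" "p \<in> fst c" using chart_exists by blast
  have "open (snd c ` (fst c \<inter> N))" by (rule chart_image_open[OF c(1) assms(1)])
  moreover have "snd c p \<in> snd c ` (fst c \<inter> N)" using c assms by auto
  ultimately obtain R where "R > 0" "ball (snd c p) R \<subseteq> snd c ` (fst c \<inter> N)"
    using open_contains_ball by metis
  then show ?thesis using c by blast
qed

lemma chart_in_image: "c \<in> atlas M \<Longrightarrow> x \<in> fst c \<Longrightarrow> snd c x \<in> snd c ` (fst c \<inter> N) \<Longrightarrow> x \<in> N"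
  using chart_inj[of c] by (auto simp: inj_on_def)

lemma manifold_bump:
  assumes "open N" "p \<in> N"
  shows "\<exists>\<eta>\<in>smooth_functions M. \<exists>W. open W \<and> p \<in> W \<and> W \<subseteq> N \<and> (\<forall>x\<in>W. \<eta> x = 1) \<and> (\<forall>x. x \<notin> N \<longrightarrow> \<eta> x = 0)"
proof -
  obtain c R where c: "c \<in> atlas M" "R > 0" "p \<in> fst c" "ball (snd c p) R \<subseteq> snd c ` (fst c \<inter> N)"
    using chart_ball_exists[OF assms] by blast
  define q where "q = snd c p"
  obtain b :: "real ^ 'n \<Rightarrow> real" where b: "smooth_on UNIV b" "\<And>y. dist q y \<le> (R/2)/2 \<Longrightarrow> b y = 1" "\<And>y. dist q y \<ge> R/2 \<Longrightarrow> b y = 0"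
    using smooth_bump_exists[of "R/2" q] c(2) by auto
  let ?f = "\<lambda>x. if x \<in> fst c \<and> snd c x \<in> ball q R then b (snd c x) * 1 else 0"
  have "?f \<in> smooth_functions M"
    by (rule chart_cutoff[where r = "R/2"]) (use c b in \<open>auto simp: q_def intro: smooth_on_const\<close>)
  moreover let ?W = "{x \<in> fst c. snd c x \<in> ball q (R/4)}"
  have "open ?W" by (rule chart_preimage_open[OF c(1) open_ball])
  moreover have "p \<in> ?W" using c by (simp add: q_def)
  moreover have "x \<in> N" if "x \<in> ?W" for x
  proof -
    have "snd c x \<in> ball (snd c p) R" using that c(2) by (auto simp: q_def)
    then show ?thesis using that c chart_in_image[OF c(1), of x N] by auto
  qed
  moreover have "?f x = 1" if "x \<in> ?W" for x
    using that c(2) b(2)[of "snd c x"] by auto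
  moreover have "?f x = 0" if "x \<notin> N" for x
    using that c chart_in_image[OF c(1), of x N] by (auto simp: q_def)
  ultimately show ?thesis by (intro bexI[of _ ?f] exI[of _ ?W]) auto
qed

text \<open>For a bump \<eta> at x that vanishes off \<open>N\<close>, the product \<eta> (f - h) is
  identically zero; the Leibniz rule at x, where \<eta> = 1 and f = h, leaves v (f - h).\<close>

lemma tangent_local:
  assumes v: "v \<in> tangent_space M x" and N: "open N" "x \<in> N"
    and f: "f \<in> smooth_functions M" and h: "h \<in> smooth_functions M" and eq: "\<And>y. y \<in> N \<Longrightarrow> f y = h y"
  shows "v f = v h"
proof -
  obtain \<eta> where \<eta>: "\<eta> \<in> smooth_functions M" "\<eta> x = 1" "\<And>y. y \<notin> N \<Longrightarrow> \<eta> y = 0"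
    using manifold_bump[OF N] by blast
  have "(\<lambda>y. \<eta> y * (f y - h y)) = (\<lambda>y. 0)"
    using eq \<eta>(3) by fastforce
  then have "v (\<lambda>y. \<eta> y * (f y - h y)) = 0" using tangent_const[OF v] by simp
  moreover have "v (\<lambda>y. \<eta> y * (f y - h y)) = v \<eta> * (f x - h x) + \<eta> x * v (\<lambda>y. f y - h y)"
    by (rule tangent_mult[OF v \<eta>(1) smooth_diff[OF f h]])
  ultimately show ?thesis using eq[OF N(2)] \<eta>(2) tangent_diff[OF v f h] by simp
qed

section \<open>Coordinate frames\<close>

lemma smooth_function_chart:
  assumes "f \<in> smooth_functions M" "c \<in> atlas M" "S \<subseteq> snd c ` fst c"
  shows "smooth_on S (f \<circ> inv_into (fst c) (snd c))"
  using assms smooth_on_subset[of "snd c ` fst c" "f \<circ> inv_into (fst c) (snd c)" S]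
  by (simp add: smooth_functions_def)

lemma chart_has_derivative:
  assumes c: "c \<in> atlas M" and x: "x \<in> fst c" and f: "f \<in> smooth_functions M"
  shows "(f \<circ> inv_into (fst c) (snd c) has_derivative
    frechet_derivative (f \<circ> inv_into (fst c) (snd c)) (at (snd c x))) (at (snd c x))"
  by (rule smooth_on_has_derivative[of "snd c ` fst c"]) (use c x f in \<open>auto simp: smooth_functions_def\<close>)

text \<open>The i-th coordinate field, multiplied by a cutoff \<open>b\<close> and extended by 0.
  The test for \<open>smooth_functions\<close> provides the normalisation that
  \<open>tangent_space\<close> imposes on other functions.\<close>

definition chart_field :: "('m, 'n) chart \<Rightarrow> (real ^ 'n \<Rightarrow> real) \<Rightarrow> (real ^ 'n) set \<Rightarrow> 'n \<Rightarrow> 'm vfield" where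
  "chart_field c b B i x f = (if f \<in> smooth_functions M \<and> x \<in> fst c \<and> snd c x \<in> B
     then b (snd c x) * frechet_derivative (f \<circ> inv_into (fst c) (snd c)) (at (snd c x)) (axis i 1) else 0)"

lemma chart_field_tangent:
  assumes c: "c \<in> atlas M"
  shows "chart_field c b B i x \<in> tangent_space M x"
proof (cases "x \<in> fst c \<and> snd c x \<in> B")
  case False
  then have "chart_field c b B i x = 0" by (auto simp: chart_field_def fun_eq_iff)
  then show ?thesis using subspace_0[OF subspace_tangent_space] by metis
next
  case True
  let ?\<psi> = "inv_into (fst c) (snd c)"
  note D = chart_has_derivative[OF c conjunct1[OF True]]
  have \<psi>: "?\<psi> (snd c x) = x" using True chart_inv[OF c] by blast
  have 1: "frechet_derivative ((\<lambda>y. f y + h y) \<circ> ?\<psi>) (at (snd c x)) =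
      (\<lambda>v. frechet_derivative (f \<circ> ?\<psi>) (at (snd c x)) v + frechet_derivative (h \<circ> ?\<psi>) (at (snd c x)) v)"
    if "f \<in> smooth_functions M" "h \<in> smooth_functions M" for f h
    using frechet_derivative_at[OF has_derivative_add[OF D[OF that(1)] D[OF that(2)]]] by (simp add: o_def)
  have 2: "frechet_derivative ((\<lambda>y. a * f y) \<circ> ?\<psi>) (at (snd c x)) =
      (\<lambda>v. a * frechet_derivative (f \<circ> ?\<psi>) (at (snd c x)) v)"
    if "f \<in> smooth_functions M" for f a
    using frechet_derivative_at[OF has_derivative_mult_right[OF D[OF that], of a]] by (simp add: o_def)
  have 3: "frechet_derivative ((\<lambda>y. f y * h y) \<circ> ?\<psi>) (at (snd c x)) =
      (\<lambda>v. f x * frechet_derivative (h \<circ> ?\<psi>) (at (snd c x)) v + frechet_derivative (f \<circ> ?\<psi>) (at (snd c x)) v * h x)"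
    if "f \<in> smooth_functions M" "h \<in> smooth_functions M" for f h
    using frechet_derivative_at[OF has_derivative_mult[OF D[OF that(1)] D[OF that(2)]]] by (simp add: o_def \<psi>)
  show ?thesis
    using True 1 2 3 smooth_add smooth_cmult smooth_mult
    by (simp add: tangent_space_def chart_field_def algebra_simps)
qed

lemma chart_field_vector_field:
  assumes c: "c \<in> atlas M" and r: "r < R" and B: "ball q R \<subseteq> snd c ` fst c"
    and b: "smooth_on UNIV b" "\<And>y. dist q y \<ge> r \<Longrightarrow> b y = 0"
  shows "chart_field c b (ball q R) i \<in> vector_fields M"
  unfolding vector_fields_def
proof (intro CollectI conjI allI ballI)
  show "chart_field c b (ball q R) i x \<in> tangent_space M x" for x
    by (rule chart_field_tangent[OF c])
  fix f assume f: "f \<in> smooth_functions M"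
  have "smooth_on (ball q R) (f \<circ> inv_into (fst c) (snd c))"
    by (rule smooth_function_chart[OF f c B])
  from chart_cutoff[OF c r B smooth_on_frechet_derivative[OF this] b(1) b(2)]
  show "(\<lambda>x. chart_field c b (ball q R) i x f) \<in> smooth_functions M"
    using f by (simp add: chart_field_def)
qed

text \<open>\<open>F\<close> and \<open>E\<close> are global smooth objects (coordinates and
  coordinate fields after a cutoff), because derivations act on functions of the whole manifold;
  that they form dual frames is asserted on \<open>W\<close> only.\<close>

definition frame_on :: "'m set \<Rightarrow> ('n \<Rightarrow> 'm \<Rightarrow> real) \<Rightarrow> ('n \<Rightarrow> 'm vfield) \<Rightarrow> bool" where
  "frame_on W F E \<longleftrightarrow> open W \<and> (\<forall>i. F i \<in> smooth_functions M \<and> E i \<in> vector_fields M) \<and>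
     (\<forall>x\<in>W. \<forall>v\<in>tangent_space M x. v = (\<Sum>i\<in>UNIV. v (F i) *\<^sub>R E i x)) \<and>
     (\<forall>x\<in>W. \<forall>i j. E i x (F j) = (if i = j then 1 else 0))"

text \<open>At x in \<open>W\<close>, Hadamard's lemma in the chart gives f = f x + \<Sum> (F i - F
  i x) H i near x. A derivation v at x kills constants and, by the Leibniz rule, sends this to
  \<Sum> v (F i) H i x, where H i x is the i-th partial derivative of f, that is
  \<open>E i x f\<close>.\<close>

lemma local_frame: "\<exists>W F E. p \<in> W \<and> frame_on W F E"
proof -
  obtain c R where c: "c \<in> atlas M" and R: "R > 0" and p: "p \<in> fst c" and B0: "ball (snd c p) R \<subseteq> snd c ` fst c"
    using chart_ball_exists[of UNIV p] by auto
  define q where "q = snd c p"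
  have B: "ball q R \<subseteq> snd c ` fst c" using B0 by (simp add: q_def)
  let ?\<psi> = "inv_into (fst c) (snd c)"
  obtain b :: "real ^ 'n \<Rightarrow> real" where b: "smooth_on UNIV b" "\<And>y. dist q y \<le> (R/2)/2 \<Longrightarrow> b y = 1" "\<And>y. dist q y \<ge> R/2 \<Longrightarrow> b y = 0"
    using smooth_bump_exists[of "R/2" q] R by auto
  define F where "F i x = (if x \<in> fst c \<and> snd c x \<in> ball q R then b (snd c x) * (snd c x $ i) else 0)" for i x
  define E where "E = chart_field c b (ball q R)"
  define W where "W = {x \<in> fst c. snd c x \<in> ball q (R/8)}"
  have r: "R/2 < R" using R by simp
  have F: "F i \<in> smooth_functions M" for i
    unfolding F_def by (rule chart_cutoff[OF c r B smooth_on_linear[OF open_ball bounded_linear_vec_nth] b(1) b(3)])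
  have E: "E i \<in> vector_fields M" for i
    unfolding E_def by (rule chart_field_vector_field[OF c r B b(1) b(3)])
  have W: "open W" unfolding W_def by (rule chart_preimage_open[OF c open_ball])
  \<comment> \<open>The cutoff is 1 up to distance R/4 from q and \<open>W\<close> stops at R/8; so
    around each point of \<open>W\<close> there is a chart ball of radius R/8 on which the cutoff is
    still 1.\<close>
  have near: "dist q y < R/4" if "y0 \<in> ball q (R/8)" "dist y0 y < R/8" for y0 y
    using dist_triangle[of q y y0] that by simp
  have Eval: "E i x f = frechet_derivative (f \<circ> ?\<psi>) (at (snd c x)) (axis i 1)"
    if "x \<in> W" "f \<in> smooth_functions M" for i x f
    using that R b(2)[of "snd c x"] by (auto simp: E_def chart_field_def W_def)
  have 1: "v f = (\<Sum>i\<in>UNIV. v (F i) * E i x f)"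
    if x: "x \<in> W" and v: "v \<in> tangent_space M x" and f: "f \<in> smooth_functions M" for x v f
  proof -
    define y0 where "y0 = snd c x"
    have xU: "x \<in> fst c" and y0: "y0 \<in> ball q (R/8)" using x by (auto simp: W_def y0_def)
    have sub: "ball y0 (R/8) \<subseteq> snd c ` fst c" using near[OF y0] R B by fastforce
    have "smooth_on (ball y0 (R/8)) (f \<circ> ?\<psi>)"
      by (rule smooth_function_chart[OF f c sub])
    from Hadamard_lemma[OF this] obtain h where h: "\<And>b. smooth_on (ball y0 (R/8)) (h b)"
      "\<And>b. h b y0 = frechet_derivative (f \<circ> ?\<psi>) (at y0) b"
      "\<And>y. y \<in> ball y0 (R/8) \<Longrightarrow> (f \<circ> ?\<psi>) y = (f \<circ> ?\<psi>) y0 + (\<Sum>b\<in>Basis. ((y - y0) \<bullet> b) * h b y)"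
      by blast
    \<comment> \<open>The Hadamard coefficients live on a small chart ball; a second cutoff, equal
      to 1 up to distance R/32, turns them into global functions that are unchanged near x.\<close>
    obtain b' :: "real ^ 'n \<Rightarrow> real" where b': "smooth_on UNIV b'" "\<And>y. dist y0 y \<le> (R/16)/2 \<Longrightarrow> b' y = 1" "\<And>y. dist y0 y \<ge> R/16 \<Longrightarrow> b' y = 0"
      using smooth_bump_exists[of "R/16" y0] R by auto
    define H where "H i z = (if z \<in> fst c \<and> snd c z \<in> ball y0 (R/8) then b' (snd c z) * h (axis i 1) (snd c z) else 0)" for i z
    have "R/16 < R/8" using R by simp
    then have H: "H i \<in> smooth_functions M" for i
      unfolding H_def by (rule chart_cutoff[OF c _ sub h(1) b'(1) b'(3)])
    define N where "N = {z \<in> fst c. snd c z \<in> ball y0 (R/32)}"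
    have N: "open N" "x \<in> N"
      unfolding N_def using chart_preimage_open[OF c open_ball] R xU by (blast, simp add: y0_def)
    have "f z = f x + (\<Sum>i\<in>UNIV. (F i z - y0 $ i) * H i z)" if "z \<in> N" for z
    proof -
      have z: "z \<in> fst c" "dist y0 (snd c z) < R/32" using that by (auto simp: N_def)
      have "dist q (snd c z) < R/4" using near[OF y0, of "snd c z"] z R by simp
      then have "F i z = snd c z $ i" for i using z R b(2)[of "snd c z"] by (auto simp: F_def)
      moreover have "H i z = h (axis i 1) (snd c z)" for i
        using z R b'(2)[of "snd c z"] by (auto simp: H_def)
      moreover have "f z = f x + (\<Sum>b\<in>Basis. ((snd c z - y0) \<bullet> b) * h b (snd c z))"
        using h(3)[of "snd c z"] z R chart_inv[OF c] xU by (simp add: y0_def)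
      ultimately show ?thesis by (simp add: sum_Basis_axis inner_axis)
    qed
    then have "v f = v (\<lambda>z. f x + (\<Sum>i\<in>UNIV. (F i z - y0 $ i) * H i z))"
      by (intro tangent_local[OF v N f]) (auto intro!: smooth_add smooth_sum smooth_mult smooth_diff F H)
    also have "\<dots> = (\<Sum>i\<in>UNIV. v (\<lambda>z. (F i z - y0 $ i) * H i z))"
    proof -
      have FH: "(\<lambda>z. (F i z - y0 $ i) * H i z) \<in> smooth_functions M" for i
        by (intro smooth_mult smooth_diff smooth_const F H)
      have S: "(\<lambda>z. \<Sum>i\<in>UNIV. (F i z - y0 $ i) * H i z) \<in> smooth_functions M"
        by (rule smooth_sum) (rule FH)
      have "v (\<lambda>z. \<Sum>i\<in>UNIV. (F i z - y0 $ i) * H i z) = (\<Sum>i\<in>UNIV. v (\<lambda>z. (F i z - y0 $ i) * H i z))"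
        by (rule tangent_sum[OF v]) (rule FH)
      then show ?thesis
        using tangent_add[OF v smooth_const[of "f x"] S] tangent_const[OF v, of "f x"] by simp
    qed
    also have "\<dots> = (\<Sum>i\<in>UNIV. v (F i) * E i x f)"
    proof (rule sum.cong[OF refl])
      fix i
      have Fx: "F i x = y0 $ i" using y0 R xU b(2)[of y0] by (auto simp: F_def y0_def)
      have "H i x = h (axis i 1) y0" using R xU b'(2)[of y0] by (auto simp: H_def y0_def)
      then have Hx: "H i x = E i x f" using h(2) Eval[OF x f] by (simp add: y0_def)
      have "v (\<lambda>z. (F i z - y0 $ i) * H i z) = v (\<lambda>z. F i z - y0 $ i) * H i x + (F i x - y0 $ i) * v (H i)"
        by (intro tangent_mult[OF v] smooth_diff smooth_const F H)
      then show "v (\<lambda>z. (F i z - y0 $ i) * H i z) = v (F i) * E i x f"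
        using Fx Hx tangent_diff[OF v F smooth_const] tangent_const[OF v] by simp
    qed
    finally show ?thesis .
  qed
  have "v = (\<Sum>i\<in>UNIV. v (F i) *\<^sub>R E i x)" if x: "x \<in> W" and v: "v \<in> tangent_space M x" for x v
  proof
    fix f
    show "v f = (\<Sum>i\<in>UNIV. v (F i) *\<^sub>R E i x) f"
    proof (cases "f \<in> smooth_functions M")
      case False
      then show ?thesis
        using tangent_nonsmooth[OF v] tangent_nonsmooth[OF vector_field_tangent[OF E]] by simp
    qed (simp add: 1[OF x v])
  qed
  note dec = this
  have dual: "E i x (F j) = (if i = j then 1 else 0)" if x: "x \<in> W" for x i j
  proof -
    have "(\<lambda>y. y $ j) y = (F j \<circ> ?\<psi>) y" if "y \<in> ball q (R/4)" for y
    proof -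
      have "y \<in> snd c ` fst c" using that B R by auto
      then have "?\<psi> y \<in> fst c" "snd c (?\<psi> y) = y" by (auto simp: inv_into_into f_inv_into_f)
      then show ?thesis using that R b(2)[of y] by (auto simp: F_def)
    qed
    moreover have "snd c x \<in> ball q (R/4)" using x R by (auto simp: W_def)
    moreover have "((\<lambda>y. y $ j) has_derivative (\<lambda>y. y $ j)) (at (snd c x))"
      by (rule bounded_linear_imp_has_derivative[OF bounded_linear_vec_nth])
    ultimately have "(F j \<circ> ?\<psi> has_derivative (\<lambda>y. y $ j)) (at (snd c x))"
      using has_derivative_transform_within_open[OF _ open_ball] by blast
    then have "frechet_derivative (F j \<circ> ?\<psi>) (at (snd c x)) = (\<lambda>y. y $ j)"
      by (rule frechet_derivative_at[symmetric])
    then show ?thesis unfolding Eval[OF x F] by (auto simp: axis_def)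
  qed
  have "frame_on W F E"
    unfolding frame_on_def using F E W dec dual by simp
  moreover have "p \<in> W" using p R by (simp add: W_def q_def)
  ultimately show ?thesis by blast
qed

end

section \<open>Operations on probability measures\<close>

lemma sets_law [measurable_cong, simp]: "sets (law \<mu>) = sets borel"
  using law[of \<mu>] by simp

lemma prob_space_law: "prob_space (law \<mu>)"
  using law[of \<mu>] by simp

lemma space_law [simp]: "space (law \<mu>) = UNIV"
  using sets_eq_imp_space_eq[OF sets_law] by simp

text \<open>A coin of bias t decides from which of the two laws to sample; as a monadic bind this is
  automatically a probability measure. The integrands it is applied to are bounded by compactness of
  the manifold.\<close>

lemma mixture_exists:
  fixes \<mu> \<nu> :: "'m::topological_space borel_prob"
  assumes t: "0 \<le> t" "t \<le> 1"
  shows "\<exists>\<rho>::'m borel_prob. \<forall>f K. f \<in> borel_measurable borel \<longrightarrow> (\<forall>x. \<bar>f x\<bar> \<le> K) \<longrightarrow>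
    star f \<rho> = (1 - t) * star f \<mu> + t * star f \<nu>"
proof -
  let ?N = "\<lambda>b. if b then law \<nu> else law \<mu>"
  let ?B = "measure_pmf (bernoulli_pmf t) \<bind> ?N"
  have sub: "law \<kappa> \<in> space (subprob_algebra borel)" for \<kappa> :: "'m borel_prob"
    using prob_space_law prob_space_imp_subprob_space by (auto simp: space_subprob_algebra)
  have e1: "emeasure (law \<kappa>) UNIV = 1" for \<kappa> :: "'m borel_prob"
    using prob_space.emeasure_space_1[OF prob_space_law[of \<kappa>]] by simp
  have N: "?N \<in> measurable (measure_pmf (bernoulli_pmf t)) (subprob_algebra borel)"
    using sub by (auto intro: measurableI)
  have "sets ?B = sets borel" by (rule sets_bind) auto
  moreover have "prob_space ?B"
    by (rule prob_space.prob_space_bind[OF prob_space_measure_pmf _ N]) (auto simp: prob_space_law)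
  ultimately have law: "law (Abs_borel_prob ?B) = ?B" by (simp add: Abs_borel_prob_inverse)
  have "star f (Abs_borel_prob ?B) = (1 - t) * star f \<mu> + t * star f \<nu>"
    if f: "f \<in> borel_measurable borel" "\<And>x. \<bar>f x\<bar> \<le> K" for f K
  proof -
    have "integral\<^sup>L ?B f = (\<integral>b. integral\<^sup>L (?N b) f \<partial>measure_pmf (bernoulli_pmf t))"
      by (rule integral_bind[where K = borel and B = K and B' = 1])
        (use f N e1 prob_space.finite_measure[OF prob_space_measure_pmf] in \<open>auto simp: e1\<close>)
    then show ?thesis using t unfolding star_def law by (simp add: mult.commute)
  qed
  then show ?thesis by blast
qed

lemma dirac_exists:
  fixes y :: "'m::topological_space"
  shows "\<exists>\<delta>::'m borel_prob. \<forall>f. f \<in> borel_measurable borel \<longrightarrow> star f \<delta> = f y"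
proof -
  have "law (Abs_borel_prob (return borel y)) = return borel y"
    by (simp add: Abs_borel_prob_inverse prob_space_return)
  then show ?thesis
    by (intro exI[of _ "Abs_borel_prob (return borel y)"]) (simp add: star_def integral_return)
qed

lemma push_exists:
  fixes \<mu> :: "'m::topological_space borel_prob"
  assumes s: "s \<in> measurable borel borel"
  shows "\<exists>\<nu>::'m borel_prob. \<forall>f. f \<in> borel_measurable borel \<longrightarrow> star f \<nu> = star (\<lambda>x. f (s x)) \<mu>"
proof -
  have s': "s \<in> measurable (law \<mu>) borel" using s by simp
  have "law (Abs_borel_prob (distr (law \<mu>) borel s)) = distr (law \<mu>) borel s"
    using prob_space.prob_space_distr[OF prob_space_law s'] by (simp add: Abs_borel_prob_inverse)
  then show ?thesis
    using s' by (intro exI[of _ "Abs_borel_prob (distr (law \<mu>) borel s)"]) (simp add: star_def integral_distr)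
qed

section \<open>Gradients and tensorial maps on closed Riemannian manifolds\<close>

locale closed_riemannian =
  fixes M :: "('m::{t2_space, second_countable_topology}, 'n::finite) riemannian"
  assumes closed_riemannian: "closed_connected_oriented_riemannian M"
begin

lemma atlas_cases: "oriented_smooth_atlas (atlas M) \<or> atlas M = {} \<and> (\<exists>p. (UNIV :: 'm set) = {p})"
  using closed_riemannian by (simp add: closed_connected_oriented_riemannian_def)

lemma compact_UNIV: "compact (UNIV :: 'm set)"
  using closed_riemannian by (simp add: closed_connected_oriented_riemannian_def)

lemma riemannian_metric: "riemannian_metric M"
  using closed_riemannian by (simp add: closed_connected_oriented_riemannian_def)

sublocale charted M
  using atlas_cases by unfold_locales (auto simp: oriented_smooth_atlas_def)

text \<open>On the one-point space every function is constant and derivations kill constants, so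
  only the zero field remains. Results that rest on charts are proved for
  \<open>smooth_manifold\<close> and are immediate in the other case.\<close>

lemma smooth_manifold_or_point:
  obtains "smooth_manifold M" | p where "(UNIV :: 'm set) = {p}" "smooth_functions M = UNIV" "\<And>x. tangent_space M x = {0}"
    "vector_fields M = {0}"
proof (cases "oriented_smooth_atlas (atlas M)")
  case True
  then show ?thesis using that(1) by (simp add: smooth_manifold_def)
next
  case False
  then obtain p where p: "atlas M = {}" "(UNIV :: 'm set) = {p}" using atlas_cases by blast
  then have C: "smooth_functions M = UNIV" by (simp add: smooth_functions_def)
  have 1: "v = 0" if "v \<in> tangent_space M x" for v x
  proof
    fix f :: "'m \<Rightarrow> real"
    have "f = (\<lambda>y. f p)" using p(2) by (metis (mono_tags) UNIV_I singletonD ext)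
    then show "v f = 0 f" using tangent_const[OF that, of "f p"] by simp
  qed
  then have T: "tangent_space M x = {0}" for x using subspace_0[OF subspace_tangent_space] by blast
  then have "w = 0" if "w \<in> vector_fields M" for w
    using vector_field_tangent[OF that] by (auto simp: fun_eq_iff)
  then have "vector_fields M = {0}" using subspace_0[OF subspace_vector_fields] by blast
  then show ?thesis using that(2) p C T by blast
qed

lemma smooth_functions_continuous: "f \<in> smooth_functions M \<Longrightarrow> continuous_on UNIV f"
proof -
  assume f: "f \<in> smooth_functions M"
  show ?thesis
  proof (rule smooth_manifold_or_point)
    assume "smooth_manifold M"
    then show ?thesis using smooth_manifold.smooth_functions_continuous f by blast
  next
    fix p assume "(UNIV :: 'm set) = {p}"
    then show ?thesis using continuous_on_sing[of p f] by metis
  qed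
qed

lemma smooth_functions_bounded:
  assumes "f \<in> smooth_functions M"
  shows "\<exists>K>0. \<forall>x. \<bar>f x\<bar> \<le> K"
proof -
  have "bounded (f ` UNIV)"
    using compact_continuous_image[OF smooth_functions_continuous[OF assms] compact_UNIV] compact_imp_bounded by blast
  then show ?thesis by (auto simp: bounded_pos)
qed

lemma manifold_bump:
  assumes "open N" "p \<in> N"
  shows "\<exists>\<eta>\<in>smooth_functions M. \<exists>W. open W \<and> p \<in> W \<and> W \<subseteq> N \<and> (\<forall>x\<in>W. \<eta> x = 1) \<and> (\<forall>x. x \<notin> N \<longrightarrow> \<eta> x = 0)"
proof (rule smooth_manifold_or_point)
  assume "smooth_manifold M"
  then show ?thesis using smooth_manifold.manifold_bump assms by blast
next
  fix q assume "(UNIV :: 'm set) = {q}"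
  then have "N = UNIV" using assms(2) by (metis UNIV_I singletonD UNIV_eq_I)
  then show ?thesis using assms by (intro bexI[of _ "\<lambda>x. 1"] exI[of _ N]) auto
qed

lemma tangent_local:
  assumes v: "v \<in> tangent_space M x" and N: "open N" "x \<in> N"
    and f: "f \<in> smooth_functions M" and h: "h \<in> smooth_functions M" and eq: "\<And>y. y \<in> N \<Longrightarrow> f y = h y"
  shows "v f = v h"
proof (rule smooth_manifold_or_point)
  assume "smooth_manifold M"
  then show ?thesis using smooth_manifold.tangent_local assms by blast
next
  fix q assume "\<And>x. tangent_space M x = {0}"
  then show ?thesis using v by auto
qed

lemma metric_smooth: "w \<in> vector_fields M \<Longrightarrow> z \<in> vector_fields M \<Longrightarrow> (\<lambda>x. metric M x (w x) (z x)) \<in> smooth_functions M"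
  using riemannian_metric by (simp add: riemannian_metric_def)

lemma metric_pos: "v \<in> tangent_space M x \<Longrightarrow> v \<noteq> 0 \<Longrightarrow> metric M x v v > 0"
  using riemannian_metric unfolding riemannian_metric_def zero_fun_def by blast

sublocale pt: semi_inner "tangent_space M x" "metric M x" for x
proof
  show "subspace (tangent_space M x)" by (rule subspace_tangent_space)
  show sym: "metric M x v w = metric M x w v" if "v \<in> tangent_space M x" "w \<in> tangent_space M x" for v w
    using riemannian_metric that unfolding riemannian_metric_def by blast
  show "metric M x (v + w) z = metric M x v z + metric M x w z"
    if "v \<in> tangent_space M x" "w \<in> tangent_space M x" "z \<in> tangent_space M x" for v w z
    using riemannian_metric that unfolding riemannian_metric_def tv_add_eq by blast
  show sc: "metric M x (c *\<^sub>R v) w = c * metric M x v w" if "v \<in> tangent_space M x" "w \<in> tangent_space M x" for v w c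
    using riemannian_metric that unfolding riemannian_metric_def tv_scale_eq by blast
  show "metric M x v v \<ge> 0" if v: "v \<in> tangent_space M x" for v
  proof (cases "v = 0")
    case True
    then show ?thesis using sc[OF v v, of 0] by simp
  qed (use metric_pos[OF v] in simp)
qed

section \<open>Existence of gradients\<close>

lemma smooth_at_open_det:
  fixes A :: "'m \<Rightarrow> real ^ 'n ^ 'n"
  assumes "open W" "\<And>i j. smooth_at_open M W (\<lambda>x. A x $ i $ j)"
  shows "smooth_at_open M W (\<lambda>x. det (A x))"
  unfolding det_def
  by (intro smooth_at_open_sum smooth_at_open_mult smooth_at_open_const smooth_at_open_prod assms)

text \<open>In a local frame the gradient solves a linear system with the Gram matrix of the frame.
  Cramer's rule writes its coefficients as quotients of determinants, which makes their smooth
  dependence on the point evident.\<close>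

lemma gradient_local:
  assumes "smooth_manifold M" and f: "f \<in> smooth_functions M"
  shows "\<exists>W u. open W \<and> p \<in> W \<and>
    (\<forall>x\<in>W. u x \<in> tangent_space M x \<and> (\<forall>v\<in>tangent_space M x. metric M x (u x) v = v f)) \<and>
    (\<forall>h\<in>smooth_functions M. smooth_at_open M W (\<lambda>x. u x h))"
proof -
  interpret smooth_manifold M by fact
  obtain W F E where p: "p \<in> W" and fr: "frame_on W F E" using local_frame by blast
  have W: "open W" and E: "\<And>i. E i \<in> vector_fields M"
    and exp: "\<And>x v. x \<in> W \<Longrightarrow> v \<in> tangent_space M x \<Longrightarrow> v = (\<Sum>i\<in>UNIV. v (F i) *\<^sub>R E i x)"
    and dual: "\<And>x i j. x \<in> W \<Longrightarrow> E i x (F j) = (if i = j then 1 else 0)"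
    using fr by (auto simp: frame_on_def)
  note Et = vector_field_tangent[OF E]
  define A :: "'m \<Rightarrow> real ^ 'n ^ 'n" where "A x = (\<chi> i j. metric M x (E i x) (E j x))" for x
  define b :: "'m \<Rightarrow> real ^ 'n" where "b x = (\<chi> i. E i x f)" for x
  define c :: "'m \<Rightarrow> real ^ 'n" where "c x = (\<chi> k. det (\<chi> i j. if j = k then b x $ i else A x $ i $ j) / det (A x))" for x
  define u where "u x = (\<Sum>k\<in>UNIV. c x $ k *\<^sub>R E k x)" for x
  have mult: "(A x *v a) $ i = metric M x (E i x) (\<Sum>k\<in>UNIV. a $ k *\<^sub>R E k x)" for x a i
    by (simp add: A_def matrix_vector_mult_def pt.sum_right pt.scale_right Et pt.closed_simps mult.commute)
  \<comment> \<open>A kernel vector gives a combination of the frame of length zero, hence the zero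
    tangent vector; applying it to \<open>F j\<close> reads off the j-th coefficient.\<close>
  have det: "det (A x) \<noteq> 0" if x: "x \<in> W" for x
  proof -
    have "a = 0" if a: "A x *v a = 0" for a
    proof -
      let ?v = "\<Sum>k\<in>UNIV. a $ k *\<^sub>R E k x"
      have v: "?v \<in> tangent_space M x" by (intro pt.closed_simps Et)
      have "metric M x (E i x) ?v = 0" for i using a mult[of x a i] by simp
      then have "metric M x ?v ?v = 0"
        by (subst pt.sum_left) (auto simp: pt.scale_left v Et pt.closed_simps)
      then have v0: "?v = 0" using metric_pos[OF v] by force
      have "a $ j = 0" for j
      proof -
        have "0 = ?v (F j)" unfolding v0 by simp
        also have "\<dots> = a $ j" by (simp add: dual[OF x] if_distrib cong: if_cong)
        finally show ?thesis by simp
      qed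
      then show ?thesis by (simp add: vec_eq_iff)
    qed
    then have "inj ((*v) (A x))"
      using linear_injective_0[OF matrix_vector_mul_linear] by blast
    then have "invertible (A x)"
      by (simp add: invertible_left_inverse matrix_left_invertible_injective)
    then show ?thesis by (simp add: invertible_det_nz)
  qed
  have "u x \<in> tangent_space M x" for x unfolding u_def by (intro pt.closed_simps Et)
  moreover have "metric M x (u x) v = v f" if x: "x \<in> W" and v: "v \<in> tangent_space M x" for x v
  proof -
    have "A x *v c x = b x" using cramer[OF det[OF x], of "c x" "b x"] by (simp add: c_def)
    then have 1: "metric M x (E i x) (u x) = E i x f" for i
      using mult[of x "c x" i] by (simp add: u_def b_def)
    have "metric M x (u x) v = metric M x v (u x)"
      using v \<open>u x \<in> _\<close> by (rule pt.sym[rotated])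
    also have "\<dots> = metric M x (\<Sum>i\<in>UNIV. v (F i) *\<^sub>R E i x) (u x)" using exp[OF x v] by simp
    also have "\<dots> = (\<Sum>i\<in>UNIV. v (F i) * E i x f)"
      using \<open>u x \<in> _\<close> by (simp add: pt.sum_left pt.scale_left Et pt.closed_simps 1)
    also have "\<dots> = (\<Sum>i\<in>UNIV. v (F i) *\<^sub>R E i x) f" by simp
    finally show ?thesis using exp[OF x v] by simp
  qed
  moreover have "smooth_at_open M W (\<lambda>x. u x h)" if h: "h \<in> smooth_functions M" for h
  proof -
    have Eh: "smooth_at_open M W (\<lambda>x. E i x h)" if "h \<in> smooth_functions M" for i h
      by (rule smooth_functions_at_open[OF vector_field_smooth[OF E that]])
    have sA: "smooth_at_open M W (\<lambda>x. A x $ i $ j)" for i j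
      unfolding A_def using smooth_functions_at_open[OF metric_smooth[OF E E]] by simp
    have "smooth_at_open M W (\<lambda>x. (\<chi> i j. if j = k then b x $ i else A x $ i $ j) $ i $ j)" for i j k
      using sA Eh[OF f] by (cases "j = k") (simp_all add: b_def)
    then have "smooth_at_open M W (\<lambda>x. c x $ k)" for k
      unfolding c_def divide_inverse
      using smooth_at_open_mult[OF W smooth_at_open_det[OF W] smooth_at_open_inverse[OF W smooth_at_open_det[OF W sA] det]]
      by simp
    then have "smooth_at_open M W (\<lambda>x. \<Sum>k\<in>UNIV. c x $ k * E k x h)"
      by (intro smooth_at_open_sum[OF W] smooth_at_open_mult[OF W] Eh[OF h])
    then show ?thesis unfolding u_def by simp
  qed
  ultimately show ?thesis using W p by (intro exI[of _ W] exI[of _ u]) blast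
qed

lemma gradient_unique:
  assumes "u \<in> tangent_space M x" "u' \<in> tangent_space M x"
    and "\<And>v. v \<in> tangent_space M x \<Longrightarrow> metric M x u v = metric M x u' v"
  shows "u = u'"
proof (rule ccontr)
  assume "u \<noteq> u'"
  then have "metric M x (u - u') (u - u') > 0"
    using assms by (intro metric_pos pt.closed_simps) auto
  moreover have "metric M x (u - u') (u - u') = 0"
    using assms pt.closed_simps by (subst pt.diff_left) auto
  ultimately show False by simp
qed

text \<open>By nondegeneracy the gradient is determined at each point, so the local solutions agree
  with the pointwise description, which inherits their smoothness.\<close>

lemma gradient_exists:
  assumes f: "f \<in> smooth_functions M"
  shows "\<exists>w\<in>vector_fields M. \<forall>x. \<forall>v\<in>tangent_space M x. metric M x (w x) v = v f"
proof (rule smooth_manifold_or_point)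
  assume sm: "smooth_manifold M"
  define w where "w x = (THE u. u \<in> tangent_space M x \<and> (\<forall>v\<in>tangent_space M x. metric M x u v = v f))" for x
  have weq: "w x = u" if "u \<in> tangent_space M x" "\<And>v. v \<in> tangent_space M x \<Longrightarrow> metric M x u v = v f" for x u
    unfolding w_def using that by (intro the_equality) (auto intro: gradient_unique)
  have w: "w x \<in> tangent_space M x \<and> (\<forall>v\<in>tangent_space M x. metric M x (w x) v = v f)" for x
  proof -
    obtain W u where "x \<in> W" "\<forall>x\<in>W. u x \<in> tangent_space M x \<and> (\<forall>v\<in>tangent_space M x. metric M x (u x) v = v f)"
      using gradient_local[OF sm f, of x] by blast
    then show ?thesis using weq[of "u x" x] by simp
  qed
  have "(\<lambda>x. w x h) \<in> smooth_functions M" if h: "h \<in> smooth_functions M" for h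
  proof (rule smooth_functions_local)
    fix x
    obtain W u where u: "open W" "x \<in> W" "\<forall>x\<in>W. u x \<in> tangent_space M x \<and> (\<forall>v\<in>tangent_space M x. metric M x (u x) v = v f)"
      "smooth_at_open M W (\<lambda>x. u x h)"
      using gradient_local[OF sm f, of x] h by blast
    have "smooth_at_open M W (\<lambda>x. w x h)"
      by (rule smooth_at_open_cong[OF u(1) _ u(4)]) (use u(3) weq in auto)
    then show "\<exists>W. open W \<and> x \<in> W \<and> smooth_at_open M W (\<lambda>x. w x h)" using u by blast
  qed
  then have "w \<in> vector_fields M" using w by (simp add: vector_fields_def)
  then show ?thesis using w by blast
next
  assume X: "vector_fields M = {0}" and T: "\<And>x. tangent_space M x = {0}"
  then show ?thesis using pt.zero_left[of 0] by auto
qed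

lemma gradient_fields_exists:
  assumes "f \<in> smooth_functions M"
  obtains w where "w \<in> gradient_fields M" "\<And>x v. v \<in> tangent_space M x \<Longrightarrow> metric M x (w x) v = v f"
  using gradient_exists[OF assms] assms that by (auto simp: gradient_fields_def)

section \<open>Uniform bounds from compactness\<close>

lemma field_nrm_bounded:
  assumes "w \<in> vector_fields M"
  shows "\<exists>K>0. \<forall>x. pt.nrm x (w x) \<le> K"
proof -
  obtain K where K: "K > 0" "\<And>x. \<bar>metric M x (w x) (w x)\<bar> \<le> K"
    using smooth_functions_bounded[OF metric_smooth[OF assms assms]] by blast
  have "pt.nrm x (w x) \<le> sqrt K" for x
    unfolding pt.nrm_def using K(2)[of x] by (intro real_sqrt_le_mono) simp
  then show ?thesis using K(1) by (intro exI[of _ "sqrt K"]) simp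
qed

text \<open>Cauchy-Schwarz against the gradient of f, whose length is bounded by
  compactness.\<close>

lemma derivation_bounded:
  assumes f: "f \<in> smooth_functions M"
  shows "\<exists>K>0. \<forall>x. \<forall>v\<in>tangent_space M x. \<bar>v f\<bar> \<le> K * pt.nrm x v"
proof -
  obtain w where w: "w \<in> gradient_fields M" "\<And>x v. v \<in> tangent_space M x \<Longrightarrow> metric M x (w x) v = v f"
    using gradient_fields_exists[OF f] by blast
  then have wX: "w \<in> vector_fields M" by (simp add: gradient_fields_def)
  then obtain K where K: "K > 0" "\<And>x. pt.nrm x (w x) \<le> K" using field_nrm_bounded by blast
  have "\<bar>v f\<bar> \<le> K * pt.nrm x v" if v: "v \<in> tangent_space M x" for x v
  proof -
    have "\<bar>v f\<bar> \<le> pt.nrm x (w x) * pt.nrm x v"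
      using pt.abs_le_nrm[OF vector_field_tangent[OF wX] v] w(2)[OF v] by simp
    also have "\<dots> \<le> K * pt.nrm x v" using K v by (intro mult_right_mono) auto
    finally show ?thesis .
  qed
  then show ?thesis using K(1) by blast
qed

text \<open>A function-linear \<open>L\<close> is computed in a frame: near p, L w is \<Sum> w (F i)
  L (E i), so bounds on the derivatives of the \<open>F i\<close> and on the finitely many fields
  \<open>L (E i)\<close> suffice. As \<open>L\<close> takes global fields, the expansion is first
  multiplied by a cutoff \<eta>; outside the frame domain both sides then vanish.\<close>

lemma tensorial_bounded_local:
  assumes sm: "smooth_manifold M"
    and L: "\<And>w. w \<in> vector_fields M \<Longrightarrow> L w \<in> vector_fields M"
    and add: "\<And>w z. w \<in> vector_fields M \<Longrightarrow> z \<in> vector_fields M \<Longrightarrow> L (w + z) = L w + L z"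
    and smult: "\<And>h w. h \<in> smooth_functions M \<Longrightarrow> w \<in> vector_fields M \<Longrightarrow> L (vf_smult h w) = vf_smult h (L w)"
  shows "\<exists>V C. open V \<and> p \<in> V \<and> C > 0 \<and> (\<forall>x\<in>V. \<forall>w\<in>vector_fields M. pt.nrm x (L w x) \<le> C * pt.nrm x (w x))"
proof -
  interpret smooth_manifold M by fact
  obtain W F E where p: "p \<in> W" and fr: "frame_on W F E" using local_frame by blast
  have W: "open W" and E: "\<And>i. E i \<in> vector_fields M" and F: "\<And>i. F i \<in> smooth_functions M"
    and exp: "\<And>x v. x \<in> W \<Longrightarrow> v \<in> tangent_space M x \<Longrightarrow> v = (\<Sum>i\<in>UNIV. v (F i) *\<^sub>R E i x)"
    using fr by (auto simp: frame_on_def)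
  obtain \<eta> V where \<eta>: "\<eta> \<in> smooth_functions M" "\<And>x. x \<in> V \<Longrightarrow> \<eta> x = 1" "\<And>x. x \<notin> W \<Longrightarrow> \<eta> x = 0"
    and V: "open V" "p \<in> V" "V \<subseteq> W"
    using manifold_bump[OF W p] by blast
  have L0: "L 0 = 0" using add[of 0 0] subspace_0[OF subspace_vector_fields] by simp
  have Lsum: "L (\<Sum>i\<in>I. w i) = (\<Sum>i\<in>I. L (w i))" if "\<And>i. w i \<in> vector_fields M" for I and w :: "'n \<Rightarrow> 'm vfield"
  proof (induction I rule: finite_induct[OF finite])
    case (2 i I)
    note insert = 2
    have "L (w i + sum w I) = L (w i) + L (sum w I)"
      by (rule add[OF that subspace_sum[OF subspace_vector_fields that]])
    then show ?case unfolding sum.insert[OF insert(1,2)] insert(3) .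
  qed (simp only: L0 sum.empty)
  have "\<exists>K. \<forall>x v. v \<in> tangent_space M x \<longrightarrow> \<bar>v (F i)\<bar> \<le> K * pt.nrm x v" for i
    using derivation_bounded[OF F[of i]] by (elim exE conjE) blast
  then obtain K where K: "\<And>i x v. v \<in> tangent_space M x \<Longrightarrow> \<bar>v (F i)\<bar> \<le> K i * pt.nrm x v" by metis
  have "\<exists>K. K > 0 \<and> (\<forall>x. pt.nrm x (L (E i) x) \<le> K)" for i
    using field_nrm_bounded[OF L[OF E[of i]]] .
  then obtain K' where K': "\<And>i. K' i > 0" "\<And>i x. pt.nrm x (L (E i) x) \<le> K' i" by metis
  define C where "C = (\<Sum>i\<in>UNIV. \<bar>K i\<bar> * K' i) + 1"
  have "pt.nrm x (L w x) \<le> C * pt.nrm x (w x)" if x: "x \<in> V" and w: "w \<in> vector_fields M" for x w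
  proof -
    note wt = vector_field_tangent[OF w]
    have sF: "(\<lambda>x. \<eta> x * w x (F i)) \<in> smooth_functions M" for i
      by (rule smooth_mult[OF \<eta>(1) vector_field_smooth[OF w F]])
    have "vf_smult \<eta> w = (\<Sum>i\<in>UNIV. vf_smult (\<lambda>x. \<eta> x * w x (F i)) (E i))"
    proof
      fix y
      show "vf_smult \<eta> w y = (\<Sum>i\<in>UNIV. vf_smult (\<lambda>x. \<eta> x * w x (F i)) (E i)) y"
      proof (cases "y \<in> W")
        case True
        have "vf_smult \<eta> w y = \<eta> y *\<^sub>R (\<Sum>i\<in>UNIV. w y (F i) *\<^sub>R E i y)"
          using exp[OF True wt[of y]] by (simp add: vf_smult_def tv_scale_eq)
        then show ?thesis by (simp add: vf_smult_def tv_scale_eq scaleR_sum_right)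
      next
        case False
        then show ?thesis by (simp add: vf_smult_def tv_scale_eq \<eta>)
      qed
    qed
    then have "L (vf_smult \<eta> w) = (\<Sum>i\<in>UNIV. L (vf_smult (\<lambda>x. \<eta> x * w x (F i)) (E i)))"
      using Lsum[of "\<lambda>i. vf_smult (\<lambda>x. \<eta> x * w x (F i)) (E i)" UNIV] vf_smult_vector_field[OF sF E] by simp
    then have "vf_smult \<eta> (L w) = (\<Sum>i\<in>UNIV. vf_smult (\<lambda>x. \<eta> x * w x (F i)) (L (E i)))"
      using smult[OF \<eta>(1) w] smult[OF sF E] by simp
    then have "vf_smult \<eta> (L w) x = (\<Sum>i\<in>UNIV. vf_smult (\<lambda>x. \<eta> x * w x (F i)) (L (E i))) x" by simp
    then have "L w x = (\<Sum>i\<in>UNIV. w x (F i) *\<^sub>R L (E i) x)"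
      using \<eta>(2)[OF x] by (simp add: vf_smult_def tv_scale_eq)
    then have "pt.nrm x (L w x) \<le> (\<Sum>i\<in>UNIV. pt.nrm x (w x (F i) *\<^sub>R L (E i) x))"
      using pt.nrm_sum[of UNIV "\<lambda>i. w x (F i) *\<^sub>R L (E i) x" x] vector_field_tangent[OF L[OF E]]
      by (simp add: pt.closed_simps)
    also have "\<dots> \<le> (\<Sum>i\<in>UNIV. (\<bar>K i\<bar> * pt.nrm x (w x)) * K' i)"
    proof (rule sum_mono)
      fix i
      have "\<bar>w x (F i)\<bar> \<le> \<bar>K i\<bar> * pt.nrm x (w x)"
        by (rule order_trans[OF K[OF wt] mult_right_mono]) (auto simp: wt)
      then have "\<bar>w x (F i)\<bar> * pt.nrm x (L (E i) x) \<le> (\<bar>K i\<bar> * pt.nrm x (w x)) * K' i"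
        using K' vector_field_tangent[OF L[OF E]] by (intro mult_mono) (auto simp: wt)
      then show "pt.nrm x (w x (F i) *\<^sub>R L (E i) x) \<le> (\<bar>K i\<bar> * pt.nrm x (w x)) * K' i"
        using pt.nrm_scale[OF vector_field_tangent[OF L[OF E]]] by simp
    qed
    also have "\<dots> = (\<Sum>i\<in>UNIV. \<bar>K i\<bar> * K' i) * pt.nrm x (w x)"
      unfolding sum_distrib_right by (intro sum.cong refl) simp
    also have "\<dots> \<le> C * pt.nrm x (w x)" by (intro mult_right_mono) (auto simp: C_def wt)
    finally show ?thesis .
  qed
  moreover have "C > 0"
  proof -
    have "(\<Sum>i\<in>UNIV. \<bar>K i\<bar> * K' i) \<ge> 0" using K'(1) by (intro sum_nonneg) (simp add: less_imp_le)
    then show ?thesis by (simp add: C_def)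
  qed
  ultimately show ?thesis using V by blast
qed

text \<open>Finitely many of the local neighbourhoods cover the manifold, and the sum of their
  positive constants dominates each of them.\<close>

lemma tensorial_bounded:
  assumes L: "\<And>w. w \<in> vector_fields M \<Longrightarrow> L w \<in> vector_fields M"
    and add: "\<And>w z. w \<in> vector_fields M \<Longrightarrow> z \<in> vector_fields M \<Longrightarrow> L (w + z) = L w + L z"
    and smult: "\<And>h w. h \<in> smooth_functions M \<Longrightarrow> w \<in> vector_fields M \<Longrightarrow> L (vf_smult h w) = vf_smult h (L w)"
  shows "\<exists>C>0. \<forall>w\<in>vector_fields M. \<forall>x. pt.nrm x (L w x) \<le> C * pt.nrm x (w x)"
proof (rule smooth_manifold_or_point)
  assume sm: "smooth_manifold M"
  have "\<exists>V C. open V \<and> p \<in> V \<and> C > 0 \<and> (\<forall>x\<in>V. \<forall>w\<in>vector_fields M. pt.nrm x (L w x) \<le> C * pt.nrm x (w x))" for p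
    by (rule tensorial_bounded_local[OF sm]) (use assms in auto)
  then obtain V C where V: "\<And>p. open (V p)" "\<And>p. p \<in> V p" "\<And>p. C p > 0"
    and C: "\<And>p x w. x \<in> V p \<Longrightarrow> w \<in> vector_fields M \<Longrightarrow> pt.nrm x (L w x) \<le> C p * pt.nrm x (w x)"
    by metis
  obtain D where D: "finite D" "UNIV \<subseteq> (\<Union>p\<in>D. V p)"
    by (rule compactE_image[OF compact_UNIV, of UNIV V]) (use V in blast)+
  define K where "K = sum C D + 1"
  have "pt.nrm x (L w x) \<le> K * pt.nrm x (w x)" if w: "w \<in> vector_fields M" for x w
  proof -
    obtain p where p: "p \<in> D" "x \<in> V p" using D by blast
    have "C p \<le> K" using member_le_sum[of p D C] p D V(3) by (simp add: K_def less_imp_le add_increasing2)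
    then show ?thesis
      by (rule order_trans[OF C[OF p(2) w] mult_right_mono]) (simp add: vector_field_tangent[OF w])
  qed
  moreover have "K > 0" using sum_nonneg[of D C] V(3) by (simp add: K_def less_imp_le add_nonneg_pos)
  ultimately show ?thesis by blast
next
  assume X: "vector_fields M = {0}"
  then show ?thesis using L[of 0] by (intro exI[of _ 1]) (auto simp: pt.nrm_def)
qed

subsection \<open>Square-integrable vector fields\<close>

lemma smooth_functions_measurable: "f \<in> smooth_functions M \<Longrightarrow> f \<in> borel_measurable borel"
  by (intro borel_measurable_continuous_onI smooth_functions_continuous)

lemma smooth_functions_integrable:
  assumes "f \<in> smooth_functions M"
  shows "integrable (law \<mu>) f"
proof -
  interpret prob_space "law \<mu>" by (rule prob_space_law)
  obtain K where "\<And>x. \<bar>f x\<bar> \<le> K" using smooth_functions_bounded[OF assms] by blast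
  then show ?thesis
    using smooth_functions_measurable[OF assms] by (intro integrable_const_bound[of _ K]) auto
qed

lemma star_add: "f \<in> smooth_functions M \<Longrightarrow> h \<in> smooth_functions M \<Longrightarrow> star (\<lambda>x. f x + h x) \<mu> = star f \<mu> + star h \<mu>"
  by (simp add: star_def smooth_functions_integrable)

lemma star_diff: "f \<in> smooth_functions M \<Longrightarrow> h \<in> smooth_functions M \<Longrightarrow> star (\<lambda>x. f x - h x) \<mu> = star f \<mu> - star h \<mu>"
  by (simp add: star_def smooth_functions_integrable)

lemma star_cmult: "star (\<lambda>x. c * f x) \<mu> = c * star f \<mu>"
  by (simp add: star_def)

lemma star_sum: "(\<And>i. i \<in> I \<Longrightarrow> f i \<in> smooth_functions M) \<Longrightarrow> star (\<lambda>x. \<Sum>i\<in>I. f i x) \<mu> = (\<Sum>i\<in>I. star (f i) \<mu>)"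
  by (simp add: star_def smooth_functions_integrable)

lemma star_mono: "f \<in> smooth_functions M \<Longrightarrow> h \<in> smooth_functions M \<Longrightarrow> (\<And>x. f x \<le> h x) \<Longrightarrow> star f \<mu> \<le> star h \<mu>"
  by (simp add: star_def smooth_functions_integrable integral_mono)

lemma l2_inner_star: "l2_inner M \<mu> w z = star (\<lambda>x. metric M x (w x) (z x)) \<mu>"
  by (simp add: l2_inner_def star_def)

sublocale l2: semi_inner "vector_fields M" "l2_inner M \<mu>" for \<mu>
proof
  show "subspace (vector_fields M)" by (rule subspace_vector_fields)
  fix w z y c assume w: "w \<in> vector_fields M"
  note wt = vector_field_tangent[OF w]
  show "l2_inner M \<mu> w w \<ge> 0"
    using star_mono[OF smooth_const metric_smooth[OF w w], of 0 \<mu>] pt.nonneg[OF wt]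
    by (simp add: l2_inner_star star_def)
  assume z: "z \<in> vector_fields M"
  note zt = vector_field_tangent[OF z]
  show "l2_inner M \<mu> w z = l2_inner M \<mu> z w" unfolding l2_inner_star using pt.sym[OF wt zt] by simp
  show "l2_inner M \<mu> (c *\<^sub>R w) z = c * l2_inner M \<mu> w z"
    by (simp add: l2_inner_star pt.scale_left[OF wt zt] star_cmult)
  assume y: "y \<in> vector_fields M"
  note yt = vector_field_tangent[OF y]
  show "l2_inner M \<mu> (w + z) y = l2_inner M \<mu> w y + l2_inner M \<mu> z y"
    by (simp add: l2_inner_star pt.add_left[OF wt zt yt] star_add metric_smooth w z y)
qed

lemma l2_norm_eq: "l2_norm M \<mu> w = l2.nrm \<mu> w"
  by (simp add: l2_norm_def l2.nrm_def)

lemma l2_nrm_bound: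
  assumes w: "w \<in> vector_fields M" "z \<in> vector_fields M" and C: "C \<ge> 0" and le: "\<And>x. pt.nrm x (z x) \<le> C * pt.nrm x (w x)"
  shows "l2.nrm \<mu> z \<le> C * l2.nrm \<mu> w"
proof (rule power2_le_imp_le)
  have "metric M x (z x) (z x) \<le> C\<^sup>2 * metric M x (w x) (w x)" for x
  proof -
    have "(pt.nrm x (z x))\<^sup>2 \<le> (C * pt.nrm x (w x))\<^sup>2"
      using le w vector_field_tangent by (intro power_mono) auto
    then show ?thesis using w vector_field_tangent by (simp add: pt.nrm_square power_mult_distrib)
  qed
  then have "l2_inner M \<mu> z z \<le> C\<^sup>2 * l2_inner M \<mu> w w"
    unfolding l2_inner_star star_cmult[symmetric] by (intro star_mono smooth_cmult metric_smooth w)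
  then show "(l2.nrm \<mu> z)\<^sup>2 \<le> (C * l2.nrm \<mu> w)\<^sup>2"
    by (simp add: l2.nrm_square w power_mult_distrib)
qed (use C w in simp)

sublocale hb: semi_inner "Collect (l2.cauchy_in \<mu>)" "l2.lim_inner \<mu>" for \<mu>
  by (rule l2.semi_inner_cauchy_seqs)

section \<open>Tangent classes through representatives\<close>

lemma cauchy_fields_eq: "cauchy_fields M \<mu> = Collect (l2.cauchy_in \<mu>)"
  by (auto simp: cauchy_fields_def l2.cauchy_in_def l2_norm_eq vf_diff_eq)

lemma null_rel_iff:
  "(a, b) \<in> null_rel M \<mu> \<longleftrightarrow> l2.cauchy_in \<mu> a \<and> l2.cauchy_in \<mu> b \<and> hb.nrm \<mu> (a - b) = 0"
proof -
  have "(\<lambda>n. l2.nrm \<mu> (a n - b n)) \<longlonglongrightarrow> 0 \<longleftrightarrow> hb.nrm \<mu> (a - b) = 0"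
    if "l2.cauchy_in \<mu> a" "l2.cauchy_in \<mu> b"
    using l2.lim_nrm_tendsto[OF l2.cauchy_in_diff[OF that]] LIMSEQ_unique by (auto simp: fun_diff_def)
  then show ?thesis by (auto simp: null_rel_def cauchy_fields_eq l2_norm_eq vf_diff_eq)
qed

lemma tclass_of_eq: "l2.cauchy_in \<mu> a \<Longrightarrow> tclass_of M \<mu> a = {b. l2.cauchy_in \<mu> b \<and> hb.nrm \<mu> (a - b) = 0}"
  by (auto simp: tclass_of_def null_rel_iff)

lemma hb_nrm_diff_zero_sym:
  assumes "l2.cauchy_in \<mu> a" "l2.cauchy_in \<mu> b" shows "hb.nrm \<mu> (a - b) = hb.nrm \<mu> (b - a)"
  using hb.nrm_minus_commute[of a \<mu> b] assms by simp

lemma hb_nrm_diff_zero_trans: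
  assumes "l2.cauchy_in \<mu> a" "l2.cauchy_in \<mu> b" "l2.cauchy_in \<mu> c"
    and "hb.nrm \<mu> (a - b) = 0" "hb.nrm \<mu> (b - c) = 0"
  shows "hb.nrm \<mu> (a - c) = 0"
proof -
  have "hb.nrm \<mu> ((a - b) + (b - c)) \<le> hb.nrm \<mu> (a - b) + hb.nrm \<mu> (b - c)"
    by (intro hb.nrm_triangle) (simp_all add: l2.cauchy_in_diff assms)
  moreover have "hb.nrm \<mu> (a - c) \<ge> 0" by (simp add: l2.cauchy_in_diff assms)
  ultimately show ?thesis using assms by simp
qed

lemma tclass_of_eq_iff:
  assumes "l2.cauchy_in \<mu> a" "l2.cauchy_in \<mu> b"
  shows "tclass_of M \<mu> a = tclass_of M \<mu> b \<longleftrightarrow> hb.nrm \<mu> (a - b) = 0"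
proof
  assume "tclass_of M \<mu> a = tclass_of M \<mu> b"
  then have "b \<in> tclass_of M \<mu> a" using assms by (simp add: tclass_of_eq)
  then show "hb.nrm \<mu> (a - b) = 0" using assms by (simp add: tclass_of_eq)
next
  assume "hb.nrm \<mu> (a - b) = 0"
  then show "tclass_of M \<mu> a = tclass_of M \<mu> b"
    unfolding tclass_of_eq[OF assms(1)] tclass_of_eq[OF assms(2)]
    using assms hb_nrm_diff_zero_sym hb_nrm_diff_zero_trans by (metis (no_types, lifting))
qed

lemma tangent_der_eq: "tangent_der M \<mu> = tclass_of M \<mu> ` Collect (l2.cauchy_in \<mu>)"
  by (auto simp: tangent_der_def quotient_def tclass_of_def cauchy_fields_eq)

lemma tclass_of_mem: "l2.cauchy_in \<mu> a \<Longrightarrow> a \<in> tclass_of M \<mu> a"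
  by (simp add: tclass_of_eq)

text \<open>By Cauchy-Schwarz a null sequence in either slot leaves the limit unchanged, so the
  description singles out one number, computable on any representatives.\<close>

lemma G_der_tclass:
  assumes "l2.cauchy_in \<mu> a" "l2.cauchy_in \<mu> b"
  shows "G_der M \<mu> (tclass_of M \<mu> a) (tclass_of M \<mu> b) = l2.lim_inner \<mu> a b"
  unfolding G_der_def
proof (rule the_equality)
  have "l2.lim_inner \<mu> a' b' = l2.lim_inner \<mu> a b" if "a' \<in> tclass_of M \<mu> a" "b' \<in> tclass_of M \<mu> b" for a' b'
  proof -
    have c: "l2.cauchy_in \<mu> a'" "l2.cauchy_in \<mu> b'" "hb.nrm \<mu> (a - a') = 0" "hb.nrm \<mu> (b - b') = 0"
      using that assms by (auto simp: tclass_of_eq)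
    have "l2.lim_inner \<mu> a b = l2.lim_inner \<mu> a' b" by (rule hb.null_cong) (use c assms in auto)
    moreover have "l2.lim_inner \<mu> b a' = l2.lim_inner \<mu> b' a'" by (rule hb.null_cong) (use c assms in auto)
    ultimately show ?thesis using hb.sym c assms by (metis mem_Collect_eq)
  qed
  then show "\<forall>a'\<in>tclass_of M \<mu> a. \<forall>b'\<in>tclass_of M \<mu> b. (\<lambda>n. l2_inner M \<mu> (a' n) (b' n)) \<longlonglongrightarrow> l2.lim_inner \<mu> a b"
    using l2.lim_inner_tendsto assms by (metis (no_types, lifting) mem_Collect_eq tclass_of_eq)
  fix r assume "\<forall>a'\<in>tclass_of M \<mu> a. \<forall>b'\<in>tclass_of M \<mu> b. (\<lambda>n. l2_inner M \<mu> (a' n) (b' n)) \<longlonglongrightarrow> r"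
  then have "(\<lambda>n. l2_inner M \<mu> (a n) (b n)) \<longlonglongrightarrow> r" using tclass_of_mem assms by blast
  then show "r = l2.lim_inner \<mu> a b" using l2.lim_inner_tendsto[OF assms] LIMSEQ_unique by blast
qed

lemma tc_add_tclass:
  assumes "l2.cauchy_in \<mu> a" "l2.cauchy_in \<mu> b"
  shows "tc_add M \<mu> (tclass_of M \<mu> a) (tclass_of M \<mu> b) = tclass_of M \<mu> (a + b)"
proof -
  have "tclass_of M \<mu> (\<lambda>n. vf_add (a' n) (b' n)) = tclass_of M \<mu> (a + b)"
    if "a' \<in> tclass_of M \<mu> a" "b' \<in> tclass_of M \<mu> b" for a' b'
  proof -
    have c: "l2.cauchy_in \<mu> a'" "l2.cauchy_in \<mu> b'" "hb.nrm \<mu> (a - a') = 0" "hb.nrm \<mu> (b - b') = 0"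
      using that assms by (auto simp: tclass_of_eq)
    have "hb.nrm \<mu> ((a - a') + (b - b')) \<le> hb.nrm \<mu> (a - a') + hb.nrm \<mu> (b - b')"
      by (intro hb.nrm_triangle) (simp_all add: l2.cauchy_in_diff assms c)
    moreover have "hb.nrm \<mu> (a + b - (a' + b')) \<ge> 0" by (simp add: l2.cauchy_in_diff l2.cauchy_in_add assms c)
    moreover have "(a - a') + (b - b') = a + b - (a' + b')" by simp
    ultimately have "hb.nrm \<mu> (a + b - (a' + b')) = 0" using c by simp
    then have "tclass_of M \<mu> (a + b) = tclass_of M \<mu> (a' + b')"
      by (subst tclass_of_eq_iff) (simp_all add: l2.cauchy_in_add assms c)
    then show ?thesis by (simp add: plus_fun_def vf_add_eq)
  qed
  then show ?thesis
    unfolding tc_add_def using tclass_of_mem assms by (simp cong: SUP_cong) blast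
qed

lemma tc_diff_tclass:
  assumes "l2.cauchy_in \<mu> a" "l2.cauchy_in \<mu> b"
  shows "tc_diff M \<mu> (tclass_of M \<mu> a) (tclass_of M \<mu> b) = tclass_of M \<mu> (a - b)"
proof -
  have "tclass_of M \<mu> (\<lambda>n. vf_diff (a' n) (b' n)) = tclass_of M \<mu> (a - b)"
    if "a' \<in> tclass_of M \<mu> a" "b' \<in> tclass_of M \<mu> b" for a' b'
  proof -
    have c: "l2.cauchy_in \<mu> a'" "l2.cauchy_in \<mu> b'" "hb.nrm \<mu> (a - a') = 0" "hb.nrm \<mu> (b' - b) = 0"
      using that assms hb_nrm_diff_zero_sym by (auto simp: tclass_of_eq)
    have "hb.nrm \<mu> ((a - a') + (b' - b)) \<le> hb.nrm \<mu> (a - a') + hb.nrm \<mu> (b' - b)"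
      by (intro hb.nrm_triangle) (simp_all add: l2.cauchy_in_diff assms c)
    moreover have "hb.nrm \<mu> (a - b - (a' - b')) \<ge> 0" by (simp add: l2.cauchy_in_diff assms c)
    moreover have "(a - a') + (b' - b) = a - b - (a' - b')" by simp
    ultimately have "hb.nrm \<mu> (a - b - (a' - b')) = 0" using c by simp
    then have "tclass_of M \<mu> (a - b) = tclass_of M \<mu> (a' - b')"
      by (subst tclass_of_eq_iff) (simp_all add: l2.cauchy_in_diff assms c)
    then show ?thesis by (simp add: fun_diff_def vf_diff_eq)
  qed
  then show ?thesis
    unfolding tc_diff_def using tclass_of_mem assms by (simp cong: SUP_cong) blast
qed

text \<open>A bounded linear operator takes Cauchy sequences to Cauchy sequences and null sequences
  to null sequences. The images of a class therefore lie in a single class, and any class containing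
  one of them must be that one.\<close>

lemma extend_tclass:
  assumes a: "l2.cauchy_in \<mu> a" and L: "\<And>w. w \<in> vector_fields M \<Longrightarrow> L w \<in> vector_fields M"
    "\<And>w z. w \<in> vector_fields M \<Longrightarrow> z \<in> vector_fields M \<Longrightarrow> L (w - z) = L w - L z"
    and C: "\<And>w. w \<in> vector_fields M \<Longrightarrow> l2.nrm \<mu> (L w) \<le> C * l2.nrm \<mu> w"
  shows "extend M \<mu> L (tclass_of M \<mu> a) = tclass_of M \<mu> (\<lambda>n. L (a n))"
proof -
  have cL: "l2.cauchy_in \<mu> (\<lambda>n. L (b n))" if "l2.cauchy_in \<mu> b" for b
    by (rule l2.cauchy_in_image[OF that L C])
  have null: "hb.nrm \<mu> ((\<lambda>n. L (a n)) - (\<lambda>n. L (b n))) = 0" if b: "l2.cauchy_in \<mu> b" "hb.nrm \<mu> (a - b) = 0" for b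
  proof -
    have S: "a n \<in> vector_fields M" "b n \<in> vector_fields M" for n using a b by (auto simp: l2.cauchy_in_mem)
    have 1: "(\<lambda>n. C * l2.nrm \<mu> ((a - b) n)) \<longlonglongrightarrow> C * 0"
      using l2.lim_nrm_tendsto[OF l2.cauchy_in_diff[OF a b(1)]] b(2) by (intro tendsto_intros) simp
    have 2: "(\<lambda>n. l2.nrm \<mu> (((\<lambda>n. L (a n)) - (\<lambda>n. L (b n))) n)) \<longlonglongrightarrow> hb.nrm \<mu> ((\<lambda>n. L (a n)) - (\<lambda>n. L (b n)))"
      by (intro l2.lim_nrm_tendsto l2.cauchy_in_diff cL a b)
    have "hb.nrm \<mu> ((\<lambda>n. L (a n)) - (\<lambda>n. L (b n))) \<le> C * 0"
    proof (rule LIMSEQ_le[OF 2 1], intro exI allI impI)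
      fix n
      show "l2.nrm \<mu> (((\<lambda>n. L (a n)) - (\<lambda>n. L (b n))) n) \<le> C * l2.nrm \<mu> ((a - b) n)"
        using C[of "a n - b n"] S by (simp add: L(2) l2.closed_simps)
    qed
    moreover have "hb.nrm \<mu> ((\<lambda>n. L (a n)) - (\<lambda>n. L (b n))) \<ge> 0"
      by (simp add: l2.cauchy_in_diff cL a b)
    ultimately show ?thesis by simp
  qed
  show ?thesis
    unfolding extend_def
  proof (rule the_equality)
    show "tclass_of M \<mu> (\<lambda>n. L (a n)) \<in> tangent_der M \<mu> \<and>
      (\<forall>b\<in>tclass_of M \<mu> a. (\<lambda>n. L (b n)) \<in> tclass_of M \<mu> (\<lambda>n. L (a n)))"
      using cL a null by (simp add: tangent_der_eq tclass_of_eq)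
    fix B assume "B \<in> tangent_der M \<mu> \<and> (\<forall>b\<in>tclass_of M \<mu> a. (\<lambda>n. L (b n)) \<in> B)"
    then obtain c where c: "l2.cauchy_in \<mu> c" "B = tclass_of M \<mu> c" "(\<lambda>n. L (a n)) \<in> B"
      using tclass_of_mem[OF a] by (auto simp: tangent_der_eq)
    then show "B = tclass_of M \<mu> (\<lambda>n. L (a n))" using cL[OF a] by (simp add: tclass_of_eq_iff) (simp add: tclass_of_eq)
  qed
qed

section \<open>The gradient subspace and its projection\<close>

lemma subspace_gradient_fields: "subspace (gradient_fields M)"
proof (rule subspaceI)
  show "0 \<in> gradient_fields M"
    using pt.zero_left tangent_const by (auto simp: gradient_fields_def l2.closed_simps intro!: bexI[of _ "\<lambda>x. 0"])
next
  fix w z assume "w \<in> gradient_fields M" "z \<in> gradient_fields M"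
  then obtain f h where w: "w \<in> vector_fields M" "f \<in> smooth_functions M" "\<And>x v. v \<in> tangent_space M x \<Longrightarrow> metric M x (w x) v = v f"
    and z: "z \<in> vector_fields M" "h \<in> smooth_functions M" "\<And>x v. v \<in> tangent_space M x \<Longrightarrow> metric M x (z x) v = v h"
    by (auto simp: gradient_fields_def)
  have "metric M x ((w + z) x) v = v (\<lambda>y. f y + h y)" if "v \<in> tangent_space M x" for x v
    using that w z by (simp add: pt.add_left vector_field_tangent tangent_add)
  then show "w + z \<in> gradient_fields M"
    using w z by (auto simp: gradient_fields_def l2.closed_simps intro!: bexI[of _ "\<lambda>y. f y + h y"])
next
  fix c w assume "w \<in> gradient_fields M"
  then obtain f where w: "w \<in> vector_fields M" "f \<in> smooth_functions M" "\<And>x v. v \<in> tangent_space M x \<Longrightarrow> metric M x (w x) v = v f"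
    by (auto simp: gradient_fields_def)
  have "metric M x ((c *\<^sub>R w) x) v = v (\<lambda>y. c * f y)" if "v \<in> tangent_space M x" for x v
    using that w by (simp add: pt.scale_left vector_field_tangent tangent_cmult)
  then show "c *\<^sub>R w \<in> gradient_fields M"
    using w by (auto simp: gradient_fields_def l2.closed_simps intro!: bexI[of _ "\<lambda>y. c * f y"])
qed

lemma gradient_fields_subset: "gradient_fields M \<subseteq> vector_fields M"
  by (auto simp: gradient_fields_def)

text \<open>Gradient fields inside the completion, as constant sequences;
  \<open>tangent_grad\<close> will be the set of classes of the closure of this set.\<close>

definition grad_seqs :: "(nat \<Rightarrow> 'm vfield) set" where
  "grad_seqs = (\<lambda>w n. w) ` gradient_fields M"

lemma subspace_grad_seqs: "subspace grad_seqs"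
proof -
  have "linear (\<lambda>(w::'m vfield) (n::nat). w)" by (rule linearI) (auto simp: fun_eq_iff)
  then show ?thesis unfolding grad_seqs_def using linear_subspace_image subspace_gradient_fields by blast
qed

lemma grad_seqs_subset: "grad_seqs \<subseteq> Collect (l2.cauchy_in \<mu>)"
  using gradient_fields_subset by (auto simp: grad_seqs_def intro: l2.cauchy_in_const)

abbreviation grad_closure :: "'m borel_prob \<Rightarrow> (nat \<Rightarrow> 'm vfield) set" where
  "grad_closure \<mu> \<equiv> hb.clos \<mu> grad_seqs"

lemma grad_closure_cauchy: "a \<in> grad_closure \<mu> \<Longrightarrow> l2.cauchy_in \<mu> a"
  by (simp add: hb.clos_def)

lemma const_grad_closure: "w \<in> gradient_fields M \<Longrightarrow> (\<lambda>n. w) \<in> grad_closure \<mu>"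
  using hb.clos_subset[OF grad_seqs_subset] by (auto simp: grad_seqs_def)

lemma tangent_grad_tclass:
  assumes a: "l2.cauchy_in \<mu> a"
  shows "tclass_of M \<mu> a \<in> tangent_grad M \<mu> \<longleftrightarrow> a \<in> grad_closure \<mu>"
proof -
  have "sqrt (G_der M \<mu> (tc_diff M \<mu> (tclass_of M \<mu> a) (emb M \<mu> w)) (tc_diff M \<mu> (tclass_of M \<mu> a) (emb M \<mu> w))) =
      hb.nrm \<mu> (a - (\<lambda>n. w))" if "w \<in> gradient_fields M" for w
    using that a gradient_fields_subset
    by (auto simp: emb_def tc_diff_tclass l2.cauchy_in_const l2.cauchy_in_diff G_der_tclass hb.nrm_def subset_iff)
  then show ?thesis
    using a by (auto simp: tangent_grad_def hb.clos_def grad_seqs_def tangent_der_eq)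
qed

lemma tangent_grad_eq: "tangent_grad M \<mu> = tclass_of M \<mu> ` grad_closure \<mu>"
proof
  show "tangent_grad M \<mu> \<subseteq> tclass_of M \<mu> ` grad_closure \<mu>"
  proof
    fix A assume A: "A \<in> tangent_grad M \<mu>"
    then obtain a where "l2.cauchy_in \<mu> a" "A = tclass_of M \<mu> a" by (auto simp: tangent_grad_def tangent_der_eq)
    then show "A \<in> tclass_of M \<mu> ` grad_closure \<mu>" using A tangent_grad_tclass by blast
  qed
qed (use tangent_grad_tclass grad_closure_cauchy in blast)

text \<open>A chosen representative of the projected class. It is determined only up to a null
  sequence and need not be additive, so laws of the projection are obtained from orthogonality and
  \<open>hb.projection_unique\<close>.\<close>

definition pr :: "'m borel_prob \<Rightarrow> (nat \<Rightarrow> 'm vfield) \<Rightarrow> nat \<Rightarrow> 'm vfield" where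
  "pr \<mu> a = (SOME b. b \<in> grad_closure \<mu> \<and> (\<forall>w\<in>grad_closure \<mu>. l2.lim_inner \<mu> (a - b) w = 0))"

lemma pr:
  assumes a: "l2.cauchy_in \<mu> a"
  shows "pr \<mu> a \<in> grad_closure \<mu>" "w \<in> grad_closure \<mu> \<Longrightarrow> l2.lim_inner \<mu> (a - pr \<mu> a) w = 0"
    "l2.cauchy_in \<mu> (pr \<mu> a)"
proof -
  have "\<exists>b\<in>grad_closure \<mu>. \<forall>w\<in>grad_closure \<mu>. l2.lim_inner \<mu> (a - b) w = 0"
  proof (rule hb.projection_exists[OF subspace_grad_seqs grad_seqs_subset])
    fix w assume "hb.cauchy_in \<mu> w" "\<And>n. w n \<in> grad_seqs"
    then show "\<exists>b\<in>Collect (l2.cauchy_in \<mu>). (\<lambda>n. hb.nrm \<mu> (w n - b)) \<longlonglongrightarrow> 0"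
      using l2.cauchy_seqs_complete[of \<mu> w "gradient_fields M"] gradient_fields_subset by (simp add: grad_seqs_def)
  qed (use a in simp)
  then have "\<exists>b. b \<in> grad_closure \<mu> \<and> (\<forall>w\<in>grad_closure \<mu>. l2.lim_inner \<mu> (a - b) w = 0)" by blast
  then have "pr \<mu> a \<in> grad_closure \<mu> \<and> (\<forall>w\<in>grad_closure \<mu>. l2.lim_inner \<mu> (a - pr \<mu> a) w = 0)"
    unfolding pr_def by (rule someI_ex)
  then show "pr \<mu> a \<in> grad_closure \<mu>" "w \<in> grad_closure \<mu> \<Longrightarrow> l2.lim_inner \<mu> (a - pr \<mu> a) w = 0"
    "l2.cauchy_in \<mu> (pr \<mu> a)"
    using grad_closure_cauchy by auto
qed

lemma proj_tclass:
  assumes a: "l2.cauchy_in \<mu> a"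
  shows "proj M \<mu> (tclass_of M \<mu> a) = tclass_of M \<mu> (pr \<mu> a)"
  unfolding proj_def
proof (rule the_equality)
  have eq: "G_der M \<mu> (tc_diff M \<mu> (tclass_of M \<mu> a) (tclass_of M \<mu> b)) (tclass_of M \<mu> c) = l2.lim_inner \<mu> (a - b) c"
    if "l2.cauchy_in \<mu> b" "l2.cauchy_in \<mu> c" for b c
    using that a by (simp add: tc_diff_tclass G_der_tclass l2.cauchy_in_diff)
  show "tclass_of M \<mu> (pr \<mu> a) \<in> tangent_grad M \<mu> \<and>
      (\<forall>C\<in>tangent_grad M \<mu>. G_der M \<mu> (tc_diff M \<mu> (tclass_of M \<mu> a) (tclass_of M \<mu> (pr \<mu> a))) C = 0)"
    using pr[OF a] grad_closure_cauchy by (auto simp: tangent_grad_eq eq)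
  fix B assume B: "B \<in> tangent_grad M \<mu> \<and> (\<forall>C\<in>tangent_grad M \<mu>. G_der M \<mu> (tc_diff M \<mu> (tclass_of M \<mu> a) B) C = 0)"
  then obtain b where b: "b \<in> grad_closure \<mu>" "B = tclass_of M \<mu> b" by (auto simp: tangent_grad_eq)
  have "l2.lim_inner \<mu> (a - b) w = 0" if "w \<in> grad_closure \<mu>" for w
    using B b that eq grad_closure_cauchy by (auto simp: tangent_grad_eq)
  then have "hb.nrm \<mu> (b - pr \<mu> a) = 0"
    using hb.projection_unique[OF subspace_grad_seqs grad_seqs_subset _ b(1) pr(1)[OF a]] pr(2)[OF a] a by blast
  then show "B = tclass_of M \<mu> (pr \<mu> a)"
    using b grad_closure_cauchy pr(3)[OF a] by (simp add: tclass_of_eq_iff)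
qed

subsection \<open>Cylinder functions and fields\<close>

lemma dirac_mixture_exists:
  assumes t: "0 \<le> t" "t \<le> 1"
  shows "\<exists>\<nu>. \<forall>f\<in>smooth_functions M. star f \<nu> = star f \<mu> + t * (f y - star f \<mu>)"
proof -
  obtain \<delta> :: "'m borel_prob" where \<delta>: "\<And>f. f \<in> borel_measurable borel \<Longrightarrow> star f \<delta> = f y"
    using dirac_exists by blast
  obtain \<nu> where \<nu>: "\<And>f K. f \<in> borel_measurable borel \<Longrightarrow> (\<And>x. \<bar>f x\<bar> \<le> K) \<Longrightarrow> star f \<nu> = (1 - t) * star f \<mu> + t * star f \<delta>"
    using mixture_exists[OF t, of \<mu> \<delta>] by blast
  have "star f \<nu> = star f \<mu> + t * (f y - star f \<mu>)" if f: "f \<in> smooth_functions M" for f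
  proof -
    obtain K where "\<And>x. \<bar>f x\<bar> \<le> K" using smooth_functions_bounded[OF f] by blast
    from \<nu>[OF smooth_functions_measurable[OF f] this] \<delta>[OF smooth_functions_measurable[OF f]]
    show ?thesis by (simp add: algebra_simps)
  qed
  then show ?thesis by blast
qed

text \<open>Differentiating \<open>u\<close> along \<open>(1 - t) \<mu> + t \<delta>\<^sub>y\<close> determines \<open>\<Sum>i. \<partial>\<^sub>iF f\<^sub>i\<close> as a function of \<open>y\<close> up to a
  constant, which tangent vectors do not see.\<close>

lemma represents_unique:
  assumes F: "represents M k F f u" and G: "represents M l G h u" and v: "v \<in> tangent_space M x"
  shows "(\<Sum>i<k. partial i F (\<lambda>j. star (f j) \<mu>) * v (f i)) = (\<Sum>i<l. partial i G (\<lambda>j. star (h j) \<mu>) * v (h i))"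
proof -
  have f: "f i \<in> smooth_functions M" and h: "h i \<in> smooth_functions M" for i
    using F G by (auto simp: represents_def)
  let ?a = "\<lambda>j. star (f j) \<mu>" and ?b = "\<lambda>j. star (h j) \<mu>"
  have eq: "(\<Sum>i<k. partial i F ?a * (f i y - ?a i)) = (\<Sum>i<l. partial i G ?b * (h i y - ?b i))" for y
  proof (rule real_derivative_unique_right)
    show "((\<lambda>t. F (\<lambda>i. ?a i + t * (f i y - ?a i))) has_real_derivative (\<Sum>i<k. partial i F ?a * (f i y - ?a i))) (at 0)"
      using F by (intro smooth_coords_line_DERIV) (simp add: represents_def)
    show "((\<lambda>t. G (\<lambda>i. ?b i + t * (h i y - ?b i))) has_real_derivative (\<Sum>i<l. partial i G ?b * (h i y - ?b i))) (at 0)"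
      using G by (intro smooth_coords_line_DERIV) (simp add: represents_def)
    fix t :: real assume t: "0 \<le> t" "t \<le> 1"
    obtain \<nu> where \<nu>: "\<And>f. f \<in> smooth_functions M \<Longrightarrow> star f \<nu> = star f \<mu> + t * (f y - star f \<mu>)"
      using dirac_mixture_exists[OF t] by blast
    have "u \<nu> = F (\<lambda>i. ?a i + t * (f i y - ?a i))" using F \<nu>[OF f] by (simp add: represents_def)
    moreover have "u \<nu> = G (\<lambda>i. ?b i + t * (h i y - ?b i))" using G \<nu>[OF h] by (simp add: represents_def)
    ultimately show "F (\<lambda>i. ?a i + t * (f i y - ?a i)) = G (\<lambda>i. ?b i + t * (h i y - ?b i))" by simp
  qed
  have D: "v (\<lambda>y. \<Sum>i<n. c i * (e i y - d i)) = (\<Sum>i<n. c i * v (e i))"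
    if e: "\<And>i. e i \<in> smooth_functions M" for e :: "nat \<Rightarrow> 'm \<Rightarrow> real" and c d :: "nat \<Rightarrow> real" and n
  proof -
    have s: "(\<lambda>y. e i y - d i) \<in> smooth_functions M" for i by (intro smooth_diff e smooth_const)
    have "v (\<lambda>y. \<Sum>i<n. c i * (e i y - d i)) = (\<Sum>i<n. v (\<lambda>y. c i * (e i y - d i)))"
      by (rule tangent_sum[OF v]) (rule smooth_cmult[OF s])
    also have "\<dots> = (\<Sum>i<n. c i * v (e i))"
      using tangent_cmult[OF v s] tangent_diff[OF v e smooth_const] tangent_const[OF v] by simp
    finally show ?thesis .
  qed
  show ?thesis unfolding D[where e = f and d = ?a, OF f, symmetric] D[where e = h and d = ?b, OF h, symmetric] eq ..
qed

lemma differential_eq: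
  assumes F: "represents M k F f u" and v: "v \<in> tangent_space M x"
  shows "differential M u \<mu> x v = (\<Sum>i<k. partial i F (\<lambda>j. star (f j) \<mu>) * v (f i))"
  unfolding differential_def
proof (rule the_equality)
  fix r assume "\<exists>k F f. represents M k F f u \<and> r = (\<Sum>i<k. partial i F (\<lambda>j. star (f j) \<mu>) * v (f i))"
  then show "r = (\<Sum>i<k. partial i F (\<lambda>j. star (f j) \<mu>) * v (f i))"
    using represents_unique[OF _ F v] by blast
qed (use F in blast)

lemma action_at_eq:
  assumes F: "represents M k F f u" and w: "w \<in> vector_fields M"
  shows "action_at M \<mu> w u = (\<Sum>i<k. partial i F (\<lambda>j. star (f j) \<mu>) * star (\<lambda>x. w x (f i)) \<mu>)"
proof -
  have f: "f i \<in> smooth_functions M" for i using F by (simp add: represents_def)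
  have "action_at M \<mu> w u = star (\<lambda>x. \<Sum>i<k. partial i F (\<lambda>j. star (f j) \<mu>) * w x (f i)) \<mu>"
    unfolding action_at_def differential_eq[OF F vector_field_tangent[OF w]] star_def ..
  also have "\<dots> = (\<Sum>i<k. star (\<lambda>x. partial i F (\<lambda>j. star (f j) \<mu>) * w x (f i)) \<mu>)"
    by (rule star_sum) (rule smooth_cmult[OF vector_field_smooth[OF w f]])
  finally show ?thesis by (simp add: star_cmult)
qed

section \<open>The algebra of cylinder functions\<close>

lemma cyl_functionsI: "represents M k F f u \<Longrightarrow> u \<in> cyl_functions M"
  by (auto simp: cyl_functions_def)

text \<open>The two lists of functions are concatenated; the first outer function ignores the new
  variables, the second reads its own shifted by k. Sums and products can then be formed over one
  list.\<close>

lemma common_representation: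
  assumes F: "represents M k F f u" and G: "represents M l G h u'"
  shows "\<exists>n F' G' e. represents M n F' e u \<and> represents M n G' e u'"
proof (intro exI conjI)
  let ?e = "\<lambda>i. if i < k then f i else h (i - k)"
  have "F (\<lambda>i. star (f i) \<mu>) = F (\<lambda>i. star (?e i) \<mu>)" for \<mu>
    by (rule depends_belowD[of k]) (use F in \<open>auto simp: represents_def smooth_coords_iff\<close>)
  then show "represents M (k + l) F ?e u"
    using F G by (simp add: represents_def smooth_coords_weaken)
  show "represents M (k + l) (\<lambda>x. G (\<lambda>i. x (i + k))) ?e u'"
    using F G by (simp add: represents_def smooth_coords_shift)
qed

lemma cyl_const: "represents M 0 (\<lambda>x. c) (\<lambda>i x. 0) (\<lambda>\<mu>. c)"
  by (simp add: represents_def smooth_coords_const)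

lemma cyl_star: "f \<in> smooth_functions M \<Longrightarrow> represents M 1 (\<lambda>x. x 0) (\<lambda>i. f) (star f)"
  by (auto simp: represents_def smooth_coords_coordinate)

lemma cyl_functions_const [simp, intro]: "(\<lambda>\<mu>. c) \<in> cyl_functions M"
  by (rule cyl_functionsI[OF cyl_const])

lemma cyl_functions_star [intro]: "f \<in> smooth_functions M \<Longrightarrow> star f \<in> cyl_functions M"
  by (rule cyl_functionsI[OF cyl_star])

lemma action_at_const: "w \<in> vector_fields M \<Longrightarrow> action_at M \<mu> w (\<lambda>\<mu>. c) = 0"
  by (simp add: action_at_eq[OF cyl_const])

lemma action_at_star:
  assumes "w \<in> vector_fields M" "f \<in> smooth_functions M"
  shows "action_at M \<mu> w (star f) = star (\<lambda>x. w x f) \<mu>"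
  unfolding action_at_eq[OF cyl_star[OF assms(2)] assms(1)] by (simp add: partial_coordinate)

lemma cyl_functions_add_action:
  assumes "u \<in> cyl_functions M" "u' \<in> cyl_functions M"
  shows "(\<lambda>\<mu>. u \<mu> + u' \<mu>) \<in> cyl_functions M"
    and "w \<in> vector_fields M \<Longrightarrow> action_at M \<mu> w (\<lambda>\<mu>. u \<mu> + u' \<mu>) = action_at M \<mu> w u + action_at M \<mu> w u'"
proof -
  obtain n F G e where F: "represents M n F e u" and G: "represents M n G e u'"
    using assms common_representation unfolding cyl_functions_def by blast
  then have FG: "represents M n (\<lambda>x. F x + G x) e (\<lambda>\<mu>. u \<mu> + u' \<mu>)"
    by (simp add: represents_def smooth_coords_add)
  then show "(\<lambda>\<mu>. u \<mu> + u' \<mu>) \<in> cyl_functions M" by (rule cyl_functionsI)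
  assume w: "w \<in> vector_fields M"
  have "F \<in> smooth_coords n" "G \<in> smooth_coords n" using F G by (auto simp: represents_def)
  then show "action_at M \<mu> w (\<lambda>\<mu>. u \<mu> + u' \<mu>) = action_at M \<mu> w u + action_at M \<mu> w u'"
    unfolding action_at_eq[OF F w] action_at_eq[OF G w] action_at_eq[OF FG w]
    by (simp add: partial_add[of F n G] distrib_right sum.distrib)
qed

lemma cyl_functions_mult_action:
  assumes "u \<in> cyl_functions M" "u' \<in> cyl_functions M"
  shows "(\<lambda>\<mu>. u \<mu> * u' \<mu>) \<in> cyl_functions M"
    and "w \<in> vector_fields M \<Longrightarrow> action_at M \<mu> w (\<lambda>\<mu>. u \<mu> * u' \<mu>) = action_at M \<mu> w u * u' \<mu> + u \<mu> * action_at M \<mu> w u'"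
proof -
  obtain n F G e where F: "represents M n F e u" and G: "represents M n G e u'"
    using assms common_representation unfolding cyl_functions_def by blast
  then have FG: "represents M n (\<lambda>x. F x * G x) e (\<lambda>\<mu>. u \<mu> * u' \<mu>)"
    by (simp add: represents_def smooth_coords_mult)
  then show "(\<lambda>\<mu>. u \<mu> * u' \<mu>) \<in> cyl_functions M" by (rule cyl_functionsI)
  assume w: "w \<in> vector_fields M"
  have FG': "F \<in> smooth_coords n" "G \<in> smooth_coords n" "u \<mu> = F (\<lambda>j. star (e j) \<mu>)" "u' \<mu> = G (\<lambda>j. star (e j) \<mu>)"
    using F G by (auto simp: represents_def)
  show "action_at M \<mu> w (\<lambda>\<mu>. u \<mu> * u' \<mu>) = action_at M \<mu> w u * u' \<mu> + u \<mu> * action_at M \<mu> w u'"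
    unfolding action_at_eq[OF F w] action_at_eq[OF G w] action_at_eq[OF FG w] partial_mult[OF FG'(1,2)] FG'(3,4)
    by (simp add: algebra_simps sum.distrib sum_distrib_left)
qed

lemmas cyl_functions_add [intro] = cyl_functions_add_action(1)
lemmas action_at_cyl_add = cyl_functions_add_action(2)
lemmas cyl_functions_mult [intro] = cyl_functions_mult_action(1)
lemmas action_at_cyl_mult = cyl_functions_mult_action(2)

lemma cyl_functions_sum:
  "(\<And>i. i \<in> I \<Longrightarrow> u i \<in> cyl_functions M) \<Longrightarrow> (\<lambda>\<mu>. \<Sum>i\<in>I. u i \<mu>) \<in> cyl_functions M"
  by (induction I rule: infinite_finite_induct) (auto intro: cyl_functions_add)

lemma action_at_cyl_sum:
  "w \<in> vector_fields M \<Longrightarrow> (\<And>i. i \<in> I \<Longrightarrow> u i \<in> cyl_functions M) \<Longrightarrow>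
    action_at M \<mu> w (\<lambda>\<mu>. \<Sum>i\<in>I. u i \<mu>) = (\<Sum>i\<in>I. action_at M \<mu> w (u i))"
  by (induction I rule: infinite_finite_induct)
    (auto simp: action_at_const action_at_cyl_add cyl_functions_sum)

lemma action_at_cyl_cmult:
  "w \<in> vector_fields M \<Longrightarrow> u \<in> cyl_functions M \<Longrightarrow> action_at M \<mu> w (\<lambda>\<mu>. u \<mu> * c) = action_at M \<mu> w u * c"
  by (simp add: action_at_cyl_mult action_at_const)

lemma action_at_sum_field:
  assumes u: "u \<in> cyl_functions M" and w: "\<And>i. i \<in> I \<Longrightarrow> w i \<in> vector_fields M"
  shows "action_at M \<mu> (\<Sum>i\<in>I. c i *\<^sub>R w i) u = (\<Sum>i\<in>I. c i * action_at M \<mu> (w i) u)"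
proof -
  obtain k F f where F: "represents M k F f u" using u by (auto simp: cyl_functions_def)
  then have f: "f j \<in> smooth_functions M" for j by (simp add: represents_def)
  have W: "(\<Sum>i\<in>I. c i *\<^sub>R w i) \<in> vector_fields M" by (intro l2.closed_simps w)
  have "star (\<lambda>x. (\<Sum>i\<in>I. c i *\<^sub>R w i) x (f j)) \<mu> = (\<Sum>i\<in>I. c i * star (\<lambda>x. w i x (f j)) \<mu>)" for j
  proof -
    have "star (\<lambda>x. (\<Sum>i\<in>I. c i *\<^sub>R w i) x (f j)) \<mu> = star (\<lambda>x. \<Sum>i\<in>I. c i * w i x (f j)) \<mu>" by simp
    also have "\<dots> = (\<Sum>i\<in>I. star (\<lambda>x. c i * w i x (f j)) \<mu>)"
      by (rule star_sum) (rule smooth_cmult[OF vector_field_smooth[OF w f]])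
    finally show ?thesis by (simp add: star_cmult)
  qed
  then have "action_at M \<mu> (\<Sum>i\<in>I. c i *\<^sub>R w i) u =
      (\<Sum>j<k. \<Sum>i\<in>I. c i * (partial j F (\<lambda>j. star (f j) \<mu>) * star (\<lambda>x. w i x (f j)) \<mu>))"
    unfolding action_at_eq[OF F W] by (simp add: sum_distrib_left mult_ac)
  also have "\<dots> = (\<Sum>i\<in>I. c i * (\<Sum>j<k. partial j F (\<lambda>j. star (f j) \<mu>) * star (\<lambda>x. w i x (f j)) \<mu>))"
    by (subst sum.swap) (simp add: sum_distrib_left)
  finally show ?thesis using action_at_eq[OF F w] by simp
qed

lemma action_at_field_cyl:
  assumes u: "u \<in> cyl_functions M" and w: "w \<in> vector_fields M"
  shows "(\<lambda>\<mu>. action_at M \<mu> w u) \<in> cyl_functions M"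
proof -
  obtain k F f where F: "represents M k F f u" using u by (auto simp: cyl_functions_def)
  then have f: "f j \<in> smooth_functions M" for j by (simp add: represents_def)
  have "(\<lambda>\<mu>. partial i F (\<lambda>j. star (f j) \<mu>)) \<in> cyl_functions M" if "i < k" for i
    using F that by (intro cyl_functionsI[of k "partial i F" f]) (simp add: represents_def smooth_coords_partial)
  then have "(\<lambda>\<mu>. \<Sum>i<k. partial i F (\<lambda>j. star (f j) \<mu>) * star (\<lambda>x. w x (f i)) \<mu>) \<in> cyl_functions M"
    by (intro cyl_functions_sum cyl_functions_mult cyl_functions_star vector_field_smooth[OF w] f) auto
  then show ?thesis unfolding action_at_eq[OF F w] .
qed

section \<open>Cylinder fields as finite sums\<close>

text \<open>Sums of fields and the connection lead to disjoint unions and products of index sets;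
  any finite index set is enumerated to match \<open>tensor_rep\<close>.\<close>

lemma tensor_repI:
  assumes "finite I" "\<And>i. i \<in> I \<Longrightarrow> u i \<in> cyl_functions M" "\<And>i. i \<in> I \<Longrightarrow> w i \<in> X"
  shows "\<exists>k u' w'. tensor_rep M X k u' w' (\<lambda>\<mu>. \<Sum>i\<in>I. u i \<mu> *\<^sub>R w i)"
proof -
  obtain h where h: "bij_betw h {..<card I} I"
    using ex_bij_betw_nat_finite[OF assms(1)] by (auto simp: atLeast0LessThan)
  then have "h i \<in> I" if "i < card I" for i using that by (auto simp: bij_betw_def)
  moreover have "(\<Sum>i\<in>I. u i \<mu> *\<^sub>R w i) = (\<Sum>i<card I. u (h i) \<mu> *\<^sub>R w (h i))" for \<mu>
    by (rule sum.reindex_bij_betw[OF h, symmetric])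
  ultimately show ?thesis
    using assms(2,3) unfolding tensor_rep_def vf_lincomb_eq
    by (intro exI[of _ "card I"] exI[of _ "\<lambda>i. u (h i)"] exI[of _ "\<lambda>i. w (h i)"]) auto
qed

lemma cyl_fieldsI:
  assumes "finite I" "\<And>i. i \<in> I \<Longrightarrow> u i \<in> cyl_functions M" "\<And>i. i \<in> I \<Longrightarrow> w i \<in> vector_fields M"
  shows "(\<lambda>\<mu>. \<Sum>i\<in>I. u i \<mu> *\<^sub>R w i) \<in> cyl_fields M"
  using tensor_repI[OF assms] by (simp add: cyl_fields_def)

lemma cyl_fieldsE:
  assumes "V \<in> cyl_fields M"
  obtains k :: nat and u w where "\<And>i. i < k \<Longrightarrow> u i \<in> cyl_functions M" "\<And>i. i < k \<Longrightarrow> w i \<in> vector_fields M"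
    "V = (\<lambda>\<mu>. \<Sum>i<k. u i \<mu> *\<^sub>R w i)"
  using assms by (auto simp: cyl_fields_def tensor_rep_def vf_lincomb_eq)

lemma cyl_grad_fieldsE:
  assumes "V \<in> cyl_grad_fields M"
  obtains k :: nat and u w where "\<And>i. i < k \<Longrightarrow> u i \<in> cyl_functions M" "\<And>i. i < k \<Longrightarrow> w i \<in> gradient_fields M"
    "V = (\<lambda>\<mu>. \<Sum>i<k. u i \<mu> *\<^sub>R w i)"
  using assms by (auto simp: cyl_grad_fields_def tensor_rep_def vf_lincomb_eq)

lemma cyl_grad_fields_subset: "cyl_grad_fields M \<subseteq> cyl_fields M"
  using gradient_fields_subset unfolding cyl_grad_fields_def cyl_fields_def tensor_rep_def by blast

lemma cyl_fields_mem: "V \<in> cyl_fields M \<Longrightarrow> V \<mu> \<in> vector_fields M"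
  by (elim cyl_fieldsE) (auto intro!: l2.closed_simps)

lemma cyl_grad_fields_mem: "V \<in> cyl_grad_fields M \<Longrightarrow> V \<mu> \<in> gradient_fields M"
  by (elim cyl_grad_fieldsE)
    (auto intro!: subspace_sum[OF subspace_gradient_fields] subspace_scale[OF subspace_gradient_fields])

lemma cyl_grad_fields_const: "w \<in> gradient_fields M \<Longrightarrow> (\<lambda>\<mu>. w) \<in> cyl_grad_fields M"
  using tensor_repI[of "{()}" "\<lambda>i \<mu>. 1" "\<lambda>i. w" "gradient_fields M"] by (simp add: cyl_grad_fields_def)

lemma cyl_fields_add:
  assumes "V \<in> cyl_fields M" "Z \<in> cyl_fields M"
  shows "(\<lambda>\<mu>. V \<mu> + Z \<mu>) \<in> cyl_fields M"
proof -
  obtain k :: nat and u w where V: "\<And>i. i < k \<Longrightarrow> u i \<in> cyl_functions M" "\<And>i. i < k \<Longrightarrow> w i \<in> vector_fields M"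
    "V = (\<lambda>\<mu>. \<Sum>i<k. u i \<mu> *\<^sub>R w i)" by (rule cyl_fieldsE[OF assms(1)]) blast
  obtain l :: nat and v z where Z: "\<And>i. i < l \<Longrightarrow> v i \<in> cyl_functions M" "\<And>i. i < l \<Longrightarrow> z i \<in> vector_fields M"
    "Z = (\<lambda>\<mu>. \<Sum>i<l. v i \<mu> *\<^sub>R z i)" by (rule cyl_fieldsE[OF assms(2)]) blast
  let ?u = "case_sum u v" and ?w = "case_sum w z"
  have "(\<lambda>\<mu>. \<Sum>i\<in>{..<k} <+> {..<l}. ?u i \<mu> *\<^sub>R ?w i) \<in> cyl_fields M"
    by (rule cyl_fieldsI) (use V Z in auto)
  then show ?thesis by (simp add: V(3) Z(3) sum.Plus)
qed

lemma cyl_fields_scale: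
  assumes "V \<in> cyl_fields M"
  shows "(\<lambda>\<mu>. c *\<^sub>R V \<mu>) \<in> cyl_fields M"
proof -
  obtain k :: nat and u w where V: "\<And>i. i < k \<Longrightarrow> u i \<in> cyl_functions M" "\<And>i. i < k \<Longrightarrow> w i \<in> vector_fields M"
    "V = (\<lambda>\<mu>. \<Sum>i<k. u i \<mu> *\<^sub>R w i)" by (rule cyl_fieldsE[OF assms(1)]) blast
  have "(\<lambda>\<mu>. \<Sum>i<k. (\<lambda>\<mu>. c * u i \<mu>) \<mu> *\<^sub>R w i) \<in> cyl_fields M"
    by (rule cyl_fieldsI) (use V in auto)
  then show ?thesis by (simp add: V(3) scaleR_sum_right)
qed

lemma cyl_fields_diff:
  assumes "V \<in> cyl_fields M" "Z \<in> cyl_fields M"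
  shows "(\<lambda>\<mu>. V \<mu> - Z \<mu>) \<in> cyl_fields M"
  using cyl_fields_add[OF assms(1) cyl_fields_scale[OF assms(2), of "-1"]] by simp

lemma action_cyl:
  assumes "V \<in> cyl_fields M" "u \<in> cyl_functions M"
  shows "action M V u \<in> cyl_functions M"
proof -
  obtain k :: nat and v w where V: "\<And>i. i < k \<Longrightarrow> v i \<in> cyl_functions M" "\<And>i. i < k \<Longrightarrow> w i \<in> vector_fields M"
    "V = (\<lambda>\<mu>. \<Sum>i<k. v i \<mu> *\<^sub>R w i)" by (rule cyl_fieldsE[OF assms(1)]) blast
  have "(\<lambda>\<mu>. \<Sum>i<k. v i \<mu> * action_at M \<mu> (w i) u) \<in> cyl_functions M"
    by (rule cyl_functions_sum) (use V action_at_field_cyl[OF assms(2)] in auto)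
  moreover have "action M V u \<mu> = (\<Sum>i<k. v i \<mu> * action_at M \<mu> (w i) u)" for \<mu>
    unfolding action_def V(3) by (rule action_at_sum_field[OF assms(2)]) (use V in auto)
  ultimately show ?thesis by presburger
qed

text \<open>At fixed x and f, all representations of \<open>Z\<close> express the same cylinder
  function \<nu> \<mapsto> Z \<nu> x f, and its derivative in direction w is the x, f component of
  the corresponding sum.\<close>

lemma nabla_int_at_eq:
  fixes k :: nat
  assumes u: "\<And>i. i < k \<Longrightarrow> u i \<in> cyl_functions M" and z: "\<And>i. i < k \<Longrightarrow> z i \<in> vector_fields M"
    and Z: "Z = (\<lambda>\<mu>. \<Sum>i<k. u i \<mu> *\<^sub>R z i)" and w: "w \<in> vector_fields M"
  shows "nabla_int_at M \<mu> w Z = (\<Sum>i<k. action_at M \<mu> w (u i) *\<^sub>R z i)"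
  unfolding nabla_int_at_def
proof (rule the_equality)
  show "\<exists>k' u' z'. tensor_rep M (vector_fields M) k' u' z' Z \<and>
      (\<Sum>i<k. action_at M \<mu> w (u i) *\<^sub>R z i) = vf_lincomb k' (\<lambda>i. action_at M \<mu> w (u' i)) z'"
    using u z Z by (intro exI[of _ k] exI[of _ u] exI[of _ z]) (simp add: tensor_rep_def vf_lincomb_eq)
  fix y assume "\<exists>k' u' z'. tensor_rep M (vector_fields M) k' u' z' Z \<and> y = vf_lincomb k' (\<lambda>i. action_at M \<mu> w (u' i)) z'"
  then obtain l :: nat and u' z' where *: "\<And>i. i < l \<Longrightarrow> u' i \<in> cyl_functions M"
    "Z = (\<lambda>\<mu>. \<Sum>i<l. u' i \<mu> *\<^sub>R z' i)" "y = (\<Sum>i<l. action_at M \<mu> w (u' i) *\<^sub>R z' i)"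
    by (auto simp: tensor_rep_def vf_lincomb_eq)
  have act: "(\<Sum>i<n. action_at M \<mu> w (v i) * c i) = action_at M \<mu> w (\<lambda>\<nu>. \<Sum>i<n. v i \<nu> * c i)"
    if "\<And>i. i < n \<Longrightarrow> v i \<in> cyl_functions M" for n v and c :: "nat \<Rightarrow> real"
    using that by (subst action_at_cyl_sum[OF w]) (auto simp: action_at_cyl_cmult[OF w])
  have "Z \<nu> x f = (\<Sum>i<k. u i \<nu> * z i x f)" "Z \<nu> x f = (\<Sum>i<l. u' i \<nu> * z' i x f)" for \<nu> x f
    by (simp add: Z) (simp add: *(2))
  then have "(\<lambda>\<nu>. \<Sum>i<k. u i \<nu> * z i x f) = (\<lambda>\<nu>. \<Sum>i<l. u' i \<nu> * z' i x f)" for x f by metis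
  then have "y x f = (\<Sum>i<k. action_at M \<mu> w (u i) *\<^sub>R z i) x f" for x f
    using act[of k u "\<lambda>i. z i x f"] act[of l u' "\<lambda>i. z' i x f"] u *(1) by (simp add: *(3))
  then show "y = (\<Sum>i<k. action_at M \<mu> w (u i) *\<^sub>R z i)" by (intro ext)
qed

text \<open>The gradient of u at \<mu> combines the gradients of the \<open>f i\<close>, with the
  partial derivatives of F as coefficients. This gives both the boundedness of the action in its
  direction and its vanishing on directions orthogonal to gradients.\<close>

lemma action_at_gradient:
  assumes u: "u \<in> cyl_functions M"
  shows "\<exists>G\<in>gradient_fields M. \<forall>w\<in>vector_fields M. action_at M \<mu> w u = l2_inner M \<mu> G w"
proof -
  obtain k F f where F: "represents M k F f u" using u by (auto simp: cyl_functions_def)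
  then have f: "f j \<in> smooth_functions M" for j by (simp add: represents_def)
  have "\<exists>G. G \<in> gradient_fields M \<and> (\<forall>x. \<forall>v\<in>tangent_space M x. metric M x (G x) v = v (f i))" for i
    by (rule gradient_fields_exists[OF f[of i]]) blast
  then obtain G where G: "\<And>i. G i \<in> gradient_fields M" "\<And>i x v. v \<in> tangent_space M x \<Longrightarrow> metric M x (G i x) v = v (f i)"
    by metis
  have GX: "G i \<in> vector_fields M" for i using G(1) gradient_fields_subset by blast
  let ?G = "\<Sum>i<k. partial i F (\<lambda>j. star (f j) \<mu>) *\<^sub>R G i"
  have "action_at M \<mu> w u = l2_inner M \<mu> ?G w" if w: "w \<in> vector_fields M" for w
  proof -
    have "star (\<lambda>x. w x (f i)) \<mu> = l2_inner M \<mu> (G i) w" for i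
      using G(2)[OF vector_field_tangent[OF w]] by (simp add: l2_inner_star)
    then show ?thesis
      by (simp add: action_at_eq[OF F w] l2.sum_left l2.scale_left l2.closed_simps GX w)
  qed
  moreover have "?G \<in> gradient_fields M"
    by (intro subspace_sum[OF subspace_gradient_fields] subspace_scale[OF subspace_gradient_fields] G)
  ultimately show ?thesis by blast
qed

section \<open>Separation of cylinder fields by measures\<close>

text \<open>Push \<mu> forward by the map that collapses \<open>N n\<close> to x, then mix in a
  Dirac mass at x. A function h that vanishes off \<open>N n\<close> has integral h x times the mass
  at x, while both modifications disappear in the limit as \<open>N n\<close> shrinks.\<close>

lemma concentrating_measures:
  fixes x :: 'm
  shows "\<exists>N \<nu>. (\<forall>n. open (N n)) \<and> (\<forall>n::nat. x \<in> N n) \<and>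
    (\<forall>n. \<forall>h\<in>smooth_functions M. (\<forall>y. y \<notin> N n \<longrightarrow> h y = 0) \<longrightarrow> star h (\<nu> n) = 0 \<longrightarrow> h x = 0) \<and>
    (\<forall>h\<in>smooth_functions M. (\<lambda>n. star h (\<nu> n)) \<longlonglongrightarrow> star h \<mu>)"
proof -
  interpret prob_space "law \<mu>" by (rule prob_space_law)
  obtain N where N: "\<And>n. open (N n)" "\<And>n. x \<in> N n" "\<And>S. open S \<Longrightarrow> x \<in> S \<Longrightarrow> \<forall>\<^sub>F n in sequentially. N n \<subseteq> S"
    using countable_basis_at_decseq[of x] by metis
  \<comment> \<open>The weight of the Dirac mass tends to 0 but is positive for every n, so x
    carries mass even if \<mu> gives none to \<open>N n\<close>.\<close>
  define t where "t n = inverse (real (Suc n))" for n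
  have t: "0 < t n" "t n \<le> 1" for n by (auto simp: t_def field_simps)
  define s where "s n y = (if y \<in> N n then x else y)" for n y
  have s: "s n \<in> measurable borel borel" for n
    unfolding s_def using N(1) by (intro measurable_If) auto
  have "\<exists>\<nu>::'m borel_prob. \<forall>h\<in>smooth_functions M. star h \<nu> = (1 - t n) * star (\<lambda>y. h (s n y)) \<mu> + t n * h x" for n
  proof -
    obtain \<delta> :: "'m borel_prob" where \<delta>: "\<And>f. f \<in> borel_measurable borel \<Longrightarrow> star f \<delta> = f x"
      using dirac_exists by blast
    obtain \<rho> :: "'m borel_prob" where \<rho>: "\<And>f. f \<in> borel_measurable borel \<Longrightarrow> star f \<rho> = star (\<lambda>y. f (s n y)) \<mu>"
      using push_exists[OF s] by blast
    obtain \<nu> :: "'m borel_prob" where \<nu>: "\<And>f K. f \<in> borel_measurable borel \<Longrightarrow> (\<And>x. \<bar>f x\<bar> \<le> K) \<Longrightarrow> star f \<nu> = (1 - t n) * star f \<rho> + t n * star f \<delta>"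
      using mixture_exists[of "t n" \<rho> \<delta>] t[of n] by auto
    have "star h \<nu> = (1 - t n) * star (\<lambda>y. h (s n y)) \<mu> + t n * h x" if h: "h \<in> smooth_functions M" for h
    proof -
      obtain K where "\<And>x. \<bar>h x\<bar> \<le> K" using smooth_functions_bounded[OF h] by blast
      from \<nu>[OF smooth_functions_measurable[OF h] this] show ?thesis
        using \<delta>[OF smooth_functions_measurable[OF h]] \<rho>[OF smooth_functions_measurable[OF h]] by simp
    qed
    then show ?thesis by blast
  qed
  then obtain \<nu> :: "nat \<Rightarrow> 'm borel_prob" where \<nu>: "\<And>n h. h \<in> smooth_functions M \<Longrightarrow>
      star h (\<nu> n) = (1 - t n) * star (\<lambda>y. h (s n y)) \<mu> + t n * h x" by metis
  have 1: "h x = 0" if h: "h \<in> smooth_functions M" "\<And>y. y \<notin> N n \<Longrightarrow> h y = 0" "star h (\<nu> n) = 0" for n h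
  proof -
    have "h (s n y) = h x * indicator (N n) y" for y using h(2) by (simp add: s_def)
    then have "star (\<lambda>y. h (s n y)) \<mu> = h x * measure (law \<mu>) (N n)" by (simp add: star_def)
    then have "h x * ((1 - t n) * measure (law \<mu>) (N n) + t n) = 0"
      using \<nu>[OF h(1), of n] h(3) by (simp add: algebra_simps)
    moreover have "(1 - t n) * measure (law \<mu>) (N n) + t n > 0" using t[of n] by (intro add_nonneg_pos) auto
    ultimately show ?thesis by simp
  qed
  have 2: "(\<lambda>n. star h (\<nu> n)) \<longlonglongrightarrow> star h \<mu>" if h: "h \<in> smooth_functions M" for h
  proof -
    obtain K where K: "\<And>y. \<bar>h y\<bar> \<le> K" using smooth_functions_bounded[OF h] by blast
    have "(\<lambda>n. star (\<lambda>y. h (s n y)) \<mu>) \<longlonglongrightarrow> star h \<mu>"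
      unfolding star_def
    proof (rule integral_dominated_convergence[where w = "\<lambda>y. K"])
      show "h \<in> borel_measurable (law \<mu>)" using smooth_functions_measurable[OF h] by simp
      show "(\<lambda>y. h (s n y)) \<in> borel_measurable (law \<mu>)" for n
        using measurable_compose[OF s smooth_functions_measurable[OF h]] by simp
      \<comment> \<open>A point y other than x eventually leaves \<open>N n\<close>, the complement
        of y being an open neighbourhood of x; the point x is fixed by every collapse.\<close>
      show "AE y in law \<mu>. (\<lambda>n. h (s n y)) \<longlonglongrightarrow> h y"
      proof (rule AE_I2)
        fix y
        show "(\<lambda>n. h (s n y)) \<longlonglongrightarrow> h y"
        proof (cases "y = x")
          case True
          then show ?thesis using N(2) by (simp add: s_def)
        next
          case False
          then have "open (- {y})" "x \<in> - {y}" by auto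
          then have "\<forall>\<^sub>F n in sequentially. N n \<subseteq> - {y}" by (rule N(3))
          then have "\<forall>\<^sub>F n in sequentially. h (s n y) = h y" by (rule eventually_mono) (auto simp: s_def)
          then show ?thesis by (rule tendsto_eventually)
        qed
      qed
    qed (auto simp: K)
    moreover have "t \<longlonglongrightarrow> 0" unfolding t_def by (rule LIMSEQ_inverse_real_of_nat)
    ultimately have "(\<lambda>n. (1 - t n) * star (\<lambda>y. h (s n y)) \<mu> + t n * h x) \<longlonglongrightarrow> (1 - 0) * star h \<mu> + 0 * h x"
      by (intro tendsto_intros)
    then show ?thesis using \<nu>[OF h] by simp
  qed
  show ?thesis using N(1,2) 1 2 by (intro exI[of _ N] exI[of _ \<nu>] conjI allI ballI impI) blast+
qed

text \<open>Convergence of the integrals of smooth functions is convergence of the arguments of F in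
  the product topology, for which F is continuous.\<close>

lemma cyl_functions_tendsto:
  assumes u: "u \<in> cyl_functions M" and lim: "\<And>h. h \<in> smooth_functions M \<Longrightarrow> (\<lambda>n. star h (\<nu> n)) \<longlonglongrightarrow> star h \<mu>"
  shows "(\<lambda>n. u (\<nu> n)) \<longlonglongrightarrow> u \<mu>"
proof -
  obtain k F f where F: "represents M k F f u" using u by (auto simp: cyl_functions_def)
  then have f: "f j \<in> smooth_functions M" and S: "F \<in> smooth_coords k" and ueq: "u = (\<lambda>\<mu>. F (\<lambda>i. star (f i) \<mu>))" for j
    by (auto simp: represents_def)
  have "(\<lambda>n i. star (f i) (\<nu> n)) \<longlonglongrightarrow> (\<lambda>i. star (f i) \<mu>)"
    by (rule tendsto_fun_componentwise) (rule lim[OF f])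
  then show ?thesis
    unfolding ueq by (intro continuous_on_tendsto_compose[OF smooth_coords_continuous[OF S]]) auto
qed

text \<open>Testing with \<open>f \<eta>\<^sup>2\<close> for a bump function \<open>\<eta>\<close> at \<open>x\<close> isolates the value at \<open>x\<close> for measures that
  have a neighbourhood of \<open>x\<close> collapsed to \<open>x\<close>; these approximate \<open>\<mu>\<close>.\<close>

lemma cyl_field_eq_zero:
  assumes W: "W \<in> cyl_fields M" and zero: "\<And>\<nu> f. f \<in> smooth_functions M \<Longrightarrow> star (\<lambda>x. W \<nu> x f) \<nu> = 0"
  shows "W \<mu> = 0"
proof (intro ext)
  fix x f
  show "W \<mu> x f = 0 x f"
  proof (cases "f \<in> smooth_functions M")
    case False
    then show ?thesis using tangent_nonsmooth[OF vector_field_tangent[OF cyl_fields_mem[OF W]]] by simp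
  next
    case f: True
    obtain N \<nu> where N: "\<And>n. open (N n)" "\<And>n. x \<in> N n"
      "\<And>n h. h \<in> smooth_functions M \<Longrightarrow> (\<And>y. y \<notin> N n \<Longrightarrow> h y = 0) \<Longrightarrow> star h (\<nu> n) = 0 \<Longrightarrow> h x = 0"
      "\<And>h. h \<in> smooth_functions M \<Longrightarrow> (\<lambda>n. star h (\<nu> n)) \<longlonglongrightarrow> star h \<mu>"
      using concentrating_measures[of x \<mu>] by blast
    have "W (\<nu> n) x f = 0" for n
    proof -
      obtain \<eta> U where \<eta>: "\<eta> \<in> smooth_functions M" "open U" "x \<in> U" "\<And>y. y \<in> U \<Longrightarrow> \<eta> y = 1" "\<And>y. y \<notin> N n \<Longrightarrow> \<eta> y = 0"
        using manifold_bump[OF N(1,2)] by metis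
      \<comment> \<open>Off \<open>N n\<close> only the value of \<eta> is known to vanish, not its
        derivative; with two factors of \<eta> the Leibniz rule gives zero there all the
        same.\<close>
      let ?h = "\<lambda>y. f y * \<eta> y * \<eta> y"
      have fe: "(\<lambda>y. f y * \<eta> y) \<in> smooth_functions M" by (rule smooth_mult[OF f \<eta>(1)])
      have h: "?h \<in> smooth_functions M" by (rule smooth_mult[OF fe \<eta>(1)])
      have WX: "W (\<nu> n) \<in> vector_fields M" by (rule cyl_fields_mem[OF W])
      have "W (\<nu> n) x ?h = 0"
      proof (rule N(3)[OF vector_field_smooth[OF WX h]])
        show "star (\<lambda>x. W (\<nu> n) x ?h) (\<nu> n) = 0" by (rule zero[OF h])
        fix y assume "y \<notin> N n"
        then show "W (\<nu> n) y ?h = 0"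
          using tangent_mult[OF vector_field_tangent[OF WX] fe \<eta>(1), of y] \<eta>(5)[of y] by simp
      qed
      moreover have "W (\<nu> n) x f = W (\<nu> n) x ?h"
        by (rule tangent_local[OF vector_field_tangent[OF WX] \<eta>(2,3) f h]) (simp add: \<eta>(4))
      ultimately show ?thesis by simp
    qed
    \<comment> \<open>The coefficients of \<open>W\<close> are cylinder functions, so the vanishing
      along the approximating measures passes to \<mu>.\<close>
    moreover have "(\<lambda>n. W (\<nu> n) x f) \<longlonglongrightarrow> W \<mu> x f"
    proof -
      obtain k :: nat and u w where V: "\<And>i. i < k \<Longrightarrow> u i \<in> cyl_functions M" "\<And>i. i < k \<Longrightarrow> w i \<in> vector_fields M" "W = (\<lambda>\<mu>. \<Sum>i<k. u i \<mu> *\<^sub>R w i)"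
        by (rule cyl_fieldsE[OF W]) blast
      have "(\<lambda>n. u i (\<nu> n) * w i x f) \<longlonglongrightarrow> u i \<mu> * w i x f" if "i < k" for i
        by (rule tendsto_mult[OF cyl_functions_tendsto[OF V(1)[OF that]] tendsto_const]) (rule N(4))
      then have "(\<lambda>n. \<Sum>i<k. u i (\<nu> n) * w i x f) \<longlonglongrightarrow> (\<Sum>i<k. u i \<mu> * w i x f)"
        by (intro tendsto_sum) auto
      then show ?thesis by (simp add: V(3))
    qed
    ultimately have "(\<lambda>n. 0) \<longlonglongrightarrow> W \<mu> x f" by simp
    then show ?thesis by (simp add: LIMSEQ_const_iff)
  qed
qed

subsection \<open>The gradient tangent space\<close>

lemma l2_inner_sums:
  assumes "\<And>i. i \<in> I \<Longrightarrow> P i \<in> vector_fields M" "\<And>j. j \<in> J \<Longrightarrow> Q j \<in> vector_fields M"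
  shows "l2_inner M \<mu> (\<Sum>i\<in>I. p i *\<^sub>R P i) (\<Sum>j\<in>J. q j *\<^sub>R Q j) = (\<Sum>i\<in>I. \<Sum>j\<in>J. p i * (q j * l2_inner M \<mu> (P i) (Q j)))"
proof -
  have Q: "(\<Sum>j\<in>J. q j *\<^sub>R Q j) \<in> vector_fields M" by (intro l2.closed_simps assms)
  have "l2_inner M \<mu> (\<Sum>i\<in>I. p i *\<^sub>R P i) (\<Sum>j\<in>J. q j *\<^sub>R Q j) = (\<Sum>i\<in>I. l2_inner M \<mu> (p i *\<^sub>R P i) (\<Sum>j\<in>J. q j *\<^sub>R Q j))"
    by (rule l2.sum_left[OF l2.closed_simps(4)[OF assms(1)] Q])
  also have "\<dots> = (\<Sum>i\<in>I. p i * l2_inner M \<mu> (P i) (\<Sum>j\<in>J. q j *\<^sub>R Q j))"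
    by (intro sum.cong refl l2.scale_left assms Q)
  also have "\<dots> = (\<Sum>i\<in>I. p i * (\<Sum>j\<in>J. q j * l2_inner M \<mu> (P i) (Q j)))"
  proof (intro sum.cong refl arg_cong2[where f = "(*)"])
    fix i assume i: "i \<in> I"
    have "l2_inner M \<mu> (P i) (\<Sum>j\<in>J. q j *\<^sub>R Q j) = (\<Sum>j\<in>J. l2_inner M \<mu> (P i) (q j *\<^sub>R Q j))"
      by (rule l2.sum_right[OF l2.closed_simps(4)[OF assms(2)] assms(1)[OF i]])
    also have "\<dots> = (\<Sum>j\<in>J. q j * l2_inner M \<mu> (P i) (Q j))"
      by (intro sum.cong refl l2.scale_right assms i)
    finally show "l2_inner M \<mu> (P i) (\<Sum>j\<in>J. q j *\<^sub>R Q j) = (\<Sum>j\<in>J. q j * l2_inner M \<mu> (P i) (Q j))" .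
  qed
  finally show ?thesis by (simp only: sum_distrib_left)
qed

abbreviation cseq :: "'m vfield \<Rightarrow> nat \<Rightarrow> 'm vfield" where
  "cseq w \<equiv> \<lambda>n. w"

lemma pr_fixed:
  assumes "b \<in> grad_closure \<mu>"
  shows "hb.nrm \<mu> (b - pr \<mu> b) = 0"
proof (rule hb.projection_unique[OF subspace_grad_seqs grad_seqs_subset _ assms pr(1)])
  show b: "l2.cauchy_in \<mu> b" "b \<in> Collect (l2.cauchy_in \<mu>)" using grad_closure_cauchy[OF assms] by auto
  show "l2.lim_inner \<mu> (b - b) w = 0" if "w \<in> grad_closure \<mu>" for w
    using grad_closure_cauchy[OF that] by simp
  show "l2.lim_inner \<mu> (b - pr \<mu> b) w = 0" if "w \<in> grad_closure \<mu>" for w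
    by (rule pr(2)[OF b(1) that])
qed

lemma lim_inner_pr:
  assumes a: "l2.cauchy_in \<mu> a" and b: "b \<in> grad_closure \<mu>"
  shows "l2.lim_inner \<mu> (pr \<mu> a) b = l2.lim_inner \<mu> a b"
  using pr(2)[OF a b] hb.diff_left[of a \<mu> "pr \<mu> a" b] a pr(3)[OF a] grad_closure_cauchy[OF b] by simp

lemma lim_inner_pythagoras:
  assumes a: "l2.cauchy_in \<mu> a" and b: "l2.cauchy_in \<mu> b"
  shows "l2.lim_inner \<mu> (pr \<mu> a) (pr \<mu> b) + l2.lim_inner \<mu> (a - pr \<mu> a) (b - pr \<mu> b) = l2.lim_inner \<mu> a b"
proof -
  note c = a b pr(3)[OF a] pr(3)[OF b]
  have "l2.lim_inner \<mu> (a - pr \<mu> a) (b - pr \<mu> b) = l2.lim_inner \<mu> (a - pr \<mu> a) b"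
    using pr(2)[OF a pr(1)[OF b]] c by (subst hb.diff_right) (auto simp: l2.cauchy_in_diff)
  also have "\<dots> = l2.lim_inner \<mu> a b - l2.lim_inner \<mu> (pr \<mu> a) b" using c by (simp add: hb.diff_left)
  also have "l2.lim_inner \<mu> (pr \<mu> a) b = l2.lim_inner \<mu> b (pr \<mu> a)" using c hb.sym by simp
  also have "\<dots> = l2.lim_inner \<mu> (pr \<mu> b) (pr \<mu> a)" by (rule lim_inner_pr[OF b pr(1)[OF a], symmetric])
  also have "\<dots> = l2.lim_inner \<mu> (pr \<mu> a) (pr \<mu> b)" using c hb.sym by simp
  finally show ?thesis by linarith
qed

text \<open>An element of the gradient closure is fixed by the projection up to a null sequence, and
  it is orthogonal to what the projection removes from \<open>a\<close>. Every pairing with a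
  gradient-type field thus becomes a plain inner product.\<close>

lemma G_grad_tclass:
  assumes a: "l2.cauchy_in \<mu> a" and b: "b \<in> grad_closure \<mu>"
  shows "G_grad M \<mu> (tclass_of M \<mu> a) (tclass_of M \<mu> b) = l2.lim_inner \<mu> a b"
proof -
  have bc: "l2.cauchy_in \<mu> b" by (rule grad_closure_cauchy[OF b])
  note c = a bc pr(3)[OF a] pr(3)[OF bc]
  have "G_grad M \<mu> (tclass_of M \<mu> a) (tclass_of M \<mu> b) = l2.lim_inner \<mu> (pr \<mu> a) (pr \<mu> b)"
    using c by (simp add: G_grad_def proj_tclass G_der_tclass)
  also have "\<dots> = l2.lim_inner \<mu> (pr \<mu> b) (pr \<mu> a)" using c hb.sym by simp
  also have "\<dots> = l2.lim_inner \<mu> b (pr \<mu> a)"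
    by (rule hb.null_cong[symmetric]) (use c pr_fixed[OF b] in auto)
  also have "\<dots> = l2.lim_inner \<mu> (pr \<mu> a) b" using c hb.sym by simp
  finally show ?thesis using lim_inner_pr[OF a b] by simp
qed

text \<open>The difference lies in the closure and is orthogonal to its generators, hence to itself.
  This is the uniqueness behind \<open>sharp\<close> and \<open>R_grad\<close>.\<close>

lemma tangent_grad_ext:
  assumes s: "s \<in> grad_closure \<mu>" "s' \<in> grad_closure \<mu>"
    and eq: "\<And>w. w \<in> gradient_fields M \<Longrightarrow> l2.lim_inner \<mu> s (cseq w) = l2.lim_inner \<mu> s' (cseq w)"
  shows "tclass_of M \<mu> s = tclass_of M \<mu> s'"
proof -
  note c = grad_closure_cauchy[OF s(1)] grad_closure_cauchy[OF s(2)]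
  have d: "s - s' \<in> grad_closure \<mu>"
    using subspace_diff[OF hb.subspace_clos[OF subspace_grad_seqs grad_seqs_subset]] s by blast
  have "l2.lim_inner \<mu> (s - s') z = 0" if z: "z \<in> grad_seqs" for z
  proof -
    obtain w where w: "w \<in> gradient_fields M" "z = cseq w" using z by (auto simp: grad_seqs_def)
    have zc: "l2.cauchy_in \<mu> z" using grad_seqs_subset z by blast
    have "l2.lim_inner \<mu> (s - s') z = l2.lim_inner \<mu> s z - l2.lim_inner \<mu> s' z"
      by (rule hb.diff_left) (use c zc in auto)
    then show ?thesis using eq[OF w(1)] unfolding w(2) by linarith
  qed
  then have "l2.lim_inner \<mu> (s - s') (s - s') = 0"
    by (intro hb.clos_orthogonal[OF grad_seqs_subset _ _ d]) (use l2.cauchy_in_diff[OF c] in auto)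
  then show ?thesis using c by (simp add: tclass_of_eq_iff hb.nrm_def)
qed

lemma cyl_grad_const_closure: "V \<in> cyl_grad_fields M \<Longrightarrow> cseq (V \<mu>) \<in> grad_closure \<mu>"
  by (rule const_grad_closure[OF cyl_grad_fields_mem])

lemma sharp_eq:
  assumes s: "s \<in> grad_closure \<mu>" and l: "\<And>V. V \<in> cyl_grad_fields M \<Longrightarrow> l2.lim_inner \<mu> s (cseq (V \<mu>)) = l V"
  shows "sharp M \<mu> l = tclass_of M \<mu> s"
  unfolding sharp_def
proof (rule the_equality)
  have G: "G_der M \<mu> (tclass_of M \<mu> s') (emb M \<mu> (V \<mu>)) = l2.lim_inner \<mu> s' (cseq (V \<mu>))"
    if "s' \<in> grad_closure \<mu>" "V \<in> cyl_grad_fields M" for s' V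
    unfolding emb_def by (intro G_der_tclass grad_closure_cauchy cyl_grad_const_closure that)
  show "tclass_of M \<mu> s \<in> tangent_grad M \<mu> \<and> (\<forall>V\<in>cyl_grad_fields M. G_der M \<mu> (tclass_of M \<mu> s) (emb M \<mu> (V \<mu>)) = l V)"
    using s l G by (simp add: tangent_grad_eq)
  fix B assume B: "B \<in> tangent_grad M \<mu> \<and> (\<forall>V\<in>cyl_grad_fields M. G_der M \<mu> B (emb M \<mu> (V \<mu>)) = l V)"
  then obtain s' where s': "s' \<in> grad_closure \<mu>" "B = tclass_of M \<mu> s'" by (auto simp: tangent_grad_eq)
  \<comment> \<open>Each gradient field is the value of a constant cylinder field, so testing with
    cylinder fields reaches all of \<open>gradient_fields\<close>.\<close>
  have "l2.lim_inner \<mu> s' (cseq w) = l2.lim_inner \<mu> s (cseq w)" if "w \<in> gradient_fields M" for w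
    using B s' l[OF cyl_grad_fields_const[OF that]] G[OF s'(1) cyl_grad_fields_const[OF that]] cyl_grad_fields_const[OF that]
    by auto
  then show "B = tclass_of M \<mu> s" unfolding s'(2) by (rule tangent_grad_ext[OF s'(1) s])
qed

end

section \<open>The connection on cylinder fields\<close>

locale levi_civita_manifold = closed_riemannian M
  for M :: "('m::{t2_space, second_countable_topology}, 'n::finite) riemannian" +
  fixes LC :: "'m vfield \<Rightarrow> 'm vfield \<Rightarrow> 'm vfield"
  assumes levi_civita: "levi_civita M LC"
begin

section \<open>Linearity and boundedness of the Levi-Civita connection\<close>

lemma LC_mem: "w \<in> vector_fields M \<Longrightarrow> z \<in> vector_fields M \<Longrightarrow> LC w z \<in> vector_fields M"
  using levi_civita by (simp add: levi_civita_def)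

lemma LC_rules:
  assumes "w \<in> vector_fields M" "y \<in> vector_fields M" "z \<in> vector_fields M" "h \<in> smooth_functions M"
  shows "LC (w + y) z = LC w z + LC y z" "LC (vf_smult h w) z = vf_smult h (LC w z)"
    "LC w (y + z) = LC w y + LC w z" "LC w (vf_smult h z) = vf_smult (\<lambda>x. w x h) z + vf_smult h (LC w z)"
    "LC w z - LC z w = lie_bracket w z"
    "w x (\<lambda>p. metric M p (y p) (z p)) = metric M x (LC w y x) (z x) + metric M x (y x) (LC w z x)"
  using levi_civita assms unfolding levi_civita_def vf_add_eq vf_diff_eq by blast+

lemma LC_add_left: "w \<in> vector_fields M \<Longrightarrow> y \<in> vector_fields M \<Longrightarrow> z \<in> vector_fields M \<Longrightarrow> LC (w + y) z = LC w z + LC y z"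
  by (rule LC_rules(1)[OF _ _ _ smooth_const])

lemma LC_add_right: "w \<in> vector_fields M \<Longrightarrow> y \<in> vector_fields M \<Longrightarrow> z \<in> vector_fields M \<Longrightarrow> LC w (y + z) = LC w y + LC w z"
  by (rule LC_rules(3)[OF _ _ _ smooth_const])

lemma LC_torsion: "w \<in> vector_fields M \<Longrightarrow> z \<in> vector_fields M \<Longrightarrow> LC w z - LC z w = lie_bracket w z"
  by (rule LC_rules(5)[OF _ _ _ smooth_const])

lemma LC_metric: "w \<in> vector_fields M \<Longrightarrow> y \<in> vector_fields M \<Longrightarrow> z \<in> vector_fields M \<Longrightarrow>
    w x (\<lambda>p. metric M p (y p) (z p)) = metric M x (LC w y x) (z x) + metric M x (y x) (LC w z x)"
  by (rule LC_rules(6)[OF _ _ _ smooth_const])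

lemma LC_scale_left: "w \<in> vector_fields M \<Longrightarrow> z \<in> vector_fields M \<Longrightarrow> LC (c *\<^sub>R w) z = c *\<^sub>R LC w z"
  using LC_rules(2)[OF _ _ _ smooth_const, of w w z c] by (simp add: vf_smult_const_eq)

lemma LC_scale_right:
  assumes "w \<in> vector_fields M" "z \<in> vector_fields M"
  shows "LC w (c *\<^sub>R z) = c *\<^sub>R LC w z"
proof -
  have "vf_smult (\<lambda>x. w x (\<lambda>x. c)) z = 0"
    using tangent_const[OF vector_field_tangent[OF assms(1)]] by (simp add: fun_eq_iff vf_smult_def tv_scale_def)
  then show ?thesis
    using LC_rules(4)[OF assms(1,1,2) smooth_const, of c] by (simp add: vf_smult_const_eq)
qed

lemma LC_diff_left: "w \<in> vector_fields M \<Longrightarrow> y \<in> vector_fields M \<Longrightarrow> z \<in> vector_fields M \<Longrightarrow> LC (w - y) z = LC w z - LC y z"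
  using LC_add_left[of w "(-1) *\<^sub>R y" z] LC_scale_left[of y z "-1"] l2.closed_simps by simp

lemma LC_sum_right:
  assumes w: "w \<in> vector_fields M" and "finite I" "\<And>i. i \<in> I \<Longrightarrow> z i \<in> vector_fields M"
  shows "LC w (\<Sum>i\<in>I. c i *\<^sub>R z i) = (\<Sum>i\<in>I. c i *\<^sub>R LC w (z i))"
  using assms(2,3)
proof (induction I)
  case empty
  have "LC w 0 = 0" using LC_scale_right[OF w w, of 0] by simp
  then show ?case by (simp only: sum.empty)
next
  case (insert i I)
  have zS: "(\<Sum>i\<in>I. c i *\<^sub>R z i) \<in> vector_fields M" using insert by (intro l2.closed_simps) auto
  have zi: "z i \<in> vector_fields M" using insert by simp
  have "LC w (c i *\<^sub>R z i + (\<Sum>i\<in>I. c i *\<^sub>R z i)) = LC w (c i *\<^sub>R z i) + LC w (\<Sum>i\<in>I. c i *\<^sub>R z i)"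
    by (intro LC_add_right w l2.closed_simps zS zi)
  moreover have "LC w (\<Sum>i\<in>I. c i *\<^sub>R z i) = (\<Sum>i\<in>I. c i *\<^sub>R LC w (z i))"
    by (rule insert.IH) (use insert.prems in simp)
  ultimately show ?case
    unfolding sum.insert[OF insert.hyps] LC_scale_right[OF w zi] by (simp only:)
qed

lemma LC_sum_left:
  assumes w: "w \<in> vector_fields M" and "finite I" "\<And>i. i \<in> I \<Longrightarrow> z i \<in> vector_fields M"
  shows "LC (\<Sum>i\<in>I. c i *\<^sub>R z i) w = (\<Sum>i\<in>I. c i *\<^sub>R LC (z i) w)"
  using assms(2,3)
proof (induction I)
  case empty
  have "LC 0 w = 0" using LC_scale_left[OF w w, of 0] by simp
  then show ?case by (simp only: sum.empty)
next
  case (insert i I)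
  have zS: "(\<Sum>i\<in>I. c i *\<^sub>R z i) \<in> vector_fields M" using insert by (intro l2.closed_simps) auto
  have zi: "z i \<in> vector_fields M" using insert by simp
  have "LC (c i *\<^sub>R z i + (\<Sum>i\<in>I. c i *\<^sub>R z i)) w = LC (c i *\<^sub>R z i) w + LC (\<Sum>i\<in>I. c i *\<^sub>R z i) w"
    by (intro LC_add_left w l2.closed_simps zS zi)
  moreover have "LC (\<Sum>i\<in>I. c i *\<^sub>R z i) w = (\<Sum>i\<in>I. c i *\<^sub>R LC (z i) w)"
    by (rule insert.IH) (use insert.prems in simp)
  ultimately show ?case
    unfolding sum.insert[OF insert.hyps] LC_scale_left[OF zi w] by (simp only:)
qed

text \<open>Function-linearity in the direction gives a pointwise bound that is uniform in x, and
  such a bound integrates against any \<mu>.\<close>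

lemma LC_bounded:
  assumes z: "z \<in> vector_fields M"
  shows "\<exists>C>0. \<forall>w\<in>vector_fields M. l2.nrm \<mu> (LC w z) \<le> C * l2.nrm \<mu> w"
proof -
  have "\<exists>C>0. \<forall>w\<in>vector_fields M. \<forall>x. pt.nrm x (LC w z x) \<le> C * pt.nrm x (w x)"
    by (rule tensorial_bounded) (auto intro: LC_mem LC_add_left LC_rules(2) z)
  then obtain C where "C > 0" "\<And>w x. w \<in> vector_fields M \<Longrightarrow> pt.nrm x (LC w z x) \<le> C * pt.nrm x (w x)" by blast
  then show ?thesis using l2_nrm_bound[of _ "LC _ z" C] LC_mem z by (intro exI[of _ C]) auto
qed

section \<open>Hessians and symmetrised derivatives\<close>

lemma gradient_fieldsE:
  assumes "v \<in> gradient_fields M"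
  obtains f where "v \<in> vector_fields M" "f \<in> smooth_functions M" "\<And>x w. w \<in> tangent_space M x \<Longrightarrow> metric M x (v x) w = w f"
  using assms by (auto simp: gradient_fields_def)

text \<open>For v the gradient of f, metric compatibility identifies the left side with y (z f)
  minus the derivative of f along \<open>LC y z\<close>. Exchanging y and z changes the two terms by
  the same amount, namely [y, z] f, because the torsion vanishes.\<close>

lemma hessian_symmetric:
  assumes v: "v \<in> gradient_fields M" and y: "y \<in> vector_fields M" and z: "z \<in> vector_fields M"
  shows "metric M x (LC y v x) (z x) = metric M x (LC z v x) (y x)"
proof -
  obtain f where vX: "v \<in> vector_fields M" and f: "f \<in> smooth_functions M"
    and g: "\<And>x w. w \<in> tangent_space M x \<Longrightarrow> metric M x (v x) w = w f" using gradient_fieldsE[OF v] by metis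
  have gz: "metric M p (v p) (w p) = w p f" if "w \<in> vector_fields M" for w p
    by (rule g[OF vector_field_tangent[OF that]])
  have 1: "y x (\<lambda>p. z p f) = metric M x (LC y v x) (z x) + LC y z x f"
    using LC_metric[OF y vX z, of x] by (simp add: gz z LC_mem y)
  have 2: "z x (\<lambda>p. y p f) = metric M x (LC z v x) (y x) + LC z y x f"
    using LC_metric[OF z vX y, of x] by (simp add: gz z LC_mem y)
  have "(LC y z - LC z y) x f = lie_bracket y z x f" using LC_torsion[OF y z] by simp
  then show ?thesis using 1 2 by (simp add: lie_bracket_def)
qed

text \<open>Differentiate g(v, z) in a direction y by metric compatibility; the symmetry of both
  Hessians then moves y out of the differentiating slot. What is paired with y is the symmetrised
  derivative, so it is the gradient of g(v, z).\<close>

lemma LC_symmetrized_gradient: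
  assumes v: "v \<in> gradient_fields M" and z: "z \<in> gradient_fields M"
  shows "LC v z + LC z v \<in> gradient_fields M"
proof -
  have vX: "v \<in> vector_fields M" and zX: "z \<in> vector_fields M" using v z gradient_fields_subset by auto
  let ?g = "\<lambda>x. metric M x (v x) (z x)"
  obtain G where G: "G \<in> gradient_fields M" "\<And>x w. w \<in> tangent_space M x \<Longrightarrow> metric M x (G x) w = w ?g"
    using gradient_fields_exists[OF metric_smooth[OF vX zX]] by metis
  then have GX: "G \<in> vector_fields M" using gradient_fields_subset by auto
  let ?d = "LC v z + LC z v - G"
  have d: "?d \<in> vector_fields M" by (intro l2.closed_simps LC_mem vX zX GX)
  have eq: "metric M x (?d x) (y x) = 0" if y: "y \<in> vector_fields M" for x y
  proof -
    note t = vector_field_tangent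
    have "metric M x (G x) (y x) = metric M x (LC y v x) (z x) + metric M x (v x) (LC y z x)"
      using G(2)[OF t[OF y]] LC_metric[OF y vX zX] by simp
    also have "metric M x (LC y v x) (z x) = metric M x (LC z v x) (y x)" by (rule hessian_symmetric[OF v y zX])
    also have "metric M x (v x) (LC y z x) = metric M x (LC y z x) (v x)" by (intro pt.sym t LC_mem vX zX y)
    also have "\<dots> = metric M x (LC v z x) (y x)" by (rule hessian_symmetric[OF z y vX])
    finally show ?thesis
      using t[OF LC_mem[OF vX zX]] t[OF LC_mem[OF zX vX]] t[OF GX] t[OF y]
      by (simp add: pt.diff_left pt.add_left pt.closed_simps)
  qed
  have "?d x = 0" for x
    using eq[OF d, of x] metric_pos[OF vector_field_tangent[OF d], of x] by force
  then have "?d = 0" by (simp add: fun_eq_iff)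
  then have "LC v z + LC z v = G" by simp
  then show ?thesis using G by simp
qed

section \<open>The cylinder connection as an operator in its direction\<close>

lemma nabla_LC_at_eq: "nabla_LC_at M LC \<mu> w Z = nabla_int_at M \<mu> w Z + LC w (Z \<mu>)"
  by (simp add: nabla_LC_at_def omega_at_def vf_add_eq)

lemma nabla_int_at_mem:
  assumes "Z \<in> cyl_fields M" "w \<in> vector_fields M"
  shows "nabla_int_at M \<mu> w Z \<in> vector_fields M"
proof -
  obtain k :: nat and u z where Z: "\<And>i. i < k \<Longrightarrow> u i \<in> cyl_functions M" "\<And>i. i < k \<Longrightarrow> z i \<in> vector_fields M"
    "Z = (\<lambda>\<mu>. \<Sum>i<k. u i \<mu> *\<^sub>R z i)" by (rule cyl_fieldsE[OF assms(1)]) blast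
  have eq: "nabla_int_at M \<mu> w Z = (\<Sum>i<k. action_at M \<mu> w (u i) *\<^sub>R z i)"
    by (rule nabla_int_at_eq[OF Z assms(2)])
  show ?thesis unfolding eq by (intro l2.closed_simps) (use Z in auto)
qed

text \<open>Only scalar coefficients are differentiated, so this part of the connection stays among
  gradients and contributes nothing to \<open>II\<close>.\<close>

lemma nabla_int_at_gradient:
  assumes "Z \<in> cyl_grad_fields M" "w \<in> vector_fields M"
  shows "nabla_int_at M \<mu> w Z \<in> gradient_fields M"
proof -
  obtain k :: nat and u z where Z: "\<And>i. i < k \<Longrightarrow> u i \<in> cyl_functions M" "\<And>i. i < k \<Longrightarrow> z i \<in> gradient_fields M"
    "Z = (\<lambda>\<mu>. \<Sum>i<k. u i \<mu> *\<^sub>R z i)" by (rule cyl_grad_fieldsE[OF assms(1)]) blast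
  have zX: "\<And>i. i < k \<Longrightarrow> z i \<in> vector_fields M" using Z(2) gradient_fields_subset by blast
  have eq: "nabla_int_at M \<mu> w Z = (\<Sum>i<k. action_at M \<mu> w (u i) *\<^sub>R z i)"
    by (rule nabla_int_at_eq[OF Z(1) zX Z(3) assms(2)])
  show ?thesis unfolding eq
    by (intro subspace_sum[OF subspace_gradient_fields] subspace_scale[OF subspace_gradient_fields]) (use Z in auto)
qed

text \<open>In its direction this part of the connection has finite rank, with gradient fields as
  the testing vectors. Linearity, boundedness and vanishing on directions orthogonal to gradients
  are all read off from this form.\<close>

lemma nabla_int_at_rank:
  assumes "Z \<in> cyl_fields M"
  shows "\<exists>(k::nat) G z. (\<forall>i<k. G i \<in> gradient_fields M \<and> z i \<in> vector_fields M) \<and>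
    (\<forall>w\<in>vector_fields M. nabla_int_at M \<mu> w Z = (\<Sum>i<k. l2_inner M \<mu> (G i) w *\<^sub>R z i))"
proof -
  obtain k :: nat and u z where Z: "\<And>i. i < k \<Longrightarrow> u i \<in> cyl_functions M" "\<And>i. i < k \<Longrightarrow> z i \<in> vector_fields M"
    "Z = (\<lambda>\<mu>. \<Sum>i<k. u i \<mu> *\<^sub>R z i)" by (rule cyl_fieldsE[OF assms(1)]) blast
  have "\<forall>i. \<exists>G. i < k \<longrightarrow> G \<in> gradient_fields M \<and> (\<forall>w\<in>vector_fields M. action_at M \<mu> w (u i) = l2_inner M \<mu> G w)"
    using action_at_gradient[OF Z(1)] by blast
  then obtain G where G: "\<And>i. i < k \<Longrightarrow> G i \<in> gradient_fields M"
    "\<And>i w. i < k \<Longrightarrow> w \<in> vector_fields M \<Longrightarrow> action_at M \<mu> w (u i) = l2_inner M \<mu> (G i) w" by metis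
  then show ?thesis using nabla_int_at_eq[OF Z] Z(2)
    by (intro exI[of _ k] exI[of _ G] exI[of _ z]) auto
qed

lemma nabla_LC_at_mem: "Z \<in> cyl_fields M \<Longrightarrow> w \<in> vector_fields M \<Longrightarrow> nabla_LC_at M LC \<mu> w Z \<in> vector_fields M"
  unfolding nabla_LC_at_eq by (rule l2.closed_simps(2)[OF nabla_int_at_mem LC_mem[OF _ cyl_fields_mem]])

lemma nabla_int_at_diff:
  assumes Z: "Z \<in> cyl_fields M" and w: "w \<in> vector_fields M" "y \<in> vector_fields M"
  shows "nabla_int_at M \<mu> (w - y) Z = nabla_int_at M \<mu> w Z - nabla_int_at M \<mu> y Z"
proof -
  obtain k :: nat and G z where *: "\<forall>i<k. G i \<in> gradient_fields M \<and> z i \<in> vector_fields M"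
    "\<forall>w\<in>vector_fields M. nabla_int_at M \<mu> w Z = (\<Sum>i<k. l2_inner M \<mu> (G i) w *\<^sub>R z i)"
    using nabla_int_at_rank[OF Z] by blast
  have GX: "G i \<in> vector_fields M" if "i < k" for i using * that gradient_fields_subset by blast
  have "w - y \<in> vector_fields M" by (intro l2.closed_simps w)
  then show ?thesis using * w GX
    by (simp add: l2.diff_right scaleR_diff_left sum_subtractf)
qed

lemma nabla_LC_at_diff:
  assumes "Z \<in> cyl_fields M" "w \<in> vector_fields M" "y \<in> vector_fields M"
  shows "nabla_LC_at M LC \<mu> (w - y) Z = nabla_LC_at M LC \<mu> w Z - nabla_LC_at M LC \<mu> y Z"
  using assms by (simp add: nabla_LC_at_eq nabla_int_at_diff LC_diff_left cyl_fields_mem)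

lemma nabla_LC_at_bounded:
  assumes Z: "Z \<in> cyl_fields M"
  shows "\<exists>C. \<forall>w\<in>vector_fields M. l2.nrm \<mu> (nabla_LC_at M LC \<mu> w Z) \<le> C * l2.nrm \<mu> w"
proof -
  obtain k :: nat and G z where *: "\<forall>i<k. G i \<in> gradient_fields M \<and> z i \<in> vector_fields M"
    "\<forall>w\<in>vector_fields M. nabla_int_at M \<mu> w Z = (\<Sum>i<k. l2_inner M \<mu> (G i) w *\<^sub>R z i)"
    using nabla_int_at_rank[OF Z] by blast
  have GX: "G i \<in> vector_fields M" if "i < k" for i using * that gradient_fields_subset by blast
  obtain C where C: "\<And>w. w \<in> vector_fields M \<Longrightarrow> l2.nrm \<mu> (LC w (Z \<mu>)) \<le> C * l2.nrm \<mu> w"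
    using LC_bounded[OF cyl_fields_mem[OF Z]] by blast
  have "l2.nrm \<mu> (nabla_LC_at M LC \<mu> w Z) \<le> ((\<Sum>i<k. l2.nrm \<mu> (G i) * l2.nrm \<mu> (z i)) + C) * l2.nrm \<mu> w"
    if w: "w \<in> vector_fields M" for w
  proof -
    have "l2.nrm \<mu> (nabla_LC_at M LC \<mu> w Z) \<le> l2.nrm \<mu> (nabla_int_at M \<mu> w Z) + l2.nrm \<mu> (LC w (Z \<mu>))"
      unfolding nabla_LC_at_eq by (rule l2.nrm_triangle[OF nabla_int_at_mem[OF Z w] LC_mem[OF w cyl_fields_mem[OF Z]]])
    also have "l2.nrm \<mu> (nabla_int_at M \<mu> w Z) \<le> (\<Sum>i<k. l2.nrm \<mu> (l2_inner M \<mu> (G i) w *\<^sub>R z i))"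
      unfolding *(2)[rule_format, OF w] by (rule l2.nrm_sum) (use * in \<open>auto intro!: l2.closed_simps\<close>)
    also have "\<dots> \<le> (\<Sum>i<k. (l2.nrm \<mu> (G i) * l2.nrm \<mu> w) * l2.nrm \<mu> (z i))"
      using * w GX by (intro sum_mono) (auto simp: l2.nrm_scale intro!: mult_right_mono l2.abs_le_nrm)
    also have "\<dots> = (\<Sum>i<k. l2.nrm \<mu> (G i) * l2.nrm \<mu> (z i)) * l2.nrm \<mu> w"
      unfolding sum_distrib_right by (intro sum.cong refl) simp
    finally show ?thesis using C[OF w] by (simp add: distrib_right)
  qed
  then show ?thesis by blast
qed

text \<open>Closure under the connection is what allows it to be iterated in \<open>R_der\<close>
  and differenced into a bracket.\<close>

lemma nabla_LC_cyl:
  assumes "V \<in> cyl_fields M" "Z \<in> cyl_fields M"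
  shows "nabla_LC M LC V Z \<in> cyl_fields M"
proof -
  obtain k :: nat and u w where V: "\<And>i. i < k \<Longrightarrow> u i \<in> cyl_functions M" "\<And>i. i < k \<Longrightarrow> w i \<in> vector_fields M"
    "V = (\<lambda>\<mu>. \<Sum>i<k. u i \<mu> *\<^sub>R w i)" by (rule cyl_fieldsE[OF assms(1)]) blast
  obtain l :: nat and v z where Z: "\<And>i. i < l \<Longrightarrow> v i \<in> cyl_functions M" "\<And>i. i < l \<Longrightarrow> z i \<in> vector_fields M"
    "Z = (\<lambda>\<mu>. \<Sum>i<l. v i \<mu> *\<^sub>R z i)" by (rule cyl_fieldsE[OF assms(2)]) blast
  have 1: "(\<lambda>\<mu>. \<Sum>i<l. action M V (v i) \<mu> *\<^sub>R z i) \<in> cyl_fields M"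
    by (rule cyl_fieldsI) (use Z action_cyl[OF assms(1)] in auto)
  have 2: "(\<lambda>\<mu>. \<Sum>p\<in>{..<k} \<times> {..<l}. (\<lambda>\<mu>. u (fst p) \<mu> * v (snd p) \<mu>) \<mu> *\<^sub>R LC (w (fst p)) (z (snd p))) \<in> cyl_fields M"
    by (rule cyl_fieldsI) (use V Z LC_mem in auto)
  have "nabla_LC M LC V Z \<mu> = (\<Sum>i<l. action M V (v i) \<mu> *\<^sub>R z i) +
      (\<Sum>p\<in>{..<k} \<times> {..<l}. (u (fst p) \<mu> * v (snd p) \<mu>) *\<^sub>R LC (w (fst p)) (z (snd p)))" for \<mu>
  proof -
    have VX: "V \<mu> \<in> vector_fields M" by (rule cyl_fields_mem[OF assms(1)])
    have ZX: "Z \<mu> \<in> vector_fields M" by (rule cyl_fields_mem[OF assms(2)])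
    have "LC (V \<mu>) (Z \<mu>) = (\<Sum>i<k. u i \<mu> *\<^sub>R LC (w i) (Z \<mu>))"
      unfolding V(3) by (rule LC_sum_left[OF ZX]) (use V in auto)
    also have "\<dots> = (\<Sum>i<k. u i \<mu> *\<^sub>R (\<Sum>j<l. v j \<mu> *\<^sub>R LC (w i) (z j)))"
    proof (intro sum.cong refl arg_cong2[where f = scaleR])
      fix i assume "i \<in> {..<k}"
      then have "w i \<in> vector_fields M" using V by simp
      then show "LC (w i) (Z \<mu>) = (\<Sum>j<l. v j \<mu> *\<^sub>R LC (w i) (z j))"
        unfolding Z(3) by (rule LC_sum_right) (use Z in auto)
    qed
    finally show ?thesis
      by (simp add: nabla_LC_def nabla_LC_at_eq nabla_int_at_eq[OF Z VX] action_def scaleR_sum_right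
          sum.cartesian_product case_prod_unfold)
  qed
  then have "nabla_LC M LC V Z = (\<lambda>\<mu>. (\<Sum>i<l. action M V (v i) \<mu> *\<^sub>R z i) +
      (\<Sum>p\<in>{..<k} \<times> {..<l}. (u (fst p) \<mu> * v (snd p) \<mu>) *\<^sub>R LC (w (fst p)) (z (snd p))))" by blast
  then show ?thesis using cyl_fields_add[OF 1 2] by simp
qed

section \<open>Metric compatibility of the cylinder connection\<close>

text \<open>The pairing depends on \<nu> through the coefficients and through the measure of
  integration. The coefficients give the \<open>nabla_int\<close> terms; varying the measure
  differentiates g(y i, z j) on the manifold, and metric compatibility there gives the
  \<open>LC\<close> terms.\<close>

lemma action_at_l2_inner:
  assumes Y: "Y \<in> cyl_fields M" and Z: "Z \<in> cyl_fields M"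
  shows "(\<lambda>\<nu>. l2_inner M \<nu> (Y \<nu>) (Z \<nu>)) \<in> cyl_functions M"
    and "w \<in> vector_fields M \<Longrightarrow> action_at M \<mu> w (\<lambda>\<nu>. l2_inner M \<nu> (Y \<nu>) (Z \<nu>)) =
      l2_inner M \<mu> (nabla_LC_at M LC \<mu> w Y) (Z \<mu>) + l2_inner M \<mu> (Y \<mu>) (nabla_LC_at M LC \<mu> w Z)"
proof -
  obtain k :: nat and a y where a: "\<And>i. i < k \<Longrightarrow> a i \<in> cyl_functions M" and y: "\<And>i. i < k \<Longrightarrow> y i \<in> vector_fields M"
    and Yeq: "Y = (\<lambda>\<mu>. \<Sum>i<k. a i \<mu> *\<^sub>R y i)" by (rule cyl_fieldsE[OF Y]) blast
  obtain l :: nat and b z where b: "\<And>i. i < l \<Longrightarrow> b i \<in> cyl_functions M" and z: "\<And>i. i < l \<Longrightarrow> z i \<in> vector_fields M"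
    and Zeq: "Z = (\<lambda>\<mu>. \<Sum>i<l. b i \<mu> *\<^sub>R z i)" by (rule cyl_fieldsE[OF Z]) blast
  let ?s = "\<lambda>i j. star (\<lambda>x. metric M x (y i x) (z j x))"
  have s: "?s i j \<in> cyl_functions M" if "i < k" "j < l" for i j
    by (rule cyl_functions_star[OF metric_smooth[OF y[OF that(1)] z[OF that(2)]]])
  have eq: "(\<lambda>\<nu>. l2_inner M \<nu> (Y \<nu>) (Z \<nu>)) = (\<lambda>\<nu>. \<Sum>i<k. \<Sum>j<l. a i \<nu> * (b j \<nu> * ?s i j \<nu>))"
    unfolding Yeq Zeq
    by (rule ext, subst l2_inner_sums) (auto simp: y z l2_inner_star)
  have bs: "(\<lambda>\<nu>. b j \<nu> * ?s i j \<nu>) \<in> cyl_functions M" if "i < k" "j < l" for i j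
    by (rule cyl_functions_mult[OF b[OF that(2)] s[OF that]])
  have abs: "(\<lambda>\<nu>. a i \<nu> * (b j \<nu> * ?s i j \<nu>)) \<in> cyl_functions M" if "i < k" "j < l" for i j
    by (rule cyl_functions_mult[OF a[OF that(1)] bs[OF that]])
  have sabs: "(\<lambda>\<nu>. \<Sum>j<l. a i \<nu> * (b j \<nu> * ?s i j \<nu>)) \<in> cyl_functions M" if "i < k" for i
    by (rule cyl_functions_sum) (use abs that in auto)
  show "(\<lambda>\<nu>. l2_inner M \<nu> (Y \<nu>) (Z \<nu>)) \<in> cyl_functions M"
    unfolding eq by (rule cyl_functions_sum) (use sabs in auto)
  assume w: "w \<in> vector_fields M"
  let ?A = "action_at M \<mu> w"
  \<comment> \<open>Leibniz rule over three factors; the derivative of the integral of g(y i, z j)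
    splits in two, hence four terms.\<close>
  have 1: "?A (\<lambda>\<nu>. a i \<nu> * (b j \<nu> * ?s i j \<nu>)) =
      ?A (a i) * (b j \<mu> * l2_inner M \<mu> (y i) (z j)) + a i \<mu> * (?A (b j) * l2_inner M \<mu> (y i) (z j)) +
      a i \<mu> * (b j \<mu> * l2_inner M \<mu> (LC w (y i)) (z j)) + a i \<mu> * (b j \<mu> * l2_inner M \<mu> (y i) (LC w (z j)))"
    if ij: "i < k" "j < l" for i j
  proof -
    note yz = y[OF ij(1)] z[OF ij(2)]
    have "?A (?s i j) = star (\<lambda>x. w x (\<lambda>p. metric M p (y i p) (z j p))) \<mu>"
      by (rule action_at_star[OF w metric_smooth[OF yz]])
    also have "\<dots> = star (\<lambda>x. metric M x (LC w (y i) x) (z j x) + metric M x (y i x) (LC w (z j) x)) \<mu>"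
      using LC_metric[OF w yz] by simp
    also have "\<dots> = l2_inner M \<mu> (LC w (y i)) (z j) + l2_inner M \<mu> (y i) (LC w (z j))"
      unfolding l2_inner_star by (intro star_add metric_smooth LC_mem w yz)
    finally show ?thesis
      using action_at_cyl_mult[OF a[OF ij(1)] bs[OF ij] w, of \<mu>] action_at_cyl_mult[OF b[OF ij(2)] s[OF ij] w, of \<mu>]
      by (simp add: l2_inner_star algebra_simps)
  qed
  have "?A (\<lambda>\<nu>. l2_inner M \<nu> (Y \<nu>) (Z \<nu>)) = (\<Sum>i<k. \<Sum>j<l. ?A (\<lambda>\<nu>. a i \<nu> * (b j \<nu> * ?s i j \<nu>)))"
  proof -
    have "?A (\<lambda>\<nu>. l2_inner M \<nu> (Y \<nu>) (Z \<nu>)) = (\<Sum>i<k. ?A (\<lambda>\<nu>. \<Sum>j<l. a i \<nu> * (b j \<nu> * ?s i j \<nu>)))"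
      unfolding eq by (rule action_at_cyl_sum[OF w]) (use sabs in auto)
    also have "\<dots> = (\<Sum>i<k. \<Sum>j<l. ?A (\<lambda>\<nu>. a i \<nu> * (b j \<nu> * ?s i j \<nu>)))"
      by (intro sum.cong refl action_at_cyl_sum[OF w] abs) auto
    finally show ?thesis .
  qed
  also have "\<dots> = (\<Sum>i<k. \<Sum>j<l. ?A (a i) * (b j \<mu> * l2_inner M \<mu> (y i) (z j))) +
      (\<Sum>i<k. \<Sum>j<l. a i \<mu> * (?A (b j) * l2_inner M \<mu> (y i) (z j))) +
      (\<Sum>i<k. \<Sum>j<l. a i \<mu> * (b j \<mu> * l2_inner M \<mu> (LC w (y i)) (z j))) +
      (\<Sum>i<k. \<Sum>j<l. a i \<mu> * (b j \<mu> * l2_inner M \<mu> (y i) (LC w (z j))))"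
    unfolding sum.distrib[symmetric] by (intro sum.cong refl 1) auto
  also have "\<dots> = l2_inner M \<mu> (\<Sum>i<k. ?A (a i) *\<^sub>R y i) (Z \<mu>) + l2_inner M \<mu> (Y \<mu>) (\<Sum>j<l. ?A (b j) *\<^sub>R z j) +
      l2_inner M \<mu> (\<Sum>i<k. a i \<mu> *\<^sub>R LC w (y i)) (Z \<mu>) + l2_inner M \<mu> (Y \<mu>) (\<Sum>j<l. b j \<mu> *\<^sub>R LC w (z j))"
  proof -
    note e = l2_inner_sums[where I = "{..<k}" and J = "{..<l}" and \<mu> = \<mu>]
    have "l2_inner M \<mu> (\<Sum>i<k. ?A (a i) *\<^sub>R y i) (\<Sum>j<l. b j \<mu> *\<^sub>R z j) =
        (\<Sum>i<k. \<Sum>j<l. ?A (a i) * (b j \<mu> * l2_inner M \<mu> (y i) (z j)))"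
      by (rule e) (use y z in auto)
    moreover have "l2_inner M \<mu> (\<Sum>i<k. a i \<mu> *\<^sub>R y i) (\<Sum>j<l. ?A (b j) *\<^sub>R z j) =
        (\<Sum>i<k. \<Sum>j<l. a i \<mu> * (?A (b j) * l2_inner M \<mu> (y i) (z j)))"
      by (rule e) (use y z in auto)
    moreover have "l2_inner M \<mu> (\<Sum>i<k. a i \<mu> *\<^sub>R LC w (y i)) (\<Sum>j<l. b j \<mu> *\<^sub>R z j) =
        (\<Sum>i<k. \<Sum>j<l. a i \<mu> * (b j \<mu> * l2_inner M \<mu> (LC w (y i)) (z j)))"
      by (rule e) (use y z LC_mem[OF w] in auto)
    moreover have "l2_inner M \<mu> (\<Sum>i<k. a i \<mu> *\<^sub>R y i) (\<Sum>j<l. b j \<mu> *\<^sub>R LC w (z j)) =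
        (\<Sum>i<k. \<Sum>j<l. a i \<mu> * (b j \<mu> * l2_inner M \<mu> (y i) (LC w (z j))))"
      by (rule e) (use y z LC_mem[OF w] in auto)
    ultimately show ?thesis unfolding Yeq Zeq by (simp only:)
  qed
  also have "(\<Sum>i<k. a i \<mu> *\<^sub>R LC w (y i)) = LC w (Y \<mu>)"
    unfolding Yeq by (rule LC_sum_right[OF w, symmetric]) (use y in auto)
  also have "(\<Sum>j<l. b j \<mu> *\<^sub>R LC w (z j)) = LC w (Z \<mu>)"
    unfolding Zeq by (rule LC_sum_right[OF w, symmetric]) (use z in auto)
  also have "(\<Sum>i<k. ?A (a i) *\<^sub>R y i) = nabla_int_at M \<mu> w Y"
    by (rule nabla_int_at_eq[OF a y Yeq w, symmetric])
  also have "(\<Sum>j<l. ?A (b j) *\<^sub>R z j) = nabla_int_at M \<mu> w Z"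
    by (rule nabla_int_at_eq[OF b z Zeq w, symmetric])
  finally have *: "?A (\<lambda>\<nu>. l2_inner M \<nu> (Y \<nu>) (Z \<nu>)) = l2_inner M \<mu> (nabla_int_at M \<mu> w Y) (Z \<mu>) + l2_inner M \<mu> (Y \<mu>) (nabla_int_at M \<mu> w Z) +
      l2_inner M \<mu> (LC w (Y \<mu>)) (Z \<mu>) + l2_inner M \<mu> (Y \<mu>) (LC w (Z \<mu>))" .
  note m = cyl_fields_mem[OF Y, of \<mu>] cyl_fields_mem[OF Z, of \<mu>]
  have "l2_inner M \<mu> (nabla_LC_at M LC \<mu> w Y) (Z \<mu>) = l2_inner M \<mu> (nabla_int_at M \<mu> w Y) (Z \<mu>) + l2_inner M \<mu> (LC w (Y \<mu>)) (Z \<mu>)"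
    unfolding nabla_LC_at_eq by (intro l2.add_left nabla_int_at_mem LC_mem w m Y)
  moreover have "l2_inner M \<mu> (Y \<mu>) (nabla_LC_at M LC \<mu> w Z) = l2_inner M \<mu> (Y \<mu>) (nabla_int_at M \<mu> w Z) + l2_inner M \<mu> (Y \<mu>) (LC w (Z \<mu>))"
    unfolding nabla_LC_at_eq by (intro l2.add_right nabla_int_at_mem LC_mem w m Z)
  ultimately show "?A (\<lambda>\<nu>. l2_inner M \<nu> (Y \<nu>) (Z \<nu>)) =
      l2_inner M \<mu> (nabla_LC_at M LC \<mu> w Y) (Z \<mu>) + l2_inner M \<mu> (Y \<mu>) (nabla_LC_at M LC \<mu> w Z)"
    using * by simp
qed

section \<open>The bracket of cylinder fields\<close>

text \<open>The torsion-free expression for the bracket. It is a cylinder field because the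
  connection preserves these, and it relates the bracket to \<open>II\<close>; its agreement with
  \<open>cyl_bracket\<close> is a theorem below.\<close>

definition bracket :: "'m cvfield \<Rightarrow> 'm cvfield \<Rightarrow> 'm cvfield" where
  "bracket V Z = (\<lambda>\<mu>. nabla_LC M LC V Z \<mu> - nabla_LC M LC Z V \<mu>)"

lemma bracket_cyl: "V \<in> cyl_fields M \<Longrightarrow> Z \<in> cyl_fields M \<Longrightarrow> bracket V Z \<in> cyl_fields M"
  unfolding bracket_def by (intro cyl_fields_diff nabla_LC_cyl)

lemma action_star: "V \<in> cyl_fields M \<Longrightarrow> f \<in> smooth_functions M \<Longrightarrow> action M V (star f) \<mu> = star (\<lambda>x. V \<mu> x f) \<mu>"
  unfolding action_def by (rule action_at_star[OF cyl_fields_mem])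

text \<open>On the linear functions \<open>star f\<close> a second derivative has two parts: either
  \<open>V\<close> differentiates the coefficients of \<open>Z\<close>, or the two fields, frozen at
  \<mu>, act on f one after the other.\<close>

lemma action_action_star:
  assumes V: "V \<in> cyl_fields M" and Z: "Z \<in> cyl_fields M" and f: "f \<in> smooth_functions M"
  shows "action M V (action M Z (star f)) \<mu> = star (\<lambda>x. nabla_int_at M \<mu> (V \<mu>) Z x f) \<mu> + star (\<lambda>x. V \<mu> x (\<lambda>y. Z \<mu> y f)) \<mu>"
proof -
  obtain k :: nat and u z where u: "\<And>i. i < k \<Longrightarrow> u i \<in> cyl_functions M" and z: "\<And>i. i < k \<Longrightarrow> z i \<in> vector_fields M"
    and Zeq: "Z = (\<lambda>\<mu>. \<Sum>i<k. u i \<mu> *\<^sub>R z i)" by (rule cyl_fieldsE[OF Z]) blast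
  have VX: "V \<mu> \<in> vector_fields M" by (rule cyl_fields_mem[OF V])
  note zf = vector_field_smooth[OF z f]
  note zs = cyl_functions_star[OF zf]
  have Zf: "(\<lambda>x. \<Sum>i<k. c i * z i x f) \<in> smooth_functions M" for c :: "nat \<Rightarrow> real"
    by (rule smooth_sum) (use smooth_cmult[OF zf] in auto)
  have "action M Z (star f) \<nu> = (\<Sum>i<k. u i \<nu> * star (\<lambda>x. z i x f) \<nu>)" for \<nu>
  proof -
    have "action M Z (star f) \<nu> = star (\<lambda>x. \<Sum>i<k. u i \<nu> * z i x f) \<nu>"
      unfolding action_star[OF Z f] by (simp add: Zeq)
    also have "\<dots> = (\<Sum>i<k. star (\<lambda>x. u i \<nu> * z i x f) \<nu>)"
      by (rule star_sum) (use smooth_cmult[OF zf] in auto)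
    finally show ?thesis by (simp add: star_cmult)
  qed
  then have eq: "action M Z (star f) = (\<lambda>\<nu>. \<Sum>i<k. u i \<nu> * star (\<lambda>x. z i x f) \<nu>)" by blast
  have "action M V (action M Z (star f)) \<mu> = (\<Sum>i<k. action_at M \<mu> (V \<mu>) (\<lambda>\<nu>. u i \<nu> * star (\<lambda>x. z i x f) \<nu>))"
    unfolding eq unfolding action_def by (rule action_at_cyl_sum[OF VX]) (use u zs in auto)
  also have "\<dots> = (\<Sum>i<k. action_at M \<mu> (V \<mu>) (u i) * star (\<lambda>x. z i x f) \<mu> + u i \<mu> * star (\<lambda>x. V \<mu> x (\<lambda>y. z i y f)) \<mu>)"
  proof (intro sum.cong refl)
    fix i assume "i \<in> {..<k}"
    then have i: "i < k" by simp
    show "action_at M \<mu> (V \<mu>) (\<lambda>\<nu>. u i \<nu> * star (\<lambda>x. z i x f) \<nu>) =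
        action_at M \<mu> (V \<mu>) (u i) * star (\<lambda>x. z i x f) \<mu> + u i \<mu> * star (\<lambda>x. V \<mu> x (\<lambda>y. z i y f)) \<mu>"
      unfolding action_at_cyl_mult[OF u[OF i] zs[OF i] VX] action_at_star[OF VX zf[OF i]] ..
  qed
  also have "\<dots> = (\<Sum>i<k. star (\<lambda>x. action_at M \<mu> (V \<mu>) (u i) * z i x f) \<mu>) + (\<Sum>i<k. star (\<lambda>x. u i \<mu> * V \<mu> x (\<lambda>y. z i y f)) \<mu>)"
    by (simp add: sum.distrib star_cmult)
  also have "(\<Sum>i<k. star (\<lambda>x. action_at M \<mu> (V \<mu>) (u i) * z i x f) \<mu>) = star (\<lambda>x. nabla_int_at M \<mu> (V \<mu>) Z x f) \<mu>"
  proof -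
    have n: "nabla_int_at M \<mu> (V \<mu>) Z = (\<Sum>i<k. action_at M \<mu> (V \<mu>) (u i) *\<^sub>R z i)"
      by (rule nabla_int_at_eq[OF u z Zeq VX])
    show ?thesis
      unfolding n by (subst star_sum[symmetric]) (use smooth_cmult[OF zf] in auto)
  qed
  also have "(\<Sum>i<k. star (\<lambda>x. u i \<mu> * V \<mu> x (\<lambda>y. z i y f)) \<mu>) = star (\<lambda>x. V \<mu> x (\<lambda>y. Z \<mu> y f)) \<mu>"
  proof -
    have "V \<mu> x (\<lambda>y. Z \<mu> y f) = (\<Sum>i<k. u i \<mu> * V \<mu> x (\<lambda>y. z i y f))" for x
    proof -
      note t = vector_field_tangent[OF VX, of x]
      have "V \<mu> x (\<lambda>y. Z \<mu> y f) = V \<mu> x (\<lambda>y. \<Sum>i<k. u i \<mu> * z i y f)" by (simp add: Zeq)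
      also have "\<dots> = (\<Sum>i<k. V \<mu> x (\<lambda>y. u i \<mu> * z i y f))"
        by (rule tangent_sum[OF t]) (use smooth_cmult[OF zf] in auto)
      also have "\<dots> = (\<Sum>i<k. u i \<mu> * V \<mu> x (\<lambda>y. z i y f))"
        by (intro sum.cong refl tangent_cmult[OF t] zf) auto
      finally show ?thesis .
    qed
    then show ?thesis
      by (simp, subst star_sum) (use smooth_cmult[OF vector_field_smooth[OF VX zf]] in auto)
  qed
  finally show ?thesis .
qed

lemma commutator_star:
  assumes V: "V \<in> cyl_fields M" and Z: "Z \<in> cyl_fields M" and f: "f \<in> smooth_functions M"
  shows "action M V (action M Z (star f)) \<mu> - action M Z (action M V (star f)) \<mu> = star (\<lambda>x. bracket V Z \<mu> x f) \<mu>"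
proof -
  note X = cyl_fields_mem[OF V, of \<mu>] cyl_fields_mem[OF Z, of \<mu>]
  let ?a = "\<lambda>x. nabla_int_at M \<mu> (V \<mu>) Z x f" and ?b = "\<lambda>x. V \<mu> x (\<lambda>y. Z \<mu> y f)"
  let ?c = "\<lambda>x. nabla_int_at M \<mu> (Z \<mu>) V x f" and ?d = "\<lambda>x. Z \<mu> x (\<lambda>y. V \<mu> y f)"
  have s: "?a \<in> smooth_functions M" "?b \<in> smooth_functions M" "?c \<in> smooth_functions M" "?d \<in> smooth_functions M"
    by (rule vector_field_smooth[OF nabla_int_at_mem[OF Z X(1)] f] vector_field_smooth[OF X(1) vector_field_smooth[OF X(2) f]]
        vector_field_smooth[OF nabla_int_at_mem[OF V X(2)] f] vector_field_smooth[OF X(2) vector_field_smooth[OF X(1) f]])+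
  have "bracket V Z \<mu> x f = (?a x - ?c x) + (?b x - ?d x)" for x
  proof -
    \<comment> \<open>The parts with frozen fields combine to their Lie bracket, which
      torsion-freeness converts into the \<open>LC\<close> part of \<open>bracket\<close>.\<close>
    have "(LC (V \<mu>) (Z \<mu>) - LC (Z \<mu>) (V \<mu>)) x f = ?b x - ?d x"
      unfolding LC_torsion[OF X] lie_bracket_def ..
    then show ?thesis by (simp add: bracket_def nabla_LC_def nabla_LC_at_eq)
  qed
  then have "star (\<lambda>x. bracket V Z \<mu> x f) \<mu> = (star ?a \<mu> - star ?c \<mu>) + (star ?b \<mu> - star ?d \<mu>)"
    by (simp add: star_add[OF smooth_diff[OF s(1,3)] smooth_diff[OF s(2,4)]] star_diff[OF s(1,3)] star_diff[OF s(2,4)])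
  then show ?thesis unfolding action_action_star[OF V Z f] action_action_star[OF Z V f] by simp
qed

text \<open>By the chain rule an iterated derivative of u consists of second partials of F
  contracted with first derivatives of the \<open>star (f i)\<close>, and of first partials times
  iterated derivatives of the \<open>star (f i)\<close>. The former are symmetric in V and Z, so
  only the linear case remains.\<close>

lemma commutator:
  assumes V: "V \<in> cyl_fields M" and Z: "Z \<in> cyl_fields M" and u: "u \<in> cyl_functions M"
  shows "action M V (action M Z u) \<mu> - action M Z (action M V u) \<mu> = action M (bracket V Z) u \<mu>"
proof -
  obtain k F f where R: "represents M k F f u" using u by (auto simp: cyl_functions_def)
  have f: "f i \<in> smooth_functions M" for i using R by (simp add: represents_def)
  have F: "F \<in> smooth_coords k" using R by (simp add: represents_def)
  let ?P = "\<lambda>i G \<nu>. partial i G (\<lambda>j. star (f j) \<nu>)"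
  have P: "represents M k (partial i F) f (?P i F)" if "i < k" for i
    using R that by (simp add: represents_def smooth_coords_partial)
  have act: "action M V u = (\<lambda>\<nu>. \<Sum>i<k. ?P i F \<nu> * action M V (star (f i)) \<nu>)" if V: "V \<in> cyl_fields M" for V
    unfolding action_def action_at_eq[OF R cyl_fields_mem[OF V]] action_at_star[OF cyl_fields_mem[OF V] f] ..
  have aa: "action M V (action M Z u) \<mu> = (\<Sum>i<k. \<Sum>j<k. ?P j (partial i F) \<mu> * action M V (star (f j)) \<mu> * action M Z (star (f i)) \<mu>) +
      (\<Sum>i<k. ?P i F \<mu> * action M V (action M Z (star (f i))) \<mu>)"
    if V: "V \<in> cyl_fields M" and Z: "Z \<in> cyl_fields M" for V Z
  proof -
    have VX: "V \<mu> \<in> vector_fields M" by (rule cyl_fields_mem[OF V])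
    have zc: "action M Z (star (f i)) \<in> cyl_functions M" for i by (rule action_cyl[OF Z cyl_functions_star[OF f]])
    have "action M V (action M Z u) \<mu> = (\<Sum>i<k. action_at M \<mu> (V \<mu>) (\<lambda>\<nu>. ?P i F \<nu> * action M Z (star (f i)) \<nu>))"
      unfolding act[OF Z] unfolding action_def[of M V]
      by (rule action_at_cyl_sum[OF VX]) (use cyl_functions_mult[OF cyl_functionsI[OF P] zc] in auto)
    also have "\<dots> = (\<Sum>i<k. (\<Sum>j<k. ?P j (partial i F) \<mu> * action M V (star (f j)) \<mu>) * action M Z (star (f i)) \<mu> +
        ?P i F \<mu> * action M V (action M Z (star (f i))) \<mu>)"
    proof (intro sum.cong refl)
      fix i assume "i \<in> {..<k}"
      then have i: "i < k" by simp
      have "action_at M \<mu> (V \<mu>) (?P i F) = (\<Sum>j<k. ?P j (partial i F) \<mu> * action M V (star (f j)) \<mu>)"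
        unfolding action_at_eq[OF P[OF i] VX] action_def action_at_star[OF VX f] ..
      then show "action_at M \<mu> (V \<mu>) (\<lambda>\<nu>. ?P i F \<nu> * action M Z (star (f i)) \<nu>) =
          (\<Sum>j<k. ?P j (partial i F) \<mu> * action M V (star (f j)) \<mu>) * action M Z (star (f i)) \<mu> +
          ?P i F \<mu> * action M V (action M Z (star (f i))) \<mu>"
        unfolding action_at_cyl_mult[OF cyl_functionsI[OF P[OF i]] zc VX] by (simp add: action_def[of M V])
    qed
    finally show ?thesis by (simp add: sum.distrib sum_distrib_right)
  qed
  \<comment> \<open>Exchanging the summation indices and the order of the partial derivatives
    identifies the second-order terms for (Z, V) with those for (V, Z).\<close>
  have "(\<Sum>i<k. \<Sum>j<k. ?P j (partial i F) \<mu> * action M Z (star (f j)) \<mu> * action M V (star (f i)) \<mu>) =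
      (\<Sum>j<k. \<Sum>i<k. ?P j (partial i F) \<mu> * action M Z (star (f j)) \<mu> * action M V (star (f i)) \<mu>)"
    by (rule sum.swap)
  also have "\<dots> = (\<Sum>i<k. \<Sum>j<k. ?P j (partial i F) \<mu> * action M V (star (f j)) \<mu> * action M Z (star (f i)) \<mu>)"
    by (intro sum.cong refl) (simp add: partial_commute[OF F])
  finally have "action M V (action M Z u) \<mu> - action M Z (action M V u) \<mu> =
      (\<Sum>i<k. ?P i F \<mu> * (action M V (action M Z (star (f i))) \<mu> - action M Z (action M V (star (f i))) \<mu>))"
    unfolding aa[OF V Z] aa[OF Z V] by (simp add: sum_subtractf right_diff_distrib)
  also have "\<dots> = action M (bracket V Z) u \<mu>"
    unfolding commutator_star[OF V Z f] act[OF bracket_cyl[OF V Z]] action_star[OF bracket_cyl[OF V Z] f] ..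
  finally show ?thesis .
qed

text \<open>Existence is \<open>commutator\<close>. For uniqueness, two candidates act equally on
  every \<open>star f\<close>, so the derivative of f along their difference integrates to zero for
  every measure, and \<open>cyl_field_eq_zero\<close> applies.\<close>

lemma cyl_bracket_eq:
  assumes V: "V \<in> cyl_fields M" and Z: "Z \<in> cyl_fields M"
  shows "cyl_bracket M V Z = bracket V Z"
  unfolding cyl_bracket_def
proof (rule the_equality)
  show "bracket V Z \<in> cyl_fields M \<and> (\<forall>u\<in>cyl_functions M. \<forall>\<mu>.
     action M (bracket V Z) u \<mu> = action M V (action M Z u) \<mu> - action M Z (action M V u) \<mu>)"
    using bracket_cyl[OF V Z] commutator[OF V Z] by simp
  fix W assume W: "W \<in> cyl_fields M \<and> (\<forall>u\<in>cyl_functions M. \<forall>\<mu>.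
     action M W u \<mu> = action M V (action M Z u) \<mu> - action M Z (action M V u) \<mu>)"
  let ?D = "\<lambda>\<mu>. W \<mu> - bracket V Z \<mu>"
  have "?D \<in> cyl_fields M" using W bracket_cyl[OF V Z] by (intro cyl_fields_diff) auto
  moreover have "star (\<lambda>x. ?D \<nu> x f) \<nu> = 0" if f: "f \<in> smooth_functions M" for \<nu> f
  proof -
    have WX: "W \<nu> \<in> vector_fields M" "bracket V Z \<nu> \<in> vector_fields M"
      using W bracket_cyl[OF V Z] by (auto intro: cyl_fields_mem)
    have "star (\<lambda>x. ?D \<nu> x f) \<nu> = star (\<lambda>x. W \<nu> x f) \<nu> - star (\<lambda>x. bracket V Z \<nu> x f) \<nu>"
      using star_diff[OF vector_field_smooth[OF WX(1) f] vector_field_smooth[OF WX(2) f]] by simp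
    also have "\<dots> = action M W (star f) \<nu> - action M (bracket V Z) (star f) \<nu>"
      using W by (simp add: action_star[OF _ f] bracket_cyl[OF V Z])
    also have "\<dots> = 0"
      using W commutator[OF V Z cyl_functions_star[OF f]] cyl_functions_star[OF f] by auto
    finally show ?thesis .
  qed
  ultimately have "?D \<mu> = 0" for \<mu> by (rule cyl_field_eq_zero)
  then show "W = bracket V Z" by (simp add: fun_eq_iff)
qed

subsection \<open>The Gauss equation\<close>

lemma nabla_LC_mem: "V \<in> cyl_fields M \<Longrightarrow> Z \<in> cyl_fields M \<Longrightarrow> nabla_LC M LC V Z \<mu> \<in> vector_fields M"
  by (rule cyl_fields_mem[OF nabla_LC_cyl])

lemma nabla_LC_cauchy: "V \<in> cyl_fields M \<Longrightarrow> Z \<in> cyl_fields M \<Longrightarrow> l2.cauchy_in \<mu> (cseq (nabla_LC M LC V Z \<mu>))"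
  by (rule l2.cauchy_in_const[OF nabla_LC_mem])

section \<open>Projected derivatives and the tensor A\<close>

lemma nabla_grad_tclass:
  "V \<in> cyl_fields M \<Longrightarrow> Z \<in> cyl_fields M \<Longrightarrow>
    nabla_grad M LC \<mu> V Z = tclass_of M \<mu> (pr \<mu> (cseq (nabla_LC M LC V Z \<mu>)))"
  by (simp add: nabla_grad_def emb_def proj_tclass nabla_LC_cauchy)

lemma II_tclass:
  assumes "V \<in> cyl_fields M" "Z \<in> cyl_fields M"
  shows "II M LC \<mu> V Z = tclass_of M \<mu> (cseq (nabla_LC M LC V Z \<mu>) - pr \<mu> (cseq (nabla_LC M LC V Z \<mu>)))"
  using nabla_LC_cauchy[OF assms]
  by (simp add: II_def proj_perp_def emb_def proj_tclass tc_diff_tclass pr(3))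

text \<open>The projection need not depend on the measure in a cylinder way, but this pairing is a
  plain L2 product of cylinder fields and hence a cylinder function. That is what makes the outer
  derivatives in the first identity computable.\<close>

lemma G_grad_nabla_grad:
  assumes "V \<in> cyl_fields M" "Z \<in> cyl_fields M" "V4 \<in> cyl_grad_fields M"
  shows "G_grad M \<mu> (nabla_grad M LC \<mu> V Z) (emb M \<mu> (V4 \<mu>)) = l2_inner M \<mu> (nabla_LC M LC V Z \<mu>) (V4 \<mu>)"
  unfolding nabla_grad_tclass[OF assms(1,2)] emb_def
    G_grad_tclass[OF pr(3)[OF nabla_LC_cauchy[OF assms(1,2)]] cyl_grad_const_closure[OF assms(3)]]
    lim_inner_pr[OF nabla_LC_cauchy[OF assms(1,2)] cyl_grad_const_closure[OF assms(3)]]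
  by simp

lemma Gauss_splitting:
  assumes "V \<in> cyl_fields M" "Z \<in> cyl_fields M" "V' \<in> cyl_fields M" "Z' \<in> cyl_fields M"
  shows "G_grad M \<mu> (nabla_grad M LC \<mu> V Z) (nabla_grad M LC \<mu> V' Z') + G_der M \<mu> (II M LC \<mu> V Z) (II M LC \<mu> V' Z') =
    l2_inner M \<mu> (nabla_LC M LC V Z \<mu>) (nabla_LC M LC V' Z' \<mu>)"
proof -
  note c = nabla_LC_cauchy[OF assms(1,2), of \<mu>] nabla_LC_cauchy[OF assms(3,4), of \<mu>]
  show ?thesis
    using lim_inner_pythagoras[OF c] c
    by (simp add: nabla_grad_tclass II_tclass assms G_grad_tclass pr G_der_tclass l2.cauchy_in_diff)
qed

text \<open>\<open>II\<close> removes the projection from each derivative, and projecting is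
  additive up to null sequences; so A is the part of the bracket that is orthogonal to the
  gradients.\<close>

lemma A_tensor_tclass:
  assumes V: "V \<in> cyl_fields M" and Z: "Z \<in> cyl_fields M"
  shows "A_tensor M LC \<mu> V Z = tclass_of M \<mu> (cseq (bracket V Z \<mu>) - pr \<mu> (cseq (bracket V Z \<mu>)))"
proof -
  let ?n = "cseq (nabla_LC M LC V Z \<mu>)" and ?m = "cseq (nabla_LC M LC Z V \<mu>)" and ?b = "cseq (bracket V Z \<mu>)"
  have c: "l2.cauchy_in \<mu> ?n" "l2.cauchy_in \<mu> ?m" "l2.cauchy_in \<mu> ?b"
    using nabla_LC_cauchy V Z l2.cauchy_in_const[OF cyl_fields_mem[OF bracket_cyl[OF V Z]]] by auto
  have b: "?b = ?n - ?m" by (simp add: bracket_def fun_eq_iff)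
  have p: "pr \<mu> ?n - pr \<mu> ?m \<in> grad_closure \<mu>"
    using subspace_diff[OF hb.subspace_clos[OF subspace_grad_seqs grad_seqs_subset]] pr(1) c by blast
  \<comment> \<open>As \<open>pr\<close> is a choice, additivity is no equation between sequences.
    The difference of the two chosen projections is itself a valid projection of the bracket, and
    uniqueness compares it with the chosen one.\<close>
  have "hb.nrm \<mu> (pr \<mu> ?b - (pr \<mu> ?n - pr \<mu> ?m)) = 0"
  proof (rule hb.projection_unique[OF subspace_grad_seqs grad_seqs_subset _ pr(1)[OF c(3)] p])
    show "?b \<in> Collect (l2.cauchy_in \<mu>)" using c by simp
    show "l2.lim_inner \<mu> (?b - pr \<mu> ?b) w = 0" if "w \<in> grad_closure \<mu>" for w by (rule pr(2)[OF c(3) that])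
    show "l2.lim_inner \<mu> (?b - (pr \<mu> ?n - pr \<mu> ?m)) w = 0" if w: "w \<in> grad_closure \<mu>" for w
    proof -
      have "?b - (pr \<mu> ?n - pr \<mu> ?m) = (?n - pr \<mu> ?n) - (?m - pr \<mu> ?m)" unfolding b by simp
      moreover have "l2.lim_inner \<mu> ((?n - pr \<mu> ?n) - (?m - pr \<mu> ?m)) w =
          l2.lim_inner \<mu> (?n - pr \<mu> ?n) w - l2.lim_inner \<mu> (?m - pr \<mu> ?m) w"
        by (rule hb.diff_left)
          (simp_all only: mem_Collect_eq l2.cauchy_in_diff[OF c(1) pr(3)[OF c(1)]] l2.cauchy_in_diff[OF c(2) pr(3)[OF c(2)]]
            grad_closure_cauchy[OF w])
      ultimately show ?thesis using pr(2)[OF c(1) w] pr(2)[OF c(2) w] by (simp only: diff_self)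
    qed
  qed
  moreover have "(?n - pr \<mu> ?n - (?m - pr \<mu> ?m)) - (?b - pr \<mu> ?b) = pr \<mu> ?b - (pr \<mu> ?n - pr \<mu> ?m)"
    unfolding b by simp
  ultimately have "hb.nrm \<mu> ((?n - pr \<mu> ?n - (?m - pr \<mu> ?m)) - (?b - pr \<mu> ?b)) = 0" by (simp only:)
  moreover note d = l2.cauchy_in_diff[OF c(1) pr(3)[OF c(1)]] l2.cauchy_in_diff[OF c(2) pr(3)[OF c(2)]]
    l2.cauchy_in_diff[OF c(3) pr(3)[OF c(3)]]
  ultimately have "tclass_of M \<mu> (?n - pr \<mu> ?n - (?m - pr \<mu> ?m)) = tclass_of M \<mu> (?b - pr \<mu> ?b)"
    by (simp only: tclass_of_eq_iff[OF l2.cauchy_in_diff[OF d(1,2)] d(3)])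
  then show ?thesis
    unfolding A_tensor_def II_tclass[OF V Z] II_tclass[OF Z V] tc_diff_tclass[OF d(1,2)] .
qed

section \<open>Derivatives in completed directions\<close>

lemma LC_cauchy:
  assumes "l2.cauchy_in \<mu> a" "z \<in> vector_fields M"
  shows "l2.cauchy_in \<mu> (\<lambda>n. LC (a n) z)"
proof -
  obtain C where "\<And>w. w \<in> vector_fields M \<Longrightarrow> l2.nrm \<mu> (LC w z) \<le> C * l2.nrm \<mu> w" using LC_bounded[OF assms(2)] by blast
  then show ?thesis using l2.cauchy_in_image[OF assms(1), of "\<lambda>w. LC w z" C] LC_mem LC_diff_left assms(2) by blast
qed

lemma omega_dir_tclass:
  assumes a: "l2.cauchy_in \<mu> a" and Z: "Z \<in> cyl_fields M"
  shows "omega_dir M LC \<mu> Z (tclass_of M \<mu> a) = tclass_of M \<mu> (\<lambda>n. LC (a n) (Z \<mu>))"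
proof -
  note ZX = cyl_fields_mem[OF Z, of \<mu>]
  obtain C where "\<And>w. w \<in> vector_fields M \<Longrightarrow> l2.nrm \<mu> (LC w (Z \<mu>)) \<le> C * l2.nrm \<mu> w" using LC_bounded[OF ZX] by blast
  then show ?thesis
    unfolding omega_dir_def omega_at_def
    using extend_tclass[OF a, of "\<lambda>w. LC w (Z \<mu>)" C] LC_mem LC_diff_left ZX by blast
qed

lemma nabla_LC_at_extend:
  assumes a: "l2.cauchy_in \<mu> a" and Z: "Z \<in> cyl_fields M"
  shows "l2.cauchy_in \<mu> (\<lambda>n. nabla_LC_at M LC \<mu> (a n) Z)"
    "extend M \<mu> (\<lambda>w. nabla_LC_at M LC \<mu> w Z) (tclass_of M \<mu> a) = tclass_of M \<mu> (\<lambda>n. nabla_LC_at M LC \<mu> (a n) Z)"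
proof -
  obtain C where C: "\<And>w. w \<in> vector_fields M \<Longrightarrow> l2.nrm \<mu> (nabla_LC_at M LC \<mu> w Z) \<le> C * l2.nrm \<mu> w"
    using nabla_LC_at_bounded[OF Z] by blast
  show "l2.cauchy_in \<mu> (\<lambda>n. nabla_LC_at M LC \<mu> (a n) Z)"
    by (rule l2.cauchy_in_image[OF a nabla_LC_at_mem[OF Z] nabla_LC_at_diff[OF Z] C])
  show "extend M \<mu> (\<lambda>w. nabla_LC_at M LC \<mu> w Z) (tclass_of M \<mu> a) = tclass_of M \<mu> (\<lambda>n. nabla_LC_at M LC \<mu> (a n) Z)"
    by (rule extend_tclass[OF a nabla_LC_at_mem[OF Z] nabla_LC_at_diff[OF Z] C])
qed

text \<open>A direction orthogonal to all gradients does not act on cylinder functions.\<close>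

lemma lim_inner_nabla_orthogonal:
  assumes a: "l2.cauchy_in \<mu> a" and orth: "\<And>w. w \<in> gradient_fields M \<Longrightarrow> l2.lim_inner \<mu> a (cseq w) = 0"
    and Z: "Z \<in> cyl_fields M" and y: "y \<in> vector_fields M"
  shows "l2.lim_inner \<mu> (\<lambda>n. nabla_LC_at M LC \<mu> (a n) Z) (cseq y) = l2.lim_inner \<mu> (\<lambda>n. LC (a n) (Z \<mu>)) (cseq y)"
proof (rule LIMSEQ_unique)
  have aX: "a n \<in> vector_fields M" for n using a by (rule l2.cauchy_in_mem)
  note yc = l2.cauchy_in_const[OF y, of \<mu>]
  obtain k :: nat and G z where *: "\<forall>i<k. G i \<in> gradient_fields M \<and> z i \<in> vector_fields M"
    "\<forall>w\<in>vector_fields M. nabla_int_at M \<mu> w Z = (\<Sum>i<k. l2_inner M \<mu> (G i) w *\<^sub>R z i)"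
    using nabla_int_at_rank[OF Z, of \<mu>] by blast
  then have G: "\<And>i. i < k \<Longrightarrow> G i \<in> gradient_fields M" and z: "\<And>i. i < k \<Longrightarrow> z i \<in> vector_fields M"
    and int: "\<And>w. w \<in> vector_fields M \<Longrightarrow> nabla_int_at M \<mu> w Z = (\<Sum>i<k. l2_inner M \<mu> (G i) w *\<^sub>R z i)"
    by blast+
  have GX: "\<And>i. i < k \<Longrightarrow> G i \<in> vector_fields M" using G gradient_fields_subset by blast
  show "(\<lambda>n. l2_inner M \<mu> (nabla_LC_at M LC \<mu> (a n) Z) y) \<longlonglongrightarrow> l2.lim_inner \<mu> (\<lambda>n. nabla_LC_at M LC \<mu> (a n) Z) (cseq y)"
    by (rule l2.lim_inner_tendsto[OF nabla_LC_at_extend(1)[OF a Z] yc])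
  have lin: "l2_inner M \<mu> (nabla_LC_at M LC \<mu> w Z) y =
      (\<Sum>i<k. l2_inner M \<mu> w (G i) * l2_inner M \<mu> (z i) y) + l2_inner M \<mu> (LC w (Z \<mu>)) y"
    if w: "w \<in> vector_fields M" for w
  proof -
    have "l2_inner M \<mu> (nabla_LC_at M LC \<mu> w Z) y = l2_inner M \<mu> (nabla_int_at M \<mu> w Z) y + l2_inner M \<mu> (LC w (Z \<mu>)) y"
      unfolding nabla_LC_at_eq by (rule l2.add_left[OF nabla_int_at_mem[OF Z w] LC_mem[OF w cyl_fields_mem[OF Z]] y])
    also have "l2_inner M \<mu> (nabla_int_at M \<mu> w Z) y = (\<Sum>i<k. l2_inner M \<mu> (l2_inner M \<mu> (G i) w *\<^sub>R z i) y)"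
      unfolding int[OF w] by (rule l2.sum_left) (use z y in \<open>auto intro!: l2.closed_simps\<close>)
    also have "\<dots> = (\<Sum>i<k. l2_inner M \<mu> w (G i) * l2_inner M \<mu> (z i) y)"
    proof (intro sum.cong refl)
      fix i assume "i \<in> {..<k}"
      then have i: "i < k" by simp
      show "l2_inner M \<mu> (l2_inner M \<mu> (G i) w *\<^sub>R z i) y = l2_inner M \<mu> w (G i) * l2_inner M \<mu> (z i) y"
        unfolding l2.scale_left[OF z[OF i] y] l2.sym[OF GX[OF i] w] ..
    qed
    finally show ?thesis .
  qed
  \<comment> \<open>The fields \<open>G i\<close> are gradients, so orthogonality makes each
    coefficient vanish in the limit, though not necessarily at any given n.\<close>
  have "(\<lambda>n. l2_inner M \<mu> (a n) (G i)) \<longlonglongrightarrow> 0" if i: "i < k" for i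
    using l2.lim_inner_tendsto[OF a l2.cauchy_in_const[OF GX[OF i]]] orth[OF G[OF i]] by simp
  then have "(\<lambda>n. \<Sum>i<k. l2_inner M \<mu> (a n) (G i) * l2_inner M \<mu> (z i) y) \<longlonglongrightarrow> (\<Sum>i<k. 0 * l2_inner M \<mu> (z i) y)"
    by (intro tendsto_sum tendsto_mult tendsto_const) auto
  then have "(\<lambda>n. (\<Sum>i<k. l2_inner M \<mu> (a n) (G i) * l2_inner M \<mu> (z i) y) + l2_inner M \<mu> (LC (a n) (Z \<mu>)) y) \<longlonglongrightarrow>
      (\<Sum>i<k. 0 * l2_inner M \<mu> (z i) y) + l2.lim_inner \<mu> (\<lambda>n. LC (a n) (Z \<mu>)) (cseq y)"
    by (intro tendsto_add l2.lim_inner_tendsto[OF LC_cauchy[OF a cyl_fields_mem[OF Z]] yc])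
  then show "(\<lambda>n. l2_inner M \<mu> (nabla_LC_at M LC \<mu> (a n) Z) y) \<longlonglongrightarrow> l2.lim_inner \<mu> (\<lambda>n. LC (a n) (Z \<mu>)) (cseq y)"
    unfolding lin[OF aX] by simp
qed

lemma direction_splitting:
  assumes V1: "V1 \<in> cyl_fields M" and V2: "V2 \<in> cyl_fields M" and V3: "V3 \<in> cyl_fields M" and V4: "V4 \<in> cyl_grad_fields M"
  shows "G_grad M \<mu> (nabla_grad_dir M LC \<mu> (proj M \<mu> (emb M \<mu> (cyl_bracket M V1 V2 \<mu>))) V3) (emb M \<mu> (V4 \<mu>)) +
      G_grad M \<mu> (omega_dir M LC \<mu> V3 (A_tensor M LC \<mu> V1 V2)) (emb M \<mu> (V4 \<mu>)) =
    l2_inner M \<mu> (nabla_LC M LC (cyl_bracket M V1 V2) V3 \<mu>) (V4 \<mu>)"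
proof -
  let ?b = "cseq (bracket V1 V2 \<mu>)" and ?y = "cseq (V4 \<mu>)"
  let ?p = "pr \<mu> ?b" and ?q = "?b - pr \<mu> ?b"
  have BX: "bracket V1 V2 \<mu> \<in> vector_fields M" by (rule cyl_fields_mem[OF bracket_cyl[OF V1 V2]])
  have b: "l2.cauchy_in \<mu> ?b" by (rule l2.cauchy_in_const[OF BX])
  note p = pr(3)[OF b] and q = l2.cauchy_in_diff[OF b pr(3)[OF b]]
  have y: "?y \<in> grad_closure \<mu>" by (rule cyl_grad_const_closure[OF V4])
  have V4X: "V4 \<mu> \<in> vector_fields M" using cyl_grad_fields_mem[OF V4] gradient_fields_subset by blast
  let ?L = "\<lambda>w. nabla_LC_at M LC \<mu> w V3"
  note Lp = nabla_LC_at_extend[OF p V3] and Lq = nabla_LC_at_extend[OF q V3]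
  have "G_grad M \<mu> (nabla_grad_dir M LC \<mu> (proj M \<mu> (emb M \<mu> (cyl_bracket M V1 V2 \<mu>))) V3) (emb M \<mu> (V4 \<mu>)) =
      l2.lim_inner \<mu> (\<lambda>n. ?L (?p n)) ?y"
    unfolding nabla_grad_dir_def cyl_bracket_eq[OF V1 V2] emb_def proj_tclass[OF b] Lp(2) proj_tclass[OF Lp(1)]
      G_grad_tclass[OF pr(3)[OF Lp(1)] y] lim_inner_pr[OF Lp(1) y] ..
  moreover have "G_grad M \<mu> (omega_dir M LC \<mu> V3 (A_tensor M LC \<mu> V1 V2)) (emb M \<mu> (V4 \<mu>)) =
      l2.lim_inner \<mu> (\<lambda>n. LC (?q n) (V3 \<mu>)) ?y"
    unfolding A_tensor_tclass[OF V1 V2] omega_dir_tclass[OF q V3] emb_def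
    by (rule G_grad_tclass[OF LC_cauchy[OF q cyl_fields_mem[OF V3]] y])
  moreover have "l2.lim_inner \<mu> (\<lambda>n. LC (?q n) (V3 \<mu>)) ?y = l2.lim_inner \<mu> (\<lambda>n. ?L (?q n)) ?y"
    by (rule lim_inner_nabla_orthogonal[OF q _ V3 V4X, symmetric]) (rule pr(2)[OF b const_grad_closure])
  moreover have "l2.lim_inner \<mu> (\<lambda>n. ?L (?p n)) ?y + l2.lim_inner \<mu> (\<lambda>n. ?L (?q n)) ?y = l2_inner M \<mu> (?L (bracket V1 V2 \<mu>)) (V4 \<mu>)"
  proof -
    \<comment> \<open>Neither part of the direction need be a constant sequence, but termwise they
      add up to the bracket, so the two derivatives add up to a constant sequence.\<close>
    have "(\<lambda>n. ?L (?p n)) + (\<lambda>n. ?L (?q n)) = cseq (?L (bracket V1 V2 \<mu>))"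
    proof
      fix n
      have "?L (?q n) = ?L (bracket V1 V2 \<mu>) - ?L (?p n)"
        using nabla_LC_at_diff[OF V3 BX l2.cauchy_in_mem[OF p]] by simp
      then show "((\<lambda>n. ?L (?p n)) + (\<lambda>n. ?L (?q n))) n = ?L (bracket V1 V2 \<mu>)" by simp
    qed
    moreover have "l2.lim_inner \<mu> ((\<lambda>n. ?L (?p n)) + (\<lambda>n. ?L (?q n))) ?y =
        l2.lim_inner \<mu> (\<lambda>n. ?L (?p n)) ?y + l2.lim_inner \<mu> (\<lambda>n. ?L (?q n)) ?y"
      by (rule hb.add_left) (use Lp(1) Lq(1) grad_closure_cauchy[OF y] in auto)
    ultimately show ?thesis by simp
  qed
  ultimately show ?thesis by (simp add: cyl_bracket_eq[OF V1 V2] nabla_LC_def)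
qed

section \<open>Gauss equation for the reduced curvature form\<close>

text \<open>The right-hand side that defines \<open>R_grad\<close>. It is also the first five terms
  of the first identity, so one Gauss equation serves both claims.\<close>

definition reduced_curvature_form :: "'m borel_prob \<Rightarrow> 'm cvfield \<Rightarrow> 'm cvfield \<Rightarrow> 'm cvfield \<Rightarrow> 'm cvfield \<Rightarrow> real" where
  "reduced_curvature_form \<mu> V1 V2 V3 V4 =
          action M V1 (\<lambda>\<nu>. G_grad M \<nu> (nabla_grad M LC \<nu> V2 V3) (emb M \<nu> (V4 \<nu>))) \<mu>
        - G_grad M \<mu> (nabla_grad M LC \<mu> V2 V3) (nabla_grad M LC \<mu> V1 V4)
        - action M V2 (\<lambda>\<nu>. G_grad M \<nu> (nabla_grad M LC \<nu> V1 V3) (emb M \<nu> (V4 \<nu>))) \<mu>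
        + G_grad M \<mu> (nabla_grad M LC \<mu> V1 V3) (nabla_grad M LC \<mu> V2 V4)
        - G_grad M \<mu>
            (nabla_grad_dir M LC \<mu> (proj M \<mu> (emb M \<mu> (cyl_bracket M V1 V2 \<mu>))) V3)
            (emb M \<mu> (V4 \<mu>))"

lemma R_der_mem:
  assumes "V1 \<in> cyl_fields M" "V2 \<in> cyl_fields M" "V3 \<in> cyl_fields M"
  shows "R_der M LC V1 V2 V3 \<mu> \<in> vector_fields M"
  unfolding R_der_def vf_diff_eq
  using assms by (auto intro!: l2.closed_simps nabla_LC_mem nabla_LC_cyl simp: cyl_bracket_eq bracket_cyl)

text \<open>Metric compatibility turns each differentiated pairing into an iterated derivative plus
  an L2 product of two derivatives. These products meet the \<open>G_grad\<close> products of the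
  form and leave the \<open>II\<close> terms behind.\<close>

lemma Gauss_equation:
  assumes V1: "V1 \<in> cyl_fields M" and V2: "V2 \<in> cyl_fields M" and V3: "V3 \<in> cyl_fields M" and V4: "V4 \<in> cyl_grad_fields M"
  shows "l2_inner M \<mu> (R_der M LC V1 V2 V3 \<mu>) (V4 \<mu>) = reduced_curvature_form \<mu> V1 V2 V3 V4
        - G_der M \<mu> (II M LC \<mu> V2 V3) (II M LC \<mu> V1 V4)
        + G_der M \<mu> (II M LC \<mu> V1 V3) (II M LC \<mu> V2 V4)
        - G_grad M \<mu> (omega_dir M LC \<mu> V3 (A_tensor M LC \<mu> V1 V2)) (emb M \<mu> (V4 \<mu>))"
proof -
  have V4': "V4 \<in> cyl_fields M" using V4 cyl_grad_fields_subset by blast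
  have act: "action M V (\<lambda>\<nu>. G_grad M \<nu> (nabla_grad M LC \<nu> W V3) (emb M \<nu> (V4 \<nu>))) \<mu> =
      l2_inner M \<mu> (nabla_LC M LC V (nabla_LC M LC W V3) \<mu>) (V4 \<mu>) + l2_inner M \<mu> (nabla_LC M LC W V3 \<mu>) (nabla_LC M LC V V4 \<mu>)"
    if V: "V \<in> cyl_fields M" and W: "W \<in> cyl_fields M" for V W
    unfolding G_grad_nabla_grad[OF W V3 V4] action_def
      action_at_l2_inner(2)[OF nabla_LC_cyl[OF W V3] V4' cyl_fields_mem[OF V]]
    by (simp add: nabla_LC_def)
  have Br: "cyl_bracket M V1 V2 \<in> cyl_fields M" by (simp add: cyl_bracket_eq V1 V2 bracket_cyl)
  note X = nabla_LC_mem[OF V1 nabla_LC_cyl[OF V2 V3], of \<mu>] nabla_LC_mem[OF V2 nabla_LC_cyl[OF V1 V3], of \<mu>]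
    nabla_LC_mem[OF Br V3, of \<mu>] cyl_fields_mem[OF V4', of \<mu>]
  have "l2_inner M \<mu> (R_der M LC V1 V2 V3 \<mu>) (V4 \<mu>) =
      l2_inner M \<mu> (nabla_LC M LC V1 (nabla_LC M LC V2 V3) \<mu>) (V4 \<mu>) -
      l2_inner M \<mu> (nabla_LC M LC V2 (nabla_LC M LC V1 V3) \<mu>) (V4 \<mu>) -
      l2_inner M \<mu> (nabla_LC M LC (cyl_bracket M V1 V2) V3 \<mu>) (V4 \<mu>)"
    unfolding R_der_def vf_diff_eq using X by (simp add: l2.diff_left l2.closed_simps)
  then show ?thesis
    unfolding reduced_curvature_form_def act[OF V1 V2] act[OF V2 V1]
    using Gauss_splitting[OF V2 V3 V1 V4', of \<mu>] Gauss_splitting[OF V1 V3 V2 V4', of \<mu>]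
      direction_splitting[OF V1 V2 V3 V4, of \<mu>]
    by simp
qed

text \<open>The second fundamental form is antisymmetric on gradients, since \<open>\<nabla>\<^sub>v z + \<nabla>\<^sub>z v\<close> is the gradient of
  \<open>g(v, z)\<close>. As Hessians are symmetric, this moves all derivatives off the last argument.\<close>

lemma G_der_II_adjoint:
  assumes a: "l2.cauchy_in \<mu> a" and orth: "\<And>w. w \<in> grad_closure \<mu> \<Longrightarrow> l2.lim_inner \<mu> a w = 0"
    and V: "V \<in> cyl_grad_fields M" and V4: "V4 \<in> cyl_grad_fields M"
  shows "G_der M \<mu> (tclass_of M \<mu> a) (II M LC \<mu> V V4) = - l2.lim_inner \<mu> (\<lambda>n. LC (a n) (V \<mu>)) (cseq (V4 \<mu>))"
proof -
  have V': "V \<in> cyl_fields M" "V4 \<in> cyl_fields M" using V V4 cyl_grad_fields_subset by auto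
  note g = cyl_grad_fields_mem[OF V, of \<mu>] cyl_grad_fields_mem[OF V4, of \<mu>]
  note X = cyl_fields_mem[OF V'(1), of \<mu>] cyl_fields_mem[OF V'(2), of \<mu>]
  let ?v = "V \<mu>" and ?z = "V4 \<mu>"
  let ?n = "nabla_LC M LC V V4 \<mu>"
  have n: "l2.cauchy_in \<mu> (cseq ?n)" by (rule nabla_LC_cauchy[OF V'])
  have aX: "a n \<in> vector_fields M" for n using a by (rule l2.cauchy_in_mem)
  have 1: "G_der M \<mu> (tclass_of M \<mu> a) (II M LC \<mu> V V4) = l2.lim_inner \<mu> a (cseq ?n)"
    unfolding II_tclass[OF V'] G_der_tclass[OF a l2.cauchy_in_diff[OF n pr(3)[OF n]]]
    using hb.diff_right[of "cseq ?n" \<mu> "pr \<mu> (cseq ?n)" a] orth[OF pr(1)[OF n]] a n pr(3)[OF n] by simp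
  \<comment> \<open>Adding and subtracting the derivative of \<open>V\<close> along
    \<open>V4\<close> isolates a gradient, to which \<open>a\<close> is orthogonal.\<close>
  have "?n = (nabla_int_at M \<mu> ?v V4 + (LC ?v ?z + LC ?z ?v)) - LC ?z ?v"
    by (simp add: nabla_LC_def nabla_LC_at_eq)
  moreover have G: "nabla_int_at M \<mu> ?v V4 + (LC ?v ?z + LC ?z ?v) \<in> gradient_fields M"
    by (intro subspace_add[OF subspace_gradient_fields] nabla_int_at_gradient[OF V4 X(1)] LC_symmetrized_gradient g)
  ultimately obtain G where G: "G \<in> gradient_fields M" "?n = G - LC ?z ?v" by blast
  have GX: "G \<in> vector_fields M" using G gradient_fields_subset by blast
  have zv: "LC ?z ?v \<in> vector_fields M" by (rule LC_mem[OF X(2,1)])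
  have "cseq ?n = cseq G - cseq (LC ?z ?v)" using G(2) by (simp add: fun_eq_iff)
  then have 2: "l2.lim_inner \<mu> a (cseq ?n) = - l2.lim_inner \<mu> a (cseq (LC ?z ?v))"
    using hb.diff_right[of "cseq G" \<mu> "cseq (LC ?z ?v)" a] orth[OF const_grad_closure[OF G(1)]] a
      l2.cauchy_in_const[OF GX] l2.cauchy_in_const[OF zv] by simp
  \<comment> \<open>As \<open>V\<close> takes gradient values, symmetry of the Hessian exchanges
    directions: \<open>V4\<close> ceases to be a direction and becomes a plain factor, to which a
    fixed vector can be paired.\<close>
  have "l2_inner M \<mu> (a n) (LC ?z ?v) = l2_inner M \<mu> (LC (a n) ?v) ?z" for n
  proof -
    have "metric M x (a n x) (LC ?z ?v x) = metric M x (LC (a n) ?v x) (?z x)" for x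
      using hessian_symmetric[OF g(1) X(2) aX, of x] pt.sym[OF vector_field_tangent[OF aX] vector_field_tangent[OF zv]] by simp
    then show ?thesis by (simp add: l2_inner_star)
  qed
  then have "l2.lim_inner \<mu> a (cseq (LC ?z ?v)) = l2.lim_inner \<mu> (\<lambda>n. LC (a n) ?v) (cseq ?z)"
    by (simp add: l2.lim_inner_def)
  then show ?thesis using 1 2 by simp
qed

section \<open>Representing vectors and the reduced Riemann tensor\<close>

text \<open>The vector is the projection of the derivative of \<open>V2\<close> along II(V1, V3)
  minus the derivative of \<open>V1\<close> along II(V2, V3). The minus sign in the adjoint formula
  is what exchanges the order of the two terms.\<close>

lemma sharp_II:
  assumes V1: "V1 \<in> cyl_grad_fields M" and V2: "V2 \<in> cyl_grad_fields M" and V3: "V3 \<in> cyl_grad_fields M"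
  shows "\<exists>s\<in>grad_closure \<mu>. sharp M \<mu> (\<lambda>V. G_der M \<mu> (II M LC \<mu> V2 V3) (II M LC \<mu> V1 V)
      - G_der M \<mu> (II M LC \<mu> V1 V3) (II M LC \<mu> V2 V)) = tclass_of M \<mu> s \<and>
    (\<forall>V\<in>cyl_grad_fields M. l2.lim_inner \<mu> s (cseq (V \<mu>)) =
      G_der M \<mu> (II M LC \<mu> V2 V3) (II M LC \<mu> V1 V) - G_der M \<mu> (II M LC \<mu> V1 V3) (II M LC \<mu> V2 V))"
proof -
  have V': "V1 \<in> cyl_fields M" "V2 \<in> cyl_fields M" "V3 \<in> cyl_fields M"
    using assms cyl_grad_fields_subset by auto
  let ?a = "\<lambda>V. cseq (nabla_LC M LC V V3 \<mu>) - pr \<mu> (cseq (nabla_LC M LC V V3 \<mu>))"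
  have a: "l2.cauchy_in \<mu> (?a V)" if "V \<in> cyl_fields M" for V
    by (intro l2.cauchy_in_diff pr(3) nabla_LC_cauchy that V')
  have orth: "l2.lim_inner \<mu> (?a V) w = 0" if "V \<in> cyl_fields M" "w \<in> grad_closure \<mu>" for V w
    by (rule pr(2)[OF nabla_LC_cauchy[OF that(1) V'(3)] that(2)])
  let ?t = "\<lambda>n. LC (?a V1 n) (V2 \<mu>)" and ?t' = "\<lambda>n. LC (?a V2 n) (V1 \<mu>)"
  have t: "l2.cauchy_in \<mu> ?t" "l2.cauchy_in \<mu> ?t'"
    by (intro LC_cauchy a V' cyl_fields_mem)+
  define s where "s = pr \<mu> (?t - ?t')"
  have tt: "l2.cauchy_in \<mu> (?t - ?t')" by (rule l2.cauchy_in_diff[OF t])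
  have s: "s \<in> grad_closure \<mu>" unfolding s_def by (rule pr(1)[OF tt])
  have l: "l2.lim_inner \<mu> s (cseq (V \<mu>)) =
      G_der M \<mu> (II M LC \<mu> V2 V3) (II M LC \<mu> V1 V) - G_der M \<mu> (II M LC \<mu> V1 V3) (II M LC \<mu> V2 V)"
    if V: "V \<in> cyl_grad_fields M" for V
  proof -
    have y: "cseq (V \<mu>) \<in> grad_closure \<mu>" by (rule cyl_grad_const_closure[OF V])
    have "l2.lim_inner \<mu> s (cseq (V \<mu>)) = l2.lim_inner \<mu> ?t (cseq (V \<mu>)) - l2.lim_inner \<mu> ?t' (cseq (V \<mu>))"
      unfolding s_def lim_inner_pr[OF tt y] by (rule hb.diff_left) (use t grad_closure_cauchy[OF y] in auto)
    moreover have "G_der M \<mu> (tclass_of M \<mu> (?a V2)) (II M LC \<mu> V1 V) = - l2.lim_inner \<mu> ?t' (cseq (V \<mu>))"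
      by (rule G_der_II_adjoint[OF a[OF V'(2)] orth[OF V'(2)] V1 V])
    moreover have "G_der M \<mu> (tclass_of M \<mu> (?a V1)) (II M LC \<mu> V2 V) = - l2.lim_inner \<mu> ?t (cseq (V \<mu>))"
      by (rule G_der_II_adjoint[OF a[OF V'(1)] orth[OF V'(1)] V2 V])
    ultimately show ?thesis
      unfolding II_tclass[OF V'(2,3)] II_tclass[OF V'(1,3)] by linarith
  qed
  show ?thesis
  proof (rule bexI[OF _ s], intro conjI ballI)
    show "sharp M \<mu> (\<lambda>V. G_der M \<mu> (II M LC \<mu> V2 V3) (II M LC \<mu> V1 V)
      - G_der M \<mu> (II M LC \<mu> V1 V3) (II M LC \<mu> V2 V)) = tclass_of M \<mu> s"
      by (rule sharp_eq[OF s]) (rule l)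
  qed (rule l)
qed

lemma R_grad_tclass:
  assumes r: "r \<in> grad_closure \<mu>"
    and eq: "\<And>V4. V4 \<in> cyl_grad_fields M \<Longrightarrow> l2.lim_inner \<mu> r (cseq (V4 \<mu>)) = reduced_curvature_form \<mu> V1 V2 V3 V4"
  shows "R_grad M LC \<mu> V1 V2 V3 = tclass_of M \<mu> r"
  unfolding R_grad_def reduced_curvature_form_def[symmetric]
proof (rule the_equality)
  have G: "G_grad M \<mu> (tclass_of M \<mu> r') (emb M \<mu> (V4 \<mu>)) = l2.lim_inner \<mu> r' (cseq (V4 \<mu>))"
    if "r' \<in> grad_closure \<mu>" "V4 \<in> cyl_grad_fields M" for r' V4
    unfolding emb_def by (rule G_grad_tclass[OF grad_closure_cauchy[OF that(1)] cyl_grad_const_closure[OF that(2)]])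
  show "tclass_of M \<mu> r \<in> tangent_grad M \<mu> \<and>
      (\<forall>V4\<in>cyl_grad_fields M. G_grad M \<mu> (tclass_of M \<mu> r) (emb M \<mu> (V4 \<mu>)) = reduced_curvature_form \<mu> V1 V2 V3 V4)"
    using r eq G by (simp add: tangent_grad_eq)
  fix R assume R: "R \<in> tangent_grad M \<mu> \<and>
      (\<forall>V4\<in>cyl_grad_fields M. G_grad M \<mu> R (emb M \<mu> (V4 \<mu>)) = reduced_curvature_form \<mu> V1 V2 V3 V4)"
  then obtain r' where r': "r' \<in> grad_closure \<mu>" "R = tclass_of M \<mu> r'" by (auto simp: tangent_grad_eq)
  have "l2.lim_inner \<mu> r' (cseq w) = l2.lim_inner \<mu> r (cseq w)" if w: "w \<in> gradient_fields M" for w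
    using R r'(2) eq[OF cyl_grad_fields_const[OF w]] G[OF r'(1) cyl_grad_fields_const[OF w]] cyl_grad_fields_const[OF w]
    by auto
  then show "R = tclass_of M \<mu> r" unfolding r'(2) by (rule tangent_grad_ext[OF r'(1) r])
qed

text \<open>Tested against gradient-type fields, the vector on the right gives the defining form by
  the Gauss equation. Its \<open>omega_dir\<close> summand need not lie in
  \<open>tangent_grad\<close>, so \<open>R_grad\<close> is its projection; the same computation
  yields existence and, since the pairings do not see the projection, the identity.\<close>

lemma reduced_curvature:
  assumes V1: "V1 \<in> cyl_grad_fields M" and V2: "V2 \<in> cyl_grad_fields M" and V3: "V3 \<in> cyl_grad_fields M"
    and V4: "V4 \<in> cyl_grad_fields M"
  shows "G_grad M \<mu> (R_grad M LC \<mu> V1 V2 V3) (emb M \<mu> (V4 \<mu>)) =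
        G_grad M \<mu>
          (tc_add M \<mu>
            (tc_add M \<mu>
              (proj M \<mu> (emb M \<mu> (R_der M LC V1 V2 V3 \<mu>)))
              (sharp M \<mu> (\<lambda>V. G_der M \<mu> (II M LC \<mu> V2 V3) (II M LC \<mu> V1 V)
                            - G_der M \<mu> (II M LC \<mu> V1 V3) (II M LC \<mu> V2 V))))
            (omega_dir M LC \<mu> V3 (A_tensor M LC \<mu> V1 V2)))
          (emb M \<mu> (V4 \<mu>))"
proof -
  have V': "V1 \<in> cyl_fields M" "V2 \<in> cyl_fields M" "V3 \<in> cyl_fields M"
    using assms cyl_grad_fields_subset by auto
  obtain s where s: "s \<in> grad_closure \<mu>"
    "sharp M \<mu> (\<lambda>V. G_der M \<mu> (II M LC \<mu> V2 V3) (II M LC \<mu> V1 V)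
      - G_der M \<mu> (II M LC \<mu> V1 V3) (II M LC \<mu> V2 V)) = tclass_of M \<mu> s"
    and l: "\<And>V. V \<in> cyl_grad_fields M \<Longrightarrow> l2.lim_inner \<mu> s (cseq (V \<mu>)) =
      G_der M \<mu> (II M LC \<mu> V2 V3) (II M LC \<mu> V1 V) - G_der M \<mu> (II M LC \<mu> V1 V3) (II M LC \<mu> V2 V)"
    using sharp_II[OF V1 V2 V3, of \<mu>] by blast
  let ?b = "cseq (bracket V1 V2 \<mu>)"
  let ?o = "\<lambda>n. LC ((?b - pr \<mu> ?b) n) (V3 \<mu>)"
  let ?r = "cseq (R_der M LC V1 V2 V3 \<mu>)"
  have b: "l2.cauchy_in \<mu> ?b" by (rule l2.cauchy_in_const[OF cyl_fields_mem[OF bracket_cyl[OF V'(1,2)]]])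
  note q = l2.cauchy_in_diff[OF b pr(3)[OF b]]
  have o: "l2.cauchy_in \<mu> ?o" by (rule LC_cauchy[OF q cyl_fields_mem[OF V'(3)]])
  have om: "omega_dir M LC \<mu> V3 (A_tensor M LC \<mu> V1 V2) = tclass_of M \<mu> ?o"
    unfolding A_tensor_tclass[OF V'(1,2)] by (rule omega_dir_tclass[OF q V'(3)])
  have r: "l2.cauchy_in \<mu> ?r" by (rule l2.cauchy_in_const[OF R_der_mem[OF V']])
  note sc = grad_closure_cauchy[OF s(1)]
  let ?t = "pr \<mu> ?r + s + ?o"
  have t: "l2.cauchy_in \<mu> ?t" by (intro l2.cauchy_in_add pr(3) r sc o)
  have tc: "tc_add M \<mu> (tc_add M \<mu> (proj M \<mu> (emb M \<mu> (R_der M LC V1 V2 V3 \<mu>))) (tclass_of M \<mu> s)) (tclass_of M \<mu> ?o) = tclass_of M \<mu> ?t"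
    unfolding emb_def proj_tclass[OF r] tc_add_tclass[OF pr(3)[OF r] sc]
    by (rule tc_add_tclass[OF l2.cauchy_in_add[OF pr(3)[OF r] sc] o])
  have val: "l2.lim_inner \<mu> ?t (cseq (V \<mu>)) = reduced_curvature_form \<mu> V1 V2 V3 V" if V: "V \<in> cyl_grad_fields M" for V
  proof -
    have y: "cseq (V \<mu>) \<in> grad_closure \<mu>" by (rule cyl_grad_const_closure[OF V])
    note yc = grad_closure_cauchy[OF y]
    have "l2.lim_inner \<mu> ?t (cseq (V \<mu>)) = l2.lim_inner \<mu> (pr \<mu> ?r) (cseq (V \<mu>)) + l2.lim_inner \<mu> s (cseq (V \<mu>)) + l2.lim_inner \<mu> ?o (cseq (V \<mu>))"
      using pr(3)[OF r] sc o yc by (simp add: hb.add_left l2.cauchy_in_add)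
    moreover have "l2.lim_inner \<mu> (pr \<mu> ?r) (cseq (V \<mu>)) = l2_inner M \<mu> (R_der M LC V1 V2 V3 \<mu>) (V \<mu>)"
      unfolding lim_inner_pr[OF r y] by simp
    moreover have "G_grad M \<mu> (omega_dir M LC \<mu> V3 (A_tensor M LC \<mu> V1 V2)) (emb M \<mu> (V \<mu>)) = l2.lim_inner \<mu> ?o (cseq (V \<mu>))"
      unfolding om emb_def by (rule G_grad_tclass[OF o y])
    ultimately show ?thesis
      using l[OF V] Gauss_equation[OF V' V, of \<mu>] by linarith
  qed
  have "R_grad M LC \<mu> V1 V2 V3 = tclass_of M \<mu> (pr \<mu> ?t)"
  proof (rule R_grad_tclass[OF pr(1)[OF t]])
    show "l2.lim_inner \<mu> (pr \<mu> ?t) (cseq (V \<mu>)) = reduced_curvature_form \<mu> V1 V2 V3 V" if V: "V \<in> cyl_grad_fields M" for V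
      unfolding lim_inner_pr[OF t cyl_grad_const_closure[OF V]] by (rule val[OF V])
  qed
  moreover have "G_grad M \<mu> (tclass_of M \<mu> (pr \<mu> ?t)) (emb M \<mu> (V4 \<mu>)) = G_grad M \<mu> (tclass_of M \<mu> ?t) (emb M \<mu> (V4 \<mu>))"
    unfolding emb_def G_grad_tclass[OF t cyl_grad_const_closure[OF V4]] G_grad_tclass[OF pr(3)[OF t] cyl_grad_const_closure[OF V4]]
    by (rule lim_inner_pr[OF t cyl_grad_const_closure[OF V4]])
  ultimately show ?thesis unfolding s(2) om tc by simp
qed

lemma G_grad_R_der:
  assumes "V1 \<in> cyl_fields M" "V2 \<in> cyl_fields M" "V3 \<in> cyl_fields M" "V4 \<in> cyl_grad_fields M"
  shows "G_grad M \<mu> (proj M \<mu> (emb M \<mu> (R_der M LC V1 V2 V3 \<mu>))) (emb M \<mu> (V4 \<mu>)) =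
    l2_inner M \<mu> (R_der M LC V1 V2 V3 \<mu>) (V4 \<mu>)"
proof -
  have r: "l2.cauchy_in \<mu> (cseq (R_der M LC V1 V2 V3 \<mu>))" by (rule l2.cauchy_in_const[OF R_der_mem[OF assms(1-3)]])
  note y = cyl_grad_const_closure[OF assms(4), of \<mu>]
  show ?thesis unfolding emb_def proj_tclass[OF r] G_grad_tclass[OF pr(3)[OF r] y] lim_inner_pr[OF r y] by simp
qed

end

theorem theorem2p29:
  fixes M :: "('m::{t2_space, second_countable_topology}, 'n::finite) riemannian"
    and LC :: "'m vfield \<Rightarrow> 'm vfield \<Rightarrow> 'm vfield"
    and V1 V2 V3 :: "'m cvfield"
  assumes "closed_connected_oriented_riemannian M"
    and "levi_civita M LC"
    and "V1 \<in> cyl_grad_fields M" and "V2 \<in> cyl_grad_fields M" and "V3 \<in> cyl_grad_fields M"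
  shows
    "(\<forall>V4 \<in> cyl_grad_fields M. \<forall>\<mu>.
        G_grad M \<mu> (proj M \<mu> (emb M \<mu> (R_der M LC V1 V2 V3 \<mu>))) (emb M \<mu> (V4 \<mu>)) =
          action M V1 (\<lambda>\<nu>. G_grad M \<nu> (nabla_grad M LC \<nu> V2 V3) (emb M \<nu> (V4 \<nu>))) \<mu>
        - G_grad M \<mu> (nabla_grad M LC \<mu> V2 V3) (nabla_grad M LC \<mu> V1 V4)
        - action M V2 (\<lambda>\<nu>. G_grad M \<nu> (nabla_grad M LC \<nu> V1 V3) (emb M \<nu> (V4 \<nu>))) \<mu>
        + G_grad M \<mu> (nabla_grad M LC \<mu> V1 V3) (nabla_grad M LC \<mu> V2 V4)
        - G_grad M \<mu>
            (nabla_grad_dir M LC \<mu> (proj M \<mu> (emb M \<mu> (cyl_bracket M V1 V2 \<mu>))) V3)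
            (emb M \<mu> (V4 \<mu>))
        - G_der M \<mu> (II M LC \<mu> V2 V3) (II M LC \<mu> V1 V4)
        + G_der M \<mu> (II M LC \<mu> V1 V3) (II M LC \<mu> V2 V4)
        - G_grad M \<mu> (omega_dir M LC \<mu> V3 (A_tensor M LC \<mu> V1 V2)) (emb M \<mu> (V4 \<mu>)))
   \<and> (\<forall>V4 \<in> cyl_grad_fields M. \<forall>\<mu>.
        G_grad M \<mu> (R_grad M LC \<mu> V1 V2 V3) (emb M \<mu> (V4 \<mu>)) =
        G_grad M \<mu>
          (tc_add M \<mu>
            (tc_add M \<mu>
              (proj M \<mu> (emb M \<mu> (R_der M LC V1 V2 V3 \<mu>)))
              (sharp M \<mu> (\<lambda>V. G_der M \<mu> (II M LC \<mu> V2 V3) (II M LC \<mu> V1 V)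
                            - G_der M \<mu> (II M LC \<mu> V1 V3) (II M LC \<mu> V2 V))))
            (omega_dir M LC \<mu> V3 (A_tensor M LC \<mu> V1 V2)))
          (emb M \<mu> (V4 \<mu>)))"
proof -
  interpret levi_civita_manifold M LC
    by unfold_locales (rule assms)+
  have V: "V1 \<in> cyl_fields M" "V2 \<in> cyl_fields M" "V3 \<in> cyl_fields M"
    using assms cyl_grad_fields_subset by auto
  show ?thesis
    by (intro conjI ballI allI reduced_curvature[OF assms(3-5)])
      (simp only: G_grad_R_der[OF V] Gauss_equation[OF V] reduced_curvature_form_def)
qed

end
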